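(* The theory $\mathsf{ACA}_0^{\omega}$ proves that for every Baire 1 function $f:[0,1]\to\mathbb R$: (1) there exists $x\in[0,1]$ such that $f$ is continuous at $x$; (2) there exist $N\in\mathbb N$ and $c,d\in[0,1]$ with $c<d$ such that $(\forall y\in(c,d))(|f(y)|\le N+1)$; (3) the oscillation function $\mathrm{osc}_f:[0,1]\to\mathbb R$ exists.
   Context: Formal setting. $\mathsf{RCA}_0^{\omega}$ is Kohlenbach's base theory of higher-order Reverse Mathematics: a classical theory in the language of all finite types (type $0$ is the natural numbers, $\sigma\to\tau$ is the type of maps from type $\sigma$ to type $\tau$ objects, $1:=0\to 0$, $n+1:=n\to 0$; equality at higher types is defined pointwise from equality at type $0$), with axioms: ordered semi-ring axioms for $0,1,<,+,\times$; combinator axioms giving $\lambda$-abstraction; primitive recursion $\mathbf R_0(f,m,0)=m$, $\mathbf R_0(f,m,n+1)=f(n,\mathbf R_0(f,m,n))$ for number-valued $f$ on numbers; extensionality $x=_\rho y\to\varphi(x)=_\tau\varphi(y)$ at all types; induction for quantifier-free formulas (parameters of any type allowed); and $\mathsf{QF\text{-}AC}^{1,0}$, where $\mathsf{QF\text{-}AC}^{\sigma,\tau}$ is the schema $(\forall x^\sigma)(\exists y^\tau)A(x,y)\to(\exists Y^{\sigma\to\tau})(\forall x^\sigma)A(x,Y(x))$ for quantifier-free $A$. $\mathsf{ACA}_0^{\omega}$ is $\mathsf{RCA}_0^{\omega}$ plus $(\exists^2)$: there is $\varphi:\mathbb N^{\mathbb N}\to\{0,1\}$ with $\varphi(f)=0\leftrightarrow(\exists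 n)(f(n)=0)$ for all $f\in\mathbb N^{\mathbb N}$. Reals are fast-converging Cauchy sequences of rationals ($|q_n-q_{n+i}|<2^{-n}$) with the usual $=_{\mathbb R},<_{\mathbb R}$; functions on reals are type $1\to1$ objects respecting $=_{\mathbb R}$, with the usual epsilon-delta definition of continuity. Definitions. $f$ is Baire 1 if it is the pointwise limit on $[0,1]$ of a sequence of continuous functions $(f_n)_{n\in\mathbb N}$. The oscillation function is $\mathrm{osc}_f(x):=\lim_{k\to\infty}\mathrm{osc}_f(B(x,2^{-k}))$, where $B(x,r)$ is the open ball of radius $r$ around $x$ and $\mathrm{osc}_f(I):=\sup_{x\in I}f(x)-\inf_{x\in I}f(x)$ (over points of $I$ in $[0,1]$).
   Formalization: In (3) the oscillation function takes values in the extended reals, with the set of points of infinite oscillation given as well, because for unbounded Baire 1 f (f(0)=0, f(x)=1/x) osc_f is +∞ at some points; where it is finite it is the real-valued osc_f. *)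

theory Defs
  imports Main
begin

section \<open>Many-sorted classical logic over the finite types\<close>

datatype ty = Num | Fn ty ty (infixr \<open>\<rightarrow>\<close> 60)

abbreviation T1 :: ty where "T1 \<equiv> Num \<rightarrow> Num"
abbreviation T2 :: ty where "T2 \<equiv> T1 \<rightarrow> Num"

text \<open>Locally nameless syntax: bound variables are de Bruijn indices, free variables are
  named by a number and carry their type.  The only prime formulas are equations and
  inequalities between terms of type 0.\<close>

datatype tm =
    Bnd nat
  | Free nat ty
  | Zero | One | Plus | Times
  | Kc ty ty
  | Sc ty ty ty
  | Rec
  | App tm tm (infixl \<open>\<cdot>\<close> 90)

datatype fm =
    Eq tm tm
  | Less tm tm
  | Falsum
  | Imp fm fm
  | Forall ty fm

primrec has_type :: "ty list \<Rightarrow> tm \<Rightarrow> ty \<Rightarrow> bool" where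
  "has_type \<Gamma> (Bnd i) \<tau> \<longleftrightarrow> i < length \<Gamma> \<and> \<Gamma> ! i = \<tau>"
| "has_type \<Gamma> (Free n \<sigma>) \<tau> \<longleftrightarrow> \<tau> = \<sigma>"
| "has_type \<Gamma> Zero \<tau> \<longleftrightarrow> \<tau> = Num"
| "has_type \<Gamma> One \<tau> \<longleftrightarrow> \<tau> = Num"
| "has_type \<Gamma> Plus \<tau> \<longleftrightarrow> \<tau> = Num \<rightarrow> Num \<rightarrow> Num"
| "has_type \<Gamma> Times \<tau> \<longleftrightarrow> \<tau> = Num \<rightarrow> Num \<rightarrow> Num"
| "has_type \<Gamma> (Kc \<rho> \<sigma>) \<tau> \<longleftrightarrow> \<tau> = \<rho> \<rightarrow> \<sigma> \<rightarrow> \<rho>"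
| "has_type \<Gamma> (Sc \<delta> \<rho> \<sigma>) \<tau> \<longleftrightarrow> \<tau> = (\<delta> \<rightarrow> \<rho> \<rightarrow> \<sigma>) \<rightarrow> (\<delta> \<rightarrow> \<rho>) \<rightarrow> \<delta> \<rightarrow> \<sigma>"
| "has_type \<Gamma> Rec \<tau> \<longleftrightarrow> \<tau> = (Num \<rightarrow> Num \<rightarrow> Num) \<rightarrow> Num \<rightarrow> Num \<rightarrow> Num"
| "has_type \<Gamma> (s \<cdot> t) \<tau> \<longleftrightarrow> (\<exists>\<sigma>. has_type \<Gamma> s (\<sigma> \<rightarrow> \<tau>) \<and> has_type \<Gamma> t \<sigma>)"

primrec wf_fm :: "ty list \<Rightarrow> fm \<Rightarrow> bool" where
  "wf_fm \<Gamma> (Eq s t) \<longleftrightarrow> has_type \<Gamma> s Num \<and> has_type \<Gamma> t Num"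
| "wf_fm \<Gamma> (Less s t) \<longleftrightarrow> has_type \<Gamma> s Num \<and> has_type \<Gamma> t Num"
| "wf_fm \<Gamma> Falsum \<longleftrightarrow> True"
| "wf_fm \<Gamma> (Imp A B) \<longleftrightarrow> wf_fm \<Gamma> A \<and> wf_fm \<Gamma> B"
| "wf_fm \<Gamma> (Forall \<tau> A) \<longleftrightarrow> wf_fm (\<tau> # \<Gamma>) A"

primrec frees_tm :: "tm \<Rightarrow> (nat \<times> ty) set" where
  "frees_tm (Bnd i) = {}"
| "frees_tm (Free n \<sigma>) = {(n, \<sigma>)}"
| "frees_tm Zero = {}"
| "frees_tm One = {}"
| "frees_tm Plus = {}"
| "frees_tm Times = {}"
| "frees_tm (Kc \<rho> \<sigma>) = {}"
| "frees_tm (Sc \<delta> \<rho> \<sigma>) = {}"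
| "frees_tm Rec = {}"
| "frees_tm (s \<cdot> t) = frees_tm s \<union> frees_tm t"

primrec frees :: "fm \<Rightarrow> (nat \<times> ty) set" where
  "frees (Eq s t) = frees_tm s \<union> frees_tm t"
| "frees (Less s t) = frees_tm s \<union> frees_tm t"
| "frees Falsum = {}"
| "frees (Imp A B) = frees A \<union> frees B"
| "frees (Forall \<tau> A) = frees A"

text \<open>\<open>open_fm k u\<close> replaces the bound index \<open>k\<close> by \<open>u\<close>; as \<open>u\<close> will never contain bound
  indices, no lifting is needed.  Conversely \<open>close_fm k v\<close> turns the free variable \<open>v\<close>
  into the bound index \<open>k\<close>.\<close>

primrec open_tm :: "nat \<Rightarrow> tm \<Rightarrow> tm \<Rightarrow> tm" where
  "open_tm k u (Bnd i) = (if i = k then u else Bnd i)"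
| "open_tm k u (Free n \<sigma>) = Free n \<sigma>"
| "open_tm k u Zero = Zero"
| "open_tm k u One = One"
| "open_tm k u Plus = Plus"
| "open_tm k u Times = Times"
| "open_tm k u (Kc \<rho> \<sigma>) = Kc \<rho> \<sigma>"
| "open_tm k u (Sc \<delta> \<rho> \<sigma>) = Sc \<delta> \<rho> \<sigma>"
| "open_tm k u Rec = Rec"
| "open_tm k u (s \<cdot> t) = open_tm k u s \<cdot> open_tm k u t"

primrec open_fm :: "nat \<Rightarrow> tm \<Rightarrow> fm \<Rightarrow> fm" where
  "open_fm k u (Eq s t) = Eq (open_tm k u s) (open_tm k u t)"
| "open_fm k u (Less s t) = Less (open_tm k u s) (open_tm k u t)"
| "open_fm k u Falsum = Falsum"
| "open_fm k u (Imp A B) = Imp (open_fm k u A) (open_fm k u B)"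
| "open_fm k u (Forall \<tau> A) = Forall \<tau> (open_fm (Suc k) u A)"

primrec subst_tm :: "nat \<times> ty \<Rightarrow> tm \<Rightarrow> tm \<Rightarrow> tm" where
  "subst_tm v u (Bnd i) = Bnd i"
| "subst_tm v u (Free n \<sigma>) = (if (n, \<sigma>) = v then u else Free n \<sigma>)"
| "subst_tm v u Zero = Zero"
| "subst_tm v u One = One"
| "subst_tm v u Plus = Plus"
| "subst_tm v u Times = Times"
| "subst_tm v u (Kc \<rho> \<sigma>) = Kc \<rho> \<sigma>"
| "subst_tm v u (Sc \<delta> \<rho> \<sigma>) = Sc \<delta> \<rho> \<sigma>"
| "subst_tm v u Rec = Rec"
| "subst_tm v u (s \<cdot> t) = subst_tm v u s \<cdot> subst_tm v u t"

primrec subst_fm :: "nat \<times> ty \<Rightarrow> tm \<Rightarrow> fm \<Rightarrow> fm" where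
  "subst_fm v u (Eq s t) = Eq (subst_tm v u s) (subst_tm v u t)"
| "subst_fm v u (Less s t) = Less (subst_tm v u s) (subst_tm v u t)"
| "subst_fm v u Falsum = Falsum"
| "subst_fm v u (Imp A B) = Imp (subst_fm v u A) (subst_fm v u B)"
| "subst_fm v u (Forall \<tau> A) = Forall \<tau> (subst_fm v u A)"

primrec close_fm :: "nat \<Rightarrow> nat \<times> ty \<Rightarrow> fm \<Rightarrow> fm" where
  "close_fm k v (Eq s t) = Eq (subst_tm v (Bnd k) s) (subst_tm v (Bnd k) t)"
| "close_fm k v (Less s t) = Less (subst_tm v (Bnd k) s) (subst_tm v (Bnd k) t)"
| "close_fm k v Falsum = Falsum"
| "close_fm k v (Imp A B) = Imp (close_fm k v A) (close_fm k v B)"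
| "close_fm k v (Forall \<tau> A) = Forall \<tau> (close_fm (Suc k) v A)"

abbreviation Neg :: "fm \<Rightarrow> fm" where "Neg A \<equiv> Imp A Falsum"

definition forall_var :: "nat \<times> ty \<Rightarrow> fm \<Rightarrow> fm" where
  "forall_var v A = Forall (snd v) (close_fm 0 v A)"

definition exists_var :: "nat \<times> ty \<Rightarrow> fm \<Rightarrow> fm" where
  "exists_var v A = Neg (forall_var v (Neg A))"

text \<open>Classical natural deduction with equality at type 0, from axioms \<open>Ax\<close> and
  assumptions \<open>\<Delta>\<close>.  Free variables of axioms are read as universally quantified, so the
  eigenvariable condition in \<open>AllI\<close> concerns the assumptions only.\<close>

inductive derives :: "fm set \<Rightarrow> fm set \<Rightarrow> fm \<Rightarrow> bool" for Ax :: "fm set" where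
  Axiom: "A \<in> Ax \<Longrightarrow> derives Ax \<Delta> A"
| Assm: "A \<in> \<Delta> \<Longrightarrow> derives Ax \<Delta> A"
| ImpI: "wf_fm [] A \<Longrightarrow> derives Ax (insert A \<Delta>) B \<Longrightarrow> derives Ax \<Delta> (Imp A B)"
| ImpE: "derives Ax \<Delta> (Imp A B) \<Longrightarrow> derives Ax \<Delta> A \<Longrightarrow> derives Ax \<Delta> B"
| Contr: "wf_fm [] A \<Longrightarrow> derives Ax (insert (Neg A) \<Delta>) Falsum \<Longrightarrow> derives Ax \<Delta> A"
| AllI: "derives Ax \<Delta> (open_fm 0 (Free n \<tau>) A) \<Longrightarrow> (n, \<tau>) \<notin> frees A \<Longrightarrow>
    (\<forall>B\<in>\<Delta>. (n, \<tau>) \<notin> frees B) \<Longrightarrow> derives Ax \<Delta> (Forall \<tau> A)"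
| AllE: "derives Ax \<Delta> (Forall \<tau> A) \<Longrightarrow> has_type [] t \<tau> \<Longrightarrow> derives Ax \<Delta> (open_fm 0 t A)"
| EqRefl: "has_type [] t Num \<Longrightarrow> derives Ax \<Delta> (Eq t t)"
| EqSubst: "derives Ax \<Delta> (Eq s t) \<Longrightarrow> derives Ax \<Delta> (open_fm 0 s A) \<Longrightarrow>
    derives Ax \<Delta> (open_fm 0 t A)"

definition proves :: "fm set \<Rightarrow> fm \<Rightarrow> bool" (infix \<open>\<turnstile>\<close> 50) where
  "Ax \<turnstile> A \<longleftrightarrow> derives Ax {} A"

section \<open>Notation for writing formulas\<close>

text \<open>To write formulas with ordinary HOL binders, a formula is given as a function of the
  number of enclosing quantifiers: a quantifier at depth \<open>n\<close> binds the variable with number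
  \<open>n\<close>.  Terms occurring at depth \<open>n\<close> only mention variables with numbers below \<open>n\<close>, so
  nothing is captured.  A closed formula is obtained at depth 0.\<close>

type_synonym form = "nat \<Rightarrow> fm"

definition feq :: "tm \<Rightarrow> tm \<Rightarrow> form" (infix \<open>\<^bold>=\<close> 50) where
  "(s \<^bold>= t) = (\<lambda>n. Eq s t)"

definition fless :: "tm \<Rightarrow> tm \<Rightarrow> form" (infix \<open>\<^bold><\<close> 50) where
  "(s \<^bold>< t) = (\<lambda>n. Less s t)"

definition fimp :: "form \<Rightarrow> form \<Rightarrow> form" (infixr \<open>\<^bold>\<longrightarrow>\<close> 25) where
  "(A \<^bold>\<longrightarrow> B) = (\<lambda>n. Imp (A n) (B n))"

definition fneg :: "form \<Rightarrow> form" (\<open>\<^bold>\<not> _\<close> [40] 40) where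
  "(\<^bold>\<not> A) = (\<lambda>n. Neg (A n))"

definition fdisj :: "form \<Rightarrow> form \<Rightarrow> form" (infixr \<open>\<^bold>\<or>\<close> 30) where
  "(A \<^bold>\<or> B) = (\<^bold>\<not> A \<^bold>\<longrightarrow> B)"

definition fconj :: "form \<Rightarrow> form \<Rightarrow> form" (infixr \<open>\<^bold>\<and>\<close> 35) where
  "(A \<^bold>\<and> B) = (\<^bold>\<not> (A \<^bold>\<longrightarrow> \<^bold>\<not> B))"

definition fiff :: "form \<Rightarrow> form \<Rightarrow> form" (infix \<open>\<^bold>\<longleftrightarrow>\<close> 25) where
  "(A \<^bold>\<longleftrightarrow> B) = ((A \<^bold>\<longrightarrow> B) \<^bold>\<and> (B \<^bold>\<longrightarrow> A))"

definition fall :: "ty \<Rightarrow> (tm \<Rightarrow> form) \<Rightarrow> form" where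
  "fall \<tau> F = (\<lambda>n. forall_var (n, \<tau>) (F (Free n \<tau>) (Suc n)))"

definition fex :: "ty \<Rightarrow> (tm \<Rightarrow> form) \<Rightarrow> form" where
  "fex \<tau> F = (\<^bold>\<not> fall \<tau> (\<lambda>x. \<^bold>\<not> F x))"

abbreviation allN :: "(tm \<Rightarrow> form) \<Rightarrow> form" (binder \<open>\<^bold>\<forall>\<close> 10) where
  "allN \<equiv> fall Num"

abbreviation exN :: "(tm \<Rightarrow> form) \<Rightarrow> form" (binder \<open>\<^bold>\<exists>\<close> 10) where
  "exN \<equiv> fex Num"

definition fle :: "tm \<Rightarrow> tm \<Rightarrow> form" (infix \<open>\<^bold>\<le>\<close> 50) where
  "(s \<^bold>\<le> t) = (s \<^bold>< t \<^bold>\<or> s \<^bold>= t)"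

abbreviation add :: "tm \<Rightarrow> tm \<Rightarrow> tm" (infixl \<open>\<^bold>+\<close> 65) where
  "s \<^bold>+ t \<equiv> Plus \<cdot> s \<cdot> t"

abbreviation mul :: "tm \<Rightarrow> tm \<Rightarrow> tm" (infixl \<open>\<^bold>*\<close> 70) where
  "s \<^bold>* t \<equiv> Times \<cdot> s \<cdot> t"

primrec eq_at :: "ty \<Rightarrow> tm \<Rightarrow> tm \<Rightarrow> form" where
  "eq_at Num s t = (s \<^bold>= t)"
| "eq_at (\<sigma> \<rightarrow> \<tau>) s t = fall \<sigma> (\<lambda>x. eq_at \<tau> (s \<cdot> x) (t \<cdot> x))"

section \<open>The systems RCA_0^omega and ACA_0^omega\<close>

definition semiring_axioms :: "fm set" where
  "semiring_axioms = (\<lambda>A. A 0) ` {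
     \<^bold>\<forall>x. \<^bold>\<forall>y. \<^bold>\<forall>z. (x \<^bold>+ y) \<^bold>+ z \<^bold>= x \<^bold>+ (y \<^bold>+ z),
     \<^bold>\<forall>x. \<^bold>\<forall>y. x \<^bold>+ y \<^bold>= y \<^bold>+ x,
     \<^bold>\<forall>x. x \<^bold>+ Zero \<^bold>= x,
     \<^bold>\<forall>x. \<^bold>\<forall>y. \<^bold>\<forall>z. (x \<^bold>* y) \<^bold>* z \<^bold>= x \<^bold>* (y \<^bold>* z),
     \<^bold>\<forall>x. \<^bold>\<forall>y. x \<^bold>* y \<^bold>= y \<^bold>* x,
     \<^bold>\<forall>x. x \<^bold>* One \<^bold>= x,
     \<^bold>\<forall>x. x \<^bold>* Zero \<^bold>= Zero,
     \<^bold>\<forall>x. \<^bold>\<forall>y. \<^bold>\<forall>z. x \<^bold>* (y \<^bold>+ z) \<^bold>= x \<^bold>* y \<^bold>+ x \<^bold>* z,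
     \<^bold>\<forall>x. \<^bold>\<not> x \<^bold>< x,
     \<^bold>\<forall>x. \<^bold>\<forall>y. \<^bold>\<forall>z. x \<^bold>< y \<^bold>\<and> y \<^bold>< z \<^bold>\<longrightarrow> x \<^bold>< z,
     \<^bold>\<forall>x. \<^bold>\<forall>y. x \<^bold>< y \<^bold>\<or> x \<^bold>= y \<^bold>\<or> y \<^bold>< x,
     \<^bold>\<forall>x. \<^bold>\<forall>y. \<^bold>\<forall>z. x \<^bold>< y \<^bold>\<longrightarrow> x \<^bold>+ z \<^bold>< y \<^bold>+ z,
     \<^bold>\<forall>x. \<^bold>\<forall>y. \<^bold>\<forall>z. Zero \<^bold>< z \<^bold>\<and> x \<^bold>< y \<^bold>\<longrightarrow> x \<^bold>* z \<^bold>< y \<^bold>* z,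
     Zero \<^bold>< One }"

definition combinator_axioms :: "fm set" where
  "combinator_axioms =
     {fall \<rho> (\<lambda>x. fall \<sigma> (\<lambda>y. eq_at \<rho> (Kc \<rho> \<sigma> \<cdot> x \<cdot> y) x)) 0 | \<rho> \<sigma>. True} \<union>
     {fall (\<delta> \<rightarrow> \<rho> \<rightarrow> \<sigma>) (\<lambda>x. fall (\<delta> \<rightarrow> \<rho>) (\<lambda>y. fall \<delta> (\<lambda>z.
        eq_at \<sigma> (Sc \<delta> \<rho> \<sigma> \<cdot> x \<cdot> y \<cdot> z) (x \<cdot> z \<cdot> (y \<cdot> z))))) 0 | \<delta> \<rho> \<sigma>. True}"

definition recursor_axioms :: "fm set" where
  "recursor_axioms =
     {fall (Num \<rightarrow> Num \<rightarrow> Num) (\<lambda>f. \<^bold>\<forall>m. Rec \<cdot> f \<cdot> m \<cdot> Zero \<^bold>= m) 0,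
      fall (Num \<rightarrow> Num \<rightarrow> Num) (\<lambda>f. \<^bold>\<forall>m. \<^bold>\<forall>n.
        Rec \<cdot> f \<cdot> m \<cdot> (n \<^bold>+ One) \<^bold>= f \<cdot> n \<cdot> (Rec \<cdot> f \<cdot> m \<cdot> n)) 0}"

definition extensionality_axioms :: "fm set" where
  "extensionality_axioms =
     {fall \<rho> (\<lambda>x. fall \<rho> (\<lambda>y. fall (\<rho> \<rightarrow> \<tau>) (\<lambda>f.
        eq_at \<rho> x y \<^bold>\<longrightarrow> eq_at \<tau> (f \<cdot> x) (f \<cdot> y)))) 0 | \<rho> \<tau>. True}"

primrec quantifier_free :: "fm \<Rightarrow> bool" where
  "quantifier_free (Eq s t) \<longleftrightarrow> True"
| "quantifier_free (Less s t) \<longleftrightarrow> True"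
| "quantifier_free Falsum \<longleftrightarrow> True"
| "quantifier_free (Imp A B) \<longleftrightarrow> quantifier_free A \<and> quantifier_free B"
| "quantifier_free (Forall \<tau> A) \<longleftrightarrow> False"

definition QF_induction :: "fm set" where
  "QF_induction =
     {Imp (subst_fm (n, Num) Zero A)
        (Imp (forall_var (n, Num) (Imp A (subst_fm (n, Num) (Free n Num \<^bold>+ One) A)))
          (forall_var (n, Num) A))
      | A n. quantifier_free A \<and> wf_fm [] A}"

definition QF_AC :: "ty \<Rightarrow> ty \<Rightarrow> fm set" where
  "QF_AC \<sigma> \<tau> =
     {Imp (forall_var (x, \<sigma>) (exists_var (y, \<tau>) A))
        (exists_var (Y, \<sigma> \<rightarrow> \<tau>) (forall_var (x, \<sigma>)
          (subst_fm (y, \<tau>) (Free Y (\<sigma> \<rightarrow> \<tau>) \<cdot> Free x \<sigma>) A)))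
      | A x y Y. quantifier_free A \<and> wf_fm [] A \<and> (x, \<sigma>) \<noteq> (y, \<tau>) \<and>
          (Y, \<sigma> \<rightarrow> \<tau>) \<notin> frees A \<union> {(x, \<sigma>), (y, \<tau>)}}"

definition RCA0_omega :: "fm set" where
  "RCA0_omega = semiring_axioms \<union> combinator_axioms \<union> recursor_axioms
     \<union> extensionality_axioms \<union> QF_induction \<union> QF_AC T1 Num"

definition exists2 :: fm where
  "exists2 = fex T2 (\<lambda>\<phi>. fall T1 (\<lambda>f.
     (\<phi> \<cdot> f \<^bold>= Zero \<^bold>\<or> \<phi> \<cdot> f \<^bold>= One) \<^bold>\<and>
     (\<phi> \<cdot> f \<^bold>= Zero \<^bold>\<longleftrightarrow> (\<^bold>\<exists>n. f \<cdot> n \<^bold>= Zero)))) 0"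

definition ACA0_omega :: "fm set" where
  "ACA0_omega = insert exists2 RCA0_omega"

section \<open>Rational and real numbers\<close>

text \<open>A triple of number terms \<open>(p, m, d)\<close> stands for the signed quotient \<open>(p - m) / d\<close>,
  where \<open>d > 0\<close>; arithmetic on such quotients is thus expressed by number terms.\<close>

type_synonym quot = "tm \<times> tm \<times> tm"

fun qadd :: "quot \<Rightarrow> quot \<Rightarrow> quot" where
  "qadd (p, m, d) (p', m', d') = (p \<^bold>* d' \<^bold>+ p' \<^bold>* d, m \<^bold>* d' \<^bold>+ m' \<^bold>* d, d \<^bold>* d')"

fun qneg :: "quot \<Rightarrow> quot" where
  "qneg (p, m, d) = (m, p, d)"

fun qless :: "quot \<Rightarrow> quot \<Rightarrow> form" where
  "qless (p, m, d) (p', m', d') = (p \<^bold>* d' \<^bold>+ m' \<^bold>* d \<^bold>< p' \<^bold>* d \<^bold>+ m \<^bold>* d')"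

fun qle :: "quot \<Rightarrow> quot \<Rightarrow> form" where
  "qle (p, m, d) (p', m', d') = (p \<^bold>* d' \<^bold>+ m' \<^bold>* d \<^bold>\<le> p' \<^bold>* d \<^bold>+ m \<^bold>* d')"

definition qnat :: "tm \<Rightarrow> quot" where
  "qnat t = (t, Zero, One)"

text \<open>The recursion step of \<open>2\<^sup>n\<close> is \<open>\<lambda>k m. m + m\<close>, written with \<open>\<lambda>m. m = S K K\<close>.\<close>

definition two_pow :: "tm \<Rightarrow> tm" where
  "two_pow n =
     Rec \<cdot> (Kc T1 Num \<cdot> (Sc Num Num Num \<cdot> Plus \<cdot> (Sc Num T1 Num \<cdot> Kc Num T1 \<cdot> Kc Num Num)))
       \<cdot> One \<cdot> n"

definition qpow :: "tm \<Rightarrow> quot" where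
  "qpow n = (One, Zero, two_pow n)"

definition qpow_twice :: "tm \<Rightarrow> quot" where
  "qpow_twice n = (One \<^bold>+ One, Zero, two_pow n)"

text \<open>Rationals are coded by numbers through the injective pairing \<open>(i + j)\<^sup>2 + i\<close>;
  \<open>with_rat q F\<close> says that \<open>q\<close> codes a rational satisfying \<open>F\<close>.\<close>

definition pair :: "tm \<Rightarrow> tm \<Rightarrow> tm" where
  "pair i j = (i \<^bold>+ j) \<^bold>* (i \<^bold>+ j) \<^bold>+ i"

definition with_rat :: "tm \<Rightarrow> (quot \<Rightarrow> form) \<Rightarrow> form" where
  "with_rat q F = (\<^bold>\<exists>p. \<^bold>\<exists>m. \<^bold>\<exists>d. Zero \<^bold>< d \<^bold>\<and> q \<^bold>= pair (pair p m) d \<^bold>\<and> F (p, m, d))"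

definition is_real :: "tm \<Rightarrow> form" where
  "is_real x = (\<^bold>\<forall>n. \<^bold>\<forall>i. with_rat (x \<cdot> n) (\<lambda>q. with_rat (x \<cdot> (n \<^bold>+ i)) (\<lambda>r.
     qless (qadd q (qneg r)) (qpow n) \<^bold>\<and> qless (qadd r (qneg q)) (qpow n))))"

text \<open>A real expression is a sequence of rationals, given by the statements that its
  \<open>k\<close>-th member satisfies \<open>F\<close>.  The difference of \<open>(q\<^sub>k)\<close> and \<open>(r\<^sub>k)\<close> is
  \<open>(q\<^bsub>k+1\<^esub> - r\<^bsub>k+1\<^esub>)\<close>, which again converges fast.\<close>

type_synonym rexp = "tm \<Rightarrow> (quot \<Rightarrow> form) \<Rightarrow> form"

definition rl :: "tm \<Rightarrow> rexp" where
  "rl x = (\<lambda>k F. with_rat (x \<cdot> k) F)"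

definition rconst :: "quot \<Rightarrow> rexp" where
  "rconst q = (\<lambda>k F. F q)"

definition rdiff :: "rexp \<Rightarrow> rexp \<Rightarrow> rexp" where
  "rdiff X Y = (\<lambda>k F. X (k \<^bold>+ One) (\<lambda>q. Y (k \<^bold>+ One) (\<lambda>r. F (qadd q (qneg r)))))"

definition rabs :: "rexp \<Rightarrow> rexp" where
  "rabs X = (\<lambda>k F. X k (\<lambda>q.
     (qle (qnat Zero) q \<^bold>\<and> F q) \<^bold>\<or> (qless q (qnat Zero) \<^bold>\<and> F (qneg q))))"

text \<open>For fast converging sequences, \<open>x \<le> y\<close> iff \<open>q\<^sub>k \<le> r\<^sub>k + 2\<^bsup>-k+1\<^esup>\<close> for all \<open>k\<close>.\<close>

definition rle :: "rexp \<Rightarrow> rexp \<Rightarrow> form" where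
  "rle X Y = (\<^bold>\<forall>k. X k (\<lambda>q. Y k (\<lambda>r. qle q (qadd r (qpow_twice k)))))"

definition rless :: "rexp \<Rightarrow> rexp \<Rightarrow> form" where
  "rless X Y = (\<^bold>\<not> rle Y X)"

definition req :: "rexp \<Rightarrow> rexp \<Rightarrow> form" where
  "req X Y = (\<^bold>\<forall>k. X k (\<lambda>q. Y k (\<lambda>r.
     qle (qadd q (qneg r)) (qpow_twice k) \<^bold>\<and> qle (qadd r (qneg q)) (qpow_twice k))))"

definition all_real :: "(tm \<Rightarrow> form) \<Rightarrow> form" (binder \<open>\<^bold>\<forall>\<^sub>R\<close> 10) where
  "all_real F = fall T1 (\<lambda>x. is_real x \<^bold>\<longrightarrow> F x)"

definition ex_real :: "(tm \<Rightarrow> form) \<Rightarrow> form" (binder \<open>\<^bold>\<exists>\<^sub>R\<close> 10) where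
  "ex_real F = fex T1 (\<lambda>x. is_real x \<^bold>\<and> F x)"

definition in_unit :: "tm \<Rightarrow> form" where
  "in_unit x = (rle (rconst (qnat Zero)) (rl x) \<^bold>\<and> rle (rl x) (rconst (qnat One)))"

definition all_unit :: "(tm \<Rightarrow> form) \<Rightarrow> form" (binder \<open>\<^bold>\<forall>\<^sub>I\<close> 10) where
  "all_unit F = (\<^bold>\<forall>\<^sub>R x. in_unit x \<^bold>\<longrightarrow> F x)"

definition ex_unit :: "(tm \<Rightarrow> form) \<Rightarrow> form" (binder \<open>\<^bold>\<exists>\<^sub>I\<close> 10) where
  "ex_unit F = (\<^bold>\<exists>\<^sub>R x. in_unit x \<^bold>\<and> F x)"

definition close_to :: "tm \<Rightarrow> tm \<Rightarrow> tm \<Rightarrow> form" where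
  "close_to k x y = rless (rabs (rdiff (rl x) (rl y))) (rconst (qpow k))"

section \<open>Functions on the unit interval\<close>

definition is_fun :: "tm \<Rightarrow> form" where
  "is_fun f = ((\<^bold>\<forall>\<^sub>I x. is_real (f \<cdot> x)) \<^bold>\<and>
     (\<^bold>\<forall>\<^sub>I x. \<^bold>\<forall>\<^sub>I y. req (rl x) (rl y) \<^bold>\<longrightarrow> req (rl (f \<cdot> x)) (rl (f \<cdot> y))))"

definition cont_at :: "tm \<Rightarrow> tm \<Rightarrow> form" where
  "cont_at f x = (\<^bold>\<forall>k. \<^bold>\<exists>m. \<^bold>\<forall>\<^sub>I y. close_to m x y \<^bold>\<longrightarrow> close_to k (f \<cdot> x) (f \<cdot> y))"

definition baire1 :: "tm \<Rightarrow> form" where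
  "baire1 f = fex (Num \<rightarrow> T1 \<rightarrow> T1) (\<lambda>F.
     (\<^bold>\<forall>n. is_fun (F \<cdot> n) \<^bold>\<and> (\<^bold>\<forall>\<^sub>I x. cont_at (F \<cdot> n) x)) \<^bold>\<and>
     (\<^bold>\<forall>\<^sub>I x. \<^bold>\<forall>k. \<^bold>\<exists>m. \<^bold>\<forall>n. m \<^bold>\<le> n \<^bold>\<longrightarrow> close_to k (F \<cdot> n \<cdot> x) (f \<cdot> x)))"

definition upper_bound :: "tm \<Rightarrow> tm \<Rightarrow> tm \<Rightarrow> tm \<Rightarrow> form" where
  "upper_bound f x k s = (\<^bold>\<forall>\<^sub>I y. close_to k x y \<^bold>\<longrightarrow> rle (rl (f \<cdot> y)) (rl s))"

definition lower_bound :: "tm \<Rightarrow> tm \<Rightarrow> tm \<Rightarrow> tm \<Rightarrow> form" where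
  "lower_bound f x k s = (\<^bold>\<forall>\<^sub>I y. close_to k x y \<^bold>\<longrightarrow> rle (rl s) (rl (f \<cdot> y)))"

definition is_sup :: "tm \<Rightarrow> tm \<Rightarrow> tm \<Rightarrow> tm \<Rightarrow> form" where
  "is_sup f x k s =
     (upper_bound f x k s \<^bold>\<and> (\<^bold>\<forall>\<^sub>R t. upper_bound f x k t \<^bold>\<longrightarrow> rle (rl s) (rl t)))"

definition is_inf :: "tm \<Rightarrow> tm \<Rightarrow> tm \<Rightarrow> tm \<Rightarrow> form" where
  "is_inf f x k s =
     (lower_bound f x k s \<^bold>\<and> (\<^bold>\<forall>\<^sub>R t. lower_bound f x k t \<^bold>\<longrightarrow> rle (rl t) (rl s)))"

text \<open>A Baire 1 function may be unbounded on every ball \<open>B(x, 2\<^bsup>-k\<^esup>)\<close>, for instance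
  \<open>f 0 = 0\<close>, \<open>f x = 1 / x\<close> at \<open>0\<close>.  So the oscillation on a ball, and the limit of these, are
  extended reals.  In the formulas below, \<open>k\<close> stands for that ball, intersected with the unit
  interval.\<close>

definition ball_osc :: "tm \<Rightarrow> tm \<Rightarrow> tm \<Rightarrow> tm \<Rightarrow> form" where
  "ball_osc f x k u =
     (\<^bold>\<exists>\<^sub>R s. \<^bold>\<exists>\<^sub>R i. is_sup f x k s \<^bold>\<and> is_inf f x k i \<^bold>\<and> req (rl u) (rdiff (rl s) (rl i)))"

definition ball_osc_infinite :: "tm \<Rightarrow> tm \<Rightarrow> tm \<Rightarrow> form" where
  "ball_osc_infinite f x k =
     (\<^bold>\<not> (\<^bold>\<exists>\<^sub>R s. upper_bound f x k s) \<^bold>\<or> \<^bold>\<not> (\<^bold>\<exists>\<^sub>R s. lower_bound f x k s))"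

definition osc_limit :: "tm \<Rightarrow> tm \<Rightarrow> tm \<Rightarrow> form" where
  "osc_limit f x v =
     (\<^bold>\<forall>j. \<^bold>\<exists>m. \<^bold>\<forall>k. m \<^bold>\<le> k \<^bold>\<longrightarrow> (\<^bold>\<exists>\<^sub>R u. ball_osc f x k u \<^bold>\<and> close_to j u v))"

definition osc_limit_infinite :: "tm \<Rightarrow> tm \<Rightarrow> form" where
  "osc_limit_infinite f x =
     (\<^bold>\<forall>j. \<^bold>\<exists>m. \<^bold>\<forall>k. m \<^bold>\<le> k \<^bold>\<longrightarrow>
       ball_osc_infinite f x k \<^bold>\<or>
       (\<^bold>\<exists>\<^sub>R u. ball_osc f x k u \<^bold>\<and> rless (rconst (qnat j)) (rl u)))"

text \<open>A function from the unit interval to the extended reals is given by the set where it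
  is infinite (the points with \<open>J x = 1\<close>) and its values \<open>\<Omega> x\<close> elsewhere.\<close>

definition osc_exists :: "tm \<Rightarrow> form" where
  "osc_exists f = fex (T1 \<rightarrow> T1) (\<lambda>\<Omega>. fex T2 (\<lambda>J.
     is_fun \<Omega> \<^bold>\<and>
     (\<^bold>\<forall>\<^sub>I x. \<^bold>\<forall>\<^sub>I y. req (rl x) (rl y) \<^bold>\<longrightarrow> J \<cdot> x \<^bold>= J \<cdot> y) \<^bold>\<and>
     (\<^bold>\<forall>\<^sub>I x. (J \<cdot> x \<^bold>= Zero \<^bold>\<and> osc_limit f x (\<Omega> \<cdot> x)) \<^bold>\<or>
             (J \<cdot> x \<^bold>= One \<^bold>\<and> osc_limit_infinite f x))))"

definition has_cont_point :: "tm \<Rightarrow> form" where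
  "has_cont_point f = (\<^bold>\<exists>\<^sub>I x. cont_at f x)"

definition bounded_on_interval :: "tm \<Rightarrow> form" where
  "bounded_on_interval f =
     (\<^bold>\<exists>N. \<^bold>\<exists>\<^sub>I c. \<^bold>\<exists>\<^sub>I d. rless (rl c) (rl d) \<^bold>\<and>
       (\<^bold>\<forall>\<^sub>I y. rless (rl c) (rl y) \<^bold>\<and> rless (rl y) (rl d) \<^bold>\<longrightarrow>
          rle (rabs (rl (f \<cdot> y))) (rconst (qnat (N \<^bold>+ One)))))"

end

theory Submission
  imports Defs "HOL-Library.Countable" "HOL-Computational_Algebra.Fraction_Field"
begin

text \<open>By completeness it suffices to show that the sentence holds in every extensional Henkin
  model of the axioms.  Over the numbers of such a model one builds the ordered ring of integers,
  the field of rationals, and its Cauchy completion; the reals of the model are those elements of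
  the completion which some fast converging sequence of the model represents.  The functional of
  \<open>exists2\<close> makes the predicates of the model closed under number quantifiers, and the recursor
  and induction then provide least elements, sequences defined by arithmetical recursion and
  suprema of arithmetical sets.

  (1) Let \<open>f\<close> be the limit of the continuous \<open>F n\<close>.  In every interval there are, for given \<open>k\<close>, a
  subinterval and an \<open>m\<close> such that \<open>F n\<close> is \<open>2\<^sup>-\<^sup>k\<close>-close to \<open>F m\<close> there for all \<open>n \<ge> m\<close>: otherwise
  nested intervals lead to a point at which \<open>F\<close> diverges.  Nesting such subintervals for all \<open>k\<close>
  gives a point of continuity, near which \<open>f\<close> is bounded (2).

  (3) The supremum of \<open>f\<close> over a ball involves a quantifier over reals.  But \<open>f y > q\<close> for some \<open>y\<close>
  in \<open>[a, b]\<close> iff, for some \<open>m\<close> and some rational \<open>r > q\<close>, the closed set of those \<open>y\<close> with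
  \<open>F n y \<ge> r\<close> for all \<open>n \<ge> m\<close> meets \<open>[a, b]\<close>; by compactness this can be expressed by number
  quantifiers over rational points.  Hence suprema and infima over balls, and their limits, are
  definable uniformly in the centre of the balls.\<close>

section \<open>Syntax\<close>

text \<open>Arguing in a model gives access to ordinary HOL reasoning, but the model may be
  nonstandard: its numbers need not be well ordered, and induction holds for definable predicates
  only. Hence \<open>nat\<close>, \<open>int\<close> and \<open>real\<close> are of no use and their
  counterparts are rebuilt over the numbers of the model; every induction or minimum comes with a
  proof that the predicate is definable, and what looks finite from inside cannot be treated as
  finite. A sequence that is to lie in the model cannot be chosen freely either; its members are
  made canonical by taking least codes.

  Part (3) asks for one functional on representatives of reals, so definability is kept uniform in a
  parameter \<open>x\<close> from the start. The functional must also give equal values to different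
  representatives. This is why a definable real is given by its lower cut and turned into a sequence
  only at the end, by \<open>code\<close>, which sees the real and not its representative.

  The completion may contain more reals than the model. Sums and limits exist there without
  representatives; that a particular real belongs to the model (\<open>MR\<close>) is proved
  separately, from the definability of its cut.\<close>

instance ty :: countable by countable_datatype
instance tm :: countable by countable_datatype
instance fm :: countable by countable_datatype

section \<open>Typing under opening, closing and substitution\<close>

lemma has_type_weaken: "has_type [] t \<tau> \<Longrightarrow> has_type \<Gamma> t \<tau>"
  by (induction t arbitrary: \<tau>) auto

lemma has_type_unique: "has_type \<Gamma> t \<sigma> \<Longrightarrow> has_type \<Gamma> t \<tau> \<Longrightarrow> \<sigma> = \<tau>"
proof (induction t arbitrary: \<sigma> \<tau>)
  case (App s t)
  then show ?case by (metis has_type.simps(10) ty.inject)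
qed auto

lemma open_tm_closed: "has_type \<Gamma> t \<tau> \<Longrightarrow> length \<Gamma> \<le> k \<Longrightarrow> open_tm k u t = t"
  by (induction t arbitrary: \<tau>) auto

lemma open_fm_closed: "wf_fm \<Gamma> A \<Longrightarrow> length \<Gamma> \<le> k \<Longrightarrow> open_fm k u A = A"
  by (induction A arbitrary: \<Gamma> k) (auto simp: open_tm_closed)

lemma has_type_open_tm:
  "has_type (\<Gamma> @ [\<sigma>]) t \<tau> \<Longrightarrow> has_type [] u \<sigma> \<Longrightarrow> has_type \<Gamma> (open_tm (length \<Gamma>) u t) \<tau>"
  by (induction t arbitrary: \<tau>) (auto simp: nth_append has_type_weaken)

lemma wf_open_fm_aux:
  "wf_fm (\<Gamma> @ [\<sigma>]) A \<Longrightarrow> has_type [] u \<sigma> \<Longrightarrow> wf_fm \<Gamma> (open_fm (length \<Gamma>) u A)"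
proof (induction A arbitrary: \<Gamma>)
  case (Forall \<tau> A)
  from Forall.IH[of "\<tau> # \<Gamma>"] Forall.prems show ?case by simp
qed (auto intro: has_type_open_tm)

lemma wf_open_fm: "wf_fm [\<sigma>] A \<Longrightarrow> has_type [] u \<sigma> \<Longrightarrow> wf_fm [] (open_fm 0 u A)"
  using wf_open_fm_aux[of "[]"] by simp

lemma open_close_tm:
  "has_type \<Gamma> t \<tau> \<Longrightarrow> length \<Gamma> \<le> k \<Longrightarrow>
    open_tm k (Free n \<sigma>) (subst_tm (n, \<sigma>) (Bnd k) t) = t"
  by (induction t arbitrary: \<tau>) auto

lemma open_close_fm:
  "wf_fm \<Gamma> A \<Longrightarrow> length \<Gamma> \<le> k \<Longrightarrow> open_fm k (Free n \<sigma>) (close_fm k (n, \<sigma>) A) = A"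
  by (induction A arbitrary: \<Gamma> k) (auto simp: open_close_tm)

lemma has_type_close_tm:
  "has_type \<Gamma> t \<tau> \<Longrightarrow> has_type (\<Gamma> @ [snd v]) (subst_tm v (Bnd (length \<Gamma>)) t) \<tau>"
  by (induction t arbitrary: \<tau>) (auto simp: nth_append)

lemma wf_close_fm: "wf_fm \<Gamma> A \<Longrightarrow> wf_fm (\<Gamma> @ [snd v]) (close_fm (length \<Gamma>) v A)"
proof (induction A arbitrary: \<Gamma>)
  case (Forall \<tau> A)
  from Forall.IH[of "\<tau> # \<Gamma>"] Forall.prems show ?case by simp
qed (auto intro: has_type_close_tm)

lemma wf_forall_var: "wf_fm [] A \<Longrightarrow> wf_fm [] (forall_var v A)"
  using wf_close_fm[of "[]" A v] by (simp add: forall_var_def)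

lemma frees_tm_close: "frees_tm (subst_tm v (Bnd k) t) = frees_tm t - {v}"
  by (induction t) auto

lemma frees_close_fm: "frees (close_fm k v A) = frees A - {v}"
  by (induction A arbitrary: k) (auto simp: frees_tm_close)

lemma finite_frees: "finite (frees A)"
proof (induction A)
  have "finite (frees_tm t)" for t by (induction t) auto
  then show "finite (frees (Eq s t))" "finite (frees (Less s t))" for s t by auto
qed auto

lemma ex_fresh: "\<exists>n. (n, \<tau>) \<notin> frees A \<and> (n, \<tau>) \<notin> frees B"
proof -
  have "finite (fst ` (frees A \<union> frees B))" by (simp add: finite_frees)
  then obtain n where "n \<notin> fst ` (frees A \<union> frees B)"
    using ex_new_if_finite infinite_UNIV_nat by blast
  then show ?thesis by force
qed


text \<open>The measure for the truth lemma: an instance \<open>open_fm 0 t A\<close> is no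
  subformula of \<open>Forall \<tau> A\<close>, but it is less deep, whatever the term
  \<open>t\<close>.\<close>

primrec depth :: "fm \<Rightarrow> nat" where
  "depth (Eq s t) = 0"
| "depth (Less s t) = 0"
| "depth Falsum = 0"
| "depth (Imp A B) = Suc (depth A + depth B)"
| "depth (Forall \<tau> A) = Suc (depth A)"

lemma depth_open_fm [simp]: "depth (open_fm k t A) = depth A"
  by (induction A arbitrary: k) auto

section \<open>Completeness\<close>

text \<open>Only sequents without assumptions are used, with \<open>Ax \<turnstile> Imp D A\<close> in place of an assumption
  \<open>D\<close>: as the axioms may contain free variables, weakening is not immediate from the
  eigenvariable condition.\<close>

lemma proves_mp: "Ax \<turnstile> Imp A B \<Longrightarrow> Ax \<turnstile> A \<Longrightarrow> Ax \<turnstile> B"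
  unfolding proves_def by (rule ImpE)

lemma proves_K: "wf_fm [] A \<Longrightarrow> wf_fm [] D \<Longrightarrow> Ax \<turnstile> Imp A (Imp D A)"
  unfolding proves_def by (intro ImpI Assm) auto

lemma proves_S:
  assumes "wf_fm [] A" "wf_fm [] B" "wf_fm [] D"
  shows "Ax \<turnstile> Imp (Imp D (Imp A B)) (Imp (Imp D A) (Imp D B))"
  unfolding proves_def
proof (intro ImpI)
  let ?\<Delta> = "{D, Imp D A, Imp D (Imp A B)}"
  have "derives Ax ?\<Delta> (Imp A B)" "derives Ax ?\<Delta> A"
    by (rule ImpE[of _ _ D]; rule Assm; simp)+
  then show "derives Ax ?\<Delta> B" by (rule ImpE)
qed (use assms in auto)

lemma proves_imp_mp:
  assumes "wf_fm [] A" "wf_fm [] B" "wf_fm [] D" "Ax \<turnstile> Imp D (Imp A B)" "Ax \<turnstile> Imp D A"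
  shows "Ax \<turnstile> Imp D B"
  using proves_mp[OF proves_mp[OF proves_S]] assms by blast

lemma proves_imp_thm: "wf_fm [] A \<Longrightarrow> wf_fm [] D \<Longrightarrow> Ax \<turnstile> A \<Longrightarrow> Ax \<turnstile> Imp D A"
  using proves_mp[OF proves_K] by blast

lemma proves_imp_refl: "wf_fm [] D \<Longrightarrow> Ax \<turnstile> Imp D D"
  unfolding proves_def by (intro ImpI Assm) auto

lemma proves_imp_trans:
  assumes "wf_fm [] A" "wf_fm [] B" "wf_fm [] D" "Ax \<turnstile> Imp D A" "Ax \<turnstile> Imp A B"
  shows "Ax \<turnstile> Imp D B"
  using proves_imp_mp[OF assms(1-3)] proves_imp_thm[of "Imp A B" D] assms by simp

lemma proves_gen:
  assumes "Ax \<turnstile> open_fm 0 (Free n \<tau>) A" "(n, \<tau>) \<notin> frees A"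
  shows "Ax \<turnstile> Forall \<tau> A"
  using assms unfolding proves_def by (auto intro: AllI)

lemma proves_forall_var: "wf_fm [] A \<Longrightarrow> Ax \<turnstile> A \<Longrightarrow> Ax \<turnstile> forall_var (n, \<tau>) A"
  unfolding forall_var_def
  by (rule proves_gen[of _ n]) (auto simp: open_close_fm frees_close_fm)

text \<open>Without assumptions, \<open>Imp D A\<close> can be generalised, \<open>D\<close> being
  unchanged by opening. Then \<open>D\<close> and the generalised formula are both assumed; the
  variable \<open>(n, \<tau>)\<close> occurs in neither, so it may be instantiated and generalised
  once more.\<close>

lemma proves_imp_forall:
  assumes wf: "wf_fm [] D" "wf_fm [\<tau>] A" and pr: "Ax \<turnstile> Imp D (open_fm 0 (Free n \<tau>) A)"
    and fr: "(n, \<tau>) \<notin> frees A" "(n, \<tau>) \<notin> frees D"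
  shows "Ax \<turnstile> Imp D (Forall \<tau> A)"
proof -
  have D: "open_fm 0 t D = D" for t using wf by (simp add: open_fm_closed)
  have wfD: "wf_fm [\<tau>] D" using wf(1)
  proof -
    have "wf_fm \<Gamma> B \<Longrightarrow> wf_fm (\<Gamma> @ \<Delta>) B" for \<Gamma> \<Delta> B
    proof (induction B arbitrary: \<Gamma>)
      case (Eq s t)
      have "has_type \<Gamma> s \<sigma> \<Longrightarrow> has_type (\<Gamma> @ \<Delta>) s \<sigma>" for s \<sigma>
        by (induction s arbitrary: \<sigma>) (auto simp: nth_append)
      with Eq show ?case by simp
    next
      case (Less s t)
      have "has_type \<Gamma> s \<sigma> \<Longrightarrow> has_type (\<Gamma> @ \<Delta>) s \<sigma>" for s \<sigma>
        by (induction s arbitrary: \<sigma>) (auto simp: nth_append)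
      with Less show ?case by simp
    next
      case (Forall \<rho> B)
      from Forall.IH[of "\<rho> # \<Gamma>"] Forall.prems show ?case by simp
    qed auto
    from this[of "[]" D "[\<tau>]"] wf(1) show ?thesis by simp
  qed
  let ?I = "Forall \<tau> (Imp D A)"
  have 1: "Ax \<turnstile> ?I" using pr fr by (intro proves_gen[of _ n]) (auto simp: D)
  have "derives Ax {D, ?I} (open_fm 0 (Free n \<tau>) A)"
  proof (rule ImpE)
    have "derives Ax {D, ?I} (open_fm 0 (Free n \<tau>) (Imp D A))"
      by (intro AllE[of _ _ \<tau>] Assm) auto
    then show "derives Ax {D, ?I} (Imp D (open_fm 0 (Free n \<tau>) A))" by (simp add: D)
  qed (simp add: Assm)
  then have "derives Ax {D, ?I} (Forall \<tau> A)" by (rule AllI) (use fr in auto)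
  then have "Ax \<turnstile> Imp ?I (Imp D (Forall \<tau> A))"
    unfolding proves_def using wf wfD by (intro ImpI) auto
  then show ?thesis using 1 by (rule proves_mp)
qed

lemma proves_inst:
  assumes "wf_fm [\<tau>] A" "has_type [] t \<tau>"
  shows "Ax \<turnstile> Imp (Forall \<tau> A) (open_fm 0 t A)"
  unfolding proves_def
  by (rule ImpI, use assms in simp, rule AllE[of _ _ \<tau>], rule Assm) (use assms in auto)

lemma proves_contr:
  assumes "wf_fm [] D" "wf_fm [] A" "Ax \<turnstile> Imp D (Imp (Neg A) Falsum)"
  shows "Ax \<turnstile> Imp D A"
proof -
  have "Ax \<turnstile> Imp (Neg (Neg A)) A"
    unfolding proves_def
    by (rule ImpI, use assms(2) in simp, rule Contr, use assms(2) in simp)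
      (rule ImpE[of _ _ "Neg A"]; rule Assm; simp)
  then show ?thesis using assms by (rule_tac proves_imp_trans[of "Neg (Neg A)"]) auto
qed

text \<open>Joins the hypotheses collected so far, so that a stage of the Henkin construction is a
  single formula.\<close>

definition Conj :: "fm \<Rightarrow> fm \<Rightarrow> fm" where "Conj A B = Neg (Imp A (Neg B))"

lemma wf_Conj [simp]: "wf_fm \<Gamma> (Conj A B) \<longleftrightarrow> wf_fm \<Gamma> A \<and> wf_fm \<Gamma> B"
  by (auto simp: Conj_def)

lemma proves_Conj1: "wf_fm [] A \<Longrightarrow> wf_fm [] B \<Longrightarrow> Ax \<turnstile> Imp (Conj A B) A"
  unfolding Conj_def proves_def
proof (rule ImpI, simp, rule Contr, simp)
  let ?\<Delta> = "{Neg A, Neg (Imp A (Neg B))}"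
  assume wf: "wf_fm [] A" "wf_fm [] B"
  have "derives Ax (insert A ?\<Delta>) Falsum" by (rule ImpE[of _ _ A]; rule Assm; simp)
  moreover have "derives Ax (insert B (insert A ?\<Delta>)) Falsum"
    by (rule ImpE[of _ _ A]; rule Assm; simp)
  ultimately have "derives Ax ?\<Delta> (Imp A (Neg B))" using wf by (intro ImpI) auto
  moreover have "derives Ax ?\<Delta> (Neg (Imp A (Neg B)))" by (rule Assm) simp
  ultimately show "derives Ax ?\<Delta> Falsum" by (rule ImpE[rotated])
qed

lemma proves_Conj2: "wf_fm [] A \<Longrightarrow> wf_fm [] B \<Longrightarrow> Ax \<turnstile> Imp (Conj A B) B"
  unfolding Conj_def proves_def
proof (rule ImpI, simp, rule Contr, simp)
  let ?\<Delta> = "{Neg B, Neg (Imp A (Neg B))}"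
  assume wf: "wf_fm [] A" "wf_fm [] B"
  have "derives Ax ?\<Delta> (Imp A (Neg B))" using wf by (intro ImpI Assm) auto
  moreover have "derives Ax ?\<Delta> (Neg (Imp A (Neg B)))" by (rule Assm) simp
  ultimately show "derives Ax ?\<Delta> Falsum" by (rule ImpE[rotated])
qed

lemma proves_ConjE:
  assumes wf: "wf_fm [] A" "wf_fm [] B" "wf_fm [] C" and pr: "Ax \<turnstile> Imp (Conj A B) C"
  shows "Ax \<turnstile> Imp A (Imp B C)"
proof -
  let ?\<Delta> = "{B, A, Imp (Conj A B) C}"
  have "derives Ax (insert (Imp A (Neg B)) ?\<Delta>) Falsum"
    by (rule ImpE[of _ _ B], rule ImpE[of _ _ A]; rule Assm; simp)
  then have "derives Ax ?\<Delta> (Conj A B)" unfolding Conj_def using wf by (intro ImpI) auto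
  moreover have "derives Ax ?\<Delta> (Imp (Conj A B) C)" by (rule Assm) simp
  ultimately have "derives Ax ?\<Delta> C" by (rule ImpE[rotated])
  then have "Ax \<turnstile> Imp (Imp (Conj A B) C) (Imp A (Imp B C))"
    unfolding proves_def using wf by (intro ImpI) auto
  then show ?thesis using pr by (rule proves_mp)
qed

section \<open>The Henkin construction\<close>

definition consistent :: "fm set \<Rightarrow> fm \<Rightarrow> bool" where
  "consistent Ax D \<longleftrightarrow> wf_fm [] D \<and> \<not> Ax \<turnstile> Imp D Falsum"

lemma consistent_cases:
  assumes "consistent Ax D" "wf_fm [] A"
  shows "consistent Ax (Conj D A) \<or> Ax \<turnstile> Imp D (Neg A)"
  using assms by (auto simp: consistent_def intro: proves_ConjE)

text \<open>For a variable fresh in \<open>B\<close> and \<open>D\<close>, inconsistency of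
  \<open>D\<close> with the negated instance would let \<open>D\<close> prove the instance, hence by
  generalisation \<open>Forall \<tau> B\<close>, against the hypothesis.\<close>

lemma consistent_witness:
  assumes con: "consistent Ax D" and D: "Ax \<turnstile> Imp D (Neg (Forall \<tau> B))" and wf: "wf_fm [\<tau>] B"
  obtains n where "consistent Ax (Conj D (Neg (open_fm 0 (Free n \<tau>) B)))"
proof -
  obtain n where n: "(n, \<tau>) \<notin> frees B" "(n, \<tau>) \<notin> frees D" using ex_fresh by blast
  let ?B = "open_fm 0 (Free n \<tau>) B"
  have wfB: "wf_fm [] ?B" using wf by (simp add: wf_open_fm)
  have wfD: "wf_fm [] D" using con by (simp add: consistent_def)
  have "consistent Ax (Conj D (Neg ?B))"
  proof (rule ccontr)
    assume "\<not> ?thesis"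
    then have "Ax \<turnstile> Imp D (Neg (Neg ?B))"
      using consistent_cases[OF con, of "Neg ?B"] wfB by auto
    then have "Ax \<turnstile> Imp D ?B" using wfB wfD by (rule_tac proves_contr)
    then have "Ax \<turnstile> Imp D (Forall \<tau> B)" using n wf wfD by (rule_tac proves_imp_forall)
    then have "Ax \<turnstile> Imp D Falsum" using D wf wfD by (rule_tac proves_imp_mp[of "Forall \<tau> B"]) auto
    then show False using con by (simp add: consistent_def)
  qed
  then show ?thesis using that by blast
qed

text \<open>Completeness and the witness property in the form of Tarski's truth conditions. The free
  variables, infinitely many of each type, are themselves the Henkin constants, so the language
  stays the same; instances are taken over all terms without bound indices.\<close>

definition henkin :: "fm set \<Rightarrow> fm set \<Rightarrow> bool" where
  "henkin Ax H \<longleftrightarrow>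
     (\<forall>A. Ax \<turnstile> A \<and> wf_fm [] A \<longrightarrow> A \<in> H) \<and> Falsum \<notin> H \<and>
     (\<forall>A B. wf_fm [] (Imp A B) \<longrightarrow> Imp A B \<in> H \<longleftrightarrow> (A \<in> H \<longrightarrow> B \<in> H)) \<and>
     (\<forall>\<tau> A. wf_fm [] (Forall \<tau> A) \<longrightarrow>
        Forall \<tau> A \<in> H \<longleftrightarrow> (\<forall>t. has_type [] t \<tau> \<longrightarrow> open_fm 0 t A \<in> H))"

definition refines :: "fm set \<Rightarrow> fm \<Rightarrow> fm \<Rightarrow> fm \<Rightarrow> bool" where
  "refines Ax A D D' \<longleftrightarrow> consistent Ax D' \<and> Ax \<turnstile> Imp D' D \<and>
     (wf_fm [] A \<longrightarrow> Ax \<turnstile> Imp D' A \<or> Ax \<turnstile> Imp D' (Neg A)) \<and>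
     (\<forall>\<tau> B. wf_fm [] A \<and> A = Forall \<tau> B \<and> Ax \<turnstile> Imp D' (Neg A) \<longrightarrow>
        (\<exists>n. Ax \<turnstile> Imp D' (Neg (open_fm 0 (Free n \<tau>) B))))"

lemma ex_refines:
  assumes con: "consistent Ax D"
  shows "\<exists>D'. refines Ax A D D'"
proof -
  have wfD: "wf_fm [] D" using con by (simp add: consistent_def)
  consider "\<not> wf_fm [] A" | "wf_fm [] A" "consistent Ax (Conj D A)" | "wf_fm [] A" "Ax \<turnstile> Imp D (Neg A)"
    using consistent_cases[OF con] by blast
  then show ?thesis
  proof cases
    case 1
    then show ?thesis using con wfD by (auto simp: refines_def intro!: exI[of _ D] proves_imp_refl)
  next
    case 2
    have "\<not> Ax \<turnstile> Imp (Conj D A) (Neg A)"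
    proof
      assume "Ax \<turnstile> Imp (Conj D A) (Neg A)"
      then have "Ax \<turnstile> Imp (Conj D A) Falsum"
        using 2 wfD by (intro proves_imp_mp[of A Falsum "Conj D A"] proves_Conj2) auto
      then show False using 2 by (simp add: consistent_def)
    qed
    then show ?thesis using 2 wfD
      by (auto simp: refines_def intro!: exI[of _ "Conj D A"] proves_Conj1 proves_Conj2)
  next
    case 3
    show ?thesis
    proof (cases "\<exists>\<tau> B. A = Forall \<tau> B")
      case False
      then show ?thesis using 3 wfD con
        by (auto simp: refines_def intro!: exI[of _ D] proves_imp_refl)
    next
      case True
      then obtain \<tau> B where A: "A = Forall \<tau> B" by blast
      obtain n where n: "consistent Ax (Conj D (Neg (open_fm 0 (Free n \<tau>) B)))"
        using consistent_witness[OF con] 3 A by auto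
      let ?C = "Neg (open_fm 0 (Free n \<tau>) B)"
      have wfC: "wf_fm [] ?C" using 3 A by (simp add: wf_open_fm)
      have 1: "Ax \<turnstile> Imp (Conj D ?C) D" "Ax \<turnstile> Imp (Conj D ?C) ?C"
        using wfD wfC by (auto intro!: proves_Conj1 proves_Conj2)
      moreover have "Ax \<turnstile> Imp (Conj D ?C) (Neg A)"
        using 1 3 wfD wfC by (rule_tac proves_imp_trans[of D "Neg A"]) auto
      ultimately show ?thesis using n A
        by (auto simp: refines_def intro!: exI[of _ "Conj D ?C"])
    qed
  qed
qed

theorem ex_henkin:
  assumes "wf_fm [] \<phi>" "\<not> Ax \<turnstile> \<phi>"
  shows "\<exists>H. henkin Ax H \<and> \<phi> \<notin> H"
proof -
  \<comment> \<open>Stage \<open>i\<close> is followed by a decision on the formula with code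
    \<open>i\<close>; countability of the syntax ensures that every formula has its turn.\<close>
  define st where "st = rec_nat (Neg \<phi>) (\<lambda>i D. SOME D'. refines Ax (from_nat i) D D')"
  have st_0: "st 0 = Neg \<phi>" and st_Suc: "st (Suc i) = (SOME D'. refines Ax (from_nat i) (st i) D')" for i
    by (simp_all add: st_def)
  have "consistent Ax (Neg \<phi>)"
  proof -
    have "\<not> Ax \<turnstile> Imp (Neg \<phi>) Falsum"
    proof
      assume "Ax \<turnstile> Imp (Neg \<phi>) Falsum"
      moreover have "Ax \<turnstile> Imp (Imp (Neg \<phi>) Falsum) \<phi>"
        unfolding proves_def
        by (rule ImpI, use assms in simp, rule Contr, use assms in simp)
          (rule ImpE[of _ _ "Neg \<phi>"]; rule Assm; simp)
      ultimately show False using assms(2) proves_mp by blast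
    qed
    then show ?thesis using assms by (simp add: consistent_def)
  qed
  then have con: "consistent Ax (st i)" for i
  proof (induction i)
    case (Suc i)
    then show ?case
      using someI_ex[OF ex_refines[of Ax "st i" "from_nat i"]] by (simp add: st_Suc refines_def)
  qed (simp add: st_0)
  have ref: "refines Ax (from_nat i) (st i) (st (Suc i))" for i
    unfolding st_Suc by (rule someI_ex[OF ex_refines[OF con]])
  have wf_st: "wf_fm [] (st i)" for i using con by (simp add: consistent_def)
  have mono: "Ax \<turnstile> Imp (st j) (st i)" if "i \<le> j" for i j
    using that
  proof (induction j rule: dec_induct)
    case (step j)
    have "Ax \<turnstile> Imp (st (Suc j)) (st j)" using ref by (simp add: refines_def)
    then show ?case using step wf_st by (blast intro: proves_imp_trans)
  qed (simp add: proves_imp_refl wf_st)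
  \<comment> \<open>Membership is provability from some stage. Stages get stronger, so finitely many
    members follow from a common stage, which gives closure under modus ponens.\<close>
  define H where "H = {A. wf_fm [] A \<and> (\<exists>i. Ax \<turnstile> Imp (st i) A)}"
  have up: "Ax \<turnstile> Imp (st j) A" if "Ax \<turnstile> Imp (st i) A" "i \<le> j" "wf_fm [] A" for i j A
    using proves_imp_trans[OF wf_st that(3) wf_st mono[OF that(2)] that(1)] .
  have mp: "B \<in> H" if "Imp A B \<in> H" "A \<in> H" for A B
  proof -
    from that obtain i j where "Ax \<turnstile> Imp (st i) (Imp A B)" "Ax \<turnstile> Imp (st j) A"
      and wf: "wf_fm [] A" "wf_fm [] B" by (auto simp: H_def)
    then have "Ax \<turnstile> Imp (st (max i j)) (Imp A B)" "Ax \<turnstile> Imp (st (max i j)) A"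
      using up[of i "Imp A B" "max i j"] up[of j A "max i j"] by auto
    then show ?thesis using wf wf_st by (auto simp: H_def intro: proves_imp_mp)
  qed
  have prov: "A \<in> H" if "Ax \<turnstile> A" "wf_fm [] A" for A
    using that wf_st by (auto simp: H_def intro: proves_imp_thm)
  have false: "Falsum \<notin> H" using con by (auto simp: H_def consistent_def)
  have wfH: "wf_fm [] A" if "A \<in> H" for A using that by (simp add: H_def)
  have neg: "Neg A \<in> H \<longleftrightarrow> A \<notin> H" if "wf_fm [] A" for A
  proof -
    obtain i where i: "from_nat i = A" using from_nat_to_nat by blast
    then have "A \<in> H \<or> Neg A \<in> H"
      using ref[of i] that by (auto simp: refines_def H_def)
    then show ?thesis using mp[of A Falsum] false by blast
  qed
  have imp: "Imp A B \<in> H \<longleftrightarrow> (A \<in> H \<longrightarrow> B \<in> H)" if wf: "wf_fm [] (Imp A B)" for A B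
  proof -
    have "Imp A B \<in> H" if "B \<in> H"
      using mp[OF prov that] proves_K[of B A] wf by simp
    moreover have "Imp A B \<in> H" if "Neg A \<in> H"
    proof -
      have "derives Ax {Neg B, A, Neg A} Falsum" by (rule ImpE[of _ _ A]; rule Assm; simp)
      then have "Ax \<turnstile> Imp (Neg A) (Imp A B)"
        unfolding proves_def
        by (rule_tac ImpI, use wf in simp, rule_tac ImpI, use wf in simp, rule_tac Contr)
          (use wf in auto)
      then show ?thesis using mp[OF prov that] wf by simp
    qed
    ultimately show ?thesis using mp neg[of A] wf by auto
  qed
  have all: "Forall \<tau> A \<in> H \<longleftrightarrow> (\<forall>t. has_type [] t \<tau> \<longrightarrow> open_fm 0 t A \<in> H)"
    if wf: "wf_fm [] (Forall \<tau> A)" for \<tau> A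
  proof
    assume "Forall \<tau> A \<in> H"
    then show "\<forall>t. has_type [] t \<tau> \<longrightarrow> open_fm 0 t A \<in> H"
      using mp[OF prov[OF proves_inst]] wf by (auto simp: wf_open_fm)
  next
    assume *: "\<forall>t. has_type [] t \<tau> \<longrightarrow> open_fm 0 t A \<in> H"
    show "Forall \<tau> A \<in> H"
    proof (rule ccontr)
      assume "Forall \<tau> A \<notin> H"
      then have n: "Neg (Forall \<tau> A) \<in> H" using neg wf by blast
      obtain i where i: "from_nat i = Forall \<tau> A" using from_nat_to_nat by blast
      have "Ax \<turnstile> Imp (st (Suc i)) (Forall \<tau> A) \<or> Ax \<turnstile> Imp (st (Suc i)) (Neg (Forall \<tau> A))"
        using ref[of i] i wf by (auto simp: refines_def)
      then have "Ax \<turnstile> Imp (st (Suc i)) (Neg (Forall \<tau> A))"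
        using \<open>Forall \<tau> A \<notin> H\<close> wf by (auto simp: H_def)
      then obtain m where "Ax \<turnstile> Imp (st (Suc i)) (Neg (open_fm 0 (Free m \<tau>) A))"
        using ref[of i] i wf unfolding refines_def by metis
      then have "Neg (open_fm 0 (Free m \<tau>) A) \<in> H"
        using wf by (auto simp: H_def wf_open_fm)
      then show False using * neg[of "open_fm 0 (Free m \<tau>) A"] wf by (simp add: wf_open_fm)
    qed
  qed
  have "Ax \<turnstile> Imp (st 0) (Neg \<phi>)" using assms by (simp add: st_0 proves_imp_refl)
  then have "\<phi> \<notin> H" using neg[of \<phi>] assms by (auto simp: H_def)
  then show ?thesis unfolding henkin_def using prov false imp all by blast
qed

section \<open>Structures and satisfaction\<close>

locale interp =
  fixes D :: "ty \<Rightarrow> 'u set" and ap :: "'u \<Rightarrow> 'u \<Rightarrow> 'u" (infixl \<open>\<bullet>\<close> 90)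
    and cn :: "tm \<Rightarrow> 'u" and eq ls :: "'u \<Rightarrow> 'u \<Rightarrow> bool"
begin

primrec teval :: "(nat \<Rightarrow> 'u) \<Rightarrow> (nat \<times> ty \<Rightarrow> 'u) \<Rightarrow> tm \<Rightarrow> 'u" where
  "teval b e (Bnd i) = b i"
| "teval b e (Free n \<sigma>) = e (n, \<sigma>)"
| "teval b e Zero = cn Zero"
| "teval b e One = cn One"
| "teval b e Plus = cn Plus"
| "teval b e Times = cn Times"
| "teval b e (Kc \<rho> \<sigma>) = cn (Kc \<rho> \<sigma>)"
| "teval b e (Sc \<delta> \<rho> \<sigma>) = cn (Sc \<delta> \<rho> \<sigma>)"
| "teval b e Rec = cn Rec"
| "teval b e (s \<cdot> t) = teval b e s \<bullet> teval b e t"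

primrec sat :: "(nat \<Rightarrow> 'u) \<Rightarrow> (nat \<times> ty \<Rightarrow> 'u) \<Rightarrow> fm \<Rightarrow> bool" where
  "sat b e (Eq s t) \<longleftrightarrow> eq (teval b e s) (teval b e t)"
| "sat b e (Less s t) \<longleftrightarrow> ls (teval b e s) (teval b e t)"
| "sat b e Falsum \<longleftrightarrow> False"
| "sat b e (Imp A B) \<longleftrightarrow> (sat b e A \<longrightarrow> sat b e B)"
| "sat b e (Forall \<tau> A) \<longleftrightarrow> (\<forall>u\<in>D \<tau>. sat (case_nat u b) e A)"

lemma teval_cong:
  assumes "has_type \<Gamma> t \<tau>" "\<And>i. i < length \<Gamma> \<Longrightarrow> b i = b' i" "\<And>v. v \<in> frees_tm t \<Longrightarrow> e v = e' v"
  shows "teval b e t = teval b' e' t"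
  using assms(1,3) by (induction t arbitrary: \<tau>) (auto simp: assms(2) | blast)+

lemma sat_cong:
  assumes "wf_fm \<Gamma> A" "\<And>i. i < length \<Gamma> \<Longrightarrow> b i = b' i" "\<And>v. v \<in> frees A \<Longrightarrow> e v = e' v"
  shows "sat b e A \<longleftrightarrow> sat b' e' A"
  using assms
proof (induction A arbitrary: \<Gamma> b b')
  case (Eq s t)
  then have "teval b e s = teval b' e' s" "teval b e t = teval b' e' t"
    by (auto intro!: teval_cong)
  then show ?case by simp
next
  case (Less s t)
  then have "teval b e s = teval b' e' s" "teval b e t = teval b' e' t"
    by (auto intro!: teval_cong)
  then show ?case by simp
next
  case (Forall \<tau> A)
  have "sat (case_nat u b) e A \<longleftrightarrow> sat (case_nat u b') e' A" for u
    by (rule Forall.IH[of "\<tau> # \<Gamma>"]) (use Forall.prems in \<open>auto split: nat.split\<close>)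
  then show ?case by simp
next
  case (Imp A B)
  from Imp.IH[of \<Gamma> b b'] Imp.prems show ?case by auto
qed auto

lemma sat_closed: "wf_fm [] A \<Longrightarrow> sat b e A \<longleftrightarrow> sat b' e A"
  by (rule sat_cong) auto

lemma teval_open: "teval b e (open_tm k u t) = teval (b(k := teval b e u)) e t"
  by (induction t) auto

lemma sat_open:
  assumes u: "has_type [] u \<sigma>"
  shows "sat b e (open_fm k u A) \<longleftrightarrow> sat (b(k := teval b e u)) e A"
proof (induction A arbitrary: b k)
  case (Forall \<tau> A)
  have "teval (case_nat w b) e u = teval b e u" for w using u by (intro teval_cong) auto
  moreover have "(case_nat w b)(Suc k := z) = case_nat w (b(k := z))" for w z
    by (auto split: nat.split)
  ultimately have "sat (case_nat w b) e (open_fm (Suc k) u A) \<longleftrightarrow>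
      sat (case_nat w (b(k := teval b e u))) e A" for w
    using Forall[of "case_nat w b" "Suc k"] by (simp only:)
  then show ?case unfolding sat.simps open_fm.simps by blast
qed (auto simp: teval_open)

lemma teval_subst: "teval b e (subst_tm v u t) = teval b (e(v := teval b e u)) t"
  by (induction t) auto

lemma sat_close: "sat b e (close_fm k v A) \<longleftrightarrow> sat b (e(v := b k)) A"
  by (induction A arbitrary: b k) (auto simp: teval_subst)

lemma sat_subst_qf:
  "quantifier_free A \<Longrightarrow> sat b e (subst_fm v u A) \<longleftrightarrow> sat b (e(v := teval b e u)) A"
  by (induction A) (auto simp: teval_subst)

lemma sat_forall_var:
  "sat b e (forall_var v A) \<longleftrightarrow> (\<forall>u\<in>D (snd v). sat (case_nat u b) (e(v := u)) A)"
  by (simp add: forall_var_def sat_close)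

lemma sat_exists_var:
  "sat b e (exists_var v A) \<longleftrightarrow> (\<exists>u\<in>D (snd v). sat (case_nat u b) (e(v := u)) A)"
  by (simp add: exists_var_def sat_forall_var)

text \<open>The generic truth lemma is used twice: for the structure of all closed terms, where it
  serves to read off extensionality, and then for its extensional collapse.\<close>

lemma truth:
  assumes H: "henkin Ax H"
    and D: "\<And>\<tau>. D \<tau> = c ` {t. has_type [] t \<tau>}"
    and ap: "\<And>s t \<sigma> \<tau>. has_type [] s (\<sigma> \<rightarrow> \<tau>) \<Longrightarrow> has_type [] t \<sigma> \<Longrightarrow> c (s \<cdot> t) = c s \<bullet> c t"
    and cn: "\<And>t. cn t = c t"
    and eq: "\<And>s t. has_type [] s Num \<Longrightarrow> has_type [] t Num \<Longrightarrow> eq (c s) (c t) \<longleftrightarrow> Eq s t \<in> H"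
    and ls: "\<And>s t. has_type [] s Num \<Longrightarrow> has_type [] t Num \<Longrightarrow> ls (c s) (c t) \<longleftrightarrow> Less s t \<in> H"
    and wf: "wf_fm [] A"
  shows "sat b (\<lambda>(n, \<sigma>). c (Free n \<sigma>)) A \<longleftrightarrow> A \<in> H"
  using wf
proof (induction "depth A" arbitrary: A b rule: less_induct)
  case less
  let ?e = "\<lambda>(n, \<sigma>). c (Free n \<sigma>)"
  have tv: "teval b ?e t = c t" if "has_type [] t \<tau>" for b t \<tau>
    using that by (induction t arbitrary: \<tau>) (auto simp: cn ap)
  show ?case
  proof (cases A)
    case (Forall \<tau> B)
    have "sat (case_nat (c t) b) ?e B \<longleftrightarrow> open_fm 0 t B \<in> H" if t: "has_type [] t \<tau>" for t
    proof -
      have "sat (case_nat (c t) b) ?e B \<longleftrightarrow> sat (b(0 := c t)) ?e B"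
        by (rule sat_cong[of "[\<tau>]"]) (use less.prems Forall in auto)
      also have "\<dots> \<longleftrightarrow> sat b ?e (open_fm 0 t B)" by (simp add: sat_open[OF t] tv[OF t])
      also have "\<dots> \<longleftrightarrow> open_fm 0 t B \<in> H"
        using less.hyps[of "open_fm 0 t B"] less.prems Forall t by (simp add: wf_open_fm)
      finally show ?thesis .
    qed
    then show ?thesis using H less.prems Forall by (auto simp: henkin_def D)
  next
    case (Imp B C)
    then show ?thesis using H less.prems less.hyps[of B] less.hyps[of C] by (auto simp: henkin_def)
  qed (use H less.prems in \<open>auto simp: tv eq ls henkin_def\<close>)
qed

end

text \<open>Formulas built with HOL binders at depth \<open>n\<close> contain only terms whose
  variables have numbers below \<open>n\<close>. For these terms the assignment made by a quantifier
  at depth \<open>n\<close> is invisible, which lets satisfaction be computed by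
  simplification.\<close>

primrec ok :: "nat \<Rightarrow> tm \<Rightarrow> bool" where
  "ok n (Bnd i) \<longleftrightarrow> False"
| "ok n (Free i \<sigma>) \<longleftrightarrow> i < n"
| "ok n Zero \<longleftrightarrow> True"
| "ok n One \<longleftrightarrow> True"
| "ok n Plus \<longleftrightarrow> True"
| "ok n Times \<longleftrightarrow> True"
| "ok n (Kc \<rho> \<sigma>) \<longleftrightarrow> True"
| "ok n (Sc \<delta> \<rho> \<sigma>) \<longleftrightarrow> True"
| "ok n Rec \<longleftrightarrow> True"
| "ok n (s \<cdot> t) \<longleftrightarrow> ok n s \<and> ok n t"

lemma ok_Suc [simp]: "ok n t \<Longrightarrow> ok (Suc n) t"
  by (induction t) auto

context interp
begin

lemma teval_ok [simp]: "ok n t \<Longrightarrow> teval (case_nat u b) (e((n, \<tau>) := u)) t = teval b e t"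
  by (induction t) auto

lemma sat_form:
  "sat b e ((s \<^bold>= t) n) \<longleftrightarrow> eq (teval b e s) (teval b e t)"
  "sat b e ((s \<^bold>< t) n) \<longleftrightarrow> ls (teval b e s) (teval b e t)"
  "sat b e ((F \<^bold>\<longrightarrow> G) n) \<longleftrightarrow> (sat b e (F n) \<longrightarrow> sat b e (G n))"
  "sat b e ((\<^bold>\<not> F) n) \<longleftrightarrow> \<not> sat b e (F n)"
  "sat b e ((F \<^bold>\<or> G) n) \<longleftrightarrow> sat b e (F n) \<or> sat b e (G n)"
  "sat b e ((F \<^bold>\<and> G) n) \<longleftrightarrow> sat b e (F n) \<and> sat b e (G n)"
  "sat b e ((F \<^bold>\<longleftrightarrow> G) n) \<longleftrightarrow> (sat b e (F n) \<longleftrightarrow> sat b e (G n))"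
  "sat b e ((s \<^bold>\<le> t) n) \<longleftrightarrow> ls (teval b e s) (teval b e t) \<or> eq (teval b e s) (teval b e t)"
  "sat b e (fall \<tau> Q n) \<longleftrightarrow> (\<forall>u\<in>D \<tau>. sat (case_nat u b) (e((n, \<tau>) := u)) (Q (Free n \<tau>) (Suc n)))"
  "sat b e (fex \<tau> Q n) \<longleftrightarrow> (\<exists>u\<in>D \<tau>. sat (case_nat u b) (e((n, \<tau>) := u)) (Q (Free n \<tau>) (Suc n)))"
  by (auto simp: feq_def fless_def fimp_def fneg_def fdisj_def fconj_def fiff_def fle_def
      fall_def fex_def sat_forall_var)

primrec eqs :: "ty \<Rightarrow> 'u \<Rightarrow> 'u \<Rightarrow> bool" where
  "eqs Num x y \<longleftrightarrow> eq x y"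
| "eqs (\<sigma> \<rightarrow> \<tau>) x y \<longleftrightarrow> (\<forall>u\<in>D \<sigma>. eqs \<tau> (x \<bullet> u) (y \<bullet> u))"

lemma sat_eq_at:
  "ok n s \<Longrightarrow> ok n t \<Longrightarrow> sat b e (eq_at \<tau> s t n) \<longleftrightarrow> eqs \<tau> (teval b e s) (teval b e t)"
  by (induction \<tau> arbitrary: n s t b e) (auto simp: sat_form)

end

lemma wf_form:
  "wf_fm [] ((s \<^bold>= t) n) \<longleftrightarrow> has_type [] s Num \<and> has_type [] t Num"
  "wf_fm [] ((s \<^bold>< t) n) \<longleftrightarrow> has_type [] s Num \<and> has_type [] t Num"
  "wf_fm [] ((F \<^bold>\<longrightarrow> G) n) \<longleftrightarrow> wf_fm [] (F n) \<and> wf_fm [] (G n)"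
  "wf_fm [] ((\<^bold>\<not> F) n) \<longleftrightarrow> wf_fm [] (F n)"
  "wf_fm [] ((F \<^bold>\<or> G) n) \<longleftrightarrow> wf_fm [] (F n) \<and> wf_fm [] (G n)"
  "wf_fm [] ((F \<^bold>\<and> G) n) \<longleftrightarrow> wf_fm [] (F n) \<and> wf_fm [] (G n)"
  "wf_fm [] ((F \<^bold>\<longleftrightarrow> G) n) \<longleftrightarrow> wf_fm [] (F n) \<and> wf_fm [] (G n)"
  "wf_fm [] ((s \<^bold>\<le> t) n) \<longleftrightarrow> has_type [] s Num \<and> has_type [] t Num"
  by (auto simp: feq_def fless_def fimp_def fneg_def fdisj_def fconj_def fiff_def fle_def)

lemma wf_quant:
  "wf_fm [] (Q (Free n \<tau>) (Suc n)) \<Longrightarrow> wf_fm [] (fall \<tau> Q n)"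
  "wf_fm [] (Q (Free n \<tau>) (Suc n)) \<Longrightarrow> wf_fm [] (fex \<tau> Q n)"
  by (auto simp: fall_def fex_def fneg_def intro: wf_forall_var)

lemma wf_eq_at: "has_type [] s \<tau> \<Longrightarrow> has_type [] t \<tau> \<Longrightarrow> wf_fm [] (eq_at \<tau> s t n)"
  by (induction \<tau> arbitrary: n s t) (auto simp: wf_form intro!: wf_quant)

section \<open>The extensional collapse of a Henkin theory\<close>

primrec eqv :: "fm set \<Rightarrow> ty \<Rightarrow> tm \<Rightarrow> tm \<Rightarrow> bool" where
  "eqv H Num s t \<longleftrightarrow> Eq s t \<in> H"
| "eqv H (\<sigma> \<rightarrow> \<tau>) s t \<longleftrightarrow> (\<forall>u. has_type [] u \<sigma> \<longrightarrow> eqv H \<tau> (s \<cdot> u) (t \<cdot> u))"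

text \<open>No type index is carried along: a term has at most one type in the empty context.
  Ill-typed terms get the empty class.\<close>

definition cls :: "fm set \<Rightarrow> tm \<Rightarrow> tm set" where
  "cls H t = {s. \<exists>\<tau>. has_type [] s \<tau> \<and> has_type [] t \<tau> \<and> eqv H \<tau> s t}"

text \<open>The union over all representatives avoids a choice; by congruence all the classes in it
  coincide (\<open>cls_ap_cls\<close>).\<close>

definition cls_ap :: "fm set \<Rightarrow> tm set \<Rightarrow> tm set \<Rightarrow> tm set" where
  "cls_ap H X Y = (\<Union>s\<in>X. \<Union>t\<in>Y. cls H (s \<cdot> t))"

definition cls_dom :: "fm set \<Rightarrow> ty \<Rightarrow> tm set set" where
  "cls_dom H \<tau> = cls H ` {t. has_type [] t \<tau>}"

definition cls_less :: "fm set \<Rightarrow> tm set \<Rightarrow> tm set \<Rightarrow> bool" where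
  "cls_less H X Y \<longleftrightarrow> (\<exists>s\<in>X. \<exists>t\<in>Y. Less s t \<in> H)"

locale henkin_theory =
  fixes Ax H :: "fm set"
  assumes henkin: "henkin Ax H" and ext_Ax: "extensionality_axioms \<subseteq> Ax"
begin

lemma Eq_refl: "has_type [] t Num \<Longrightarrow> Eq t t \<in> H"
  using henkin by (auto simp: henkin_def proves_def intro: EqRefl)

lemma Eq_subst:
  assumes "Eq s t \<in> H" "has_type [] s Num" "has_type [] t Num" "wf_fm [Num] A" "open_fm 0 s A \<in> H"
  shows "open_fm 0 t A \<in> H"
proof -
  have wf: "wf_fm [] (open_fm 0 s A)" "wf_fm [] (open_fm 0 t A)" using assms by (auto simp: wf_open_fm)
  let ?\<Delta> = "{open_fm 0 s A, Eq s t}"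
  have "derives Ax ?\<Delta> (open_fm 0 t A)" by (rule EqSubst[of _ _ s]; rule Assm; simp)
  then have "Ax \<turnstile> Imp (Eq s t) (Imp (open_fm 0 s A) (open_fm 0 t A))"
    unfolding proves_def using wf assms(2,3) by (intro ImpI) auto
  moreover have "wf_fm [] (Imp (Eq s t) (Imp (open_fm 0 s A) (open_fm 0 t A)))"
    using wf assms(2,3) by simp
  ultimately show ?thesis using henkin assms(1,5) wf_fm.simps(4) unfolding henkin_def by metis
qed

lemma Eq_sym: "Eq s t \<in> H \<Longrightarrow> has_type [] s Num \<Longrightarrow> has_type [] t Num \<Longrightarrow> Eq t s \<in> H"
  using Eq_subst[of s t "Eq (Bnd 0) s"] Eq_refl[of s] by (simp add: open_tm_closed has_type_weaken)

lemma Eq_trans: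
  "Eq s t \<in> H \<Longrightarrow> Eq t u \<in> H \<Longrightarrow> has_type [] s Num \<Longrightarrow> has_type [] t Num \<Longrightarrow> has_type [] u Num
    \<Longrightarrow> Eq s u \<in> H"
  using Eq_subst[of t u "Eq s (Bnd 0)"] by (simp add: open_tm_closed has_type_weaken)

lemma Less_cong:
  assumes "Eq s s' \<in> H" "Eq t t' \<in> H" "Less s t \<in> H"
    and ty: "has_type [] s Num" "has_type [] s' Num" "has_type [] t Num" "has_type [] t' Num"
  shows "Less s' t' \<in> H"
proof -
  have "Less s' t \<in> H"
    using Eq_subst[of s s' "Less (Bnd 0) t"] assms by (simp add: open_tm_closed has_type_weaken)
  then show ?thesis
    using Eq_subst[of t t' "Less s' (Bnd 0)"] assms by (simp add: open_tm_closed has_type_weaken)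
qed

lemma eqv_refl: "has_type [] t \<tau> \<Longrightarrow> eqv H \<tau> t t"
proof (induction \<tau> arbitrary: t)
  case (Fn \<sigma> \<tau>)
  then show ?case by (meson eqv.simps(2) has_type.simps(10))
qed (simp add: Eq_refl)

lemma eqv_sym: "eqv H \<tau> s t \<Longrightarrow> has_type [] s \<tau> \<Longrightarrow> has_type [] t \<tau> \<Longrightarrow> eqv H \<tau> t s"
proof (induction \<tau> arbitrary: s t)
  case (Fn \<sigma> \<tau>)
  then show ?case by (meson eqv.simps(2) has_type.simps(10))
qed (simp add: Eq_sym)

lemma eqv_trans:
  "eqv H \<tau> s t \<Longrightarrow> eqv H \<tau> t u \<Longrightarrow> has_type [] s \<tau> \<Longrightarrow> has_type [] t \<tau> \<Longrightarrow> has_type [] u \<tau>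
    \<Longrightarrow> eqv H \<tau> s u"
proof (induction \<tau> arbitrary: s t u)
  case Num
  then show ?case using Eq_trans[of s t u] by simp
next
  case (Fn \<sigma> \<tau>)
  have "eqv H \<tau> (s \<cdot> w) (u \<cdot> w)" if w: "has_type [] w \<sigma>" for w
  proof (rule Fn.IH(2)[of _ "t \<cdot> w"])
    show "eqv H \<tau> (s \<cdot> w) (t \<cdot> w)" "eqv H \<tau> (t \<cdot> w) (u \<cdot> w)"
      using Fn.prems(1,2) w by simp_all
  qed (use Fn.prems(3-5) w in \<open>simp_all, blast+\<close>)
  then show ?case by simp
qed

text \<open>The extensionality axiom belongs to \<open>H\<close>; the truth lemma for the structure
  of closed terms turns it into congruence in the argument, since there \<open>eqv\<close> is the
  meaning of \<open>eq_at\<close>.\<close>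

lemma eqv_arg:
  assumes "eqv H \<sigma> s t" "has_type [] s \<sigma>" "has_type [] t \<sigma>" "has_type [] r (\<sigma> \<rightarrow> \<tau>)"
  shows "eqv H \<tau> (r \<cdot> s) (r \<cdot> t)"
proof -
  interpret T: interp "\<lambda>\<tau>. {t. has_type [] t \<tau>}" App id "\<lambda>s t. Eq s t \<in> H" "\<lambda>s t. Less s t \<in> H" .
  let ?A = "fall \<sigma> (\<lambda>x. fall \<sigma> (\<lambda>y. fall (\<sigma> \<rightarrow> \<tau>) (\<lambda>f.
        eq_at \<sigma> x y \<^bold>\<longrightarrow> eq_at \<tau> (f \<cdot> x) (f \<cdot> y)))) 0"
  have "?A \<in> Ax" using ext_Ax unfolding extensionality_axioms_def by auto
  moreover have wf: "wf_fm [] ?A" by (auto simp: wf_form intro!: wf_quant wf_eq_at)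
  ultimately have "?A \<in> H"
    using henkin by (auto simp: henkin_def proves_def intro: Axiom)
  then have "T.sat b (\<lambda>(n, \<sigma>). id (Free n \<sigma>)) ?A" for b
    using T.truth[OF henkin, of id] wf by simp
  moreover have "T.eqs \<tau> s t \<longleftrightarrow> eqv H \<tau> s t" for \<tau> s t
    by (induction \<tau> arbitrary: s t) auto
  ultimately show ?thesis using assms by (simp add: T.sat_form T.sat_eq_at)
qed

lemma mem_cls: "has_type [] t \<tau> \<Longrightarrow> s \<in> cls H t \<longleftrightarrow> has_type [] s \<tau> \<and> eqv H \<tau> s t"
proof -
  assume t: "has_type [] t \<tau>"
  show ?thesis
  proof
    assume "s \<in> cls H t"
    then obtain \<rho> where "has_type [] s \<rho>" "has_type [] t \<rho>" "eqv H \<rho> s t" unfolding cls_def by blast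
    then show "has_type [] s \<tau> \<and> eqv H \<tau> s t" using has_type_unique[OF t, of \<rho>] by simp
  qed (use t in \<open>auto simp: cls_def\<close>)
qed

lemma cls_mono:
  assumes e: "eqv H \<tau> s t" and ty: "has_type [] s \<tau>" "has_type [] t \<tau>"
  shows "cls H s \<subseteq> cls H t"
proof
  fix r assume "r \<in> cls H s"
  then have r: "has_type [] r \<tau>" "eqv H \<tau> r s" by (simp_all add: mem_cls[OF ty(1)])
  show "r \<in> cls H t" using r(1) eqv_trans[OF r(2) e r(1) ty] by (simp add: mem_cls[OF ty(2)])
qed

lemma cls_self: "has_type [] t \<tau> \<Longrightarrow> t \<in> cls H t"
  by (simp add: mem_cls[of t \<tau>] eqv_refl)

lemma cls_eq_iff:
  assumes "has_type [] s \<tau>" "has_type [] t \<tau>"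
  shows "cls H s = cls H t \<longleftrightarrow> eqv H \<tau> s t"
proof
  assume "cls H s = cls H t"
  then have "s \<in> cls H t" using mem_cls[OF assms(1)] eqv_refl[OF assms(1)] assms(1) by simp
  then show "eqv H \<tau> s t" using mem_cls[OF assms(2)] by simp
next
  assume e: "eqv H \<tau> s t"
  show "cls H s = cls H t"
    using cls_mono[OF e assms] cls_mono[OF eqv_sym[OF e assms] assms(2,1)] by (rule equalityI)
qed

lemma cls_ap_cls:
  assumes "has_type [] s (\<sigma> \<rightarrow> \<tau>)" "has_type [] t \<sigma>"
  shows "cls_ap H (cls H s) (cls H t) = cls H (s \<cdot> t)"
proof -
  have "cls H (s' \<cdot> t') = cls H (s \<cdot> t)" if "s' \<in> cls H s" "t' \<in> cls H t" for s' t'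
  proof -
    have s': "has_type [] s' (\<sigma> \<rightarrow> \<tau>)" "eqv H (\<sigma> \<rightarrow> \<tau>) s' s" and t': "has_type [] t' \<sigma>" "eqv H \<sigma> t' t"
      using that by (simp_all only: mem_cls[OF assms(1)] mem_cls[OF assms(2)])
    have "eqv H \<tau> (s' \<cdot> t') (s' \<cdot> t)" using eqv_arg[OF t'(2,1)] assms s' by blast
    moreover have "eqv H \<tau> (s' \<cdot> t) (s \<cdot> t)" using s'(2) assms(2) by simp
    ultimately have "eqv H \<tau> (s' \<cdot> t') (s \<cdot> t)"
      using eqv_trans[of \<tau> "s' \<cdot> t'" "s' \<cdot> t" "s \<cdot> t"] s'(1) t'(1) assms
      by (meson has_type.simps(10))
    then show ?thesis using cls_eq_iff[of "s' \<cdot> t'" \<tau> "s \<cdot> t"] s'(1) t'(1) assms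
      by (meson has_type.simps(10))
  qed
  moreover have "s \<in> cls H s" "t \<in> cls H t" using assms by (auto intro: cls_self)
  ultimately show ?thesis unfolding cls_ap_def by blast
qed

lemma cls_less_cls:
  assumes "has_type [] s Num" "has_type [] t Num"
  shows "cls_less H (cls H s) (cls H t) \<longleftrightarrow> Less s t \<in> H"
proof -
  have "s \<in> cls H s" "t \<in> cls H t" using assms by (auto intro: cls_self)
  moreover have "Less s t \<in> H" if "s' \<in> cls H s" "t' \<in> cls H t" "Less s' t' \<in> H" for s' t'
  proof -
    have "has_type [] s' Num" "Eq s' s \<in> H" "has_type [] t' Num" "Eq t' t \<in> H"
      using that(1,2) by (simp_all only: mem_cls[OF assms(1)] mem_cls[OF assms(2)] eqv.simps)
    then show ?thesis using Less_cong that assms by blast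
  qed
  ultimately show ?thesis unfolding cls_less_def by blast
qed

end

locale ext_model = interp D ap cn "(=)" ls
  for D :: "ty \<Rightarrow> 'u set" and ap (infixl \<open>\<bullet>\<close> 90) and cn ls +
  fixes Ax :: "fm set"
  assumes cn_dom: "t \<noteq> s \<cdot> r \<Longrightarrow> has_type [] t \<tau> \<Longrightarrow> cn t \<in> D \<tau>"
    and ap_dom: "x \<in> D (\<sigma> \<rightarrow> \<tau>) \<Longrightarrow> y \<in> D \<sigma> \<Longrightarrow> x \<bullet> y \<in> D \<tau>"
    and ext: "x \<in> D (\<sigma> \<rightarrow> \<tau>) \<Longrightarrow> y \<in> D (\<sigma> \<rightarrow> \<tau>) \<Longrightarrow> (\<And>u. u \<in> D \<sigma> \<Longrightarrow> x \<bullet> u = y \<bullet> u) \<Longrightarrow> x = y"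
    and sat_Ax: "A \<in> Ax \<Longrightarrow> wf_fm [] A \<Longrightarrow> (\<And>n \<sigma>. e (n, \<sigma>) \<in> D \<sigma>) \<Longrightarrow> sat b e A"

text \<open>Axioms such as quantifier-free induction have free variables. Membership in
  \<open>H\<close> speaks about one assignment only, so they are first closed universally and then
  instantiated here.\<close>

lemma (in interp) sat_closure:
  assumes "sat b e (foldr forall_var vs A)" "wf_fm [] A"
    and "\<And>n \<sigma>. e' (n, \<sigma>) \<in> D \<sigma>" "\<And>v. v \<notin> set vs \<Longrightarrow> e' v = e v"
  shows "sat b e' A"
  using assms
proof (induction vs arbitrary: e b)
  case Nil
  then show ?case using sat_cong[of "[]" A b b e e'] by auto
next
  case (Cons v vs)
  have wf: "wf_fm [] (foldr forall_var us A)" for us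
    using Cons.prems(2) by (induction us) (auto intro: wf_forall_var)
  have "e' v \<in> D (snd v)" using Cons.prems(3)[of "fst v" "snd v"] by simp
  then have "sat (case_nat (e' v) b) (e(v := e' v)) (foldr forall_var vs A)"
    using Cons.prems(1) by (simp add: sat_forall_var)
  then have "sat b (e(v := e' v)) (foldr forall_var vs A)" using sat_closed[OF wf] by blast
  then show ?case
  proof (rule Cons.IH)
    show "e' w = (e(v := e' v)) w" if "w \<notin> set vs" for w
      using Cons.prems(4)[of w] that by (cases "w = v") simp_all
  qed (rule Cons.prems)+
qed

context henkin_theory
begin

sublocale C: interp "cls_dom H" "cls_ap H" "cls H" "(=)" "cls_less H" .

lemma sat_cls: "wf_fm [] A \<Longrightarrow> C.sat b (\<lambda>(n, \<sigma>). cls H (Free n \<sigma>)) A \<longleftrightarrow> A \<in> H"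
  by (rule C.truth[OF henkin])
    (auto simp: cls_dom_def cls_ap_cls cls_eq_iff[of _ Num] cls_less_cls)

sublocale ext_model "cls_dom H" "cls_ap H" "cls H" "cls_less H" Ax
proof
  show "cls H t \<in> cls_dom H \<tau>" if "has_type [] t \<tau>" for t \<tau>
    using that by (auto simp: cls_dom_def)
  show "cls_ap H x y \<in> cls_dom H \<tau>" if "x \<in> cls_dom H (\<sigma> \<rightarrow> \<tau>)" "y \<in> cls_dom H \<sigma>" for x y \<sigma> \<tau>
    using that by (auto simp: cls_dom_def cls_ap_cls intro!: imageI) blast
  show "x = y" if "x \<in> cls_dom H (\<sigma> \<rightarrow> \<tau>)" "y \<in> cls_dom H (\<sigma> \<rightarrow> \<tau>)"
    "\<And>u. u \<in> cls_dom H \<sigma> \<Longrightarrow> cls_ap H x u = cls_ap H y u" for x y \<sigma> \<tau>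
  proof -
    from that obtain s t where st: "x = cls H s" "y = cls H t"
      "has_type [] s (\<sigma> \<rightarrow> \<tau>)" "has_type [] t (\<sigma> \<rightarrow> \<tau>)" by (auto simp: cls_dom_def)
    have "eqv H \<tau> (s \<cdot> u) (t \<cdot> u)" if "has_type [] u \<sigma>" for u
    proof -
      have "cls H (s \<cdot> u) = cls H (t \<cdot> u)"
        using \<open>\<And>u. u \<in> cls_dom H \<sigma> \<Longrightarrow> cls_ap H x u = cls_ap H y u\<close>[of "cls H u"] st that
        using cls_ap_cls[OF st(3) that] cls_ap_cls[OF st(4) that] by (simp add: cls_dom_def)
      then show ?thesis using cls_eq_iff[of "s \<cdot> u" \<tau> "t \<cdot> u"] st(3,4) that by (meson has_type.simps(10))
    qed
    then show ?thesis using cls_eq_iff[of s "\<sigma> \<rightarrow> \<tau>" t] st by simp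
  qed
  show "C.sat b e A" if A: "A \<in> Ax" "wf_fm [] A" and e: "\<And>n \<sigma>. e (n, \<sigma>) \<in> cls_dom H \<sigma>" for A e b
  proof -
    \<comment> \<open>A formula has finitely many free variables, so \<open>?e\<close> differs from
      the canonical assignment at finitely many places only and can be reached from it through the
      closure over \<open>vs\<close>.\<close>
    let ?e = "\<lambda>v. if v \<in> frees A then e v else cls H (Free (fst v) (snd v))"
    obtain vs where vs: "set vs = frees A" using finite_frees finite_list by blast
    have "Ax \<turnstile> foldr forall_var us A \<and> wf_fm [] (foldr forall_var us A)" for us
    proof (induction us)
      case (Cons v us)
      then show ?case by (cases v) (auto intro: proves_forall_var wf_forall_var)
    qed (use A in \<open>auto simp: proves_def intro: Axiom\<close>)
    then have "C.sat b (\<lambda>(n, \<sigma>). cls H (Free n \<sigma>)) (foldr forall_var vs A)"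
      using henkin by (auto simp: sat_cls henkin_def)
    then have "C.sat b ?e A"
      by (rule C.sat_closure) (use A e vs in \<open>auto simp: cls_dom_def\<close>)
    moreover have "C.sat b ?e A \<longleftrightarrow> C.sat b e A" by (rule C.sat_cong[OF A(2)]) auto
    ultimately show ?thesis by simp
  qed
qed

end

section \<open>First consequences of the axioms\<close>

lemma has_type_subst_tm:
  "has_type \<Gamma> t \<tau> \<Longrightarrow> has_type \<Gamma> u (snd v) \<Longrightarrow> has_type \<Gamma> (subst_tm v u t) \<tau>"
  by (induction t arbitrary: \<tau>) auto

lemma wf_subst_qf:
  "quantifier_free A \<Longrightarrow> wf_fm \<Gamma> A \<Longrightarrow> has_type \<Gamma> u (snd v) \<Longrightarrow> wf_fm \<Gamma> (subst_fm v u A)"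
  by (induction A) (auto simp: has_type_subst_tm)

lemma ACA0_subsets:
  "semiring_axioms \<subseteq> ACA0_omega" "combinator_axioms \<subseteq> ACA0_omega" "recursor_axioms \<subseteq> ACA0_omega"
  "QF_induction \<subseteq> ACA0_omega" "QF_AC T1 Num \<subseteq> ACA0_omega" "extensionality_axioms \<subseteq> ACA0_omega"
  by (auto simp: ACA0_omega_def RCA0_omega_def)

locale aca_model = ext_model D ap cn ls ACA0_omega
  for D :: "ty \<Rightarrow> 'u set" and ap (infixl \<open>\<bullet>\<close> 90) and cn ls
begin

abbreviation "zero \<equiv> cn Zero"
abbreviation "one \<equiv> cn One"
abbreviation "pl x y \<equiv> cn Plus \<bullet> x \<bullet> y"
abbreviation "ti x y \<equiv> cn Times \<bullet> x \<bullet> y"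
abbreviation "K \<rho> \<sigma> \<equiv> cn (Kc \<rho> \<sigma>)"
abbreviation "S \<delta> \<rho> \<sigma> \<equiv> cn (Sc \<delta> \<rho> \<sigma>)"
abbreviation "R \<equiv> cn Rec"

lemma cn_typed [simp]:
  "zero \<in> D Num" "one \<in> D Num" "cn Plus \<in> D (Num \<rightarrow> Num \<rightarrow> Num)" "cn Times \<in> D (Num \<rightarrow> Num \<rightarrow> Num)"
  "K \<rho> \<sigma> \<in> D (\<rho> \<rightarrow> \<sigma> \<rightarrow> \<rho>)" "S \<delta> \<rho> \<sigma> \<in> D ((\<delta> \<rightarrow> \<rho> \<rightarrow> \<sigma>) \<rightarrow> (\<delta> \<rightarrow> \<rho>) \<rightarrow> \<delta> \<rightarrow> \<sigma>)"
  "R \<in> D ((Num \<rightarrow> Num \<rightarrow> Num) \<rightarrow> Num \<rightarrow> Num \<rightarrow> Num)"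
  by (auto intro: cn_dom)

lemma pl_typed [simp]: "x \<in> D Num \<Longrightarrow> y \<in> D Num \<Longrightarrow> pl x y \<in> D Num"
  and ti_typed [simp]: "x \<in> D Num \<Longrightarrow> y \<in> D Num \<Longrightarrow> ti x y \<in> D Num"
  by (meson ap_dom cn_typed)+

lemma D_nonempty: "\<exists>x. x \<in> D \<tau>"
proof (induction \<tau>)
  case (Fn \<sigma> \<tau>)
  then obtain y where "y \<in> D \<tau>" by blast
  then show ?case using ap_dom[OF cn_typed(5)] by blast
qed (use cn_typed in blast)

definition e0 :: "nat \<times> ty \<Rightarrow> 'u" where "e0 v = (SOME u. u \<in> D (snd v))"

lemma e0_typed: "e0 v \<in> D (snd v)"
  unfolding e0_def using D_nonempty by (rule someI_ex)

lemma sat_axiom: "A \<in> ACA0_omega \<Longrightarrow> wf_fm [] A \<Longrightarrow> sat b e0 A"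
  using sat_Ax[of A e0 b] e0_typed by (metis snd_conv)

lemma eqs_eq: "x \<in> D \<tau> \<Longrightarrow> y \<in> D \<tau> \<Longrightarrow> eqs \<tau> x y \<longleftrightarrow> x = y"
proof (induction \<tau> arbitrary: x y)
  case (Fn \<sigma> \<tau>)
  then have "eqs (\<sigma> \<rightarrow> \<tau>) x y \<longleftrightarrow> (\<forall>u\<in>D \<sigma>. x \<bullet> u = y \<bullet> u)" using ap_dom by simp
  then show ?case using ext[of x \<sigma> \<tau> y] Fn.prems by auto
qed simp

section \<open>The axioms read in the model\<close>

lemma K_eq:
  assumes "x \<in> D \<rho>" "y \<in> D \<sigma>"
  shows "K \<rho> \<sigma> \<bullet> x \<bullet> y = x"
proof -
  let ?A = "fall \<rho> (\<lambda>x. fall \<sigma> (\<lambda>y. eq_at \<rho> (Kc \<rho> \<sigma> \<cdot> x \<cdot> y) x)) 0"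
  have "?A \<in> combinator_axioms" unfolding combinator_axioms_def by blast
  then have "?A \<in> ACA0_omega" by (rule subsetD[OF ACA0_subsets(2)])
  moreover have "wf_fm [] ?A" by (intro wf_quant wf_eq_at) auto
  ultimately have "sat (\<lambda>_. zero) e0 ?A" by (rule sat_axiom)
  then have "eqs \<rho> (K \<rho> \<sigma> \<bullet> x \<bullet> y) x" using assms by (simp add: sat_form sat_eq_at)
  moreover have "K \<rho> \<sigma> \<bullet> x \<bullet> y \<in> D \<rho>" using assms by (meson ap_dom cn_typed)
  ultimately show ?thesis using assms by (simp add: eqs_eq)
qed

lemma S_eq:
  assumes "x \<in> D (\<delta> \<rightarrow> \<rho> \<rightarrow> \<sigma>)" "y \<in> D (\<delta> \<rightarrow> \<rho>)" "z \<in> D \<delta>"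
  shows "S \<delta> \<rho> \<sigma> \<bullet> x \<bullet> y \<bullet> z = x \<bullet> z \<bullet> (y \<bullet> z)"
proof -
  let ?A = "fall (\<delta> \<rightarrow> \<rho> \<rightarrow> \<sigma>) (\<lambda>x. fall (\<delta> \<rightarrow> \<rho>) (\<lambda>y. fall \<delta> (\<lambda>z.
        eq_at \<sigma> (Sc \<delta> \<rho> \<sigma> \<cdot> x \<cdot> y \<cdot> z) (x \<cdot> z \<cdot> (y \<cdot> z))))) 0"
  have "?A \<in> combinator_axioms" unfolding combinator_axioms_def by blast
  then have "?A \<in> ACA0_omega" by (rule subsetD[OF ACA0_subsets(2)])
  moreover have "wf_fm [] ?A" by (intro wf_quant wf_eq_at) auto
  ultimately have "sat (\<lambda>_. zero) e0 ?A" by (rule sat_axiom)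
  then have "eqs \<sigma> (S \<delta> \<rho> \<sigma> \<bullet> x \<bullet> y \<bullet> z) (x \<bullet> z \<bullet> (y \<bullet> z))"
    using assms by (simp add: sat_form sat_eq_at)
  moreover have "S \<delta> \<rho> \<sigma> \<bullet> x \<bullet> y \<bullet> z \<in> D \<sigma>" "x \<bullet> z \<bullet> (y \<bullet> z) \<in> D \<sigma>"
    using assms by (meson ap_dom cn_typed)+
  ultimately show ?thesis using assms by (simp add: eqs_eq)
qed

lemma R_0:
  assumes "f \<in> D (Num \<rightarrow> Num \<rightarrow> Num)" "m \<in> D Num"
  shows "R \<bullet> f \<bullet> m \<bullet> zero = m"
proof -
  let ?A = "fall (Num \<rightarrow> Num \<rightarrow> Num) (\<lambda>f. \<^bold>\<forall>m. Rec \<cdot> f \<cdot> m \<cdot> Zero \<^bold>= m) 0"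
  have "?A \<in> recursor_axioms" unfolding recursor_axioms_def by blast
  then have "?A \<in> ACA0_omega" by (rule subsetD[OF ACA0_subsets(3)])
  moreover have "wf_fm [] ?A" by (intro wf_quant) (auto simp: wf_form)
  ultimately have "sat (\<lambda>_. zero) e0 ?A" by (rule sat_axiom)
  then show ?thesis using assms by (simp add: sat_form)
qed

lemma R_Suc:
  assumes "f \<in> D (Num \<rightarrow> Num \<rightarrow> Num)" "m \<in> D Num" "n \<in> D Num"
  shows "R \<bullet> f \<bullet> m \<bullet> (pl n one) = f \<bullet> n \<bullet> (R \<bullet> f \<bullet> m \<bullet> n)"
proof -
  let ?A = "fall (Num \<rightarrow> Num \<rightarrow> Num) (\<lambda>f. \<^bold>\<forall>m. \<^bold>\<forall>n.
        Rec \<cdot> f \<cdot> m \<cdot> (n \<^bold>+ One) \<^bold>= f \<cdot> n \<cdot> (Rec \<cdot> f \<cdot> m \<cdot> n)) 0"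
  have "?A \<in> recursor_axioms" unfolding recursor_axioms_def by blast
  then have "?A \<in> ACA0_omega" by (rule subsetD[OF ACA0_subsets(3)])
  moreover have "wf_fm [] ?A" by (intro wf_quant) (auto simp: wf_form)
  ultimately have "sat (\<lambda>_. zero) e0 ?A" by (rule sat_axiom)
  then show ?thesis using assms by (simp add: sat_form)
qed

lemma semiring:
  "(\<forall>x\<in>D Num. \<forall>y\<in>D Num. \<forall>z\<in>D Num. pl (pl x y) z = pl x (pl y z)) \<and>
   (\<forall>x\<in>D Num. \<forall>y\<in>D Num. pl x y = pl y x) \<and>
   (\<forall>x\<in>D Num. pl x zero = x) \<and>
   (\<forall>x\<in>D Num. \<forall>y\<in>D Num. \<forall>z\<in>D Num. ti (ti x y) z = ti x (ti y z)) \<and>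
   (\<forall>x\<in>D Num. \<forall>y\<in>D Num. ti x y = ti y x) \<and>
   (\<forall>x\<in>D Num. ti x one = x) \<and>
   (\<forall>x\<in>D Num. ti x zero = zero) \<and>
   (\<forall>x\<in>D Num. \<forall>y\<in>D Num. \<forall>z\<in>D Num. ti x (pl y z) = pl (ti x y) (ti x z)) \<and>
   (\<forall>x\<in>D Num. \<not> ls x x) \<and>
   (\<forall>x\<in>D Num. \<forall>y\<in>D Num. \<forall>z\<in>D Num. ls x y \<and> ls y z \<longrightarrow> ls x z) \<and>
   (\<forall>x\<in>D Num. \<forall>y\<in>D Num. ls x y \<or> x = y \<or> ls y x) \<and>
   (\<forall>x\<in>D Num. \<forall>y\<in>D Num. \<forall>z\<in>D Num. ls x y \<longrightarrow> ls (pl x z) (pl y z)) \<and>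
   (\<forall>x\<in>D Num. \<forall>y\<in>D Num. \<forall>z\<in>D Num. ls zero z \<and> ls x y \<longrightarrow> ls (ti x z) (ti y z)) \<and>
   ls zero one"
proof -
  have "wf_fm [] A" if "A \<in> semiring_axioms" for A
    using that unfolding semiring_axioms_def by (auto simp: wf_form intro!: wf_quant)
  then have *: "\<forall>A\<in>semiring_axioms. sat (\<lambda>_. zero) e0 A"
    using sat_axiom unfolding ACA0_omega_def RCA0_omega_def by blast
  show ?thesis
    using *[unfolded semiring_axioms_def image_insert image_empty ball_simps]
    by (simp only: sat_form teval.simps fun_upd_apply prod.inject simp_thms if_True if_False
        n_not_Suc_n Suc_n_not_n nat.inject One_nat_def nat.distinct) (intro conjI; elim conjE; assumption)
qed

lemma sr:
  assumes "x \<in> D Num" "y \<in> D Num" "z \<in> D Num"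
  shows "pl (pl x y) z = pl x (pl y z)" "pl x y = pl y x" "pl x zero = x"
    "ti (ti x y) z = ti x (ti y z)" "ti x y = ti y x" "ti x one = x" "ti x zero = zero"
    "ti x (pl y z) = pl (ti x y) (ti x z)" "\<not> ls x x" "ls x y \<Longrightarrow> ls y z \<Longrightarrow> ls x z"
    "ls x y \<or> x = y \<or> ls y x" "ls x y \<Longrightarrow> ls (pl x z) (pl y z)"
    "ls zero z \<Longrightarrow> ls x y \<Longrightarrow> ls (ti x z) (ti y z)" "ls zero one"
proof -
  note s0 = semiring[THEN conjunct1, THEN bspec, OF assms(1), THEN bspec, OF assms(2), THEN bspec, OF assms(3)]
  note s1 = semiring[THEN conjunct2, THEN conjunct1, THEN bspec, OF assms(1), THEN bspec, OF assms(2)]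
  note s2 = semiring[THEN conjunct2, THEN conjunct2, THEN conjunct1, THEN bspec, OF assms(1)]
  note s3 = semiring[THEN conjunct2, THEN conjunct2, THEN conjunct2, THEN conjunct1, THEN bspec, OF assms(1), THEN bspec, OF assms(2), THEN bspec, OF assms(3)]
  note s4 = semiring[THEN conjunct2, THEN conjunct2, THEN conjunct2, THEN conjunct2, THEN conjunct1, THEN bspec, OF assms(1), THEN bspec, OF assms(2)]
  note s5 = semiring[THEN conjunct2, THEN conjunct2, THEN conjunct2, THEN conjunct2, THEN conjunct2, THEN conjunct1, THEN bspec, OF assms(1)]
  note s6 = semiring[THEN conjunct2, THEN conjunct2, THEN conjunct2, THEN conjunct2, THEN conjunct2, THEN conjunct2, THEN conjunct1, THEN bspec, OF assms(1)]
  note s7 = semiring[THEN conjunct2, THEN conjunct2, THEN conjunct2, THEN conjunct2, THEN conjunct2, THEN conjunct2, THEN conjunct2, THEN conjunct1, THEN bspec, OF assms(1), THEN bspec, OF assms(2), THEN bspec, OF assms(3)]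
  note s8 = semiring[THEN conjunct2, THEN conjunct2, THEN conjunct2, THEN conjunct2, THEN conjunct2, THEN conjunct2, THEN conjunct2, THEN conjunct2, THEN conjunct1, THEN bspec, OF assms(1)]
  note s9 = semiring[THEN conjunct2, THEN conjunct2, THEN conjunct2, THEN conjunct2, THEN conjunct2, THEN conjunct2, THEN conjunct2, THEN conjunct2, THEN conjunct2, THEN conjunct1, THEN bspec, OF assms(1), THEN bspec, OF assms(2), THEN bspec, OF assms(3)]
  note s10 = semiring[THEN conjunct2, THEN conjunct2, THEN conjunct2, THEN conjunct2, THEN conjunct2, THEN conjunct2, THEN conjunct2, THEN conjunct2, THEN conjunct2, THEN conjunct2, THEN conjunct1, THEN bspec, OF assms(1), THEN bspec, OF assms(2)]
  note s11 = semiring[THEN conjunct2, THEN conjunct2, THEN conjunct2, THEN conjunct2, THEN conjunct2, THEN conjunct2, THEN conjunct2, THEN conjunct2, THEN conjunct2, THEN conjunct2, THEN conjunct2, THEN conjunct1, THEN bspec, OF assms(1), THEN bspec, OF assms(2), THEN bspec, OF assms(3)]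
  note s12 = semiring[THEN conjunct2, THEN conjunct2, THEN conjunct2, THEN conjunct2, THEN conjunct2, THEN conjunct2, THEN conjunct2, THEN conjunct2, THEN conjunct2, THEN conjunct2, THEN conjunct2, THEN conjunct2, THEN conjunct1, THEN bspec, OF assms(1), THEN bspec, OF assms(2), THEN bspec, OF assms(3)]
  note s13 = semiring[THEN conjunct2, THEN conjunct2, THEN conjunct2, THEN conjunct2, THEN conjunct2, THEN conjunct2, THEN conjunct2, THEN conjunct2, THEN conjunct2, THEN conjunct2, THEN conjunct2, THEN conjunct2, THEN conjunct2]
  show "pl (pl x y) z = pl x (pl y z)" "pl x y = pl y x" "pl x zero = x"
    "ti (ti x y) z = ti x (ti y z)" "ti x y = ti y x" "ti x one = x" "ti x zero = zero"
    "ti x (pl y z) = pl (ti x y) (ti x z)" "\<not> ls x x" "ls x y \<or> x = y \<or> ls y x" "ls zero one"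
    by (rule s0 s1 s2 s3 s4 s5 s6 s7 s8 s10 s13)+
  show "ls x y \<Longrightarrow> ls y z \<Longrightarrow> ls x z" "ls x y \<Longrightarrow> ls (pl x z) (pl y z)"
    "ls zero z \<Longrightarrow> ls x y \<Longrightarrow> ls (ti x z) (ti y z)" using s9 s11 s12 by simp_all
qed

lemma ls_Suc: "w \<in> D Num \<Longrightarrow> ls w (pl w one)"
  using sr(12)[of zero one w] sr(14)[of zero zero zero] sr(2)[of w zero zero] sr(2)[of w one zero]
    sr(3)[of w zero zero] by simp

section \<open>Induction, choice and search\<close>

lemma qf_induct:
  assumes A: "quantifier_free A" "wf_fm [] A" and e: "\<And>n \<sigma>. e (n, \<sigma>) \<in> D \<sigma>"
    and zero: "sat b (e((n, Num) := zero)) A"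
    and Suc: "\<And>u. u \<in> D Num \<Longrightarrow> sat b (e((n, Num) := u)) A \<Longrightarrow> sat b (e((n, Num) := pl u one)) A"
    and u: "u \<in> D Num"
  shows "sat b (e((n, Num) := u)) A"
proof -
  let ?A = "Imp (subst_fm (n, Num) Zero A)
        (Imp (forall_var (n, Num) (Imp A (subst_fm (n, Num) (Free n Num \<^bold>+ One) A)))
          (forall_var (n, Num) A))"
  have "?A \<in> QF_induction" using A unfolding QF_induction_def by blast
  then have "?A \<in> ACA0_omega" by (rule subsetD[OF ACA0_subsets(4)])
  moreover have "wf_fm [] ?A" using A by (auto intro!: wf_forall_var wf_subst_qf)
  ultimately have "sat b e ?A" using e by (rule sat_Ax)
  moreover have "sat (case_nat w b) e' A \<longleftrightarrow> sat b e' A" for w e' by (rule sat_closed[OF A(2)])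
  ultimately show ?thesis using zero Suc u by (simp add: sat_subst_qf A(1) sat_forall_var)
qed

lemma qf_choice:
  assumes A: "quantifier_free A" "wf_fm [] A" and e: "\<And>n \<sigma>. e (n, \<sigma>) \<in> D \<sigma>"
    and ex: "\<And>u. u \<in> D T1 \<Longrightarrow> \<exists>w\<in>D Num. sat b (e((x, T1) := u, (y, Num) := w)) A"
  obtains F where "F \<in> D T2" "\<And>u. u \<in> D T1 \<Longrightarrow> sat b (e((x, T1) := u, (y, Num) := F \<bullet> u)) A"
proof -
  obtain Y where Y: "(Y, T2) \<notin> frees A" using ex_fresh by blast
  let ?A = "Imp (forall_var (x, T1) (exists_var (y, Num) A))
        (exists_var (Y, T2) (forall_var (x, T1)
          (subst_fm (y, Num) (Free Y T2 \<cdot> Free x T1) A)))"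
  have "?A \<in> QF_AC T1 Num" using A Y unfolding QF_AC_def by blast
  then have "?A \<in> ACA0_omega" by (rule subsetD[OF ACA0_subsets(5)])
  moreover have "wf_fm [] ?A"
    using A by (auto intro!: wf_forall_var wf_subst_qf simp: exists_var_def)
  ultimately have "sat b e ?A" using e by (rule sat_Ax)
  moreover have c: "sat (case_nat w b') e' A \<longleftrightarrow> sat b e' A" for w e' b' by (rule sat_closed[OF A(2)])
  ultimately obtain F where F: "F \<in> D T2"
    "\<And>u. u \<in> D T1 \<Longrightarrow> sat b (e((Y, T2) := F, (x, T1) := u, (y, Num) := F \<bullet> u)) A"
    using ex by (auto simp: sat_subst_qf A(1) sat_forall_var sat_exists_var)
  have "sat b (e((x, T1) := u, (y, Num) := F \<bullet> u)) A" if "u \<in> D T1" for u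
    by (rule iffD1[OF sat_cong[OF A(2)] F(2)[OF that]]) (use Y in auto)
  then show ?thesis using F(1) that by blast
qed

lemma ex_Phi:
  obtains \<Phi> where "\<Phi> \<in> D T2" "\<And>f. f \<in> D T1 \<Longrightarrow> \<Phi> \<bullet> f = zero \<longleftrightarrow> (\<exists>n\<in>D Num. f \<bullet> n = zero)"
proof -
  have "exists2 \<in> ACA0_omega" by (simp add: ACA0_omega_def)
  moreover have "wf_fm [] exists2"
    unfolding exists2_def by (intro wf_quant) (auto simp: wf_form intro!: wf_quant)
  ultimately have "sat (\<lambda>_. zero) e0 exists2" by (rule sat_axiom)
  then show ?thesis using that unfolding exists2_def by (auto simp: sat_form)
qed

text \<open>Quantifier-free choice is applied to
  \<open>\<Phi> f = 0 \<longrightarrow> f n = 0\<close>: this has no number quantifier, and some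
  \<open>n\<close> always satisfies it, a zero of \<open>f\<close> if there is one and any number
  otherwise. The choice functional is the search operator.\<close>

lemma ex_search:
  obtains \<mu> where "\<mu> \<in> D T2"
    "\<And>f n. f \<in> D T1 \<Longrightarrow> n \<in> D Num \<Longrightarrow> f \<bullet> n = zero \<Longrightarrow> f \<bullet> (\<mu> \<bullet> f) = zero"
proof -
  obtain \<Phi> where \<Phi>: "\<Phi> \<in> D T2" "\<And>f. f \<in> D T1 \<Longrightarrow> \<Phi> \<bullet> f = zero \<longleftrightarrow> (\<exists>n\<in>D Num. f \<bullet> n = zero)"
    by (rule ex_Phi) blast
  let ?A = "Imp (Eq (Free 0 T2 \<cdot> Free 0 T1) Zero) (Eq (Free 0 T1 \<cdot> Free 0 Num) Zero)"
  let ?e = "e0((0, T2) := \<Phi>)"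
  obtain F where "F \<in> D T2" "\<And>u. u \<in> D T1 \<Longrightarrow> sat (\<lambda>_. zero) (?e((0, T1) := u, (0, Num) := F \<bullet> u)) ?A"
  proof (rule qf_choice[of ?A ?e "\<lambda>_. zero" 0 0])
    show "?e (n, \<sigma>) \<in> D \<sigma>" for n \<sigma> using e0_typed[of "(n, \<sigma>)"] \<Phi>(1) by auto
    show "\<exists>w\<in>D Num. sat (\<lambda>_. zero) (?e((0, T1) := u, (0, Num) := w)) ?A" if "u \<in> D T1" for u
    proof (cases "\<exists>n\<in>D Num. u \<bullet> n = zero")
      case False
      then show ?thesis using \<Phi>(2)[OF that] by (intro bexI[of _ zero]) auto
    qed auto
  qed auto
  then show ?thesis using that[of F] \<Phi>(2) by auto
qed

lemma nonneg: "u \<in> D Num \<Longrightarrow> u = zero \<or> ls zero u"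
proof -
  let ?A = "Imp (Neg (Eq (Free 0 Num) Zero)) (Less Zero (Free 0 Num))"
  assume "u \<in> D Num"
  then have "sat (\<lambda>_. zero) (e0((0, Num) := u)) ?A"
  proof (rule qf_induct[rotated -1])
    show "e0 (n, \<sigma>) \<in> D \<sigma>" for n \<sigma> using e0_typed[of "(n, \<sigma>)"] by simp
    fix w assume w: "w \<in> D Num" "sat (\<lambda>_. zero) (e0((0, Num) := w)) ?A"
    have "w = zero \<or> ls zero w" using w(2) by auto
    then have "ls zero (pl w one)" using ls_Suc[OF w(1)] sr(10)[of zero w "pl w one"] w(1) by auto
    then show "sat (\<lambda>_. zero) (e0((0, Num) := pl w one)) ?A" by simp
  qed auto
  then show ?thesis by auto
qed

text \<open>With \<open>K Num Num\<close> as recursion step the value at \<open>n + 1\<close> is the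
  stage \<open>n\<close> itself, which is the predecessor. In \<open>monus\<close> the step forgets
  the stage and takes the predecessor of the previous value.\<close>

abbreviation "pred \<equiv> R \<bullet> K Num Num \<bullet> zero"
abbreviation "monus y z \<equiv> R \<bullet> (K T1 Num \<bullet> pred) \<bullet> y \<bullet> z"

lemma monus_typed: "pred \<in> D T1" "K T1 Num \<bullet> pred \<in> D (Num \<rightarrow> Num \<rightarrow> Num)"
  "y \<in> D Num \<Longrightarrow> z \<in> D Num \<Longrightarrow> monus y z \<in> D Num"
  by (meson ap_dom cn_typed)+

lemma pred_eq: "u \<in> D Num \<Longrightarrow> u \<noteq> zero \<Longrightarrow> pl (pred \<bullet> u) one = u"
proof -
  let ?A = "Imp (Neg (Eq (Free 0 Num) Zero))
    (Eq (Rec \<cdot> Kc Num Num \<cdot> Zero \<cdot> Free 0 Num \<^bold>+ One) (Free 0 Num))"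
  assume "u \<in> D Num"
  then have "sat (\<lambda>_. zero) (e0((0, Num) := u)) ?A"
  proof (rule qf_induct[rotated -1])
    show "e0 (n, \<sigma>) \<in> D \<sigma>" for n \<sigma> using e0_typed[of "(n, \<sigma>)"] by simp
    fix w assume w: "w \<in> D Num"
    have "R \<bullet> K Num Num \<bullet> zero \<bullet> w \<in> D Num" using w by (meson ap_dom cn_typed)
    then have "pred \<bullet> (pl w one) = w" using w by (simp add: R_Suc K_eq)
    then show "sat (\<lambda>_. zero) (e0((0, Num) := pl w one)) ?A" by simp
  qed auto
  then show "u \<noteq> zero \<Longrightarrow> ?thesis" by auto
qed

text \<open>The axioms have no subtraction; it serves to make the numbers an instance of the class
  of ordered semirings and to express equality by a zero test. Induction on \<open>z\<close>: the
  difference for \<open>w\<close> is nonzero while \<open>w < y\<close>, so another one can be taken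
  off.\<close>

lemma monus_eq: "y \<in> D Num \<Longrightarrow> z \<in> D Num \<Longrightarrow> \<not> ls y z \<Longrightarrow> pl (monus y z) z = y"
proof -
  let ?A = "Imp (Neg (Less (Free 1 Num) (Free 0 Num)))
    (Eq (Rec \<cdot> (Kc T1 Num \<cdot> (Rec \<cdot> Kc Num Num \<cdot> Zero)) \<cdot> Free 1 Num \<cdot> Free 0 Num \<^bold>+ Free 0 Num)
      (Free 1 Num))"
  assume y: "y \<in> D Num" and z: "z \<in> D Num"
  let ?e = "e0((1, Num) := y)"
  from z have "sat (\<lambda>_. zero) (?e((0, Num) := z)) ?A"
  proof (rule qf_induct[rotated -1])
    show "?e (n, \<sigma>) \<in> D \<sigma>" for n \<sigma> using e0_typed[of "(n, \<sigma>)"] y by simp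
    show "sat (\<lambda>_. zero) (?e((0, Num) := zero)) ?A" using y sr(3)[of y y y] by (simp add: R_0 monus_typed)
    fix w assume w: "w \<in> D Num" and IH: "sat (\<lambda>_. zero) (?e((0, Num) := w)) ?A"
    have lt: "ls w (pl w one)" using w by (rule ls_Suc)
    have "pl (monus y (pl w one)) (pl w one) = y" if n: "\<not> ls y (pl w one)"
    proof -
      let ?m = "monus y w"
      have m: "?m \<in> D Num" using monus_typed y w by blast
      have "\<not> ls y w" using n lt sr(10)[of y w "pl w one"] y w by auto
      then have eq: "pl ?m w = y" using IH by simp
      have "?m \<noteq> zero"
      proof
        assume "?m = zero"
        then have "y = w" using eq sr(2)[of zero w w] sr(3)[of w w w] w by simp
        then show False using n lt by simp
      qed
      then have p: "pl (pred \<bullet> ?m) one = ?m" using pred_eq m by blast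
      have pm: "pred \<bullet> ?m \<in> D Num" using m monus_typed(1) ap_dom by blast
      have "monus y (pl w one) = pred \<bullet> ?m"
        using y w m by (simp add: R_Suc monus_typed K_eq)
      moreover have "pl (pred \<bullet> ?m) (pl w one) = pl (pl (pred \<bullet> ?m) one) w"
        using sr(1)[of "pred \<bullet> ?m" one w] sr(2)[of w one one] pm w by simp
      ultimately show ?thesis using p eq by simp
    qed
    then show "sat (\<lambda>_. zero) (?e((0, Num) := pl w one)) ?A" by simp
  qed auto
  then show "\<not> ls y z \<Longrightarrow> ?thesis" by auto
qed

lemma num_induct:
  assumes f: "f \<in> D T1" and 0: "f \<bullet> zero = zero"
    and Suc: "\<And>n. n \<in> D Num \<Longrightarrow> f \<bullet> n = zero \<Longrightarrow> f \<bullet> (pl n one) = zero" and n: "n \<in> D Num"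
  shows "f \<bullet> n = zero"
proof -
  let ?A = "Eq (Free 0 T1 \<cdot> Free 0 Num) Zero"
  have "sat (\<lambda>_. zero) ((e0((0, T1) := f))((0, Num) := n)) ?A"
  proof (rule qf_induct)
    show "(e0((0, T1) := f)) (n, \<sigma>) \<in> D \<sigma>" for n \<sigma> using e0_typed[of "(n, \<sigma>)"] f by simp
  qed (use 0 Suc n in auto)
  then show ?thesis by simp
qed

end

section \<open>Definable functions and predicates\<close>

text \<open>Presenting the numbers of the model as a type \<open>'n\<close> makes the libraries for ordered
  semirings, fraction fields and ordered rings applicable to them.\<close>

locale aca_num = aca_model D ap cn ls
  for D :: "ty \<Rightarrow> 'u set" and ap (infixl \<open>\<bullet>\<close> 90) and cn ls +
  fixes num :: "'n::linordered_semidom \<Rightarrow> 'u"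
  assumes bij_num: "bij_betw num UNIV (D Num)"
    and num_zero: "num 0 = zero" and num_one: "num 1 = one"
    and num_pl: "num (a + b) = pl (num a) (num b)" and num_ti: "num (a * b) = ti (num a) (num b)"
    and num_ls: "ls (num a) (num b) \<longleftrightarrow> a < b"
begin

lemma num_typed [simp]: "num a \<in> D Num"
  using bij_num by (auto simp: bij_betw_def)

lemma num_eq [simp]: "num a = num b \<longleftrightarrow> a = b"
  using bij_num by (auto simp: bij_betw_def inj_def)

lemma ball_Num: "(\<forall>u\<in>D Num. P u) \<longleftrightarrow> (\<forall>a. P (num a))"
  and bex_Num: "(\<exists>u\<in>D Num. P u) \<longleftrightarrow> (\<exists>a. P (num a))"
proof -
  have "D Num = range num" using bij_num by (simp add: bij_betw_def)
  then show "(\<forall>u\<in>D Num. P u) \<longleftrightarrow> (\<forall>a. P (num a))" "(\<exists>u\<in>D Num. P u) \<longleftrightarrow> (\<exists>a. P (num a))"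
    by auto
qed

lemma num_inv: "u \<in> D Num \<Longrightarrow> num (inv num u) = u"
  using bij_num by (intro f_inv_into_f) (auto simp: bij_betw_def)

lemma inv_num [simp]: "inv num (num a) = a"
  using bij_num by (auto simp: bij_betw_def)

lemma nonneg_n [simp]: "0 \<le> (a::'n)"
  using nonneg[of "num a"] by (auto simp: num_zero[symmetric] num_ls)

lemma n_cases: obtains "n = 0" | k where "n = k + (1::'n)"
proof (cases "n = 0")
  case False
  then have "pl (pred \<bullet> num n) one = num n" using pred_eq[of "num n"] by (simp add: num_zero[symmetric])
  moreover have "pred \<bullet> num n \<in> D Num" using monus_typed(1) num_typed by (rule ap_dom)
  ultimately have "num (inv num (pred \<bullet> num n) + 1) = num n"
    by (simp add: num_pl num_one num_inv)
  then have "n = inv num (pred \<bullet> num n) + 1" by (simp only: num_eq)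
  then show ?thesis by (rule that(2))
qed

text \<open>Discreteness comes from the predecessor: a nonzero difference is a successor, hence at
  least 1.\<close>

lemma less_Suc_iff: "a < b + 1 \<longleftrightarrow> a \<le> (b::'n)"
proof
  assume "a < b + 1"
  show "a \<le> b"
  proof (rule ccontr)
    assume "\<not> a \<le> b"
    then have a: "a = b + (a - b)" using le_add_diff_inverse[of b a] by simp
    have "a - b \<noteq> 0"
    proof
      assume "a - b = 0"
      with a have "a = b" by simp
      with \<open>\<not> a \<le> b\<close> show False by simp
    qed
    then obtain k where "a - b = k + 1" by (metis n_cases)
    then have "b + 1 \<le> a" using a nonneg_n[of k] by (metis add_left_mono le_add_same_cancel2)
    then show False using \<open>a < b + 1\<close> by simp
  qed
qed (simp add: le_less_trans)

definition fn :: "'u \<Rightarrow> 'n \<Rightarrow> 'n" where "fn u n = inv num (u \<bullet> num n)"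

lemma ap_typed:
  "f \<in> D T1 \<Longrightarrow> n \<in> D Num \<Longrightarrow> f \<bullet> n \<in> D Num"
  "F \<in> D T2 \<Longrightarrow> f \<in> D T1 \<Longrightarrow> F \<bullet> f \<in> D Num"
  "G \<in> D (T1 \<rightarrow> T1) \<Longrightarrow> f \<in> D T1 \<Longrightarrow> G \<bullet> f \<in> D T1"
  "H \<in> D (Num \<rightarrow> T1 \<rightarrow> T1) \<Longrightarrow> n \<in> D Num \<Longrightarrow> H \<bullet> n \<in> D (T1 \<rightarrow> T1)"
  "M \<in> D (Num \<rightarrow> T1) \<Longrightarrow> n \<in> D Num \<Longrightarrow> M \<bullet> n \<in> D T1"
  by (rule ap_dom; assumption)+

lemma ap_num: "f \<in> D T1 \<Longrightarrow> f \<bullet> num n = num (fn f n)"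
  by (simp add: fn_def num_inv ap_typed)

lemma fn_inject: "f \<in> D T1 \<Longrightarrow> g \<in> D T1 \<Longrightarrow> fn f = fn g \<longleftrightarrow> f = g"
  using ext[of f Num Num g] by (auto simp: ball_Num[symmetric] ap_num dest: fun_cong)
    (metis ap_num num_inv)

text \<open>Composition as the combinator \<open>S (K S) K\<close>.\<close>

lemma B_ex:
  obtains B where "B \<in> D ((\<sigma> \<rightarrow> \<tau>) \<rightarrow> (\<rho> \<rightarrow> \<sigma>) \<rightarrow> \<rho> \<rightarrow> \<tau>)"
    "\<And>f g x. f \<in> D (\<sigma> \<rightarrow> \<tau>) \<Longrightarrow> g \<in> D (\<rho> \<rightarrow> \<sigma>) \<Longrightarrow> x \<in> D \<rho> \<Longrightarrow> B \<bullet> f \<bullet> g \<bullet> x = f \<bullet> (g \<bullet> x)"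
proof -
  let ?S = "S \<rho> \<sigma> \<tau>" and ?K = "K (\<sigma> \<rightarrow> \<tau>) \<rho>"
  let ?KS = "K ((\<rho> \<rightarrow> \<sigma> \<rightarrow> \<tau>) \<rightarrow> (\<rho> \<rightarrow> \<sigma>) \<rightarrow> \<rho> \<rightarrow> \<tau>) (\<sigma> \<rightarrow> \<tau>) \<bullet> ?S"
  let ?B = "S (\<sigma> \<rightarrow> \<tau>) (\<rho> \<rightarrow> \<sigma> \<rightarrow> \<tau>) ((\<rho> \<rightarrow> \<sigma>) \<rightarrow> \<rho> \<rightarrow> \<tau>) \<bullet> ?KS \<bullet> ?K"
  have KS: "?KS \<in> D ((\<sigma> \<rightarrow> \<tau>) \<rightarrow> (\<rho> \<rightarrow> \<sigma> \<rightarrow> \<tau>) \<rightarrow> (\<rho> \<rightarrow> \<sigma>) \<rightarrow> \<rho> \<rightarrow> \<tau>)" by (meson ap_dom cn_typed)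
  have "?B \<in> D ((\<sigma> \<rightarrow> \<tau>) \<rightarrow> (\<rho> \<rightarrow> \<sigma>) \<rightarrow> \<rho> \<rightarrow> \<tau>)" using KS by (meson ap_dom cn_typed)
  moreover have "?B \<bullet> f \<bullet> g \<bullet> x = f \<bullet> (g \<bullet> x)"
    if f: "f \<in> D (\<sigma> \<rightarrow> \<tau>)" and g: "g \<in> D (\<rho> \<rightarrow> \<sigma>)" and x: "x \<in> D \<rho>" for f g x
  proof -
    have Kf: "?K \<bullet> f \<in> D (\<rho> \<rightarrow> \<sigma> \<rightarrow> \<tau>)" using f by (meson ap_dom cn_typed)
    have "?B \<bullet> f = ?S \<bullet> (?K \<bullet> f)"
      by (subst S_eq[OF KS cn_typed(5) f], subst K_eq[OF cn_typed(6) f]) simp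
    then have "?B \<bullet> f \<bullet> g \<bullet> x = (?K \<bullet> f) \<bullet> x \<bullet> (g \<bullet> x)" using S_eq[OF Kf g x] by simp
    then show ?thesis using K_eq[OF f x] by simp
  qed
  ultimately show ?thesis using that by blast
qed

text \<open>\<open>psh m e\<close> extends the context \<open>e\<close> of number parameters by a new first entry \<open>m\<close>.\<close>

definition psh :: "'n \<Rightarrow> ('n \<Rightarrow> 'n) \<Rightarrow> 'n \<Rightarrow> 'n" where
  "psh m e n = (if n = 0 then m else e (n - 1))"

lemma psh_0 [simp]: "psh m e 0 = m" and psh_Suc [simp]: "psh m e (i + 1) = e i"
  using nonneg_n[of i] by (auto simp: psh_def add_nonneg_eq_0_iff)

text \<open>The recursor with start \<open>m\<close> and a step that yields \<open>e k\<close> at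
  stage \<open>k\<close> regardless of the previous value: entry 0 is \<open>m\<close> and entry
  \<open>k + 1\<close> is \<open>e k\<close>. The compositions \<open>B\<close> and
  \<open>B'\<close> make this uniform in \<open>e\<close>.\<close>

lemma push_ex:
  obtains P where "P \<in> D (T1 \<rightarrow> Num \<rightarrow> T1)"
    "\<And>e m. e \<in> D T1 \<Longrightarrow> fn (P \<bullet> e \<bullet> num m) = psh m (fn e)"
proof -
  let ?K = "K Num Num" and ?F = "Num \<rightarrow> Num \<rightarrow> Num"
  obtain B where B: "B \<in> D ((Num \<rightarrow> Num \<rightarrow> Num) \<rightarrow> (Num \<rightarrow> Num) \<rightarrow> Num \<rightarrow> Num \<rightarrow> Num)"
    "\<And>f g x. f \<in> D (Num \<rightarrow> Num \<rightarrow> Num) \<Longrightarrow> g \<in> D T1 \<Longrightarrow> x \<in> D Num \<Longrightarrow> B \<bullet> f \<bullet> g \<bullet> x = f \<bullet> (g \<bullet> x)"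
    using B_ex[of Num "Num \<rightarrow> Num" Num] by blast
  obtain B' where B': "B' \<in> D ((?F \<rightarrow> Num \<rightarrow> T1) \<rightarrow> (T1 \<rightarrow> ?F) \<rightarrow> T1 \<rightarrow> Num \<rightarrow> T1)"
    "\<And>f g x. f \<in> D (?F \<rightarrow> Num \<rightarrow> T1) \<Longrightarrow> g \<in> D (T1 \<rightarrow> ?F) \<Longrightarrow> x \<in> D T1 \<Longrightarrow>
      B' \<bullet> f \<bullet> g \<bullet> x = f \<bullet> (g \<bullet> x)"
    using B_ex[of ?F "Num \<rightarrow> T1" T1] by blast
  have BK: "B \<bullet> ?K \<in> D (T1 \<rightarrow> ?F)" using B(1) cn_typed(5) by (rule ap_dom)
  let ?P = "B' \<bullet> R \<bullet> (B \<bullet> ?K)"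
  have "?P \<in> D (T1 \<rightarrow> Num \<rightarrow> T1)" using B'(1) BK by (meson ap_dom cn_typed(7))
  moreover have "fn (?P \<bullet> e \<bullet> num m) = psh m (fn e)" if e: "e \<in> D T1" for e m
  proof
    fix n
    have BKe: "B \<bullet> ?K \<bullet> e \<in> D ?F" using BK e by (rule ap_dom)
    have P: "?P \<bullet> e = R \<bullet> (B \<bullet> ?K \<bullet> e)" using B'(2)[OF cn_typed(7) BK e] .
    show "fn (?P \<bullet> e \<bullet> num m) n = psh m (fn e) n"
    proof (cases n rule: n_cases)
      case 1
      then show ?thesis using R_0[OF BKe] by (simp add: P fn_def num_zero)
    next
      case (2 k)
      have r: "R \<bullet> (B \<bullet> ?K \<bullet> e) \<bullet> num m \<bullet> num k \<in> D Num"
        using BKe by (meson ap_dom cn_typed(7) num_typed)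
      have "R \<bullet> (B \<bullet> ?K \<bullet> e) \<bullet> num m \<bullet> num n = e \<bullet> num k"
        using e r by (simp add: 2 num_pl num_one R_Suc BKe B(2) K_eq ap_typed)
      then show ?thesis using psh_Suc[of m "fn e" k] by (simp add: P fn_def 2)
    qed
  qed
  ultimately show ?thesis using that by blast
qed

end

text \<open>Definability uniformly in a parameter \<open>x\<close> from \<open>X\<close> and a number context \<open>e\<close>.\<close>

locale aca_def = aca_num D ap cn ls num
  for D :: "ty \<Rightarrow> 'u set" and ap (infixl \<open>\<bullet>\<close> 90) and cn ls
    and num :: "'n::linordered_semidom \<Rightarrow> 'u" +
  fixes X :: "'u set"
  assumes X: "X \<subseteq> D T1" "X \<noteq> {}"
begin

text \<open>One element \<open>T\<close> serves all parameters and contexts at once; specialised to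
  a fixed context it becomes an object of the model that takes \<open>x\<close> to the
  value.\<close>

definition rp :: "ty \<Rightarrow> ('u \<Rightarrow> 'u \<Rightarrow> 'u) \<Rightarrow> bool" where
  "rp \<tau> g \<longleftrightarrow> (\<exists>T\<in>D (T1 \<rightarrow> T1 \<rightarrow> \<tau>). \<forall>x\<in>X. \<forall>e\<in>D T1. T \<bullet> x \<bullet> e = g x e)"

lemma rp_cong: "rp \<tau> g \<Longrightarrow> (\<And>x e. x \<in> X \<Longrightarrow> e \<in> D T1 \<Longrightarrow> g x e = h x e) \<Longrightarrow> rp \<tau> h"
  unfolding rp_def by auto

lemma rp_typed: "rp \<tau> g \<Longrightarrow> x \<in> X \<Longrightarrow> e \<in> D T1 \<Longrightarrow> g x e \<in> D \<tau>"
  unfolding rp_def using X(1) by (metis ap_dom subsetD)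

lemma rp_const: "c \<in> D \<tau> \<Longrightarrow> rp \<tau> (\<lambda>x e. c)"
  unfolding rp_def
proof (intro bexI ballI)
  assume c: "c \<in> D \<tau>"
  have Kc: "K \<tau> T1 \<bullet> c \<in> D (T1 \<rightarrow> \<tau>)" using c by (meson ap_dom cn_typed(5))
  then show "K (T1 \<rightarrow> \<tau>) T1 \<bullet> (K \<tau> T1 \<bullet> c) \<in> D (T1 \<rightarrow> T1 \<rightarrow> \<tau>)" by (meson ap_dom cn_typed(5))
  show "K (T1 \<rightarrow> \<tau>) T1 \<bullet> (K \<tau> T1 \<bullet> c) \<bullet> x \<bullet> e = c" if "x \<in> X" "e \<in> D T1" for x e
    using K_eq[OF Kc] K_eq[OF c] that X(1) by (simp add: subset_iff)
qed

lemma rp_x: "rp T1 (\<lambda>x e. x)"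
  unfolding rp_def using K_eq[of _ T1 _ T1] X(1) cn_typed(5) by (meson subsetD)

lemma rp_e: "rp T1 (\<lambda>x e. e)"
  unfolding rp_def
proof (intro bexI ballI)
  let ?I = "S T1 (T1 \<rightarrow> T1) T1 \<bullet> K T1 (T1 \<rightarrow> T1) \<bullet> K T1 T1"
  have I: "?I \<in> D (T1 \<rightarrow> T1)" by (meson ap_dom cn_typed)
  then show "K (T1 \<rightarrow> T1) T1 \<bullet> ?I \<in> D (T1 \<rightarrow> T1 \<rightarrow> T1)" by (meson ap_dom cn_typed)
  show "K (T1 \<rightarrow> T1) T1 \<bullet> ?I \<bullet> x \<bullet> e = e" if "x \<in> X" "e \<in> D T1" for x e
  proof -
    have "K T1 T1 \<bullet> e \<in> D (T1 \<rightarrow> T1)" using that by (meson ap_dom cn_typed)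
    then have "?I \<bullet> e = e" using S_eq[OF cn_typed(5) cn_typed(5) that(2)] K_eq[OF that(2)] by simp
    then show ?thesis using K_eq[OF I, of x T1] that X(1) by (simp add: subset_iff)
  qed
qed

text \<open>Bracket abstraction of an application, twice over: the inner variable \<open>e\<close>
  by \<open>S\<close>, and the outer variable \<open>x\<close> by the lifted combination
  \<open>S (S (K S) G) H\<close>.\<close>

lemma rp_ap:
  assumes "rp (\<sigma> \<rightarrow> \<tau>) g" "rp \<sigma> h"
  shows "rp \<tau> (\<lambda>x e. g x e \<bullet> h x e)"
proof -
  obtain G H where G: "G \<in> D (T1 \<rightarrow> T1 \<rightarrow> \<sigma> \<rightarrow> \<tau>)" "\<And>x e. x \<in> X \<Longrightarrow> e \<in> D T1 \<Longrightarrow> G \<bullet> x \<bullet> e = g x e"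
    and H: "H \<in> D (T1 \<rightarrow> T1 \<rightarrow> \<sigma>)" "\<And>x e. x \<in> X \<Longrightarrow> e \<in> D T1 \<Longrightarrow> H \<bullet> x \<bullet> e = h x e"
    using assms unfolding rp_def by blast
  let ?S = "S T1 \<sigma> \<tau>" and ?t = "(T1 \<rightarrow> \<sigma> \<rightarrow> \<tau>) \<rightarrow> (T1 \<rightarrow> \<sigma>) \<rightarrow> T1 \<rightarrow> \<tau>"
  let ?KS = "K ?t T1 \<bullet> ?S"
  let ?U = "S T1 (T1 \<rightarrow> \<sigma> \<rightarrow> \<tau>) ((T1 \<rightarrow> \<sigma>) \<rightarrow> T1 \<rightarrow> \<tau>) \<bullet> ?KS \<bullet> G"
  let ?T = "S T1 (T1 \<rightarrow> \<sigma>) (T1 \<rightarrow> \<tau>) \<bullet> ?U \<bullet> H"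
  have KS: "?KS \<in> D (T1 \<rightarrow> ?t)" by (meson ap_dom cn_typed)
  have U: "?U \<in> D (T1 \<rightarrow> (T1 \<rightarrow> \<sigma>) \<rightarrow> T1 \<rightarrow> \<tau>)" using KS G(1) by (meson ap_dom cn_typed)
  have "?T \<in> D (T1 \<rightarrow> T1 \<rightarrow> \<tau>)" using U H(1) by (meson ap_dom cn_typed)
  moreover have "?T \<bullet> x \<bullet> e = g x e \<bullet> h x e" if xe: "x \<in> X" "e \<in> D T1" for x e
  proof -
    have x: "x \<in> D T1" using xe(1) X(1) by blast
    have "?T \<bullet> x = ?U \<bullet> x \<bullet> (H \<bullet> x)" using S_eq[OF U H(1) x] .
    moreover have "?U \<bullet> x = ?KS \<bullet> x \<bullet> (G \<bullet> x)" using S_eq[OF KS G(1) x] .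
    moreover have "?KS \<bullet> x = ?S" using K_eq[OF cn_typed(6) x] .
    moreover have "?S \<bullet> (G \<bullet> x) \<bullet> (H \<bullet> x) \<bullet> e = G \<bullet> x \<bullet> e \<bullet> (H \<bullet> x \<bullet> e)"
      using S_eq[OF ap_dom[OF G(1) x] ap_dom[OF H(1) x] xe(2)] .
    ultimately show ?thesis using G(2)[OF xe] H(2)[OF xe] by simp
  qed
  ultimately show ?thesis unfolding rp_def by blast
qed

lemmas rp_const_ap = rp_ap[OF rp_const]

section \<open>Definable numbers and predicates\<close>

definition dN :: "('u \<Rightarrow> ('n \<Rightarrow> 'n) \<Rightarrow> 'n) \<Rightarrow> bool" where
  "dN G \<longleftrightarrow> rp Num (\<lambda>x e. num (G x (fn e)))"

definition dP :: "('u \<Rightarrow> ('n \<Rightarrow> 'n) \<Rightarrow> bool) \<Rightarrow> bool" where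
  "dP P \<longleftrightarrow> (\<exists>G. dN G \<and> (\<forall>x\<in>X. \<forall>e\<in>D T1. P x (fn e) \<longleftrightarrow> G x (fn e) = 0))"

lemma dN_rp: "dN G \<Longrightarrow> rp Num (\<lambda>x e. num (G x (fn e)))"
  by (simp add: dN_def)

lemma dNI: "rp Num g \<Longrightarrow> (\<And>x e. x \<in> X \<Longrightarrow> e \<in> D T1 \<Longrightarrow> g x e = num (G x (fn e))) \<Longrightarrow> dN G"
  unfolding dN_def by (rule rp_cong)

text \<open>By extensionality \<open>fn\<close> is injective on the sequences of the model, so a
  function of the element \<open>e\<close> is one of the context \<open>fn e\<close>.\<close>

lemma rp_dN: assumes "rp Num g"
  obtains G where "dN G" "\<And>x e. x \<in> X \<Longrightarrow> e \<in> D T1 \<Longrightarrow> num (G x (fn e)) = g x e"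
proof -
  let ?G = "\<lambda>x f. inv num (g x (inv_into (D T1) fn f))"
  have *: "num (?G x (fn e)) = g x e" if "x \<in> X" "e \<in> D T1" for x e
  proof -
    have "inj_on fn (D T1)" by (auto simp: inj_on_def fn_inject)
    then show ?thesis using that rp_typed[OF assms] by (simp add: num_inv)
  qed
  then have "dN ?G" using dNI[OF assms, of ?G] by simp
  then show ?thesis using that * by blast
qed

lemma dN_cong:
  assumes "dN G" "\<And>x e. x \<in> X \<Longrightarrow> e \<in> D T1 \<Longrightarrow> G x (fn e) = H x (fn e)"
  shows "dN H"
  by (rule dNI[OF dN_rp[OF assms(1)]]) (simp add: assms(2))

lemma dP_I: "dN G \<Longrightarrow> (\<And>x e. x \<in> X \<Longrightarrow> e \<in> D T1 \<Longrightarrow> P x (fn e) \<longleftrightarrow> G x (fn e) = 0) \<Longrightarrow> dP P"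
  unfolding dP_def by blast

lemma dP_E:
  assumes "dP P"
  obtains G where "dN G" "\<And>x e. x \<in> X \<Longrightarrow> e \<in> D T1 \<Longrightarrow> P x (fn e) \<longleftrightarrow> G x (fn e) = 0"
  using assms unfolding dP_def by blast

lemma dP_cong: "dP P \<Longrightarrow> (\<And>x e. x \<in> X \<Longrightarrow> e \<in> D T1 \<Longrightarrow> P x (fn e) \<longleftrightarrow> Q x (fn e)) \<Longrightarrow> dP Q"
  unfolding dP_def by auto

lemma dN_const: "dN (\<lambda>x e. c)"
  unfolding dN_def by (intro rp_const num_typed)

lemma dN_fun: "f \<in> D T1 \<Longrightarrow> dN s \<Longrightarrow> dN (\<lambda>x e. fn f (s x e))"
  by (rule dNI[OF rp_const_ap[OF _ dN_rp]]) (auto simp: ap_num)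

lemma dN_rp1: "rp T1 g \<Longrightarrow> (\<And>x e. x \<in> X \<Longrightarrow> e \<in> D T1 \<Longrightarrow> fn (g x e) = G x (fn e)) \<Longrightarrow> dN s \<Longrightarrow>
    dN (\<lambda>x e. G x e (s x e))"
  by (rule dNI[OF rp_ap[OF _ dN_rp]]) (auto simp: ap_num rp_typed)

lemma dN_x: "dN s \<Longrightarrow> dN (\<lambda>x e. fn x (s x e))"
  by (rule dN_rp1[OF rp_x]) auto

lemma dN_var: "dN (\<lambda>x e. e c)"
  by (rule dN_rp1[OF rp_e _ dN_const]) auto

lemma dN_plus: "dN s \<Longrightarrow> dN t \<Longrightarrow> dN (\<lambda>x e. s x e + t x e)"
  by (rule dNI[OF rp_ap[OF rp_const_ap[OF _ dN_rp] dN_rp]]) (auto simp: num_pl)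

lemma dN_times: "dN s \<Longrightarrow> dN t \<Longrightarrow> dN (\<lambda>x e. s x e * t x e)"
  by (rule dNI[OF rp_ap[OF rp_const_ap[OF _ dN_rp] dN_rp]]) (auto simp: num_ti)

text \<open>The zero test, used for negation and for definition by cases.\<close>

lemma ex_step: "\<exists>f\<in>D T1. fn f 0 = 1 \<and> (\<forall>n. fn f (n + 1) = 0)"
proof (intro bexI conjI allI)
  let ?k = "K T1 Num \<bullet> (K Num Num \<bullet> zero)"
  have k: "K Num Num \<bullet> zero \<in> D T1" "?k \<in> D (Num \<rightarrow> T1)" by (meson ap_dom cn_typed)+
  let ?f = "R \<bullet> ?k \<bullet> one"
  show f: "?f \<in> D T1" using k by (meson ap_dom cn_typed)
  show "fn ?f 0 = 1" by (metis R_0 fn_def inv_num k(2) cn_typed(2) num_one num_zero)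
  show "fn ?f (n + 1) = 0" for n
  proof -
    have "?f \<bullet> num (n + 1) = zero"
      using k by (simp add: num_pl num_one R_Suc K_eq ap_typed(1)[OF f])
    then show ?thesis by (metis fn_def inv_num num_zero)
  qed
qed

lemma dP_not: assumes "dP P" shows "dP (\<lambda>x e. \<not> P x e)"
proof -
  obtain G where G: "dN G" "\<And>x e. x \<in> X \<Longrightarrow> e \<in> D T1 \<Longrightarrow> P x (fn e) \<longleftrightarrow> G x (fn e) = 0"
    using assms by (rule dP_E) blast
  obtain f where f: "f \<in> D T1" "fn f 0 = 1" "\<And>n. fn f (n + 1) = 0" using ex_step by blast
  have "fn f n = 0 \<longleftrightarrow> n \<noteq> 0" for n
    by (cases n rule: n_cases) (auto simp: f(2,3) add_nonneg_eq_0_iff)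
  then show ?thesis by (intro dP_I[OF dN_fun[OF f(1) G(1)]]) (simp add: G(2))
qed

lemma dP_disj: assumes "dP P" "dP Q" shows "dP (\<lambda>x e. P x e \<or> Q x e)"
proof -
  obtain G where G: "dN G" "\<And>x e. x \<in> X \<Longrightarrow> e \<in> D T1 \<Longrightarrow> P x (fn e) \<longleftrightarrow> G x (fn e) = 0"
    using assms(1) by (rule dP_E) blast
  obtain H where H: "dN H" "\<And>x e. x \<in> X \<Longrightarrow> e \<in> D T1 \<Longrightarrow> Q x (fn e) \<longleftrightarrow> H x (fn e) = 0"
    using assms(2) by (rule dP_E) blast
  show ?thesis by (rule dP_I[OF dN_times[OF G(1) H(1)]]) (simp add: G(2) H(2))
qed

lemma dP_conj: "dP P \<Longrightarrow> dP Q \<Longrightarrow> dP (\<lambda>x e. P x e \<and> Q x e)"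
  using dP_not[OF dP_disj[OF dP_not dP_not, of P Q]] by simp

lemma dP_imp: "dP P \<Longrightarrow> dP Q \<Longrightarrow> dP (\<lambda>x e. P x e \<longrightarrow> Q x e)"
  unfolding imp_conv_disj by (intro dP_disj dP_not)

lemma dP_eq: assumes s: "dN s" and t: "dN t" shows "dP (\<lambda>x e. s x e = t x e)"
proof -
  let ?m = "\<lambda>a b. monus (num a) (num b)"
  let ?g = "\<lambda>x e. pl (?m (s x (fn e)) (t x (fn e))) (?m (t x (fn e)) (s x (fn e)))"
  have "rp Num (\<lambda>x e. ?m (a x (fn e)) (b x (fn e)))" if "dN a" "dN b" for a b
    by (rule rp_ap[OF rp_const_ap[OF ap_dom[OF cn_typed(7) monus_typed(2)] dN_rp[OF that(1)]] dN_rp[OF that(2)]])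
  note m = this
  have "rp Num ?g" by (rule rp_ap[OF rp_const_ap[OF cn_typed(3) m[OF s t]] m[OF t s]])
  then obtain G where G: "dN G" "\<And>x e. x \<in> X \<Longrightarrow> e \<in> D T1 \<Longrightarrow> num (G x (fn e)) = ?g x e"
    by (rule rp_dN) blast
  have m: "?m a b = num (inv num (?m a b))" for a b by (simp add: num_inv monus_typed)
  have le: "inv num (?m a b) + b = a" if "b \<le> a" for a b
  proof -
    have "num (inv num (?m a b) + b) = num a"
      using monus_eq[of "num a" "num b"] that by (simp add: num_ls num_pl num_inv monus_typed)
    then show ?thesis by (simp only: num_eq)
  qed
  \<comment> \<open>\<open>monus_eq\<close> says nothing about a difference whose subtrahend is the
    larger number. It is enough nevertheless: the other difference vanishes only for equal numbers,
    and for equal numbers both vanish.\<close>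
  have "a = b \<longleftrightarrow> inv num (?m a b) + inv num (?m b a) = 0" for a b
    using le[of a b] le[of b a] linear[of a b] by (auto simp: add_nonneg_eq_0_iff)
  moreover have "G x (fn e) = inv num (?m (s x (fn e)) (t x (fn e))) + inv num (?m (t x (fn e)) (s x (fn e)))"
    if "x \<in> X" "e \<in> D T1" for x e
  proof -
    have "num (G x (fn e)) = num (inv num (?m (s x (fn e)) (t x (fn e))) + inv num (?m (t x (fn e)) (s x (fn e))))"
      using G(2)[OF that] by (simp add: num_pl num_inv monus_typed)
    then show ?thesis by (simp only: num_eq)
  qed
  ultimately show ?thesis unfolding dP_def using G(1) by auto
qed

text \<open>Lets the first entry of the context vary: the values become a sequence of the model,
  uniformly in \<open>x\<close> and \<open>e\<close>, to which functionals of type \<open>T2\<close>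
  can be applied.\<close>

lemma rp_section:
  assumes "rp Num g"
  obtains h P where "rp T1 h" "\<And>x e m. x \<in> X \<Longrightarrow> e \<in> D T1 \<Longrightarrow> h x e \<bullet> num m = g x (P \<bullet> e \<bullet> num m)"
    "\<And>e m. e \<in> D T1 \<Longrightarrow> P \<bullet> e \<bullet> num m \<in> D T1"
    "\<And>e m. e \<in> D T1 \<Longrightarrow> fn (P \<bullet> e \<bullet> num m) = psh m (fn e)"
proof -
  obtain T where T: "T \<in> D (T1 \<rightarrow> T1 \<rightarrow> Num)" "\<And>x e. x \<in> X \<Longrightarrow> e \<in> D T1 \<Longrightarrow> T \<bullet> x \<bullet> e = g x e"
    using assms unfolding rp_def by blast
  obtain P where P: "P \<in> D (T1 \<rightarrow> Num \<rightarrow> T1)"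
    "\<And>e m. e \<in> D T1 \<Longrightarrow> fn (P \<bullet> e \<bullet> num m) = psh m (fn e)" by (rule push_ex) blast
  obtain B where B: "B \<in> D ((T1 \<rightarrow> Num) \<rightarrow> (Num \<rightarrow> T1) \<rightarrow> Num \<rightarrow> Num)"
    "\<And>f g x. f \<in> D (T1 \<rightarrow> Num) \<Longrightarrow> g \<in> D (Num \<rightarrow> T1) \<Longrightarrow> x \<in> D Num \<Longrightarrow> B \<bullet> f \<bullet> g \<bullet> x = f \<bullet> (g \<bullet> x)"
    using B_ex[of T1 Num Num] by blast
  have Pe: "P \<bullet> e \<in> D (Num \<rightarrow> T1)" if "e \<in> D T1" for e using P(1) that by (rule ap_dom)
  have Tx: "T \<bullet> x \<in> D (T1 \<rightarrow> Num)" if "x \<in> X" for x using T(1) that X(1) by (blast intro: ap_dom)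
  let ?h = "\<lambda>x e. B \<bullet> (T \<bullet> x) \<bullet> (P \<bullet> e)"
  have "rp T1 ?h"
    by (intro rp_ap[OF rp_const_ap[OF B(1)]] rp_const_ap[OF T(1) rp_x] rp_const_ap[OF P(1) rp_e])
  moreover have "?h x e \<bullet> num m = g x (P \<bullet> e \<bullet> num m)" if "x \<in> X" "e \<in> D T1" for x e m
    using B(2)[OF Tx Pe] T(2) Pe that by (simp add: ap_typed)
  moreover have "P \<bullet> e \<bullet> num m \<in> D T1" if "e \<in> D T1" for e m using Pe[OF that] by (simp add: ap_typed)
  ultimately show ?thesis using P(2) that by blast
qed

lemma dP_section:
  assumes "dP (\<lambda>x e. B x (e 0) (\<lambda>i. e (i + 1)))"
  obtains h where "rp T1 h" "\<And>x e m. x \<in> X \<Longrightarrow> e \<in> D T1 \<Longrightarrow> h x e \<bullet> num m = zero \<longleftrightarrow> B x m (fn e)"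
proof -
  obtain G where G: "dN G" "\<forall>x\<in>X. \<forall>e\<in>D T1. B x (fn e 0) (\<lambda>i. fn e (i + 1)) \<longleftrightarrow> G x (fn e) = 0"
    using assms unfolding dP_def by blast
  obtain h P where h: "rp T1 h" "\<And>x e m. x \<in> X \<Longrightarrow> e \<in> D T1 \<Longrightarrow> h x e \<bullet> num m = num (G x (fn (P \<bullet> e \<bullet> num m)))"
    "\<And>e m. e \<in> D T1 \<Longrightarrow> P \<bullet> e \<bullet> num m \<in> D T1"
    "\<And>e m. e \<in> D T1 \<Longrightarrow> fn (P \<bullet> e \<bullet> num m) = psh m (fn e)"
    using rp_section[OF dN_rp[OF G(1)]] by blast
  have "h x e \<bullet> num m = zero \<longleftrightarrow> B x m (fn e)" if "x \<in> X" "e \<in> D T1" for x e m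
    using h(2)[OF that, of m] h(4)[OF that(2), of m]
      G(2)[rule_format, OF that(1) h(3)[OF that(2), of m]] by (simp add: num_zero[symmetric])
  then show ?thesis using h(1) that by blast
qed

text \<open>The functional of \<open>exists2\<close> applied to the section of \<open>B\<close>
  decides the quantifier. The body is written in de Bruijn style: the bound number is entry 0 and
  the outer context is shifted by one.\<close>

lemma dP_ex: assumes "dP (\<lambda>x e. B x (e 0) (\<lambda>i. e (i + 1)))" shows "dP (\<lambda>x e. \<exists>m. B x m e)"
proof -
  obtain h where h: "rp T1 h" "\<And>x e m. x \<in> X \<Longrightarrow> e \<in> D T1 \<Longrightarrow> h x e \<bullet> num m = zero \<longleftrightarrow> B x m (fn e)"
    using dP_section[OF assms] by blast
  obtain \<Phi> where \<Phi>: "\<Phi> \<in> D T2" "\<And>f. f \<in> D T1 \<Longrightarrow> \<Phi> \<bullet> f = zero \<longleftrightarrow> (\<exists>n\<in>D Num. f \<bullet> n = zero)"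
    by (rule ex_Phi) blast
  obtain G where G: "dN G" "\<And>x e. x \<in> X \<Longrightarrow> e \<in> D T1 \<Longrightarrow> num (G x (fn e)) = \<Phi> \<bullet> h x e"
    using rp_dN[OF rp_const_ap[OF \<Phi>(1) h(1)]] by blast
  have "(\<exists>m. B x m (fn e)) \<longleftrightarrow> G x (fn e) = 0" if "x \<in> X" "e \<in> D T1" for x e
  proof -
    have "G x (fn e) = 0 \<longleftrightarrow> num (G x (fn e)) = zero" by (simp add: num_zero[symmetric])
    then show ?thesis using \<Phi>(2)[OF rp_typed[OF h(1) that]] h(2)[OF that] G(2)[OF that] by (simp add: bex_Num)
  qed
  then show ?thesis unfolding dP_def using G(1) by blast
qed

lemma dP_all: "dP (\<lambda>x e. B x (e 0) (\<lambda>i. e (i + 1))) \<Longrightarrow> dP (\<lambda>x e. \<forall>m. B x m e)"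
  using dP_not[OF dP_ex[of "\<lambda>x m e. \<not> B x m e"]] dP_not[of "\<lambda>x e. B x (e 0) (\<lambda>i. e (i + 1))"] by simp

text \<open>\<open>dC\<close> collects the transformations of contexts under which definability is preserved.\<close>

definition dC :: "('u \<Rightarrow> ('n \<Rightarrow> 'n) \<Rightarrow> 'n \<Rightarrow> 'n) \<Rightarrow> bool" where
  "dC C \<longleftrightarrow> (\<exists>c. rp T1 c \<and> (\<forall>x\<in>X. \<forall>e\<in>D T1. fn (c x e) = C x (fn e)))"

lemma dC_id: "dC (\<lambda>x e. e)"
  unfolding dC_def using rp_e by blast

lemma dC_E:
  assumes "dC C"
  obtains c where "rp T1 c" "\<And>x e. x \<in> X \<Longrightarrow> e \<in> D T1 \<Longrightarrow> fn (c x e) = C x (fn e)"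
  using assms unfolding dC_def by blast

lemma dC_shift: assumes "dC C" shows "dC (\<lambda>x e i. C x e (i + 1))"
proof -
  obtain c where c: "rp T1 c" "\<And>x e. x \<in> X \<Longrightarrow> e \<in> D T1 \<Longrightarrow> fn (c x e) = C x (fn e)"
    using assms by (rule dC_E) blast
  obtain B where B: "B \<in> D ((Num \<rightarrow> Num) \<rightarrow> (Num \<rightarrow> Num) \<rightarrow> Num \<rightarrow> Num)"
    "\<And>f g x. f \<in> D T1 \<Longrightarrow> g \<in> D T1 \<Longrightarrow> x \<in> D Num \<Longrightarrow> B \<bullet> f \<bullet> g \<bullet> x = f \<bullet> (g \<bullet> x)"
    using B_ex[of Num Num Num] by blast
  let ?k = "K Num Num \<bullet> one"
  let ?s = "S Num Num Num \<bullet> cn Plus \<bullet> ?k"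
  have k: "?k \<in> D T1" by (meson ap_dom cn_typed)
  have s: "?s \<in> D T1" using k by (meson ap_dom cn_typed)
  have "rp T1 (\<lambda>x e. B \<bullet> c x e \<bullet> ?s)"
    by (intro rp_ap[OF rp_const_ap[OF B(1) c(1)] rp_const[OF s]])
  moreover have "fn (B \<bullet> c x e \<bullet> ?s) = (\<lambda>i. C x (fn e) (i + 1))" if "x \<in> X" "e \<in> D T1" for x e
  proof
    fix i
    have "B \<bullet> c x e \<bullet> ?s \<bullet> num i = c x e \<bullet> (?s \<bullet> num i)"
      using B(2)[OF rp_typed[OF c(1) that] s] by simp
    moreover have "?s \<bullet> num i = num (i + 1)"
      using S_eq[OF cn_typed(3) k, of "num i"] K_eq[of one Num "num i" Num] by (simp add: num_pl num_one)
    ultimately show "fn (B \<bullet> c x e \<bullet> ?s) i = C x (fn e) (i + 1)"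
      by (simp add: c(2)[OF that, symmetric] fn_def)
  qed
  ultimately show ?thesis unfolding dC_def by blast
qed

lemma dC_psh: assumes "dN s" "dC C" shows "dC (\<lambda>x e. psh (s x e) (C x e))"
proof -
  obtain c where c: "rp T1 c" "\<And>x e. x \<in> X \<Longrightarrow> e \<in> D T1 \<Longrightarrow> fn (c x e) = C x (fn e)"
    using assms(2) by (rule dC_E) blast
  obtain P where P: "P \<in> D (T1 \<rightarrow> Num \<rightarrow> T1)"
    "\<And>e m. e \<in> D T1 \<Longrightarrow> fn (P \<bullet> e \<bullet> num m) = psh m (fn e)" by (rule push_ex) blast
  have "rp T1 (\<lambda>x e. P \<bullet> c x e \<bullet> num (s x (fn e)))"
    by (intro rp_ap[OF rp_const_ap[OF P(1) c(1)] dN_rp[OF assms(1)]])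
  moreover have "fn (P \<bullet> c x e \<bullet> num (s x (fn e))) = psh (s x (fn e)) (C x (fn e))"
    if "x \<in> X" "e \<in> D T1" for x e
    using P(2)[OF rp_typed[OF c(1) that]] c(2)[OF that] by simp
  ultimately show ?thesis unfolding dC_def by blast
qed

lemma dN_sub: assumes "dN s" "dC C" shows "dN (\<lambda>x e. s x (C x e))"
proof -
  obtain c where c: "rp T1 c" "\<And>x e. x \<in> X \<Longrightarrow> e \<in> D T1 \<Longrightarrow> fn (c x e) = C x (fn e)"
    using assms(2) by (rule dC_E) blast
  obtain T where T: "T \<in> D (T1 \<rightarrow> T1 \<rightarrow> Num)" "\<And>x e. x \<in> X \<Longrightarrow> e \<in> D T1 \<Longrightarrow> T \<bullet> x \<bullet> e = num (s x (fn e))"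
    using assms(1) unfolding dN_def rp_def by blast
  show ?thesis
    by (rule dNI[OF rp_ap[OF rp_const_ap[OF T(1) rp_x] c(1)]])
      (simp add: T(2) c(2) rp_typed[OF c(1)])
qed

lemma dP_sub: assumes "dP P" "dC C" shows "dP (\<lambda>x e. P x (C x e))"
proof -
  obtain G where G: "dN G" "\<And>x e. x \<in> X \<Longrightarrow> e \<in> D T1 \<Longrightarrow> P x (fn e) \<longleftrightarrow> G x (fn e) = 0"
    using assms(1) by (rule dP_E) blast
  obtain c where c: "rp T1 c" "\<And>x e. x \<in> X \<Longrightarrow> e \<in> D T1 \<Longrightarrow> fn (c x e) = C x (fn e)"
    using assms(2) by (rule dC_E) blast
  show ?thesis
  proof (rule dP_I[OF dN_sub[OF G(1) assms(2)]])
    show "P x (C x (fn e)) \<longleftrightarrow> G x (C x (fn e)) = 0" if "x \<in> X" "e \<in> D T1" for x e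
      using G(2)[OF that(1) rp_typed[OF c(1) that]] c(2)[OF that] by simp
  qed
qed

lemmas dN_shift = dN_sub[OF _ dC_shift[OF dC_id]]
lemma dP_le: "dN s \<Longrightarrow> dN t \<Longrightarrow> dP (\<lambda>x e. s x e \<le> t x e)"
proof -
  assume "dN s" "dN t"
  then have "dP (\<lambda>x e. \<exists>m. s x e + m = t x e)" by (intro dP_ex dP_eq dN_plus dN_shift dN_var)
  moreover have "(\<exists>m. a + m = b) \<longleftrightarrow> a \<le> b" for a b :: 'n
  proof
    show "a \<le> b" if "\<exists>m. a + m = b" using that by (auto simp: le_add_same_cancel1)
    show "\<exists>m. a + m = b" if "a \<le> b" using le_add_diff_inverse[OF that] by blast
  qed
  ultimately show ?thesis by simp
qed

lemma dP_less: "dN s \<Longrightarrow> dN t \<Longrightarrow> dP (\<lambda>x e. s x e < t x e)"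
  unfolding not_le[symmetric] by (intro dP_not dP_le)

lemma dN_if:
  assumes "dP P" "dN s" "dN t"
  shows "dN (\<lambda>x e. if P x e then s x e else t x e)"
proof -
  obtain G where G: "dN G" "\<And>x e. x \<in> X \<Longrightarrow> e \<in> D T1 \<Longrightarrow> P x (fn e) \<longleftrightarrow> G x (fn e) = 0"
    using assms(1) by (rule dP_E) blast
  obtain f where f: "f \<in> D T1" "fn f 0 = 1" "\<And>n. fn f (n + 1) = 0" using ex_step by blast
  have f': "fn f n = (if n = 0 then 1 else 0)" for n
    by (cases n rule: n_cases) (auto simp: f(2,3) add_nonneg_eq_0_iff)
  \<comment> \<open>One application of the zero test gives the indicator of \<open>P\<close>, two
    give that of its negation.\<close>
  have "dN (\<lambda>x e. fn f (G x e) * s x e + fn f (fn f (G x e)) * t x e)"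
    by (intro dN_plus dN_times dN_fun f(1) G(1) assms)
  then show ?thesis by (rule dN_cong) (use G(2) f' in auto)
qed

section \<open>Fixed parameters, induction, minimisation and recursion\<close>

lemma dP_inst: assumes "dP P" "a \<in> X" shows "dP (\<lambda>x e. P a e)"
proof -
  obtain G T where G: "\<forall>x\<in>X. \<forall>e\<in>D T1. P x (fn e) \<longleftrightarrow> G x (fn e) = 0"
    and T: "T \<in> D (T1 \<rightarrow> T1 \<rightarrow> Num)" "\<And>x e. x \<in> X \<Longrightarrow> e \<in> D T1 \<Longrightarrow> T \<bullet> x \<bullet> e = num (G x (fn e))"
    using assms unfolding dP_def dN_def rp_def by blast
  have "T \<bullet> a \<in> D (T1 \<rightarrow> Num)" using T(1) assms(2) X(1) by (blast intro: ap_dom)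
  then have "dN (\<lambda>x e. G a e)"
    by (intro dNI[OF rp_const_ap[OF _ rp_e]]) (use T(2)[OF assms(2)] in auto)
  then show ?thesis unfolding dP_def using G assms(2) by (intro exI[of _ "\<lambda>x e. G a e"]) auto
qed

text \<open>The axioms give induction for equations \<open>f n = 0\<close>, and a definable
  predicate has this form for some sequence \<open>f\<close> of the model. So induction extends to
  all arithmetical predicates.\<close>

lemma induct_n:
  assumes P: "dP (\<lambda>x e. P (e 0))" and 0: "P 0" and Suc: "\<And>n. P n \<Longrightarrow> P (n + 1)"
  shows "P (n::'n)"
proof -
  obtain h where h: "rp T1 h" "\<And>x e m. x \<in> X \<Longrightarrow> e \<in> D T1 \<Longrightarrow> h x e \<bullet> num m = zero \<longleftrightarrow> P m"
    using dP_section[of "\<lambda>x m e. P m"] P by blast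
  obtain x e where xe: "x \<in> X" "e \<in> D T1" using X(2) D_nonempty by blast
  have f: "h x e \<in> D T1" using h(1) xe by (rule rp_typed)
  have "h x e \<bullet> num n = zero"
  proof (rule num_induct[OF f])
    show "h x e \<bullet> zero = zero" using h(2)[OF xe, of 0] 0 by (simp add: num_zero)
    fix u assume u: "u \<in> D Num" "h x e \<bullet> u = zero"
    then have "P (inv num u + 1)" using h(2)[OF xe, of "inv num u"] Suc by (simp add: num_inv)
    then show "h x e \<bullet> pl u one = zero"
      using h(2)[OF xe, of "inv num u + 1"] u by (simp add: num_inv num_pl num_one)
  qed simp
  then show ?thesis using h(2)[OF xe] by blast
qed

lemma least_n:
  assumes P: "dP (\<lambda>x e. P (e 0))" and ex: "P (k::'n)"
  shows "\<exists>n. P n \<and> (\<forall>m<n. \<not> P m)"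
proof (rule ccontr)
  assume no: "\<nexists>n. P n \<and> (\<forall>m<n. \<not> P m)"
  have "\<forall>m\<le>n. \<not> P m" for n
  proof (rule induct_n[where P = "\<lambda>n. \<forall>m\<le>n. \<not> P m"])
    show "dP (\<lambda>x e. \<forall>m\<le>e 0. \<not> P m)" by (intro dP_all dP_imp dP_le dP_not dN_var P)
    show "\<forall>m\<le>0. \<not> P m" using no nonneg_n by (metis leD antisym)
    show "\<forall>m\<le>n + 1. \<not> P m" if "\<forall>m\<le>n. \<not> P m" for n
    proof (intro allI impI notI)
      fix m assume m: "m \<le> n + 1" "P m"
      have "\<not> P j" if "j < m" for j
        using that m(1) \<open>\<forall>m\<le>n. \<not> P m\<close> less_Suc_iff[of j n] by auto
      then show False using no m(2) by blast
    qed
  qed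
  then show False using ex by blast
qed

text \<open>Seen from outside, a nonempty set of numbers of the model may have no least element.
  Hence the definition tests for a least element; for definable predicates \<open>least_n\<close>
  supplies it.\<close>

definition mu :: "('n \<Rightarrow> bool) \<Rightarrow> 'n" where
  "mu P = (if \<exists>n. P n \<and> (\<forall>m<n. \<not> P m) then (THE n. P n \<and> (\<forall>m<n. \<not> P m)) else 0)"

lemma mu_eq: "P n \<Longrightarrow> (\<And>m. m < n \<Longrightarrow> \<not> P m) \<Longrightarrow> mu P = n"
proof -
  assume "P n" and *: "\<And>m. m < n \<Longrightarrow> \<not> P m"
  then have "(THE n. P n \<and> (\<forall>m<n. \<not> P m)) = n" by (intro the_equality) (auto, metis linorder_neqE)
  then show ?thesis using \<open>P n\<close> * unfolding mu_def by auto
qed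

lemma mu_I: "dP (\<lambda>x e. P (e 0)) \<Longrightarrow> P k \<Longrightarrow> P (mu P)"
  using least_n mu_eq by metis

lemma dN_mu: assumes B: "dP (\<lambda>x e. B x (e 0) (\<lambda>i. e (i + 1)))" shows "dN (\<lambda>x e. mu (\<lambda>m. B x m e))"
proof -
  \<comment> \<open>The search operator returns some zero, not the least one. Being least is put
    into the predicate, which then has at most one solution.\<close>
  let ?L = "\<lambda>x m e. B x m e \<and> (\<forall>j<m. \<not> B x j e)"
  have "dP (\<lambda>x e. B x (e 0) (\<lambda>i. e (i + 1 + 1)))"
    using dP_sub[OF B dC_psh[OF dN_var[of 0] dC_shift[OF dC_shift[OF dC_id]]]] by simp
  then have L: "dP (\<lambda>x e. ?L x (e 0) (\<lambda>i. e (i + 1)))"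
    by (intro dP_conj B dP_all dP_imp dP_less dP_not dN_var)
  obtain h where h: "rp T1 h" "\<And>x e m. x \<in> X \<Longrightarrow> e \<in> D T1 \<Longrightarrow> h x e \<bullet> num m = zero \<longleftrightarrow> ?L x m (fn e)"
    by (rule dP_section[OF L]) blast
  obtain \<mu> where \<mu>: "\<mu> \<in> D T2"
    "\<And>f n. f \<in> D T1 \<Longrightarrow> n \<in> D Num \<Longrightarrow> f \<bullet> n = zero \<Longrightarrow> f \<bullet> (\<mu> \<bullet> f) = zero"
    by (rule ex_search) blast
  obtain G where G: "dN G" "\<And>x e. x \<in> X \<Longrightarrow> e \<in> D T1 \<Longrightarrow> num (G x (fn e)) = \<mu> \<bullet> h x e"
    using rp_dN[OF rp_const_ap[OF \<mu>(1) h(1)]] by blast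
  have "dN (\<lambda>x e. if \<exists>m. ?L x m e then G x e else 0)"
    by (intro dN_if dP_ex L G(1) dN_const)
  then show ?thesis
  proof (rule dN_cong)
    fix x e assume xe: "x \<in> X" "e \<in> D T1"
    show "(if \<exists>m. ?L x m (fn e) then G x (fn e) else 0) = mu (\<lambda>m. B x m (fn e))"
    proof (cases "\<exists>m. ?L x m (fn e)")
      case True
      then obtain m where "h x e \<bullet> num m = zero" using h(2)[OF xe] by blast
      then have "h x e \<bullet> (\<mu> \<bullet> h x e) = zero" by (rule \<mu>(2)[OF rp_typed[OF h(1) xe] num_typed])
      then have "?L x (G x (fn e)) (fn e)" using h(2)[OF xe, of "G x (fn e)"] G(2)[OF xe] by simp
      then have "mu (\<lambda>m. B x m (fn e)) = G x (fn e)" by (intro mu_eq) auto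
      then show ?thesis using True by simp
    qed (auto simp: mu_def)
  qed
qed

text \<open>The combinator \<open>S T (K e)\<close> fixes an arbitrary context \<open>e\<close>; the
  values depend on entry 0 alone, which is replaced by the argument of the sequence.\<close>

lemma dN_object:
  assumes "dN (\<lambda>x e. C x (e 0))"
  obtains W where "W \<in> D (T1 \<rightarrow> T1)" "\<And>x. x \<in> X \<Longrightarrow> fn (W \<bullet> x) = C x"
proof -
  obtain h P where h: "rp T1 h" "\<And>x e m. x \<in> X \<Longrightarrow> e \<in> D T1 \<Longrightarrow> h x e \<bullet> num m = num (C x (fn (P \<bullet> e \<bullet> num m) 0))"
    "\<And>e m. e \<in> D T1 \<Longrightarrow> P \<bullet> e \<bullet> num m \<in> D T1"
    "\<And>e m. e \<in> D T1 \<Longrightarrow> fn (P \<bullet> e \<bullet> num m) = psh m (fn e)"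
    by (rule rp_section[OF dN_rp[OF assms]]) blast
  obtain T where T: "T \<in> D (T1 \<rightarrow> T1 \<rightarrow> T1)" "\<And>x e. x \<in> X \<Longrightarrow> e \<in> D T1 \<Longrightarrow> T \<bullet> x \<bullet> e = h x e"
    using h(1) unfolding rp_def by blast
  obtain e where e: "e \<in> D T1" using D_nonempty by blast
  let ?W = "S T1 T1 T1 \<bullet> T \<bullet> (K T1 T1 \<bullet> e)"
  have Ke: "K T1 T1 \<bullet> e \<in> D (T1 \<rightarrow> T1)" using e by (meson ap_dom cn_typed)
  have "?W \<in> D (T1 \<rightarrow> T1)" using T(1) Ke by (meson ap_dom cn_typed)
  moreover have "fn (?W \<bullet> x) = C x" if "x \<in> X" for x
  proof
    fix m
    have x: "x \<in> D T1" using that X(1) by blast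
    have "?W \<bullet> x = h x e" using S_eq[OF T(1) Ke x] K_eq[OF e x] T(2)[OF that e] by simp
    then show "fn (?W \<bullet> x) m = C x m" using h(2)[OF that e, of m] h(4)[OF e, of m] by (simp add: fn_def)
  qed
  ultimately show ?thesis using that by blast
qed

lemma dN_object_T2:
  assumes "dN (\<lambda>x e. C x)"
  obtains W where "W \<in> D T2" "\<And>x. x \<in> X \<Longrightarrow> W \<bullet> x = num (C x)"
proof -
  obtain T where T: "T \<in> D (T1 \<rightarrow> T1 \<rightarrow> Num)" "\<And>x e. x \<in> X \<Longrightarrow> e \<in> D T1 \<Longrightarrow> T \<bullet> x \<bullet> e = num (C x)"
    using assms unfolding dN_def rp_def by blast
  obtain e where e: "e \<in> D T1" using D_nonempty by blast
  let ?W = "S T1 T1 Num \<bullet> T \<bullet> (K T1 T1 \<bullet> e)"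
  have Ke: "K T1 T1 \<bullet> e \<in> D (T1 \<rightarrow> T1)" using e by (meson ap_dom cn_typed)
  have "?W \<in> D T2" using T(1) Ke by (meson ap_dom cn_typed)
  moreover have "?W \<bullet> x = num (C x)" if "x \<in> X" for x
  proof -
    have x: "x \<in> D T1" using that X(1) by blast
    show ?thesis using S_eq[OF T(1) Ke x] K_eq[OF e x] T(2)[OF that e] by simp
  qed
  ultimately show ?thesis using that by blast
qed

lemma dN_sequence:
  assumes "dN (\<lambda>x e. C (e 0))"
  obtains f where "f \<in> D T1" "fn f = C"
proof -
  obtain W where W: "W \<in> D (T1 \<rightarrow> T1)" "\<And>x. x \<in> X \<Longrightarrow> fn (W \<bullet> x) = C"
    using dN_object[OF assms] by blast
  obtain x where "x \<in> X" using X(2) by blast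
  then show ?thesis using that[of "W \<bullet> x"] W X(1) ap_typed(3)[OF W(1)] by blast
qed

text \<open>The step has to be an element of type
  \<open>Num \<rightarrow> Num \<rightarrow> Num\<close>: stage and previous value are pushed onto a
  fixed context in this order, so the previous value becomes entry 0 and the stage entry 1.\<close>

lemma dN_rec:
  assumes "dN (\<lambda>x e. C (e 0) (e 1))"
  obtains f where "f \<in> D T1" "fn f 0 = a" "\<And>n. fn f (n + 1) = C n (fn f n)"
proof -
  obtain x where x: "x \<in> X" using X(2) by blast
  have "dN (\<lambda>x e. C (psh (e 1) (psh (e 0) e) 0) (psh (e 1) (psh (e 0) e) 1))"
    using dN_sub[OF assms dC_psh[OF dN_var dC_psh[OF dN_var dC_id]]] by simp
  then have "dN (\<lambda>x e. C (e 1) (e 0))"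
    using psh_Suc[of _ _ 0] by simp
  then have 1: "rp Num (\<lambda>x e. num (C (fn e 1) (fn e 0)))" by (rule dN_rp)
  obtain T where T: "T \<in> D (T1 \<rightarrow> T1 \<rightarrow> Num)"
    "\<And>x e. x \<in> X \<Longrightarrow> e \<in> D T1 \<Longrightarrow> T \<bullet> x \<bullet> e = num (C (fn e 1) (fn e 0))"
    using 1 unfolding rp_def by blast
  obtain P where P: "P \<in> D (T1 \<rightarrow> Num \<rightarrow> T1)"
    "\<And>e m. e \<in> D T1 \<Longrightarrow> fn (P \<bullet> e \<bullet> num m) = psh m (fn e)" by (rule push_ex) blast
  obtain e where e: "e \<in> D T1" using D_nonempty by blast
  have Tx: "T \<bullet> x \<in> D T2" using T(1) x X(1) by (blast intro: ap_dom)
  have Pe: "P \<bullet> e \<in> D (Num \<rightarrow> T1)" using P(1) e by (rule ap_dom)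
  obtain B where B: "B \<in> D ((T1 \<rightarrow> Num) \<rightarrow> (Num \<rightarrow> T1) \<rightarrow> Num \<rightarrow> Num)"
    "\<And>f g x. f \<in> D (T1 \<rightarrow> Num) \<Longrightarrow> g \<in> D (Num \<rightarrow> T1) \<Longrightarrow> x \<in> D Num \<Longrightarrow> B \<bullet> f \<bullet> g \<bullet> x = f \<bullet> (g \<bullet> x)"
    using B_ex[of T1 Num Num] by blast
  obtain B' where B': "B' \<in> D ((T1 \<rightarrow> Num \<rightarrow> T1) \<rightarrow> (Num \<rightarrow> T1) \<rightarrow> Num \<rightarrow> Num \<rightarrow> T1)"
    "\<And>f g x. f \<in> D (T1 \<rightarrow> Num \<rightarrow> T1) \<Longrightarrow> g \<in> D (Num \<rightarrow> T1) \<Longrightarrow> x \<in> D Num \<Longrightarrow> B' \<bullet> f \<bullet> g \<bullet> x = f \<bullet> (g \<bullet> x)"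
    using B_ex[of T1 "Num \<rightarrow> T1" Num] by blast
  obtain B'' where B'': "B'' \<in> D (((Num \<rightarrow> T1) \<rightarrow> T1) \<rightarrow> (Num \<rightarrow> Num \<rightarrow> T1) \<rightarrow> Num \<rightarrow> T1)"
    "\<And>f g x. f \<in> D ((Num \<rightarrow> T1) \<rightarrow> T1) \<Longrightarrow> g \<in> D (Num \<rightarrow> Num \<rightarrow> T1) \<Longrightarrow> x \<in> D Num \<Longrightarrow>
      B'' \<bullet> f \<bullet> g \<bullet> x = f \<bullet> (g \<bullet> x)"
    using B_ex[of "Num \<rightarrow> T1" T1 Num] by blast
  let ?g = "B' \<bullet> P \<bullet> (P \<bullet> e)"
  let ?F = "B'' \<bullet> (B \<bullet> (T \<bullet> x)) \<bullet> ?g"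
  have g: "?g \<in> D (Num \<rightarrow> Num \<rightarrow> T1)" using B'(1) P(1) Pe by (meson ap_dom)
  have BT: "B \<bullet> (T \<bullet> x) \<in> D ((Num \<rightarrow> T1) \<rightarrow> T1)" using B(1) Tx by (rule ap_dom)
  have F: "?F \<in> D (Num \<rightarrow> Num \<rightarrow> Num)" using B''(1) BT g by (meson ap_dom)
  have Feq: "?F \<bullet> num n \<bullet> num r = num (C n r)" for n r
  proof -
    have Pn: "P \<bullet> e \<bullet> num n \<in> D T1" using Pe by (simp add: ap_typed)
    have Pnr: "P \<bullet> (P \<bullet> e \<bullet> num n) \<in> D (Num \<rightarrow> T1)" using P(1) Pn by (rule ap_dom)
    have "?F \<bullet> num n = B \<bullet> (T \<bullet> x) \<bullet> (P \<bullet> (P \<bullet> e \<bullet> num n))"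
      using B''(2)[OF BT g, of "num n"] B'(2)[OF P(1) Pe, of "num n"] by simp
    then have "?F \<bullet> num n \<bullet> num r = T \<bullet> x \<bullet> (P \<bullet> (P \<bullet> e \<bullet> num n) \<bullet> num r)"
      using B(2)[OF Tx Pnr, of "num r"] by simp
    then show ?thesis using T(2)[OF x, of "P \<bullet> (P \<bullet> e \<bullet> num n) \<bullet> num r"] Pnr P(2)[OF Pn] P(2)[OF e]
        psh_Suc[of r "psh n (fn e)" 0] by (simp add: ap_typed)
  qed
  let ?f = "R \<bullet> ?F \<bullet> num a"
  have f: "?f \<in> D T1" using F by (meson ap_dom cn_typed num_typed)
  moreover have "fn ?f 0 = a" using R_0[OF F, of "num a"] by (simp add: fn_def num_zero)
  moreover have "fn ?f (n + 1) = C n (fn ?f n)" for n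
    using R_Suc[OF F, of "num a" "num n"] ap_num[OF f, of n] Feq
    by (simp add: fn_def[of _ "n + 1"] num_pl num_one)
  ultimately show ?thesis using that by blast
qed

end

section \<open>Integers, rationals and reals over an ordered semiring\<close>

text \<open>Formal differences \<open>a - b\<close>. The integers of HOL are built on the standard
  numbers and do not fit a semiring that may be nonstandard.\<close>

definition zz_rel :: "'n::linordered_semidom \<times> 'n \<Rightarrow> 'n \<times> 'n \<Rightarrow> bool" where
  "zz_rel = (\<lambda>(a, b) (c, d). a + d = c + b)"

quotient_type (overloaded) 'n zz = "'n::linordered_semidom \<times> 'n" / zz_rel
  morphisms Rep_zz Abs_zz
proof (rule equivpI)
  show "reflp (zz_rel :: 'n \<times> 'n \<Rightarrow> _)" by (auto simp: zz_rel_def reflp_def)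
  show "symp (zz_rel :: 'n \<times> 'n \<Rightarrow> _)" by (auto simp: zz_rel_def symp_def)
  show "transp (zz_rel :: 'n \<times> 'n \<Rightarrow> _)"
  proof (rule transpI, clarsimp simp: zz_rel_def)
    fix a b c d e f :: 'n assume "a + d = c + b" "c + f = e + d"
    then have "(a + f) + (c + d) = (e + b) + (c + d)" by (metis add.assoc add.commute)
    then show "a + f = e + b" by (rule add_right_imp_eq)
  qed
qed

instantiation zz :: (linordered_semidom) comm_ring_1
begin

lift_definition zero_zz :: "'a zz" is "(0, 0)" .
lift_definition one_zz :: "'a zz" is "(1, 0)" .
lift_definition plus_zz :: "'a zz \<Rightarrow> 'a zz \<Rightarrow> 'a zz" is "\<lambda>(a, b) (c, d). (a + c, b + d)"
  by (clarsimp simp: zz_rel_def) (metis add.assoc add.commute)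
lift_definition uminus_zz :: "'a zz \<Rightarrow> 'a zz" is "\<lambda>(a, b). (b, a)"
  by (clarsimp simp: zz_rel_def) (metis add.commute)
definition minus_zz :: "'a zz \<Rightarrow> 'a zz \<Rightarrow> 'a zz" where "minus_zz x y = x + - y"
lift_definition times_zz :: "'a zz \<Rightarrow> 'a zz \<Rightarrow> 'a zz"
  is "\<lambda>(a, b) (c, d). (a * c + b * d, a * d + b * c)"
proof (clarsimp simp: zz_rel_def)
  fix s t u v w x y z :: 'a
  assume "s + v = u + t" and "w + z = y + x"
  \<comment> \<open>The hypotheses enter as equal factors; multiplied out, both sides contain the
    same four additional products, which cancel.\<close>
  then have "(s + v) * w + (u + t) * x + u * (w + z) + v * (y + x) =
      (u + t) * w + (s + v) * x + u * (y + x) + v * (w + z)" by simp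
  then have "((s * w + t * x) + (u * z + v * y)) + (v * w + u * x + u * w + v * x) =
      ((u * y + v * z) + (s * x + t * w)) + (v * w + u * x + u * w + v * x)"
    by (simp add: algebra_simps)
  then show "(s * w + t * x) + (u * z + v * y) = (u * y + v * z) + (s * x + t * w)"
    by (rule add_right_imp_eq)
qed

instance
proof
  fix a b c :: "'a zz"
  show "a * b * c = a * (b * c)" by transfer (clarsimp simp: zz_rel_def algebra_simps)
  show "a * b = b * a" by transfer (clarsimp simp: zz_rel_def algebra_simps)
  show "1 * a = a" by transfer (clarsimp simp: zz_rel_def)
  show "(a + b) * c = a * c + b * c" by transfer (clarsimp simp: zz_rel_def algebra_simps)
  show "a + b + c = a + (b + c)" by transfer (clarsimp simp: zz_rel_def algebra_simps)
  show "a + b = b + a" by transfer (clarsimp simp: zz_rel_def algebra_simps)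
  show "0 + a = a" by transfer (clarsimp simp: zz_rel_def)
  show "- a + a = 0" by transfer (clarsimp simp: zz_rel_def add.commute)
  show "a - b = a + - b" by (simp add: minus_zz_def)
  show "(0 :: 'a zz) \<noteq> 1" by transfer (simp add: zz_rel_def)
qed

end

instantiation zz :: (linordered_semidom) linordered_idom
begin

lift_definition less_eq_zz :: "'a zz \<Rightarrow> 'a zz \<Rightarrow> bool" is "\<lambda>(a, b) (c, d). a + d \<le> c + b"
proof (clarsimp simp: zz_rel_def)
  fix s t u v w x y z :: 'a
  assume "s + v = u + t" "w + z = y + x"
  then have *: "(s + x) + (v + y) = (u + z) + (t + w)" by (metis add.assoc add.commute)
  show "(s + x \<le> w + t) = (u + z \<le> y + v)"
  proof
    assume "s + x \<le> w + t"
    then have "(u + z) + (t + w) \<le> (w + t) + (v + y)" unfolding *[symmetric] by simp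
    then show "u + z \<le> y + v" by (simp add: add.commute)
  next
    assume "u + z \<le> y + v"
    then have "(s + x) + (v + y) \<le> (y + v) + (t + w)" unfolding * by simp
    then show "s + x \<le> w + t" by (simp add: add.commute)
  qed
qed

definition less_zz :: "'a zz \<Rightarrow> 'a zz \<Rightarrow> bool" where "less_zz x y \<longleftrightarrow> x \<le> y \<and> \<not> y \<le> x"
definition abs_zz :: "'a zz \<Rightarrow> 'a zz" where "abs_zz x = (if x < 0 then - x else x)"
definition sgn_zz :: "'a zz \<Rightarrow> 'a zz" where "sgn_zz x = (if x = 0 then 0 else if 0 < x then 1 else - 1)"

instance
proof
  fix x y z :: "'a zz"
  show "x < y \<longleftrightarrow> x \<le> y \<and> \<not> y \<le> x" by (simp add: less_zz_def)
  show "x \<le> x" by transfer auto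
  show "x \<le> z" if "x \<le> y" "y \<le> z" using that
  proof (transfer, clarsimp)
    fix a b c d e f :: 'a assume "a + d \<le> c + b" "c + f \<le> e + d"
    then have "(a + d) + (c + f) \<le> (c + b) + (e + d)" by (rule add_mono)
    then have "(a + f) + (c + d) \<le> (e + b) + (c + d)" by (simp add: ac_simps)
    then show "a + f \<le> e + b" by simp
  qed
  show "x = y" if "x \<le> y" "y \<le> x" using that by transfer (auto simp: zz_rel_def)
  show "x \<le> y \<or> y \<le> x" by transfer (auto simp: linear)
  show "z + x \<le> z + y" if "x \<le> y" using that
  proof (transfer, clarsimp)
    fix a b c d p q :: 'a assume "a + d \<le> c + b"
    then have "(p + q) + (a + d) \<le> (p + q) + (c + b)" by (rule add_left_mono)
    then show "p + a + (q + d) \<le> p + c + (q + b)" by (simp only: ac_simps)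
  qed
  show "\<bar>x\<bar> = (if x < 0 then - x else x)" by (simp add: abs_zz_def)
  show "sgn x = (if x = 0 then 0 else if 0 < x then 1 else - 1)" by (simp add: sgn_zz_def)
  have less: "Abs_zz (a, b) < Abs_zz (c, d) \<longleftrightarrow> a + d < c + b" for a b c d :: 'a
    by (auto simp: less_zz_def less_eq_zz.abs_eq)
  show "z * x < z * y" if "x < y" "0 < z"
  proof -
    obtain a b c d p q where xyz: "x = Abs_zz (a, b)" "y = Abs_zz (c, d)" "z = Abs_zz (p, q)"
      using zz.abs_induct[of "\<lambda>x. \<exists>a b. x = Abs_zz (a, b)"] by (metis surj_pair)
    then have "a + d < c + b" "q < p" using that by (simp_all add: less zero_zz_def)
    define r where "r = p - q"
    have p: "p = q + r" using \<open>q < p\<close> le_add_diff_inverse[of q p] by (simp add: r_def)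
    have "q + 0 < q + r" using \<open>q < p\<close> by (simp add: p)
    then have "0 < r" by (simp only: add_less_cancel_left)
    have "r * (a + d) < r * (c + b)" using \<open>a + d < c + b\<close> \<open>0 < r\<close> by (simp add: mult_strict_left_mono)
    \<comment> \<open>Adding \<open>q * (a + b + c + d)\<close> replaces \<open>r = p - q\<close> by
      \<open>p\<close> on both sides, so that only sums of products remain.\<close>
    then have "r * (a + d) + q * (a + b + c + d) < r * (c + b) + q * (a + b + c + d)"
      by (rule add_strict_right_mono)
    moreover have "r * (a + d) + q * (a + b + c + d) = p * a + q * b + (p * d + q * c)"
      "r * (c + b) + q * (a + b + c + d) = p * c + q * d + (p * b + q * a)"
      unfolding p by (simp_all only: algebra_simps)
    ultimately have "p * a + q * b + (p * d + q * c) < p * c + q * d + (p * b + q * a)" by simp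
    then show ?thesis by (simp add: xyz less times_zz.abs_eq)
  qed
qed

end

text \<open>Elements of the completion are classes of nets that are eventually close to constants.\<close>

definition vanishes :: "('i::linorder \<Rightarrow> 'k::linordered_field) \<Rightarrow> bool" where
  "vanishes X \<longleftrightarrow> (\<forall>\<epsilon>>0. \<forall>\<^sub>F i in at_top. \<bar>X i\<bar> < \<epsilon>)"

definition cauchy :: "('i::linorder \<Rightarrow> 'k::linordered_field) \<Rightarrow> bool" where
  "cauchy X \<longleftrightarrow> (\<forall>\<epsilon>>0. \<exists>c. \<forall>\<^sub>F i in at_top. \<bar>X i - c\<bar> < \<epsilon>)"

section \<open>The Cauchy completion of an ordered field\<close>

lemma cauchyD: "cauchy X \<Longrightarrow> 0 < \<epsilon> \<Longrightarrow> \<exists>c. \<forall>\<^sub>F i in at_top. \<bar>X i - c\<bar> < \<epsilon>"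
  by (simp add: cauchy_def)

lemma vanishesD: "vanishes X \<Longrightarrow> 0 < \<epsilon> \<Longrightarrow> \<forall>\<^sub>F i in at_top. \<bar>X i\<bar> < \<epsilon>"
  by (simp add: vanishes_def)

lemma vanishes_zero [simp]: "vanishes (\<lambda>i. 0)"
  by (simp add: vanishes_def)

lemma vanishes_add:
  assumes "vanishes X" "vanishes Y" shows "vanishes (\<lambda>i. X i + Y i)"
  unfolding vanishes_def
proof (intro allI impI)
  fix \<epsilon> :: 'b assume "0 < \<epsilon>"
  then have "\<forall>\<^sub>F i in at_top. \<bar>X i\<bar> < \<epsilon> / 2" "\<forall>\<^sub>F i in at_top. \<bar>Y i\<bar> < \<epsilon> / 2"
    using vanishesD[OF assms(1), of "\<epsilon> / 2"] vanishesD[OF assms(2), of "\<epsilon> / 2"] half_gt_zero by blast+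
  then show "\<forall>\<^sub>F i in at_top. \<bar>X i + Y i\<bar> < \<epsilon>"
    by eventually_elim linarith
qed

lemma vanishes_uminus: "vanishes X \<Longrightarrow> vanishes (\<lambda>i. - X i)"
  by (simp add: vanishes_def)

lemma cauchy_bounded:
  assumes "cauchy X" obtains b where "0 < b" "\<forall>\<^sub>F i in at_top. \<bar>X i\<bar> < b"
proof -
  obtain c where "\<forall>\<^sub>F i in at_top. \<bar>X i - c\<bar> < 1" using cauchyD[OF assms, of 1] by auto
  then have "\<forall>\<^sub>F i in at_top. \<bar>X i\<bar> < \<bar>c\<bar> + 1" by eventually_elim linarith
  then show ?thesis using that[of "\<bar>c\<bar> + 1"] by simp
qed

lemma vanishes_mult:
  assumes "cauchy X" "vanishes Y" shows "vanishes (\<lambda>i. X i * Y i)"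
  unfolding vanishes_def
proof (intro allI impI)
  fix \<epsilon> :: 'b assume \<epsilon>: "0 < \<epsilon>"
  obtain b where b: "0 < b" "\<forall>\<^sub>F i in at_top. \<bar>X i\<bar> < b" using cauchy_bounded[OF assms(1)] .
  have "\<forall>\<^sub>F i in at_top. \<bar>Y i\<bar> < \<epsilon> / b" using \<epsilon> b(1) by (intro vanishesD[OF assms(2)] divide_pos_pos)
  with b(2) show "\<forall>\<^sub>F i in at_top. \<bar>X i * Y i\<bar> < \<epsilon>"
  proof eventually_elim
    case (elim i)
    then have "\<bar>X i\<bar> * \<bar>Y i\<bar> < b * (\<epsilon> / b)" by (intro mult_strict_mono) auto
    then show ?case using b(1) by (simp add: abs_mult)
  qed
qed

lemma cauchy_const [simp]: "cauchy (\<lambda>i. c)"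
  by (auto simp: cauchy_def intro!: exI[of _ c])

lemma cauchy_add:
  assumes "cauchy X" "cauchy Y" shows "cauchy (\<lambda>i. X i + Y i)"
  unfolding cauchy_def
proof (intro allI impI)
  fix \<epsilon> :: 'b assume "0 < \<epsilon>"
  then obtain c d where "\<forall>\<^sub>F i in at_top. \<bar>X i - c\<bar> < \<epsilon> / 2" "\<forall>\<^sub>F i in at_top. \<bar>Y i - d\<bar> < \<epsilon> / 2"
    using cauchyD[OF assms(1), of "\<epsilon> / 2"] cauchyD[OF assms(2), of "\<epsilon> / 2"] half_gt_zero by blast
  then have "\<forall>\<^sub>F i in at_top. \<bar>X i + Y i - (c + d)\<bar> < \<epsilon>" by eventually_elim linarith
  then show "\<exists>c. \<forall>\<^sub>F i in at_top. \<bar>X i + Y i - c\<bar> < \<epsilon>" by blast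
qed

lemma cauchy_uminus: assumes "cauchy X" shows "cauchy (\<lambda>i. - X i)"
  unfolding cauchy_def
proof (intro allI impI)
  fix \<epsilon> :: 'b assume "0 < \<epsilon>"
  then obtain c where "\<forall>\<^sub>F i in at_top. \<bar>X i - c\<bar> < \<epsilon>" using cauchyD[OF assms] by blast
  then have "\<forall>\<^sub>F i in at_top. \<bar>- X i - (- c)\<bar> < \<epsilon>" by eventually_elim linarith
  then show "\<exists>c. \<forall>\<^sub>F i in at_top. \<bar>- X i - c\<bar> < \<epsilon>" by blast
qed

lemma cauchy_mult:
  assumes "cauchy X" "cauchy Y" shows "cauchy (\<lambda>i. X i * Y i)"
  unfolding cauchy_def
proof (intro allI impI)
  fix \<epsilon> :: 'b assume \<epsilon>: "0 < \<epsilon>"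
  obtain b where b: "0 < b" "\<forall>\<^sub>F i in at_top. \<bar>X i\<bar> < b" using cauchy_bounded[OF assms(1)] .
  obtain d where d: "\<forall>\<^sub>F i in at_top. \<bar>Y i - d\<bar> < \<epsilon> / 2 / b"
    using cauchyD[OF assms(2), of "\<epsilon> / 2 / b"] divide_pos_pos[OF half_gt_zero[OF \<epsilon>] b(1)] by blast
  \<comment> \<open>One is added because \<open>d\<close> may be 0, while
    \<open>\<epsilon> / 2 / a\<close> needs a positive denominator.\<close>
  define a where "a = \<bar>d\<bar> + 1"
  have a: "0 < a" "\<bar>d\<bar> \<le> a" by (simp_all add: a_def add_nonneg_pos)
  obtain c where c: "\<forall>\<^sub>F i in at_top. \<bar>X i - c\<bar> < \<epsilon> / 2 / a"
    using cauchyD[OF assms(1), of "\<epsilon> / 2 / a"] divide_pos_pos[OF half_gt_zero[OF \<epsilon>] a(1)] by blast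
  from b(2) d c have "\<forall>\<^sub>F i in at_top. \<bar>X i * Y i - c * d\<bar> < \<epsilon>"
  proof eventually_elim
    case (elim i)
    have "\<bar>X i\<bar> * \<bar>Y i - d\<bar> < b * (\<epsilon> / 2 / b)" using elim by (intro mult_strict_mono) auto
    then have 1: "\<bar>X i * (Y i - d)\<bar> < \<epsilon> / 2" using b(1) by (simp add: abs_mult)
    have "\<bar>X i - c\<bar> * \<bar>d\<bar> \<le> \<epsilon> / 2 / a * a"
      using elim(3) \<epsilon> a by (intro mult_mono) auto
    then have 2: "\<bar>(X i - c) * d\<bar> \<le> \<epsilon> / 2" using a(1) by (simp add: abs_mult)
    have "X i * Y i - c * d = X i * (Y i - d) + (X i - c) * d" by (simp add: algebra_simps)
    then show ?case using 1 2 by linarith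
  qed
  then show "\<exists>c. \<forall>\<^sub>F i in at_top. \<bar>X i * Y i - c\<bar> < \<epsilon>" by blast
qed

definition cr_rel :: "('i::linorder \<Rightarrow> 'k::linordered_field) \<Rightarrow> ('i \<Rightarrow> 'k) \<Rightarrow> bool" where
  "cr_rel X Y \<longleftrightarrow> cauchy X \<and> cauchy Y \<and> vanishes (\<lambda>i. X i - Y i)"

lemma cr_rel_eqI: "cauchy X \<Longrightarrow> (\<And>i. X i = Y i) \<Longrightarrow> cr_rel X Y"
proof -
  assume "cauchy X" "\<And>i. X i = Y i"
  then have "X = Y" by auto
  with \<open>cauchy X\<close> show ?thesis by (simp add: cr_rel_def)
qed

quotient_type (overloaded) ('i, 'k) cr = "'i::linorder \<Rightarrow> 'k::linordered_field" / partial: cr_rel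
  morphisms Rep_cr Abs_cr
proof (rule part_equivpI)
  show "\<exists>X :: 'i \<Rightarrow> 'k. cr_rel X X" by (intro exI[of _ "\<lambda>_. 0"]) (simp add: cr_rel_def)
  show "symp (cr_rel :: ('i \<Rightarrow> 'k) \<Rightarrow> _)"
    by (auto simp: symp_def cr_rel_def vanishes_def abs_minus_commute)
  show "transp (cr_rel :: ('i \<Rightarrow> 'k) \<Rightarrow> _)"
    unfolding transp_def cr_rel_def using vanishes_add by fastforce
qed

lemma cr_rel_cauchy: "cr_rel X X \<longleftrightarrow> cauchy X"
  by (simp add: cr_rel_def)

instantiation cr :: (linorder, linordered_field) comm_ring_1
begin

lift_definition zero_cr :: "('a, 'b) cr" is "\<lambda>i. 0" by (simp add: cr_rel_cauchy)
lift_definition one_cr :: "('a, 'b) cr" is "\<lambda>i. 1" by (simp add: cr_rel_cauchy)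
lift_definition plus_cr :: "('a, 'b) cr \<Rightarrow> ('a, 'b) cr \<Rightarrow> ('a, 'b) cr" is "\<lambda>X Y i. X i + Y i"
  unfolding cr_rel_def by (auto intro: cauchy_add) (drule (1) vanishes_add, simp add: algebra_simps)
lift_definition uminus_cr :: "('a, 'b) cr \<Rightarrow> ('a, 'b) cr" is "\<lambda>X i. - X i"
  unfolding cr_rel_def by (auto intro: cauchy_uminus) (drule vanishes_uminus, simp)
definition minus_cr :: "('a, 'b) cr \<Rightarrow> ('a, 'b) cr \<Rightarrow> ('a, 'b) cr" where "minus_cr x y = x + - y"
lift_definition times_cr :: "('a, 'b) cr \<Rightarrow> ('a, 'b) cr \<Rightarrow> ('a, 'b) cr" is "\<lambda>X Y i. X i * Y i"
proof -
  fix X Y U V :: "'a \<Rightarrow> 'b" assume *: "cr_rel X Y" "cr_rel U V"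
  then have "vanishes (\<lambda>i. X i * (U i - V i) + V i * (X i - Y i))"
    unfolding cr_rel_def by (intro vanishes_add vanishes_mult) auto
  then have "vanishes (\<lambda>i. X i * U i - Y i * V i)" by (simp add: algebra_simps)
  with * show "cr_rel (\<lambda>i. X i * U i) (\<lambda>i. Y i * V i)" by (auto simp: cr_rel_def intro: cauchy_mult)
qed

instance
proof
  fix a b c :: "('a, 'b) cr"
  note rls = cr_rel_eqI cauchy_add cauchy_mult cauchy_uminus cauchy_const
  show "a * b * c = a * (b * c)" by transfer (auto intro!: rls simp: cr_rel_cauchy algebra_simps)
  show "a * b = b * a" by transfer (auto intro!: rls simp: cr_rel_cauchy algebra_simps)
  show "1 * a = a" by transfer (auto intro!: rls simp: cr_rel_cauchy)
  show "(a + b) * c = a * c + b * c" by transfer (auto intro!: rls simp: cr_rel_cauchy algebra_simps)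
  show "a + b + c = a + (b + c)" by transfer (auto intro!: rls simp: cr_rel_cauchy algebra_simps)
  show "a + b = b + a" by transfer (auto intro!: rls simp: cr_rel_cauchy algebra_simps)
  show "0 + a = a" by transfer (auto intro!: rls simp: cr_rel_cauchy)
  show "- a + a = 0" by transfer (auto intro!: rls simp: cr_rel_cauchy)
  show "a - b = a + - b" by (simp add: minus_cr_def)
  show "(0 :: ('a, 'b) cr) \<noteq> 1"
    by transfer (auto simp: cr_rel_def vanishes_def trivial_limit_at_top_linorder
        eventually_const_iff intro!: exI[of _ 1])
qed

end

text \<open>Eventual separation from 0, unlike eventual positivity, is invariant under vanishing
  changes; so it can serve as the primitive notion of the order.\<close>

lift_definition cr_pos :: "('i::linorder, 'k::linordered_field) cr \<Rightarrow> bool"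
  is "\<lambda>X. \<exists>\<epsilon>>0. \<forall>\<^sub>F i in at_top. \<epsilon> < X i"
proof -
  have *: "\<exists>\<epsilon>>0. \<forall>\<^sub>F i in at_top. \<epsilon> < Y i" if r: "cr_rel X Y" and ex: "\<exists>\<epsilon>>0. \<forall>\<^sub>F i in at_top. \<epsilon> < X i" for X Y :: "'i \<Rightarrow> 'k"
  proof -
    obtain \<epsilon> where \<epsilon>: "0 < \<epsilon>" "\<forall>\<^sub>F i in at_top. \<epsilon> < X i" using ex by blast
    then have "\<forall>\<^sub>F i in at_top. \<bar>X i - Y i\<bar> < \<epsilon> / 2"
      using vanishesD[of "\<lambda>i. X i - Y i" "\<epsilon> / 2"] r half_gt_zero[OF \<epsilon>(1)] by (simp only: cr_rel_def)
    with \<epsilon>(2) have "\<forall>\<^sub>F i in at_top. \<epsilon> / 2 < Y i" by eventually_elim linarith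
    then show ?thesis using \<epsilon>(1) by (intro exI[of _ "\<epsilon> / 2"]) simp
  qed
  fix X Y :: "'i \<Rightarrow> 'k" assume "cr_rel X Y"
  moreover from this have "cr_rel Y X"
    by (auto simp: cr_rel_def vanishes_def abs_minus_commute)
  ultimately show "(\<exists>\<epsilon>>0. \<forall>\<^sub>F i in at_top. \<epsilon> < X i) = (\<exists>\<epsilon>>0. \<forall>\<^sub>F i in at_top. \<epsilon> < Y i)"
    using * by blast
qed

lemma cr_pos_add: "cr_pos x \<Longrightarrow> cr_pos y \<Longrightarrow> cr_pos (x + y)"
proof (transfer, clarify)
  fix X Y :: "'a \<Rightarrow> 'b" and \<epsilon> \<delta> :: 'b assume "0 < \<epsilon>" "0 < \<delta>"
    and "\<forall>\<^sub>F i in at_top. \<epsilon> < X i" "\<forall>\<^sub>F i in at_top. \<delta> < Y i"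
  from this(3,4) have "\<forall>\<^sub>F i in at_top. \<epsilon> + \<delta> < X i + Y i" by eventually_elim linarith
  then show "\<exists>\<epsilon>>0. \<forall>\<^sub>F i in at_top. \<epsilon> < X i + Y i"
    using \<open>0 < \<epsilon>\<close> \<open>0 < \<delta>\<close> by (intro exI[of _ "\<epsilon> + \<delta>"]) simp
qed

lemma cr_pos_mult: "cr_pos x \<Longrightarrow> cr_pos y \<Longrightarrow> cr_pos (x * y)"
proof (transfer, clarify)
  fix X Y :: "'a \<Rightarrow> 'b" and \<epsilon> \<delta> :: 'b assume *: "0 < \<epsilon>" "0 < \<delta>"
    and "\<forall>\<^sub>F i in at_top. \<epsilon> < X i" "\<forall>\<^sub>F i in at_top. \<delta> < Y i"
  from this(3,4) have "\<forall>\<^sub>F i in at_top. \<epsilon> * \<delta> < X i * Y i"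
    by eventually_elim (use * in \<open>auto intro!: mult_strict_mono\<close>)
  then show "\<exists>\<epsilon>>0. \<forall>\<^sub>F i in at_top. \<epsilon> < X i * Y i"
    using * by (intro exI[of _ "\<epsilon> * \<delta>"]) simp
qed

text \<open>If a net does not vanish, some \<open>\<epsilon>\<close> is not an eventual bound. A
  constant within \<open>\<epsilon> / 4\<close> of the net then has modulus at least
  \<open>\<epsilon> / 2\<close>, so the net stays beyond \<open>\<epsilon> / 4\<close> on the side
  given by its sign.\<close>

lemma cr_pos_cases: "cr_pos x \<or> x = 0 \<or> cr_pos (- x)"
proof (transfer, goal_cases)
  case (1 X)
  then have X: "cauchy X" by (simp add: cr_rel_cauchy)
  show ?case
  proof (cases "vanishes X")
    case False
    then obtain \<epsilon> where \<epsilon>: "0 < \<epsilon>" "\<not> (\<forall>\<^sub>F i in at_top. \<bar>X i\<bar> < \<epsilon>)" by (auto simp: vanishes_def)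
    obtain c where c: "\<forall>\<^sub>F i in at_top. \<bar>X i - c\<bar> < \<epsilon> / 4" using cauchyD[OF X, of "\<epsilon> / 4"] \<epsilon>(1) by auto
    have "\<not> \<bar>c\<bar> < \<epsilon> / 2"
    proof
      assume *: "\<bar>c\<bar> < \<epsilon> / 2"
      from c have "\<forall>\<^sub>F i in at_top. \<bar>X i\<bar> < \<epsilon>" by eventually_elim (use * in linarith)
      with \<epsilon>(2) show False ..
    qed
    then consider "c \<ge> \<epsilon> / 2" | "c \<le> - \<epsilon> / 2" by linarith
    then show ?thesis
    proof cases
      case 1
      from c have "\<forall>\<^sub>F i in at_top. \<epsilon> / 4 < X i" by eventually_elim (use 1 in linarith)
      then show ?thesis using \<epsilon>(1) by (intro disjI1 exI[of _ "\<epsilon> / 4"]) simp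
    next
      case 2
      from c have "\<forall>\<^sub>F i in at_top. \<epsilon> / 4 < - X i" by eventually_elim (use 2 in linarith)
      then show ?thesis using \<epsilon>(1) by (intro disjI2 exI[of _ "\<epsilon> / 4"]) simp
    qed
  qed (use X in \<open>simp add: cr_rel_def\<close>)
qed

lemma cr_pos_zero: "\<not> cr_pos 0"
  by transfer (auto simp: trivial_limit_at_top_linorder eventually_const_iff)

text \<open>An ordered domain supports linear arithmetic. Halving is done with the powers
  \<open>pw\<close> of the field of rationals, so division is never formed in the
  completion.\<close>

instantiation cr :: (linorder, linordered_field) linordered_idom
begin

definition less_cr :: "('a, 'b) cr \<Rightarrow> ('a, 'b) cr \<Rightarrow> bool" where "less_cr x y \<longleftrightarrow> cr_pos (y - x)"
definition less_eq_cr :: "('a, 'b) cr \<Rightarrow> ('a, 'b) cr \<Rightarrow> bool" where "less_eq_cr x y \<longleftrightarrow> x < y \<or> x = y"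
definition abs_cr :: "('a, 'b) cr \<Rightarrow> ('a, 'b) cr" where "abs_cr x = (if x < 0 then - x else x)"
definition sgn_cr :: "('a, 'b) cr \<Rightarrow> ('a, 'b) cr" where
  "sgn_cr x = (if x = 0 then 0 else if 0 < x then 1 else - 1)"

instance
proof
  fix a b c :: "('a, 'b) cr"
  have trans: "a < c" if "a < b" "b < c" for a b c :: "('a, 'b) cr"
    using cr_pos_add that unfolding less_cr_def by fastforce
  have irr: "\<not> a < a" for a :: "('a, 'b) cr" by (simp add: less_cr_def cr_pos_zero)
  show "\<bar>a\<bar> = (if a < 0 then - a else a)" by (rule abs_cr_def)
  show "a < b \<longleftrightarrow> a \<le> b \<and> \<not> b \<le> a" unfolding less_eq_cr_def by (metis trans irr)
  show "a \<le> a" by (simp add: less_eq_cr_def)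
  show "a \<le> c" if "a \<le> b" "b \<le> c" using that unfolding less_eq_cr_def by (metis trans)
  show "a = b" if "a \<le> b" "b \<le> a" using that unfolding less_eq_cr_def by (metis trans irr)
  show "a \<le> b \<or> b \<le> a" using cr_pos_cases[of "b - a"] by (auto simp: less_eq_cr_def less_cr_def)
  show "c + a \<le> c + b" if "a \<le> b" using that by (auto simp: less_eq_cr_def less_cr_def)
  show "sgn a = (if a = 0 then 0 else if 0 < a then 1 else - 1)" by (rule sgn_cr_def)
  show "c * a < c * b" if "a < b" "0 < c"
    using that cr_pos_mult[of c "b - a"] by (simp add: less_cr_def right_diff_distrib)
qed

end

lift_definition cK :: "'k::linordered_field \<Rightarrow> ('i::linorder, 'k) cr" is "\<lambda>c i. c"
  by (simp add: cr_rel_cauchy)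

definition net :: "('i::linorder \<Rightarrow> 'k::linordered_field) \<Rightarrow> ('i, 'k) cr" where
  "net X = Abs_cr X"

lemma cK_hom [simp]: "cK 0 = 0" "cK 1 = 1" "cK (a + b) = cK a + cK b" "cK (- a) = - cK a"
  by (transfer, simp add: cr_rel_cauchy)+

lemma cK_diff [simp]: "cK (a - b) = cK a - cK b"
  using cK_hom(3)[of a "- b"] by simp

lemma cK_less [simp]: "cK a < (cK b :: ('b::linorder, 'a::linordered_field) cr) \<longleftrightarrow> a < b"
proof -
  have "cr_pos (cK c :: ('b, 'a) cr) \<longleftrightarrow> 0 < c" for c
    by transfer (auto simp: trivial_limit_at_top_linorder eventually_const_iff intro: dense)
  then show ?thesis unfolding less_cr_def by (metis cK_diff diff_gt_0_iff_gt)
qed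

lemma cK_le [simp]: "cK a \<le> cK b \<longleftrightarrow> a \<le> b"
  by (simp flip: not_less)

lemma cK_abs: "\<bar>cK a\<bar> = cK \<bar>a\<bar>"
proof -
  have "cK a < (0 :: ('a, 'b) cr) \<longleftrightarrow> a < 0" using cK_less[of a 0] by (simp del: cK_less)
  then show ?thesis by (simp add: abs_if)
qed

lemma cK_net: "cK c = net (\<lambda>_. c)"
  by (simp add: net_def cK_def)

lemma net_add: "cauchy X \<Longrightarrow> cauchy Y \<Longrightarrow> net X + net Y = net (\<lambda>i. X i + Y i)"
  by (simp add: net_def plus_cr.abs_eq cr_rel_cauchy)

lemma net_uminus: "cauchy X \<Longrightarrow> - net X = net (\<lambda>i. - X i)"
  by (simp add: net_def uminus_cr.abs_eq cr_rel_cauchy)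

lemma net_diff: "cauchy X \<Longrightarrow> cauchy Y \<Longrightarrow> net X - net Y = net (\<lambda>i. X i - Y i)"
  using net_add[of X "\<lambda>i. - Y i"] by (simp add: net_uminus[symmetric] cauchy_uminus)

lemma net_less:
  assumes "cauchy X" "cauchy Y"
  shows "net X < net Y \<longleftrightarrow> (\<exists>\<epsilon>>0. \<forall>\<^sub>F i in at_top. X i + \<epsilon> < Y i)"
proof -
  have "cauchy (\<lambda>i. Y i - X i)" using cauchy_add[OF assms(2) cauchy_uminus[OF assms(1)]] by simp
  then show ?thesis
    unfolding less_cr_def net_diff[OF assms(2,1)] unfolding net_def
    by (simp add: cr_pos.abs_eq cr_rel_cauchy algebra_simps)
qed

lemma net_le:
  assumes "cauchy X" "cauchy Y" "\<forall>\<^sub>F i in at_top. X i \<le> Y i"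
  shows "net X \<le> net Y"
proof (rule ccontr)
  assume "\<not> ?thesis"
  then obtain \<epsilon> where "0 < \<epsilon>" "\<forall>\<^sub>F i in at_top. Y i + \<epsilon> < X i"
    using net_less[OF assms(2,1)] by (auto simp: not_le)
  from this(2) assms(3) have "\<forall>\<^sub>F i :: 'a in at_top. False"
    by eventually_elim (use \<open>0 < \<epsilon>\<close> in linarith)
  then show False by (simp add: eventually_False trivial_limit_at_top_linorder)
qed

lemma cr_dense: assumes "0 < x" obtains \<epsilon> where "0 < \<epsilon>" "cK \<epsilon> < x"
proof -
  have "\<exists>\<epsilon>>0. cK \<epsilon> < x" if pos: "cr_pos x" for x :: "('a, 'b) cr"
  proof -
    obtain X where X: "x = net X" "cauchy X"
      using Quotient3_abs_rep[OF Quotient3_cr, of x] Quotient3_rep_reflp[OF Quotient3_cr, of x]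
      by (auto simp: net_def cr_rel_cauchy) metis
    then obtain \<epsilon> where \<epsilon>: "0 < \<epsilon>" "\<forall>\<^sub>F i in at_top. \<epsilon> < X i"
      using pos by (auto simp: net_def cr_pos.abs_eq cr_rel_cauchy)
    have "\<forall>\<^sub>F i in at_top. \<epsilon> / 2 + \<epsilon> / 2 < X i" using \<epsilon>(2) by simp
    then have "cK (\<epsilon> / 2) < x" using \<epsilon>(1) X unfolding cK_net X(1)
      by (subst net_less) (auto intro!: exI[of _ "\<epsilon> / 2"])
    then show ?thesis using half_gt_zero[OF \<epsilon>(1)] by blast
  qed
  then show ?thesis using assms that by (auto simp: less_cr_def)
qed

lemma cr_approx:
  fixes x :: "('a::linorder, 'b::linordered_field) cr"
  assumes "0 < \<epsilon>" obtains c where "\<bar>x - cK c\<bar> < cK \<epsilon>"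
proof -
  obtain X where X: "x = net X" "cauchy X"
    using Quotient3_abs_rep[OF Quotient3_cr, of x] Quotient3_rep_reflp[OF Quotient3_cr, of x]
    by (auto simp: net_def cr_rel_cauchy) metis
  obtain c where c: "\<forall>\<^sub>F i in at_top. \<bar>X i - c\<bar> < \<epsilon> / 2"
    using cauchyD[OF X(2), of "\<epsilon> / 2"] assms half_gt_zero by blast
  from c have "\<forall>\<^sub>F i in at_top. X i \<le> c + \<epsilon> / 2" "\<forall>\<^sub>F i in at_top. c - \<epsilon> / 2 \<le> X i"
    by (eventually_elim, linarith)+
  then have "net X \<le> net (\<lambda>_. c + \<epsilon> / 2)" "net (\<lambda>_. c - \<epsilon> / 2) \<le> net X"
    using X(2) by (simp_all add: net_le)
  moreover have "cK (\<epsilon> / 2) < (cK \<epsilon> :: ('a, 'b) cr)" using assms by simp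
  ultimately have "\<bar>x - cK c\<bar> < cK \<epsilon>"
    unfolding X(1) cK_net[symmetric] cK_diff cK_hom by (simp only: abs_less_iff) linarith
  then show ?thesis using that by blast
qed

section \<open>Rationals as signed quotients of numbers\<close>

lift_definition zn :: "'n::linordered_semidom \<Rightarrow> 'n zz" is "\<lambda>a. (a, 0)" .

lemma zn_hom: "zn 0 = 0" "zn 1 = 1" "zn (a + b) = zn a + zn b" "zn (a * b) = zn a * zn b"
  by (transfer, simp add: zz_rel_def)+

lemma zn_le: "zn a \<le> zn b \<longleftrightarrow> a \<le> b"
  by transfer simp

lemma zz_cases: obtains a b where "z = zn a - zn b"
proof -
  have "\<exists>a b. z = Abs_zz (a, b)" by (induction z rule: zz.abs_induct) (metis surj_pair)
  then obtain a b where "z = Abs_zz (a, b)" by blast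
  then have "z = zn a - zn b"
    by (simp add: zn.abs_eq minus_zz_def uminus_zz.abs_eq plus_zz.abs_eq)
  then show ?thesis by (rule that)
qed

type_synonym 'n kk = "'n zz fract"
type_synonym 'n rr = "('n, 'n zz fract) cr"

definition kn :: "'n::linordered_semidom \<Rightarrow> 'n kk" where "kn a = Fract (zn a) 1"

lemma kn_hom: "kn 0 = 0" "kn 1 = 1" "kn (a + b) = kn a + kn b" "kn (a * b) = kn a * kn b"
  by (simp_all add: kn_def zn_hom Zero_fract_def One_fract_def)

lemma kn_le [simp]: "kn a \<le> kn b \<longleftrightarrow> a \<le> b"
  by (simp add: kn_def zn_le)

lemma kn_less [simp]: "kn a < kn b \<longleftrightarrow> a < b"
  by (simp flip: not_le)

lemma kn_pos [simp]: "0 < kn a \<longleftrightarrow> 0 < a"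
  using kn_less[of 0 a] by (simp only: kn_hom)

lemma kn_nonzero: "0 < a \<Longrightarrow> kn a \<noteq> 0"
  using kn_pos[of a] by (metis less_irrefl)

definition frac :: "'n::linordered_semidom \<Rightarrow> 'n \<Rightarrow> 'n \<Rightarrow> 'n kk" where
  "frac p m d = (kn p - kn m) / kn d"

lemma frac_less:
  "0 < d \<Longrightarrow> 0 < d' \<Longrightarrow> frac p m d < frac p' m' d' \<longleftrightarrow> p * d' + m' * d < p' * d + m * d'"
proof -
  assume d: "0 < d" "0 < d'"
  have "frac p m d < frac p' m' d' \<longleftrightarrow> (kn p - kn m) * kn d' < (kn p' - kn m') * kn d"
    using d by (simp add: frac_def divide_less_eq less_divide_eq mult.commute)
  also have "\<dots> \<longleftrightarrow> kn p * kn d' + kn m' * kn d < kn p' * kn d + kn m * kn d'"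
    by (auto simp: algebra_simps)
  also have "\<dots> \<longleftrightarrow> p * d' + m' * d < p' * d + m * d'"
    by (simp flip: kn_hom)
  finally show ?thesis .
qed

lemma frac_le:
  "0 < d \<Longrightarrow> 0 < d' \<Longrightarrow> frac p m d \<le> frac p' m' d' \<longleftrightarrow> p * d' + m' * d \<le> p' * d + m * d'"
  using frac_less[of d' d p' m' p m] by (simp add: add.commute flip: not_less)

lemma frac_add: "0 < d \<Longrightarrow> 0 < d' \<Longrightarrow>
    frac p m d + frac p' m' d' = frac (p * d' + p' * d) (m * d' + m' * d) (d * d')"
proof -
  assume "0 < d" "0 < d'"
  then have "kn d \<noteq> 0" "kn d' \<noteq> 0" by (simp_all add: kn_nonzero)
  then show ?thesis by (simp add: frac_def kn_hom field_simps)
qed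

lemma frac_minus: "- frac p m d = frac m p d"
  by (simp add: frac_def minus_divide_left)

lemma frac_cases: obtains p m d where "0 < d" "q = frac p m d"
proof -
  obtain a b where q: "q = Fract a b" "0 < b" by (cases q rule: Fract_cases) (metis linorder_neqE minus_fract_cancel neg_0_less_iff_less)
  obtain p m where a: "a = zn p - zn m" by (rule zz_cases)
  obtain u v where b: "b = zn u - zn v" by (rule zz_cases)
  have "v < u" using q(2) zn_le[of u v] by (simp add: b flip: not_le)
  then have u: "u = v + (u - v)" using le_add_diff_inverse[of v u] by simp
  then have b': "b = zn (u - v)" using zn_hom(3)[of v "u - v"] by (simp add: b)
  have "0 < u - v" using q(2) zn_le[of "u - v" 0] by (simp add: b' zn_hom flip: not_le)
  moreover have "q = frac p m (u - v)"
    unfolding q(1) b'[symmetric] using q(2)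
    by (simp add: frac_def kn_def a b' )
  ultimately show ?thesis by (rule that)
qed

context aca_num
begin

sublocale full: aca_def D ap cn ls num "D T1"
  by unfold_locales (use D_nonempty in auto)

definition pr :: "'n \<Rightarrow> 'n \<Rightarrow> 'n" where "pr i j = (i + j) * (i + j) + i"

text \<open>With \<open>s = i + j\<close>, the code is at least the square of \<open>s\<close> and
  less than that of \<open>s + 1\<close>, so it determines \<open>s\<close>, and then
  \<open>i\<close>.\<close>

lemma pr_inject [simp]: "pr i j = pr i' j' \<longleftrightarrow> i = i' \<and> j = j'"
proof -
  have less: "pr i j < pr i' j'" if "i + j < i' + j'" for i j i' j'
  proof -
    let ?s = "i + j" and ?t = "i' + j'"
    have st: "?s + 1 \<le> ?t" using that less_Suc_iff[of "?t" "?s"] by (simp flip: not_le)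
    have "i \<le> ?s" by simp
    then have "pr i j \<le> ?s * ?s + ?s" by (simp add: pr_def)
    also have "\<dots> < (?s + 1) * (?s + 1)"
    proof -
      have "?s * ?s + ?s + 0 < ?s * ?s + ?s + (?s + 1)"
        by (rule add_strict_left_mono) (simp add: add_nonneg_pos)
      then show ?thesis by (simp add: algebra_simps)
    qed
    also have "\<dots> \<le> ?t * ?t" using st by (intro mult_mono) auto
    also have "\<dots> \<le> pr i' j'" by (simp add: pr_def)
    finally show ?thesis .
  qed
  have "i = i' \<and> j = j'" if eq: "pr i j = pr i' j'"
  proof -
    have "i + j = i' + j'" using less[of i j i' j'] less[of i' j' i j] eq by (metis linorder_neqE less_irrefl)
    then show ?thesis using eq by (auto simp: pr_def)
  qed
  then show ?thesis by auto
qed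

definition vc :: "'n \<Rightarrow> bool" where "vc c \<longleftrightarrow> (\<exists>p m d. 0 < d \<and> c = pr (pr p m) d)"

text \<open>With the default 0 for invalid codes every number denotes a rational, and quantifiers
  over rationals become plain number quantifiers.\<close>

definition qv :: "'n \<Rightarrow> 'n kk" where
  "qv c = (if vc c then THE q. \<exists>p m d. 0 < d \<and> c = pr (pr p m) d \<and> q = frac p m d else 0)"

lemma qv_pr [simp]: "0 < d \<Longrightarrow> qv (pr (pr p m) d) = frac p m d"
  by (auto simp: qv_def vc_def)

lemma qv_surj: obtains c where "vc c" "qv c = q"
proof -
  obtain p m d where "0 < d" "q = frac p m d" by (rule frac_cases)
  then show ?thesis using that[of "pr (pr p m) d"] by (auto simp: vc_def)
qed

lemma qv_invalid: "\<not> vc c \<Longrightarrow> qv c = 0"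
  by (simp add: qv_def)

text \<open>A graph of \<open>qv\<close> in terms of numerators and denominators, including the
  default: it makes comparisons of coded rationals polynomial relations between numbers.\<close>

definition gr :: "'n \<Rightarrow> 'n \<Rightarrow> 'n \<Rightarrow> 'n \<Rightarrow> bool" where
  "gr c p m d \<longleftrightarrow> 0 < d \<and> c = pr (pr p m) d \<or> \<not> vc c \<and> p = 0 \<and> m = 0 \<and> d = 1"

lemma gr_frac: "gr c p m d \<Longrightarrow> 0 < d \<and> qv c = frac p m d"
  by (auto simp: gr_def qv_invalid) (simp add: frac_def kn_hom)

lemma gr_ex: "\<exists>p m d. gr c p m d"
proof (cases "vc c")
  case True
  then show ?thesis by (auto simp: gr_def vc_def)
qed (auto simp: gr_def)

text \<open>Doubling, as \<open>S Plus (S K K)\<close>; \<open>tpU\<close> is the value of the term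
  that \<open>two_pow\<close> applies to an exponent.\<close>

abbreviation "dbl \<equiv> S Num Num Num \<bullet> cn Plus \<bullet> (S Num T1 Num \<bullet> K Num T1 \<bullet> K Num Num)"
abbreviation "tpU \<equiv> R \<bullet> (K T1 Num \<bullet> dbl) \<bullet> one"

definition tp :: "'n \<Rightarrow> 'n" where "tp = fn tpU"

lemma tpU_typed [simp]: "tpU \<in> D T1"
  by (meson ap_dom cn_typed)

lemma tp_0 [simp]: "tp 0 = 1" and tp_Suc: "tp (n + 1) = tp n + tp n"
proof -
  let ?I = "S Num T1 Num \<bullet> K Num T1 \<bullet> K Num Num"
  have I: "?I \<in> D T1" by (meson ap_dom cn_typed)
  have dbl: "dbl \<in> D T1" using I by (meson ap_dom cn_typed)
  have Kd: "K T1 Num \<bullet> dbl \<in> D (Num \<rightarrow> T1)" using dbl by (meson ap_dom cn_typed)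
  have KN: "K Num Num \<bullet> num a \<in> D T1" for a by (meson ap_dom cn_typed num_typed)
  have Ia: "?I \<bullet> num a = num a" for a
    using S_eq[OF cn_typed(5) cn_typed(5) num_typed] K_eq[OF num_typed KN] by simp
  have "dbl \<bullet> num a = num (a + a)" for a
    using S_eq[OF cn_typed(3) I num_typed[of a]] by (simp add: Ia num_pl)
  moreover have "tpU \<bullet> num (n + 1) = K T1 Num \<bullet> dbl \<bullet> num n \<bullet> (tpU \<bullet> num n)"
    using R_Suc[OF Kd cn_typed(2) num_typed[of n]] by (simp add: num_pl num_one)
  ultimately show "tp (n + 1) = tp n + tp n"
    using K_eq[OF dbl num_typed[of n]] ap_num[OF tpU_typed, of n] by (simp add: tp_def fn_def[of _ "n + 1"])
  show "tp 0 = 1" using R_0[OF Kd cn_typed(2)] by (simp add: tp_def fn_def flip: num_zero num_one)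
qed

lemma tp_gt: "n < tp n"
proof (rule full.induct_n[where P = "\<lambda>n. n < tp n"])
  show "full.dP (\<lambda>x e. e 0 < tp (e 0))"
    unfolding tp_def by (intro full.dP_less full.dN_var full.dN_fun tpU_typed)
  show "n + 1 < tp (n + 1)" if "n < tp n" for n
  proof -
    have "n + 1 \<le> tp n" using that less_Suc_iff[of "tp n" n] by (simp flip: not_le)
    moreover have "tp n + 0 < tp n + tp n"
      using le_less_trans[OF nonneg_n that] by (rule add_strict_left_mono)
    ultimately show ?thesis unfolding tp_Suc by (metis add.right_neutral le_less_trans)
  qed
qed simp

lemma tp_pos [simp]: "0 < tp n"
  using tp_gt[of n] nonneg_n[of n] by (rule le_less_trans[rotated])

definition pw :: "'n \<Rightarrow> 'n kk" where "pw n = frac 1 0 (tp n)"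

lemma pw_eq: "pw n = 1 / kn (tp n)"
  by (simp add: pw_def frac_def kn_hom)

lemma pw_pos [simp]: "0 < pw n"
  by (simp add: pw_eq)

lemma pw_Suc: "pw (n + 1) + pw (n + 1) = pw n"
proof -
  have "kn (tp n) \<noteq> 0" by (simp add: kn_nonzero)
  then show ?thesis unfolding pw_eq tp_Suc kn_hom by (simp add: field_simps)
qed

lemma pw_0 [simp]: "pw 0 = 1"
  by (simp add: pw_eq kn_hom)

lemma tp_mono: "m \<le> n \<Longrightarrow> tp m \<le> tp n"
proof -
  have "tp m \<le> tp (m + i)" for i
  proof (rule full.induct_n[where P = "\<lambda>i. tp m \<le> tp (m + i)"])
    show "full.dP (\<lambda>x e. tp m \<le> tp (m + e 0))"
      unfolding tp_def by (intro full.dP_le full.dN_var full.dN_fun full.dN_plus full.dN_const tpU_typed)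
    show "tp m \<le> tp (m + (i + 1))" if "tp m \<le> tp (m + i)" for i
      using that tp_Suc[of "m + i"] by (simp add: add.assoc add_increasing2)
  qed simp
  then show "m \<le> n \<Longrightarrow> tp m \<le> tp n" by (metis le_add_diff_inverse)
qed

lemma pw_mono: "m \<le> n \<Longrightarrow> pw n \<le> pw m"
  by (simp add: pw_eq frac_le tp_mono divide_left_mono)

text \<open>A denominator is at least 1, so \<open>p\<close> bounds \<open>(p - m) / d\<close>.
  Together with \<open>tp_gt\<close> this gives the Archimedean property relative to the numbers of
  the model.\<close>

lemma kn_ge: obtains n where "(q :: 'n kk) \<le> kn n"
proof -
  obtain p m d where d: "0 < d" "q = frac p m d" by (rule frac_cases)
  have "1 \<le> d" using less_Suc_iff[of d 0] d(1) by (simp flip: not_le)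
  then have "p * 1 \<le> p * d" by (intro mult_left_mono) auto
  have "frac p m d \<le> frac p 0 1" using d(1) \<open>p * 1 \<le> p * d\<close> by (simp add: frac_le add_increasing2)
  then show ?thesis using d(2) that[of p] by (simp add: frac_def kn_hom)
qed

lemma pw_arch: assumes "0 < q" obtains n where "pw n < q"
proof -
  obtain n where n: "1 / q \<le> kn n" by (rule kn_ge)
  have "kn n < kn (tp n)" by (simp add: tp_gt)
  with n have "1 / q < kn (tp n)" by (rule le_less_trans)
  then have "pw n < q" using assms by (simp add: pw_eq field_simps)
  then show ?thesis by (rule that)
qed

lemma pw_arch_R: assumes "(0 :: 'n rr) < x" obtains n where "cK (pw n) < x"
proof -
  obtain \<epsilon> where e: "0 < \<epsilon>" "cK \<epsilon> < x" using cr_dense[OF assms] .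
  obtain n where "pw n < \<epsilon>" using pw_arch[OF e(1)] .
  then have "cK (pw n) < (cK \<epsilon> :: 'n rr)" by simp
  then show ?thesis using e(2) that[of n] by (meson less_trans)
qed

lemma le_pw_R: "(\<And>n. x \<le> y + cK (pw n)) \<Longrightarrow> x \<le> (y :: 'n rr)"
proof (rule ccontr)
  assume *: "\<And>n. x \<le> y + cK (pw n)" and "\<not> x \<le> y"
  then have "0 < x - y" by simp
  then obtain n where "cK (pw n) < x - y" by (rule pw_arch_R)
  with *[of n] show False by simp
qed

lemma pw_Suc_R: "cK (pw (n + 1)) + cK (pw (n + 1)) = (cK (pw n) :: 'n rr)"
  unfolding cK_hom(3)[symmetric] pw_Suc ..

lemma ex_between: assumes "x < (y :: 'n rr)" obtains c where "vc c" "x < cK (qv c)" "cK (qv c) < y"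
proof -
  have "0 < y - x" using assms by simp
  then obtain n where n: "cK (pw n) < y - x" by (rule pw_arch_R)
  \<comment> \<open>The target is the point \<open>x + 2^-(n+1)\<close>: an error below
    \<open>2^-(n+1)\<close> keeps \<open>q\<close> strictly above \<open>x\<close> and below
    \<open>x + 2^-n\<close>, which is less than \<open>y\<close>.\<close>
  obtain q where q: "\<bar>(x + cK (pw (n + 1))) - cK q\<bar> < cK (pw (n + 1))"
    using cr_approx[OF pw_pos] .
  obtain c where "vc c" "qv c = q" by (rule qv_surj)
  moreover have "x < cK q" "cK q < y" using q n pw_Suc_R[of n] by linarith+
  ultimately show ?thesis using that by blast
qed

lemma ex_below: obtains c where "cK (qv c) < (x :: 'n rr)"
  using ex_between[of "x - 1" x] by auto

lemma ex_above: obtains c where "(x :: 'n rr) < cK (qv c)"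
  using ex_between[of x "x + 1"] by auto

text \<open>The inequality is weak because limits preserve only weak bounds: the strict condition of
  \<open>is_real\<close> gives just this much for the limit.\<close>

definition approx :: "('n \<Rightarrow> 'n kk) \<Rightarrow> 'n rr \<Rightarrow> bool" where
  "approx X r \<longleftrightarrow> (\<forall>n. \<bar>r - cK (X n)\<bar> \<le> cK (pw n))"

lemma approxD: "approx X r \<Longrightarrow> \<bar>r - cK (X n)\<bar> \<le> cK (pw n)"
  by (simp add: approx_def)

text \<open>The slack \<open>2 * pw k\<close> is the sum of the two approximation errors.
  Conversely, slack and errors at index \<open>n + 2\<close> add up to \<open>pw n\<close>, and
  \<open>n\<close> is arbitrary. This justifies the formula \<open>rle\<close>.\<close>

lemma approx_le:
  assumes "approx X r" "approx Y s"
  shows "(\<forall>k. X k \<le> Y k + 2 * pw k) \<longleftrightarrow> r \<le> s"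
proof -
  have iff: "X k \<le> Y k + 2 * pw k \<longleftrightarrow> cK (X k) \<le> cK (Y k) + (cK (pw k) + cK (pw k) :: 'n rr)" for k
    unfolding mult_2 cK_hom(3)[symmetric] cK_le ..
  show ?thesis
  proof
    assume *: "\<forall>k. X k \<le> Y k + 2 * pw k"
    show "r \<le> s"
    proof (rule le_pw_R)
      fix n
      have "cK (X (n + 1 + 1)) \<le> cK (Y (n + 1 + 1)) + (cK (pw (n + 1 + 1)) + cK (pw (n + 1 + 1)) :: 'n rr)"
        using * iff by blast
      then show "r \<le> s + cK (pw n)"
        using approxD[OF assms(1), of "n + 1 + 1"] approxD[OF assms(2), of "n + 1 + 1"]
          pw_Suc_R[of n] pw_Suc_R[of "n + 1"] by linarith
    qed
  next
    assume "r \<le> s"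
    show "\<forall>k. X k \<le> Y k + 2 * pw k"
      unfolding iff
    proof
      fix k
      show "cK (X k) \<le> cK (Y k) + (cK (pw k) + cK (pw k) :: 'n rr)"
        using \<open>r \<le> s\<close> approxD[OF assms(1), of k] approxD[OF assms(2), of k] by linarith
    qed
  qed
qed

lemma approx_eq:
  assumes "approx X r" "approx Y s"
  shows "(\<forall>k. X k - Y k \<le> 2 * pw k \<and> Y k - X k \<le> 2 * pw k) \<longleftrightarrow> r = s"
  using approx_le[OF assms] approx_le[OF assms(2,1)] by (auto simp: algebra_simps order_eq_iff)

lemma approx_const: "approx (\<lambda>_. q) (cK q)"
  by (simp add: approx_def less_imp_le flip: cK_hom(1))

lemma approx_abs: "approx X r \<Longrightarrow> approx (\<lambda>k. \<bar>X k\<bar>) \<bar>r\<bar>"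
  unfolding approx_def cK_abs[symmetric] by (meson abs_triangle_ineq3 order_trans)

lemma approx_diff: "approx X r \<Longrightarrow> approx Y s \<Longrightarrow> approx (\<lambda>k. X (k + 1) - Y (k + 1)) (r - s)"
proof -
  assume a: "approx X r" "approx Y s"
  show ?thesis unfolding approx_def cK_diff
  proof
    fix n
    show "\<bar>r - s - (cK (X (n + 1)) - cK (Y (n + 1)))\<bar> \<le> cK (pw n)"
      using approxD[OF a(1), of "n + 1"] approxD[OF a(2), of "n + 1"] pw_Suc_R[of n] by linarith
  qed
qed

definition isr :: "('n \<Rightarrow> 'n) \<Rightarrow> bool" where
  "isr x \<longleftrightarrow> (\<forall>n i. vc (x n) \<and> vc (x (n + i)) \<and> \<bar>qv (x n) - qv (x (n + i))\<bar> < pw n)"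

definition val :: "('n \<Rightarrow> 'n) \<Rightarrow> 'n rr" where "val x = net (\<lambda>n. qv (x n))"

lemma fast_net:
  assumes "\<And>n i. \<bar>X n - X (n + i)\<bar> \<le> pw n"
  shows "cauchy X" "approx X (net X)"
proof -
  have *: "\<forall>\<^sub>F i in at_top. \<bar>X n - X i\<bar> \<le> pw n" for n
    unfolding eventually_at_top_linorder using assms by (metis le_add_diff_inverse)
  show c: "cauchy X"
    unfolding cauchy_def
  proof (intro allI impI)
    fix \<epsilon> :: "'n kk" assume "0 < \<epsilon>"
    then obtain n where n: "pw n < \<epsilon>" by (rule pw_arch)
    have "\<forall>\<^sub>F i in at_top. \<bar>X i - X n\<bar> < \<epsilon>"
      using *[of n] by eventually_elim (use n in \<open>simp add: abs_minus_commute\<close>)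
    then show "\<exists>c. \<forall>\<^sub>F i in at_top. \<bar>X i - c\<bar> < \<epsilon>" by blast
  qed
  show "approx X (net X)"
    unfolding approx_def
  proof
    fix n
    have "\<forall>\<^sub>F i in at_top. X i \<le> X n + pw n" using *[of n] by eventually_elim (simp add: abs_le_iff algebra_simps)
    then have 1: "net X \<le> net (\<lambda>_. X n + pw n)" using c by (intro net_le) auto
    have "\<forall>\<^sub>F i in at_top. X n - pw n \<le> X i" using *[of n] by eventually_elim (simp add: abs_le_iff algebra_simps)
    then have 2: "net (\<lambda>_. X n - pw n) \<le> net X" using c by (intro net_le) auto
    show "\<bar>net X - cK (X n)\<bar> \<le> cK (pw n)"
      using 1 2 unfolding cK_net[symmetric] cK_diff cK_hom by linarith
  qed
qed

lemma isr_approx: "isr x \<Longrightarrow> approx (\<lambda>n. qv (x n)) (val x)"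
  unfolding val_def by (rule fast_net(2)) (auto simp: isr_def less_imp_le)

end

section \<open>Definable reals\<close>

context aca_num
begin

definition MR :: "'n rr \<Rightarrow> bool" where "MR r \<longleftrightarrow> (\<exists>u\<in>D T1. isr (fn u) \<and> val (fn u) = r)"

abbreviation "q0 \<equiv> pr (pr 0 0) 1"

text \<open>A canonical fast sequence: the least code of a rational that is close enough. It depends
  on the real alone and not on a representative, so functions given by it respect equality of reals.
  The extra precision leaves room for the difference of two members.\<close>

definition code :: "'n rr \<Rightarrow> 'n \<Rightarrow> 'n" where
  "code r k = full.mu (\<lambda>c. vc c \<and> \<bar>cK (qv c) - r\<bar> < cK (pw (k + 1 + 1)))"

lemma cK_pw_pos [simp]: "0 < (cK (pw n) :: 'n rr)"
proof -
  have "(cK 0 :: 'n rr) < cK (pw n)" by (simp only: cK_less pw_pos)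
  then show ?thesis by (simp only: cK_hom)
qed

lemma psh_num [simp]: "psh m e 1 = e 0" "psh m e 2 = e 1" "psh m e 3 = e 2" "psh m e 4 = e 3"
  using psh_Suc[of m e 0] psh_Suc[of m e 1] psh_Suc[of m e 2] psh_Suc[of m e 3] by simp_all

end

section \<open>Definable operations on rationals and reals\<close>

context aca_def
begin

lemma dP_sub1: assumes "dP (\<lambda>x e. P x (e 0))" "dN s" shows "dP (\<lambda>x e. P x (s x e))"
  using dP_sub[OF assms(1) dC_psh[OF assms(2) dC_id]] by simp

lemma dP_sub3:
  assumes "dP (\<lambda>x e. P x (e 0) (e 1) (e 2))" "dN s" "dN t" "dN u"
  shows "dP (\<lambda>x e. P x (s x e) (t x e) (u x e))"
  using dP_sub[OF assms(1) dC_psh[OF assms(2) dC_psh[OF assms(3) dC_psh[OF assms(4) dC_id]]]] by simp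

lemma dP_sub5:
  assumes "dP (\<lambda>x e. P x (e 0) (e 1) (e 2) (e 3) (e 4))" "dN s" "dN t" "dN u" "dN v" "dN w"
  shows "dP (\<lambda>x e. P x (s x e) (t x e) (u x e) (v x e) (w x e))"
  using dP_sub[OF assms(1) dC_psh[OF assms(2) dC_psh[OF assms(3) dC_psh[OF assms(4)
    dC_psh[OF assms(5) dC_psh[OF assms(6) dC_id]]]]]] by simp

lemma dN_sub2:
  assumes "dN (\<lambda>x e. g x (e 0) (e 1))" "dN s" "dN t"
  shows "dN (\<lambda>x e. g x (s x e) (t x e))"
  using dN_sub[OF assms(1) dC_psh[OF assms(2) dC_psh[OF assms(3) dC_id]]] by simp

lemma dN_pr: "dN s \<Longrightarrow> dN t \<Longrightarrow> dN (\<lambda>x e. pr (s x e) (t x e))"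
  unfolding pr_def by (intro dN_plus dN_times)

lemma dP_vc: "dN s \<Longrightarrow> dP (\<lambda>x e. vc (s x e))"
proof (rule dP_sub1)
  show "dP (\<lambda>x e. vc (e 0))"
    unfolding vc_def by (intro dP_ex dP_conj dP_less dP_eq dN_pr dN_var dN_const)
qed

lemma dP_gr: "dN c \<Longrightarrow> dN p \<Longrightarrow> dN m \<Longrightarrow> dN d \<Longrightarrow> dP (\<lambda>x e. gr (c x e) (p x e) (m x e) (d x e))"
  unfolding gr_def by (intro dP_disj dP_conj dP_less dP_eq dP_not dP_vc dN_pr dN_const)

text \<open>The definable relations between rationals are reduced to this one: the order takes
  \<open>q0\<close> as a summand, and other inequalities are brought into this form by moving terms
  across. Through the graph \<open>gr\<close> it becomes an inequality between polynomials.\<close>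

lemma dP_qsum: "dN s \<Longrightarrow> dN t \<Longrightarrow> dN u \<Longrightarrow> dP (\<lambda>x e. qv (s x e) < qv (t x e) + qv (u x e))"
proof (rule dP_sub3)
  have iff: "qv c < qv a + qv b \<longleftrightarrow>
      (\<exists>p m d p' m' d' p'' m'' d''. gr c p m d \<and> gr a p' m' d' \<and> gr b p'' m'' d'' \<and>
        p * (d' * d'') + (m' * d'' + m'' * d') * d < (p' * d'' + p'' * d') * d + m * (d' * d''))"
    (is "_ \<longleftrightarrow> ?R") for a b c
  proof -
    have less: "qv c < qv a + qv b \<longleftrightarrow>
        p * (d' * d'') + (m' * d'' + m'' * d') * d < (p' * d'' + p'' * d') * d + m * (d' * d'')"
      if "gr c p m d" "gr a p' m' d'" "gr b p'' m'' d''" for p m d p' m' d' p'' m'' d''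
      using gr_frac[OF that(1)] gr_frac[OF that(2)] gr_frac[OF that(3)]
      by (simp add: frac_add frac_less)
    show ?thesis
    proof
      assume "qv c < qv a + qv b"
      then show ?R using gr_ex[of a] gr_ex[of b] gr_ex[of c] less by metis
    next
      assume ?R
      then show "qv c < qv a + qv b" using less by metis
    qed
  qed
  show "dP (\<lambda>x e. qv (e 0) < qv (e 1) + qv (e 2))"
    unfolding iff by (intro dP_ex dP_conj dP_gr dP_less dN_plus dN_times dN_var)
qed

lemma qv_q0 [simp]: "qv q0 = 0"
  by (simp add: frac_def)

lemma dP_qless: "dN s \<Longrightarrow> dN t \<Longrightarrow> dP (\<lambda>x e. qv (s x e) < qv (t x e))"
  using dP_qsum[OF _ _ dN_const[of q0]] by simp

text \<open>A real-valued function is definable if its lower cut is.\<close>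

definition dR :: "('u \<Rightarrow> ('n \<Rightarrow> 'n) \<Rightarrow> 'n rr) \<Rightarrow> bool" where
  "dR G \<longleftrightarrow> dP (\<lambda>x e. cK (qv (e 0)) < G x (\<lambda>i. e (i + 1)))"

lemma dR_at:
  assumes "dR G" "dN s" "dC C"
  shows "dP (\<lambda>x e. cK (qv (s x e)) < G x (C x e))"
  using dP_sub[OF assms(1)[unfolded dR_def] dC_psh[OF assms(2,3)]] by simp

lemmas dC_shift1 = dC_shift[OF dC_id]
lemmas dC_shift2 = dC_shift[OF dC_shift1]
lemmas dC_shift3 = dC_shift[OF dC_shift2]

lemma dR_shift: "dR G \<Longrightarrow> dR (\<lambda>x e. G x (\<lambda>i. e (i + 1)))"
  unfolding dR_def[of "\<lambda>x e. G x (\<lambda>i. e (i + 1))"] by (rule dR_at[OF _ dN_var dC_shift2])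

lemma dR_inst: "dR G \<Longrightarrow> a \<in> X \<Longrightarrow> e' \<in> D T1 \<Longrightarrow> dR (\<lambda>x e. G a (fn e'))"
proof -
  assume G: "dR G" and a: "a \<in> X" and e': "e' \<in> D T1"
  have "dC (\<lambda>x e. fn e')" unfolding dC_def using rp_const[OF e'] by blast
  then have "dP (\<lambda>x e. cK (qv (e 0)) < G x (fn e'))" using dR_at[OF G dN_var] by blast
  then show ?thesis unfolding dR_def using a by (rule dP_inst)
qed

lemma dR_q: "dN s \<Longrightarrow> dR (\<lambda>x e. cK (qv (s x e)))"
  unfolding dR_def cK_less by (intro dP_qless dN_var dN_shift)

lemma dN_tp: "dN s \<Longrightarrow> dN (\<lambda>x e. tp (s x e))"
  unfolding tp_def by (intro dN_fun tpU_typed)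

lemma dR_pw: "dN s \<Longrightarrow> dR (\<lambda>x e. cK (pw (s x e)))"
  using dR_q[of "\<lambda>x e. pr (pr 1 0) (tp (s x e))"] by (simp add: pw_def dN_pr dN_const dN_tp)

text \<open>Only membership in lower cuts is known to be definable, so a rational \<open>a\<close>
  with \<open>r \<le> a < s\<close> is sought: it belongs to the second cut and not to the
  first.\<close>

lemma dR_less: "dR G \<Longrightarrow> dR H \<Longrightarrow> dP (\<lambda>x e. G x e < H x e)"
proof -
  assume GH: "dR G" "dR H"
  have iff: "r < s \<longleftrightarrow> (\<exists>a. \<not> cK (qv a) < r \<and> cK (qv a) < s)" for r s :: "'n rr"
  proof
    assume "r < s"
    then obtain a where "r < cK (qv a)" "cK (qv a) < s" by (rule ex_between)
    then show "\<exists>a. \<not> cK (qv a) < r \<and> cK (qv a) < s" by (auto dest: less_asym)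
  qed (auto simp: not_less dest: le_less_trans)
  have "dP (\<lambda>x e. \<exists>a. \<not> cK (qv a) < G x e \<and> cK (qv a) < H x e)"
    using GH unfolding dR_def by (intro dP_ex dP_conj dP_not)
  then show ?thesis unfolding iff[symmetric] .
qed

lemma dR_le: "dR G \<Longrightarrow> dR H \<Longrightarrow> dP (\<lambda>x e. G x e \<le> H x e)"
  unfolding not_less[symmetric] by (intro dP_not dR_less)

lemma dR_add: "dR G \<Longrightarrow> dR H \<Longrightarrow> dR (\<lambda>x e. G x e + H x e)"
proof -
  assume GH: "dR G" "dR H"
  have iff: "cK (qv c) < r + s \<longleftrightarrow> (\<exists>a b. cK (qv a) < r \<and> cK (qv b) < s \<and> qv c < qv a + qv b)"
    (is "_ \<longleftrightarrow> ?R") for r s :: "'n rr" and c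
  proof
    assume "cK (qv c) < r + s"
    then have "0 < r + s - cK (qv c)" by simp
    then obtain n where n: "cK (pw n) < r + s - cK (qv c)" by (rule pw_arch_R)
    obtain a where a: "r - cK (pw (n + 1)) < cK (qv a)" "cK (qv a) < r"
      using ex_between[of "r - cK (pw (n + 1))" r] cK_less[of 0 "pw (n + 1)"] by auto
    obtain b where b: "s - cK (pw (n + 1)) < cK (qv b)" "cK (qv b) < s"
      using ex_between[of "s - cK (pw (n + 1))" s] cK_less[of 0 "pw (n + 1)"] by auto
    have "cK (qv c) < (cK (qv a) + cK (qv b) :: 'n rr)" using a b n pw_Suc_R[of n] by linarith
    then have "qv c < qv a + qv b" unfolding cK_hom(3)[symmetric] cK_less .
    then show ?R using a b by blast
  next
    assume ?R
    then obtain a b where *: "cK (qv a) < r" "cK (qv b) < s" "qv c < qv a + qv b" by blast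
    from *(3) have "cK (qv c) < (cK (qv a + qv b) :: 'n rr)" unfolding cK_less .
    with *(1,2) show "cK (qv c) < r + s" unfolding cK_hom by linarith
  qed
  show ?thesis unfolding dR_def iff
    by (intro dP_ex dP_conj dP_qsum dN_var dR_at[OF GH(1)] dR_at[OF GH(2)] dC_shift3)
qed

text \<open>The cut of \<open>- r\<close> is described through the complement of the cut of
  \<open>r\<close>: some \<open>b > c\<close> has a rational \<open>a \<ge> r\<close> with
  \<open>b + a \<le> 0\<close>. The strict \<open>c < b\<close> makes up for the weak
  inequalities.\<close>

lemma dR_minus: "dR G \<Longrightarrow> dR (\<lambda>x e. - G x e)"
proof -
  assume G: "dR G"
  have iff: "cK (qv c) < - r \<longleftrightarrow> (\<exists>a b. \<not> cK (qv a) < r \<and> \<not> qv q0 < qv b + qv a \<and> qv c < qv b)"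
    (is "_ \<longleftrightarrow> ?R") for r :: "'n rr" and c
  proof
    assume "cK (qv c) < - r"
    then obtain b where b: "cK (qv c) < (cK (qv b) :: 'n rr)" "cK (qv b) < - r" by (rule ex_between)
    obtain a where "qv a = - qv b" by (rule qv_surj)
    then have "\<not> cK (qv a) < r \<and> \<not> qv q0 < qv b + qv a \<and> qv c < qv b" using b by simp
    then show ?R by blast
  next
    assume ?R
    then obtain a b where *: "r \<le> cK (qv a)" "qv b + qv a \<le> 0" "qv c < qv b" by (auto simp: not_less)
    from *(2) have "cK (qv b + qv a) \<le> (cK 0 :: 'n rr)" unfolding cK_le .
    moreover from *(3) have "cK (qv c) < (cK (qv b) :: 'n rr)" unfolding cK_less .
    ultimately show "cK (qv c) < - r" using *(1) unfolding cK_hom by linarith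
  qed
  show ?thesis unfolding dR_def iff
    by (intro dP_ex dP_conj dP_not dP_qsum dP_qless dN_var dN_const dR_at[OF G] dC_shift3)
qed

lemma dR_diff: "dR G \<Longrightarrow> dR H \<Longrightarrow> dR (\<lambda>x e. G x e - H x e)"
  unfolding diff_conv_add_uminus by (intro dR_add dR_minus)

lemma dR_abs: "dR G \<Longrightarrow> dR (\<lambda>x e. \<bar>G x e\<bar>)"
proof -
  assume G: "dR G"
  have iff: "c < \<bar>r\<bar> \<longleftrightarrow> c < r \<or> c < - r" for r c :: "'n rr" by (auto simp: abs_if)
  show ?thesis using G dR_minus[OF G] unfolding dR_def iff by (intro dP_disj)
qed

lemma dR_val:
  assumes Y: "dN (\<lambda>x e. Y x (\<lambda>i. e (i + 1)) (e 0))"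
    and isr: "\<And>x e. x \<in> X \<Longrightarrow> e \<in> D T1 \<Longrightarrow> isr (Y x (fn e))"
  shows "dR (\<lambda>x e. val (Y x e))"
proof -
  \<comment> \<open>A member \<open>y k\<close> bounds \<open>val y\<close> from below up to the
    error \<open>pw k\<close>, which is coded by \<open>pr (pr 1 0) (tp k)\<close>; the rational
    \<open>b\<close> is inserted so that the relation takes the form of
    \<open>dP_qsum\<close>.\<close>
  have iff: "cK (qv c) < val y \<longleftrightarrow>
      (\<exists>k b. qv c < qv b \<and> \<not> qv (y k) < qv b + qv (pr (pr 1 0) (tp k)))" (is "_ \<longleftrightarrow> ?R")
    if y: "isr y" for y c
  proof -
    note ap = approxD[OF isr_approx[OF y]]
    have pw: "qv (pr (pr 1 0) (tp k)) = pw k" for k by (simp add: pw_def)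
    show ?thesis
    proof
      assume "cK (qv c) < val y"
      then have "0 < val y - cK (qv c)" by simp
      then obtain n where n: "cK (pw n) < val y - cK (qv c)" by (rule pw_arch_R)
      let ?k = "n + 1"
      obtain b where b: "qv b = qv (y ?k) - pw ?k" by (rule qv_surj)
      have "cK (qv c) < (cK (qv b) :: 'n rr)"
        using ap[of ?k] n pw_Suc_R[of n] unfolding b cK_diff by linarith
      then have "qv c < qv b" unfolding cK_less .
      then show ?R using b pw by (intro exI[of _ ?k] exI[of _ b]) simp
    next
      assume ?R
      then obtain k b where kb: "qv c < qv b" "qv b + pw k \<le> qv (y k)" by (auto simp: pw not_less)
      from kb(1) have "cK (qv c) < (cK (qv b) :: 'n rr)" unfolding cK_less .
      moreover from kb(2) have "cK (qv b + pw k) \<le> (cK (qv (y k)) :: 'n rr)" unfolding cK_le .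
      ultimately show "cK (qv c) < val y" using ap[of k] unfolding cK_hom by linarith
    qed
  qed
  \<comment> \<open>Under the quantifiers over \<open>k\<close> and \<open>b\<close> the entries are
    \<open>b\<close>, \<open>k\<close>, the argument of the cut, and then the context of
    \<open>Y\<close>; hence the shift by three.\<close>
  have "dN (\<lambda>x e. Y x (\<lambda>i. e (i + 1 + 1 + 1)) (e 1))"
    using dN_sub[OF Y dC_psh[OF dN_var[of 1] dC_shift3]] by simp
  then have d: "dP (\<lambda>x e. \<exists>k b. qv (e 0) < qv b \<and>
      \<not> qv (Y x (\<lambda>i. e (i + 1)) k) < qv b + qv (pr (pr 1 0) (tp k)))"
    by (intro dP_ex dP_conj dP_not dP_qless dP_qsum dN_pr dN_const dN_tp dN_var) simp
  have isr': "isr (Y x (\<lambda>i. fn e (i + 1)))" if xe: "x \<in> X" "e \<in> D T1" for x e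
  proof -
    obtain c where c: "rp T1 c" "\<And>x e. x \<in> X \<Longrightarrow> e \<in> D T1 \<Longrightarrow> fn (c x e) = (\<lambda>i. fn e (i + 1))"
      using dC_shift1 by (rule dC_E) blast
    show ?thesis using isr[OF xe(1) rp_typed[OF c(1) xe]] c(2)[OF xe] by simp
  qed
  show ?thesis
    unfolding dR_def by (rule dP_cong[OF d]) (simp add: iff[OF isr'])
qed

lemma dR_MR: "MR r \<Longrightarrow> dR (\<lambda>x e. r)"
proof -
  assume "MR r"
  then obtain u where u: "u \<in> D T1" "isr (fn u)" "val (fn u) = r" by (auto simp: MR_def)
  then show ?thesis using dR_val[of "\<lambda>x e. fn u"] dN_fun[OF u(1) dN_var] by simp
qed

lemma code_spec:
  assumes "dR (\<lambda>x e. r)"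
  shows "vc (code r k)" "\<bar>cK (qv (code r k)) - r\<bar> < cK (pw (k + 1 + 1))"
proof -
  let ?P = "\<lambda>c. vc c \<and> \<bar>cK (qv c) - r\<bar> < cK (pw (k + 1 + 1))"
  have P: "dP (\<lambda>x e. ?P (e 0))"
    by (intro dP_conj dP_vc dR_less dR_abs dR_diff dR_q dR_pw dN_var dN_const assms)
  obtain q where "\<bar>r - cK q\<bar> < cK (pw (k + 1 + 1))" using cr_approx[OF pw_pos] .
  moreover obtain c where "vc c" "qv c = q" by (rule qv_surj)
  ultimately have "?P c" by (simp add: abs_minus_commute)
  from mu_I[OF P this] show "vc (code r k)" "\<bar>cK (qv (code r k)) - r\<bar> < cK (pw (k + 1 + 1))"
    by (simp_all add: code_def)
qed

lemma isr_code: assumes "dR (\<lambda>x e. r)" shows "isr (code r)" "val (code r) = r"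
proof -
  note c = code_spec[OF assms]
  show isr: "isr (code r)" unfolding isr_def
  proof (intro allI conjI c(1))
    fix n i
    have "cK (pw (n + i + 1 + 1)) \<le> (cK (pw (n + 1 + 1)) :: 'n rr)" by (simp add: pw_mono add_right_mono)
    then have "\<bar>cK (qv (code r n)) - cK (qv (code r (n + i)))\<bar> < (cK (pw n) :: 'n rr)"
      using c(2)[of n] c(2)[of "n + i"] pw_Suc_R[of n] pw_Suc_R[of "n + 1"] by linarith
    then show "\<bar>qv (code r n) - qv (code r (n + i))\<bar> < pw n"
      unfolding cK_diff[symmetric] cK_abs cK_less .
  qed
  have "\<bar>val (code r) - r\<bar> \<le> 0"
  proof (rule le_pw_R)
    fix n
    show "\<bar>val (code r) - r\<bar> \<le> 0 + cK (pw n)"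
      using c(2)[of "n + 1"] approxD[OF isr_approx[OF isr], of "n + 1"] pw_Suc_R[of n]
        pw_Suc_R[of "n + 1"] pw_Suc_R[of "n + 1 + 1"] cK_pw_pos[of "n + 1 + 1 + 1"]
      by linarith
  qed
  then show "val (code r) = r" by simp
qed

lemma dN_code: "dR G \<Longrightarrow> dN (\<lambda>x e. code (G x (\<lambda>i. e (i + 1))) (e 0))"
  unfolding code_def
  by (intro dN_mu dP_conj dP_vc dR_less dR_abs dR_diff dR_q dR_pw dN_plus dN_var dN_const)
    (use dR_shift[OF dR_shift] in blast)

text \<open>The canonical code of a real with definable cut is a sequence of the model. With
  \<open>dR_MR\<close> this identifies the reals of the model with the elements of the completion
  that have a definable cut, and so closes them under the definable operations.\<close>

lemma MR_dR: "dR (\<lambda>x e. r) \<Longrightarrow> MR r"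
proof -
  assume r: "dR (\<lambda>x e. r)"
  obtain u where "u \<in> D T1" "fn u = code r" using dN_sequence[OF dN_code[OF r]] by blast
  then show ?thesis using isr_code[OF r] unfolding MR_def by (intro bexI[of _ u]) simp_all
qed

lemma MR_q: "MR (cK (qv c))"
  by (intro MR_dR dR_q dN_const)

text \<open>For each \<open>k\<close> there is a least \<open>n\<close> such that
  \<open>a0 + n * 2^-k\<close> is an upper bound; the point one step below it, or \<open>a0\<close>
  if \<open>n\<close> is 0, approximates the supremum to within \<open>2^-k\<close>. The cut of the
  limit consists of the rationals below some member of \<open>A\<close>, hence is definable.\<close>

lemma ex_sup:
  assumes A: "dP (\<lambda>x e. A (e 0))" and a0: "A a0" and b: "\<And>c. A c \<Longrightarrow> cK (qv c) \<le> (b :: 'n rr)"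
  obtains s where "MR s" "\<And>c. A c \<Longrightarrow> cK (qv c) \<le> s"
    "\<And>c. cK (qv c) < s \<longleftrightarrow> (\<exists>a. A a \<and> qv c < qv a)" "\<And>t. (\<And>c. A c \<Longrightarrow> cK (qv c) \<le> t) \<Longrightarrow> s \<le> t"
proof -
  obtain b' where b': "b < cK (qv b')" by (rule ex_above)
  have ub: "qv c \<le> qv b'" if "A c" for c
  proof -
    have "cK (qv c) < (cK (qv b') :: 'n rr)" using b[OF that] b' by (rule le_less_trans)
    then show ?thesis by simp
  qed
  have "\<exists>q. (\<forall>c. A c \<longrightarrow> qv c \<le> q + pw k) \<and> (\<exists>c. A c \<and> q \<le> qv c)" for k
  proof -
    let ?P = "\<lambda>n. \<forall>c. A c \<longrightarrow> qv c \<le> qv a0 + kn n * pw k"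
    have le: "qv c \<le> qv a0 + kn n * pw k \<longleftrightarrow> \<not> qv a0 + qv (pr (pr n 0) (tp k)) < qv c" for c n
      by (simp add: frac_def pw_eq kn_hom not_less)
    have "dP (\<lambda>x e. \<forall>c. A c \<longrightarrow> \<not> (qv c > qv a0 + qv (pr (pr (e 0) 0) (tp k))))"
    proof -
      \<comment> \<open>\<open>dP_qsum\<close> allows a sum on the right only, so
        \<open>n * 2^-k\<close> is moved there by means of a code of its negative.\<close>
      have iff: "qv a0 + qv (pr (pr n 0) (tp k)) < qv c \<longleftrightarrow> qv a0 < qv c + qv (pr (pr 0 n) (tp k))" for n c
      proof -
        have "qv (pr (pr 0 n) (tp k)) = - qv (pr (pr n 0) (tp k))" by (simp add: frac_minus)
        then show ?thesis by (simp only: add_uminus_conv_diff less_diff_eq)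
      qed
      show ?thesis unfolding iff
        by (intro dP_all dP_imp dP_not dP_qsum dN_pr dN_var dN_const A)
    qed
    then have dP: "dP (\<lambda>x e. ?P (e 0))" unfolding le .
    obtain n0 where n0: "(qv b' - qv a0) / pw k \<le> kn n0" by (rule kn_ge)
    then have "qv b' - qv a0 \<le> kn n0 * pw k" by (simp add: pos_divide_le_eq)
    then have "qv b' \<le> qv a0 + kn n0 * pw k" by (simp add: algebra_simps)
    then have "?P n0" using ub order_trans by blast
    then obtain n where n: "?P n" "\<forall>m<n. \<not> ?P m" using least_n[OF dP] by blast
    show ?thesis
    proof (cases n rule: n_cases)
      case 1
      then have "\<forall>c. A c \<longrightarrow> qv c \<le> qv a0" using n(1) by (simp add: kn_hom)
      then have "\<forall>c. A c \<longrightarrow> qv c \<le> qv a0 + pw k" using less_imp_le[OF pw_pos[of k]] add_increasing2 by blast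
      then show ?thesis using a0 by blast
    next
      case (2 m)
      then have "m < n" using less_Suc_iff[of m m] by simp
      then obtain c where c: "A c" "\<not> qv c \<le> qv a0 + kn m * pw k" using n(2) by blast
      have "kn n * pw k = kn m * pw k + pw k" using 2 by (simp add: kn_hom algebra_simps)
      then show ?thesis using n(1) c
        by (intro exI[of _ "qv a0 + kn m * pw k"]) (auto simp: add.assoc)
    qed
  qed
  \<comment> \<open>\<open>Q\<close> is chosen in HOL and may lie outside the model; definability is
    proved afterwards, for the cut of its limit.\<close>
  then obtain Q where Q: "\<And>k c. A c \<Longrightarrow> qv c \<le> Q k + pw k" "\<And>k. \<exists>c. A c \<and> Q k \<le> qv c" by metis
  have "\<bar>Q n - Q (n + i)\<bar> \<le> pw n" for n i
  proof -
    obtain c c' where c: "A c" "Q n \<le> qv c" "A c'" "Q (n + i) \<le> qv c'" using Q(2) by metis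
    have "Q n \<le> Q (n + i) + pw (n + i)" "Q (n + i) \<le> Q n + pw n"
      using Q(1)[OF c(1), of "n + i"] Q(1)[OF c(3), of n] c(2,4) by (auto intro: order_trans)
    moreover have "pw (n + i) \<le> pw n" by (simp add: pw_mono)
    ultimately show ?thesis by linarith
  qed
  note ap = approxD[OF fast_net(2)[OF this]]
  let ?s = "net Q"
  have up: "cK (qv c) \<le> ?s" if "A c" for c
  proof (rule le_pw_R)
    fix n
    have "cK (qv c) \<le> (cK (Q (n + 1) + pw (n + 1)) :: 'n rr)" unfolding cK_le by (rule Q(1)[OF that])
    then show "cK (qv c) \<le> ?s + cK (pw n)"
      using ap[of "n + 1"] pw_Suc_R[of n] unfolding cK_hom by linarith
  qed
  have least: "?s \<le> t" if t: "\<And>c. A c \<Longrightarrow> cK (qv c) \<le> t" for t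
  proof (rule le_pw_R)
    fix n
    obtain c where "A c" "Q n \<le> qv c" using Q(2) by blast
    then have "cK (Q n) \<le> (cK (qv c) :: 'n rr)" "cK (qv c) \<le> t" using t by simp_all
    then show "?s \<le> t + cK (pw n)" using ap[of n] by linarith
  qed
  have cut: "cK (qv c) < ?s \<longleftrightarrow> (\<exists>a. A a \<and> qv c < qv a)" for c
  proof
    assume *: "cK (qv c) < ?s"
    show "\<exists>a. A a \<and> qv c < qv a"
    proof (rule ccontr)
      assume "\<nexists>a. A a \<and> qv c < qv a"
      then have "\<And>a. A a \<Longrightarrow> cK (qv a) \<le> (cK (qv c) :: 'n rr)" by (auto simp: not_less)
      then show False using least * by (meson not_less)
    qed
  next
    assume "\<exists>a. A a \<and> qv c < qv a"
    then obtain a where "A a" "cK (qv c) < (cK (qv a) :: 'n rr)" by auto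
    then show "cK (qv c) < ?s" using up less_le_trans by blast
  qed
  have "dR (\<lambda>x e. ?s)" unfolding dR_def cut
  proof (intro dP_ex dP_conj dP_qless dN_var)
    show "dP (\<lambda>x e. A (e 0))" by (rule A)
  qed
  then show ?thesis using that[of ?s] MR_dR up cut least by blast
qed

end

section \<open>Nested intervals\<close>

context aca_num
begin

abbreviation rv :: "'n \<Rightarrow> 'n rr" where "rv c \<equiv> cK (qv c)"

text \<open>Prepares the steps of a nesting: the new interval has rational ends and at most half the
  length and lies near \<open>t\<close>, but need not contain \<open>t\<close>. It is taken to the
  right of \<open>t\<close>, except when \<open>t\<close> is the right end.\<close>

lemma sub_near:
  assumes ab: "rv a < rv b" and t: "rv a \<le> t" "t \<le> rv b" and \<delta>: "0 < \<delta>"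
  obtains a' b' where "rv a \<le> rv a'" "rv a' < rv b'" "rv b' \<le> rv b"
    "(rv b' - rv a') + (rv b' - rv a') \<le> rv b - rv a" "t - \<delta> < rv a'" "rv b' < t + \<delta>"
proof -
  have "0 < min \<delta> (rv b - rv a)" using ab \<delta> by (simp add: min_def)
  then obtain n where n: "cK (pw n) < min \<delta> (rv b - rv a)" by (rule pw_arch_R)
  define \<eta> where "\<eta> = (cK (pw (n + 1)) :: 'n rr)"
  have \<eta>: "0 < \<eta>" "\<eta> + \<eta> < \<delta>" "\<eta> + \<eta> < rv b - rv a"
    using n pw_Suc_R[of n] by (simp_all add: \<eta>_def)
  show ?thesis
  proof (cases "t < rv b")
    case True
    then have "t < min (rv b) (t + \<eta>)" using \<eta> by simp
    then obtain a' where a': "t < rv a'" "rv a' < min (rv b) (t + \<eta>)" by (rule ex_between)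
    from a'(2) obtain b' where b': "rv a' < rv b'" "rv b' < min (rv b) (t + \<eta>)" by (rule ex_between)
    show ?thesis by (rule that[of a' b']) (use a' b' \<eta> t ab in \<open>linarith | simp\<close>)+
  next
    case False
    then have tb: "t = rv b" using t by simp
    then have "max (rv a) (t - \<eta>) < t" using \<eta> ab by simp
    then obtain a' where a': "max (rv a) (t - \<eta>) < rv a'" "rv a' < t" by (rule ex_between)
    from a'(2) obtain b' where b': "rv a' < rv b'" "rv b' < t" by (rule ex_between)
    have "rv a < rv a'" "t - \<eta> < rv a'" using a'(1) by simp_all
    then show ?thesis by (intro that[of a' b']) (use a'(2) b' \<eta> tb in linarith)+
  qed
qed

lemma rat_near:
  assumes "rv a < rv b" "rv a \<le> t" "t \<le> rv b" "0 < \<delta>"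
  obtains c where "rv a \<le> rv c" "rv c \<le> rv b" "\<bar>t - rv c\<bar> < \<delta>"
proof -
  obtain a' b' where *: "rv a \<le> rv a'" "rv a' < rv b'" "rv b' \<le> rv b"
    "(rv b' - rv a') + (rv b' - rv a') \<le> rv b - rv a" "t - \<delta> < rv a'" "rv b' < t + \<delta>"
    using sub_near[OF assms] .
  then have "\<bar>t - rv a'\<bar> < \<delta>" by linarith
  then show ?thesis using * that[of a'] by linarith
qed

definition unl :: "'n \<Rightarrow> 'n" where "unl c = full.mu (\<lambda>i. \<exists>j. c = pr i j)"
definition unr :: "'n \<Rightarrow> 'n" where "unr c = full.mu (\<lambda>j. \<exists>i. c = pr i j)"

lemma un_pr [simp]: "unl (pr i j) = i" "unr (pr i j) = j"
  by (auto simp: unl_def unr_def intro!: full.mu_eq)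

end

context aca_def
begin

lemma dN_unl: "dN s \<Longrightarrow> dN (\<lambda>x e. unl (s x e))"
  unfolding unl_def by (intro dN_mu dP_ex dP_eq dN_pr dN_var dN_shift)

lemma dN_unr: "dN s \<Longrightarrow> dN (\<lambda>x e. unr (s x e))"
  unfolding unr_def by (intro dN_mu dP_ex dP_eq dN_pr dN_var dN_shift)

text \<open>The steps are not chosen freely: each is the pair with least code among the admissible
  ones, so that both sequences of end points arise by definable recursion and belong to the model.
  The common point is the supremum of the left ends.\<close>

lemma nested:
  assumes dS: "dP (\<lambda>x e. Sp (e 0) (e 1) (e 2) (e 3) (e 4))"
    and ab: "rv a0 < rv b0" "rv b0 - rv a0 \<le> 1"
    and step: "\<And>k a b. rv a0 \<le> rv a \<Longrightarrow> rv a < rv b \<Longrightarrow> rv b \<le> rv b0 \<Longrightarrow>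
      \<exists>a' b'. rv a \<le> rv a' \<and> rv a' < rv b' \<and> rv b' \<le> rv b \<and>
        (rv b' - rv a') + (rv b' - rv a') \<le> rv b - rv a \<and> Sp k a b a' b'"
  obtains y A B where "MR y" "A 0 = a0" "B 0 = b0" "\<And>k. rv (A k) \<le> y" "\<And>k. y \<le> rv (B k)"
    "\<And>k. rv a0 \<le> rv (A k)" "\<And>k. rv (A k) < rv (B k)" "\<And>k. rv (B k) \<le> rv b0"
    "\<And>k. rv (B k) - rv (A k) \<le> cK (pw k)" "\<And>k. Sp k (A k) (B k) (A (k + 1)) (B (k + 1))"
    "dN (\<lambda>x e. A (e 0))" "dN (\<lambda>x e. B (e 0))"
proof -
  define good where "good k c c' \<longleftrightarrow> rv (unl c) \<le> rv (unl c') \<and> rv (unl c') < rv (unr c') \<and>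
    rv (unr c') \<le> rv (unr c) \<and>
    (rv (unr c') - rv (unl c')) + (rv (unr c') - rv (unl c')) \<le> rv (unr c) - rv (unl c) \<and>
    Sp k (unl c) (unr c) (unl c') (unr c')" for k c c'
  have dgood: "dP (\<lambda>x e. good (s x e) (t x e) (u x e))" if "dN s" "dN t" "dN u" for s t u
    unfolding good_def
    by (intro dP_conj dR_le dR_less dR_add dR_diff dR_q dP_sub5[OF dS] dN_unl dN_unr that)
  have "dN (\<lambda>x e. mu (good (e 0) (e 1)))"
    by (intro dN_mu dgood dN_var)
  then obtain H where H: "H \<in> D T1" "fn H 0 = pr a0 b0" "\<And>n. fn H (n + 1) = mu (good n (fn H n))"
    by (rule dN_rec[where C = "\<lambda>k c. mu (good k c)"]) blast
  define A where "A k = unl (fn H k)" for k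
  define B where "B k = unr (fn H k)" for k
  have dA: "dN (\<lambda>x e. A (s x e))" and dB: "dN (\<lambda>x e. B (s x e))" if "dN s" for s
    unfolding A_def B_def by (intro dN_unl dN_unr dN_fun H(1) that)+
  define Inv where "Inv k \<longleftrightarrow> rv a0 \<le> rv (A k) \<and> rv (A k) < rv (B k) \<and> rv (B k) \<le> rv b0 \<and>
    rv (B k) - rv (A k) \<le> cK (pw k)" for k
  have good: "good k (fn H k) (fn H (k + 1))" if Inv: "Inv k" for k
  proof -
    obtain a' b' where "rv (A k) \<le> rv a' \<and> rv a' < rv b' \<and> rv b' \<le> rv (B k) \<and>
        (rv b' - rv a') + (rv b' - rv a') \<le> rv (B k) - rv (A k) \<and> Sp k (A k) (B k) a' b'"
      using step[of "A k" "B k" k] Inv unfolding Inv_def by blast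
    then have "good k (fn H k) (pr a' b')" by (simp add: good_def A_def B_def)
    then show ?thesis unfolding H(3) by (rule mu_I[rotated]) (intro dgood dN_const dN_var)
  qed
  \<comment> \<open>Induction inside the model, as stages may be nonstandard; this is why the
    invariant has to be definable.\<close>
  have Inv: "Inv k" for k
  proof (rule induct_n[where P = Inv])
    show "dP (\<lambda>x e. Inv (e 0))"
      unfolding Inv_def by (intro dP_conj dR_le dR_less dR_diff dR_q dR_pw dA dB dN_var dN_const)
    show "Inv 0" using ab by (simp add: Inv_def A_def B_def H(2))
    fix k assume k: "Inv k"
    show "Inv (k + 1)"
      using k good[OF k] pw_Suc_R[of k] unfolding Inv_def good_def A_def[symmetric] B_def[symmetric]
      by linarith
  qed
  have step': "rv (A k) \<le> rv (A (k + 1)) \<and> rv (B (k + 1)) \<le> rv (B k) \<and> Sp k (A k) (B k) (A (k + 1)) (B (k + 1))" for k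
    using good[OF Inv, of k] unfolding good_def A_def[symmetric] B_def[symmetric] by simp
  have mono: "rv (A k) \<le> rv (A (k + i)) \<and> rv (B (k + i)) \<le> rv (B k)" for k i
  proof (rule induct_n[where P = "\<lambda>i. rv (A k) \<le> rv (A (k + i)) \<and> rv (B (k + i)) \<le> rv (B k)"])
    show "dP (\<lambda>x e. rv (A k) \<le> rv (A (k + e 0)) \<and> rv (B (k + e 0)) \<le> rv (B k))"
      by (intro dP_conj dR_le dR_q dA dB dN_plus dN_var dN_const)
    fix i assume "rv (A k) \<le> rv (A (k + i)) \<and> rv (B (k + i)) \<le> rv (B k)"
    then show "rv (A k) \<le> rv (A (k + (i + 1))) \<and> rv (B (k + (i + 1))) \<le> rv (B k)"
      using step'[of "k + i"] unfolding add.assoc[symmetric] by (meson order_trans)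
  qed simp
  have cross: "rv (A i) \<le> rv (B j)" for i j
  proof (cases "i \<le> j")
    case True
    then show ?thesis using mono[of i "j - i"] Inv[of j] unfolding Inv_def
      by (simp only: le_add_diff_inverse) linarith
  next
    case False
    then have "j \<le> i" by simp
    then show ?thesis using mono[of j "i - j"] Inv[of i] unfolding Inv_def
      by (simp only: le_add_diff_inverse) linarith
  qed
  obtain y where y: "MR y" "\<And>c. \<exists>k. c = A k \<Longrightarrow> rv c \<le> y"
    "\<And>t. (\<And>c. \<exists>k. c = A k \<Longrightarrow> rv c \<le> t) \<Longrightarrow> y \<le> t"
  proof (rule ex_sup[where A = "\<lambda>c. \<exists>k. c = A k" and b = "rv b0"])
    show "dP (\<lambda>x e. \<exists>k. e 0 = A k)" by (intro dP_ex dP_eq dA dN_var)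
    show "\<exists>k. A 0 = A k" by blast
    show "rv c \<le> rv b0" if "\<exists>k. c = A k" for c
      using that cross[of _ 0] by (auto simp: B_def H(2) simp del: cK_le)
  qed blast
  have "y \<le> rv (B k)" for k by (rule y(3)) (use cross in blast)
  moreover have "rv (A k) \<le> y" for k using y(2) by blast
  moreover have "A 0 = a0" "B 0 = b0" by (simp_all add: A_def B_def H(2))
  ultimately show ?thesis
    using that[of y A B] y(1) Inv step' dA[OF dN_var] dB[OF dN_var] unfolding Inv_def by blast
qed

end

section \<open>Baire 1 functions\<close>

context aca_num
begin

definition unit :: "'n rr \<Rightarrow> bool" where "unit r \<longleftrightarrow> MR r \<and> 0 \<le> r \<and> r \<le> 1"

text \<open>Rationals outside the unit interval are replaced by 0, so that a function on the unit
  interval can be evaluated at every code.\<close>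

definition uq :: "'n \<Rightarrow> 'n rr" where "uq c = (if 0 \<le> rv c \<and> rv c \<le> 1 then rv c else 0)"


abbreviation "q1 \<equiv> pr (pr 1 0) 1"

lemma rv_01: "rv q0 = 0" "rv q1 = 1"
  by (simp_all add: frac_def kn_hom)

end

text \<open>The data of a Baire 1 function in terms of reals instead of representatives.
  Definability is required of the sequence \<open>F\<close> and at rational points; continuity
  extends what holds there to all points.\<close>

locale baire = aca_def D ap cn ls num X
  for D :: "ty \<Rightarrow> 'u set" and ap (infixl \<open>\<bullet>\<close> 90) and cn ls
    and num :: "'n::linordered_semidom \<Rightarrow> 'u" and X :: "'u set" +
  fixes F :: "'n \<Rightarrow> 'n rr \<Rightarrow> 'n rr" and f :: "'n rr \<Rightarrow> 'n rr"
  assumes dF: "dN s \<Longrightarrow> dN t \<Longrightarrow> dR (\<lambda>x e. F (s x e) (uq (t x e)))"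
    and contF: "unit y \<Longrightarrow> \<exists>m. \<forall>z. unit z \<and> \<bar>y - z\<bar> < cK (pw m) \<longrightarrow> \<bar>F n y - F n z\<bar> < cK (pw k)"
    and limF: "unit y \<Longrightarrow> \<exists>m. \<forall>n\<ge>m. \<bar>F n y - f y\<bar> < cK (pw k)"
begin

text \<open>Infima of \<open>f\<close> will be obtained as negated suprema of
  \<open>- f\<close>.\<close>

lemma baire_uminus: "baire D (\<bullet>) cn ls num X (\<lambda>n y. - F n y) (\<lambda>y. - f y)"
proof unfold_locales
  show "dR (\<lambda>x e. - F (s x e) (uq (t x e)))" if "dN s" "dN t" for s t
    using that by (intro dR_minus dF)
  show "\<exists>m. \<forall>z. unit z \<and> \<bar>y - z\<bar> < cK (pw m) \<longrightarrow> \<bar>- F n y - - F n z\<bar> < cK (pw k)" if "unit y" for y n k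
  proof -
    have "\<bar>- F n y - - F n z\<bar> = \<bar>F n y - F n z\<bar>" for z by linarith
    then show ?thesis using contF[OF that] by simp
  qed
  show "\<exists>m. \<forall>n\<ge>m. \<bar>- F n y - - f y\<bar> < cK (pw k)" if "unit y" for y k
  proof -
    have "\<bar>- F n y - - f y\<bar> = \<bar>F n y - f y\<bar>" for n by linarith
    then show ?thesis using limF[OF that] by simp
  qed
qed

lemma unit_rv: "0 \<le> rv c \<Longrightarrow> rv c \<le> 1 \<Longrightarrow> unit (rv c) \<and> uq c = rv c"
  by (simp add: unit_def uq_def MR_q)

lemma contF_eps:
  assumes "unit y" "0 < \<epsilon>"
  obtains \<delta> where "0 < \<delta>" "\<And>z. unit z \<Longrightarrow> \<bar>y - z\<bar> < \<delta> \<Longrightarrow> \<bar>F n y - F n z\<bar> < \<epsilon>"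
proof -
  obtain k where k: "cK (pw k) < \<epsilon>" using pw_arch_R[OF assms(2)] .
  obtain m where "\<forall>z. unit z \<and> \<bar>y - z\<bar> < cK (pw m) \<longrightarrow> \<bar>F n y - F n z\<bar> < cK (pw k)"
    using contF[OF assms(1)] by blast
  then show ?thesis using k by (intro that[of "cK (pw m)"]) (auto dest: less_trans)
qed

lemma limF_eps:
  assumes "unit y" "0 < \<epsilon>"
  obtains m where "\<And>n. m \<le> n \<Longrightarrow> \<bar>F n y - f y\<bar> < \<epsilon>"
proof -
  obtain k where k: "cK (pw k) < \<epsilon>" using pw_arch_R[OF assms(2)] .
  obtain m where "\<forall>n\<ge>m. \<bar>F n y - f y\<bar> < cK (pw k)" using limF[OF assms(1)] by blast
  then show ?thesis using k that[of m] by (meson less_trans)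
qed

abbreviation "Fq n c \<equiv> F n (uq c)"

text \<open>The Baire category theorem for the closed sets on which \<open>F n\<close> is \<open>2\<^sup>-\<^sup>k\<close>-close to
  \<open>F m\<close> for all \<open>n \<ge> m\<close>.\<close>

lemma osc_small:
  assumes ab: "0 \<le> rv a" "rv a < rv b" "rv b \<le> 1"
  shows "\<exists>a' b' m. rv a \<le> rv a' \<and> rv a' < rv b' \<and> rv b' \<le> rv b \<and>
    (\<forall>n\<ge>m. \<forall>c. rv a' \<le> rv c \<and> rv c \<le> rv b' \<longrightarrow> \<bar>Fq n c - Fq m c\<bar> \<le> cK (pw k))"
proof (rule ccontr)
  assume "\<not> ?thesis"
  then have no: "\<exists>n\<ge>m. \<exists>c. rv a' \<le> rv c \<and> rv c \<le> rv b' \<and> cK (pw k) < \<bar>Fq n c - Fq m c\<bar>"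
    if "rv a \<le> rv a'" "rv a' < rv b'" "rv b' \<le> rv b" for a' b' m
    using that by (meson not_less)
  \<comment> \<open>Stage \<open>j\<close> of the nesting defeats the candidate
    \<open>m = j\<close>: at all rationals of the next interval some later function is farther than
    \<open>2^-k\<close> from \<open>F j\<close>. By continuity one such point spreads to an
    interval.\<close>
  define Sp where "Sp j a1 b1 a' b' \<longleftrightarrow>
    (\<exists>n\<ge>j. \<forall>c. rv a' \<le> rv c \<and> rv c \<le> rv b' \<longrightarrow> cK (pw k) < \<bar>Fq n c - Fq j c\<bar>)" for j a1 b1 a' b' :: 'n
  obtain y A B where y: "MR y" "\<And>k. rv (A k) \<le> y" "\<And>k. y \<le> rv (B k)"
    "\<And>k. rv a \<le> rv (A k)" "\<And>k. rv (A k) < rv (B k)" "\<And>k. rv (B k) \<le> rv b"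
    "\<And>k. Sp k (A k) (B k) (A (k + 1)) (B (k + 1))"
  proof (rule nested[of Sp a b])
    show "dP (\<lambda>x e. Sp (e 0) (e 1) (e 2) (e 3) (e 4))"
      unfolding Sp_def
      by (intro dP_ex dP_all dP_conj dP_imp dR_le dR_less dP_le dR_abs dR_diff dF dR_q dR_pw dN_var dN_const)
    show "rv a < rv b" "rv b - rv a \<le> 1" using ab by linarith+
    fix j a1 b1 assume 1: "rv a \<le> rv a1" "rv a1 < rv b1" "rv b1 \<le> rv b"
    obtain n c where nc: "j \<le> n" "rv a1 \<le> rv c" "rv c \<le> rv b1" "cK (pw k) < \<bar>Fq n c - Fq j c\<bar>"
      using no[OF 1, of j] by blast
    have c: "unit (rv c)" "uq c = rv c" using unit_rv[of c] nc ab 1 by linarith+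
    have "0 < \<bar>Fq n c - Fq j c\<bar> - cK (pw k)" using nc(4) by simp
    then obtain i where i: "cK (pw i) < \<bar>Fq n c - Fq j c\<bar> - cK (pw k)" by (rule pw_arch_R)
    obtain \<delta> where d: "0 < \<delta>" "\<And>z. unit z \<Longrightarrow> \<bar>rv c - z\<bar> < \<delta> \<Longrightarrow> \<bar>F n (rv c) - F n z\<bar> < cK (pw (i + 1))"
      by (rule contF_eps[OF c(1) cK_pw_pos]) blast
    obtain \<delta>' where d': "0 < \<delta>'" "\<And>z. unit z \<Longrightarrow> \<bar>rv c - z\<bar> < \<delta>' \<Longrightarrow> \<bar>F j (rv c) - F j z\<bar> < cK (pw (i + 1))"
      by (rule contF_eps[OF c(1) cK_pw_pos]) blast
    have "0 < min \<delta> \<delta>'" using d d' by simp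
    then obtain a' b' where a'b': "rv a1 \<le> rv a'" "rv a' < rv b'" "rv b' \<le> rv b1"
      "(rv b' - rv a') + (rv b' - rv a') \<le> rv b1 - rv a1"
      "rv c - min \<delta> \<delta>' < rv a'" "rv b' < rv c + min \<delta> \<delta>'"
      using sub_near[OF 1(2) nc(2,3)] by blast
    have "cK (pw k) < \<bar>Fq n z - Fq j z\<bar>" if "rv a' \<le> rv z" "rv z \<le> rv b'" for z
    proof -
      have z: "unit (rv z)" "uq z = rv z" using unit_rv[of z] that a'b' ab 1 by linarith+
      have "\<bar>rv c - rv z\<bar> < min \<delta> \<delta>'" using that a'b' by linarith
      then have "\<bar>F n (rv c) - F n (rv z)\<bar> < cK (pw (i + 1))" "\<bar>F j (rv c) - F j (rv z)\<bar> < cK (pw (i + 1))"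
        using d(2)[OF z(1)] d'(2)[OF z(1)] by simp_all
      then show ?thesis using i pw_Suc_R[of i] unfolding c(2) z(2) by linarith
    qed
    then have "Sp j a1 b1 a' b'" unfolding Sp_def using nc(1) by blast
    then show "\<exists>a' b'. rv a1 \<le> rv a' \<and> rv a' < rv b' \<and> rv b' \<le> rv b1 \<and>
        (rv b' - rv a') + (rv b' - rv a') \<le> rv b1 - rv a1 \<and> Sp j a1 b1 a' b'"
      using a'b' by blast
  qed blast
  have "0 \<le> y" "y \<le> 1" using y(2)[of 0] y(3)[of 0] y(4)[of 0] y(6)[of 0] ab by linarith+
  then have uy: "unit y" using y(1) by (simp add: unit_def)
  \<comment> \<open>At the common point \<open>y\<close> the sequence converges. If from
    \<open>m\<close> on all values are within \<open>2^-(k+2)\<close> of \<open>f y\<close>, then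
    stage \<open>m\<close> supplies \<open>n\<close>, and continuity a rational \<open>c\<close>
    near \<open>y\<close>; four errors of this size contradict the gap \<open>2^-k\<close>.\<close>
  obtain m where m: "\<And>n. m \<le> n \<Longrightarrow> \<bar>F n y - f y\<bar> < cK (pw (k + 1 + 1))"
    by (rule limF_eps[OF uy cK_pw_pos]) blast
  obtain n where n: "m \<le> n"
    "\<And>c. rv (A (m + 1)) \<le> rv c \<Longrightarrow> rv c \<le> rv (B (m + 1)) \<Longrightarrow> cK (pw k) < \<bar>Fq n c - Fq m c\<bar>"
    using y(7)[of m] unfolding Sp_def by blast
  obtain \<delta> where d: "0 < \<delta>" "\<And>z. unit z \<Longrightarrow> \<bar>y - z\<bar> < \<delta> \<Longrightarrow> \<bar>F n y - F n z\<bar> < cK (pw (k + 1 + 1))"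
    by (rule contF_eps[OF uy cK_pw_pos]) blast
  obtain \<delta>' where d': "0 < \<delta>'" "\<And>z. unit z \<Longrightarrow> \<bar>y - z\<bar> < \<delta>' \<Longrightarrow> \<bar>F m y - F m z\<bar> < cK (pw (k + 1 + 1))"
    by (rule contF_eps[OF uy cK_pw_pos]) blast
  have "0 < min \<delta> \<delta>'" using d d' by simp
  then obtain c where c: "rv (A (m + 1)) \<le> rv c" "rv c \<le> rv (B (m + 1))" "\<bar>y - rv c\<bar> < min \<delta> \<delta>'"
    using rat_near[OF y(5)[of "m + 1"] y(2)[of "m + 1"] y(3)[of "m + 1"]] by blast
  have uc: "unit (rv c)" "uq c = rv c" using unit_rv[of c] c(1,2) y(4)[of "m + 1"] y(6)[of "m + 1"] ab by linarith+
  have "\<bar>F n y - F n (rv c)\<bar> < cK (pw (k + 1 + 1))" "\<bar>F m y - F m (rv c)\<bar> < cK (pw (k + 1 + 1))"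
    using d(2)[OF uc(1)] d'(2)[OF uc(1)] c(3) by simp_all
  moreover have "cK (pw k) < \<bar>F n (rv c) - F m (rv c)\<bar>" using n(2)[OF c(1,2)] uc(2) by simp
  ultimately show False
    using m[OF n(1)] m[OF order_refl] pw_Suc_R[of k] pw_Suc_R[of "k + 1"] by linarith
qed

theorem continuity_point:
  "\<exists>y. unit y \<and> (\<forall>k. \<exists>m. \<forall>z. unit z \<and> \<bar>y - z\<bar> < cK (pw m) \<longrightarrow> \<bar>f y - f z\<bar> < cK (pw k))"
proof -
  \<comment> \<open>The strict inclusions put the common point in the interior of every interval, so
    that each interval contains a neighbourhood of it.\<close>
  define Sp where "Sp k a b a' b' \<longleftrightarrow> rv a < rv a' \<and> rv b' < rv b \<and>
    (\<exists>m. \<forall>n\<ge>m. \<forall>c. rv a' \<le> rv c \<and> rv c \<le> rv b' \<longrightarrow> \<bar>Fq n c - Fq m c\<bar> \<le> cK (pw k))" for k a b a' b' :: 'n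
  obtain y A B where y: "MR y" "\<And>k. rv (A k) \<le> y" "\<And>k. y \<le> rv (B k)"
    "\<And>k. rv q0 \<le> rv (A k)" "\<And>k. rv (A k) < rv (B k)" "\<And>k. rv (B k) \<le> rv q1"
    "\<And>k. Sp k (A k) (B k) (A (k + 1)) (B (k + 1))"
  proof (rule nested[of Sp q0 q1])
    show "dP (\<lambda>x e. Sp (e 0) (e 1) (e 2) (e 3) (e 4))"
      unfolding Sp_def
      by (intro dP_ex dP_all dP_conj dP_imp dR_le dR_less dP_le dR_abs dR_diff dF dR_q dR_pw dN_var dN_const)
    show "rv q0 < rv q1" "rv q1 - rv q0 \<le> 1" unfolding rv_01 by simp_all
    fix k a b assume ab: "rv q0 \<le> rv a" "rv a < rv b" "rv b \<le> rv q1"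
    obtain a1 where a1: "rv a < rv a1" "rv a1 < rv b" using ab(2) by (rule ex_between)
    obtain b1 where b1: "rv a1 < rv b1" "rv b1 < rv b" using a1(2) by (rule ex_between)
    have "0 \<le> rv a1" "rv b1 \<le> 1" using ab a1 b1 unfolding rv_01 by linarith+
    then obtain a2 b2 m where 2: "rv a1 \<le> rv a2" "rv a2 < rv b2" "rv b2 \<le> rv b1"
      "\<And>n c. m \<le> n \<Longrightarrow> rv a2 \<le> rv c \<Longrightarrow> rv c \<le> rv b2 \<Longrightarrow> \<bar>Fq n c - Fq m c\<bar> \<le> cK (pw k)"
      using osc_small[OF _ b1(1), of k] by blast
    obtain a' b' where 3: "rv a2 \<le> rv a'" "rv a' < rv b'" "rv b' \<le> rv b2"
      "(rv b' - rv a') + (rv b' - rv a') \<le> rv b2 - rv a2"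
      using sub_near[OF 2(2) order_refl less_imp_le[OF 2(2)] zero_less_one] by blast
    have "Sp k a b a' b'" unfolding Sp_def
    proof (intro conjI exI[of _ m] allI impI)
      show "rv a < rv a'" "rv b' < rv b" using a1 b1 2 3 by linarith+
      show "\<bar>Fq n c - Fq m c\<bar> \<le> cK (pw k)" if "m \<le> n" "rv a' \<le> rv c \<and> rv c \<le> rv b'" for n c
        by (rule 2(4)) (use that 3 in linarith)+
    qed
    moreover have "rv a \<le> rv a'" "rv b' \<le> rv b" "(rv b' - rv a') + (rv b' - rv a') \<le> rv b - rv a"
      using a1 b1 2 3 by linarith+
    ultimately show "\<exists>a' b'. rv a \<le> rv a' \<and> rv a' < rv b' \<and> rv b' \<le> rv b \<and>
        (rv b' - rv a') + (rv b' - rv a') \<le> rv b - rv a \<and> Sp k a b a' b'"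
      using 3(2) by blast
  qed blast
  note y' = y(4,6)[unfolded rv_01]
  have "0 \<le> y" "y \<le> 1" using y(2)[of 0] y(3)[of 0] y'(1)[of 0] y'(2)[of 0] by linarith+
  then have uy: "unit y" using y(1) by (simp add: unit_def)
  have "\<exists>m. \<forall>z. unit z \<and> \<bar>y - z\<bar> < cK (pw m) \<longrightarrow> \<bar>f y - f z\<bar> < cK (pw k)" for k
  proof -
    \<comment> \<open>Three extra steps: the difference of \<open>f\<close> is estimated by two
      errors of at most \<open>2 * 2^-i\<close> and one below \<open>2^-i\<close>, five in all, and
      \<open>2^-k\<close> is eight times \<open>2^-i\<close>.\<close>
    define i where "i = k + 1 + 1 + 1"
    let ?a = "A (i + 1)" and ?b = "B (i + 1)"
    obtain m where m: "\<And>n c. m \<le> n \<Longrightarrow> rv ?a \<le> rv c \<Longrightarrow> rv c \<le> rv ?b \<Longrightarrow> \<bar>Fq n c - Fq m c\<bar> \<le> cK (pw i)"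
      using y(7)[of i] unfolding Sp_def by blast
    have int: "rv ?a < y" "y < rv ?b"
      using y(7)[of "i + 1"] y(2)[of "i + 1 + 1"] y(3)[of "i + 1 + 1"] unfolding Sp_def by linarith+
    \<comment> \<open>The estimate between \<open>F n\<close> and \<open>F m\<close> is known at
      rational points. Continuity carries it to \<open>z\<close> up to an arbitrary
      \<open>pw l\<close>, and convergence replaces \<open>F n z\<close> by \<open>f z\<close> at
      the cost of another \<open>pw i\<close>.\<close>
    have near: "\<bar>F m z - f z\<bar> \<le> cK (pw i) + cK (pw i)"
      if z: "unit z" "rv ?a \<le> z" "z \<le> rv ?b" for z
    proof (rule le_pw_R)
      fix l
      obtain m' where m': "\<And>n. m' \<le> n \<Longrightarrow> \<bar>F n z - f z\<bar> < cK (pw i)"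
        by (rule limF_eps[OF z(1) cK_pw_pos]) blast
      define n where "n = max m m'"
      have n: "m \<le> n" "m' \<le> n" by (simp_all add: n_def)
      obtain \<delta> where d: "0 < \<delta>" "\<And>w. unit w \<Longrightarrow> \<bar>z - w\<bar> < \<delta> \<Longrightarrow> \<bar>F n z - F n w\<bar> < cK (pw (l + 1))"
        by (rule contF_eps[OF z(1) cK_pw_pos]) blast
      obtain \<delta>' where d': "0 < \<delta>'" "\<And>w. unit w \<Longrightarrow> \<bar>z - w\<bar> < \<delta>' \<Longrightarrow> \<bar>F m z - F m w\<bar> < cK (pw (l + 1))"
        by (rule contF_eps[OF z(1) cK_pw_pos]) blast
      have "0 < min \<delta> \<delta>'" using d d' by simp
      then obtain c where c: "rv ?a \<le> rv c" "rv c \<le> rv ?b" "\<bar>z - rv c\<bar> < min \<delta> \<delta>'"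
        using rat_near[OF y(5) z(2,3)] by blast
      have uc: "unit (rv c)" "uq c = rv c"
        using unit_rv[of c] c(1,2) y'(1)[of "i + 1"] y'(2)[of "i + 1"] by linarith+
      have "\<bar>F n z - F n (rv c)\<bar> < cK (pw (l + 1))" "\<bar>F m z - F m (rv c)\<bar> < cK (pw (l + 1))"
        using d(2)[OF uc(1)] d'(2)[OF uc(1)] c(3) by simp_all
      moreover have "\<bar>F n (rv c) - F m (rv c)\<bar> \<le> cK (pw i)" using m[OF n(1) c(1,2)] uc(2) by simp
      ultimately show "\<bar>F m z - f z\<bar> \<le> cK (pw i) + cK (pw i) + cK (pw l)"
        using m'[OF n(2)] pw_Suc_R[of l] by linarith
    qed
    obtain \<delta> where d: "0 < \<delta>" "\<And>w. unit w \<Longrightarrow> \<bar>y - w\<bar> < \<delta> \<Longrightarrow> \<bar>F m y - F m w\<bar> < cK (pw i)"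
      by (rule contF_eps[OF uy cK_pw_pos]) blast
    have "0 < min \<delta> (min (y - rv ?a) (rv ?b - y))" using d(1) int by simp
    then obtain l where l: "cK (pw l) < min \<delta> (min (y - rv ?a) (rv ?b - y))" by (rule pw_arch_R)
    have "\<bar>f y - f z\<bar> < cK (pw k)" if z: "unit z" "\<bar>y - z\<bar> < cK (pw l)" for z
    proof -
      have "\<bar>y - z\<bar> < \<delta>" "rv ?a \<le> z" "z \<le> rv ?b" using z(2) l by (simp_all add: min_less_iff_conj) linarith+
      then show ?thesis using d(2)[OF z(1)] near[OF z(1)] near[OF uy less_imp_le[OF int(1)] less_imp_le[OF int(2)]]
          pw_Suc_R[of k] pw_Suc_R[of "k + 1"] pw_Suc_R[of "k + 1 + 1"]
        unfolding i_def[symmetric] by linarith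
    qed
    then show ?thesis by blast
  qed
  then show ?thesis using uy by blast
qed

end

section \<open>Oscillation\<close>

definition (in aca_num) lub :: "('n \<Rightarrow> bool) \<Rightarrow> 'n rr \<Rightarrow> bool" where
  "lub A s \<longleftrightarrow> (\<forall>c. rv c < s \<longleftrightarrow> (\<exists>a. A a \<and> qv c < qv a)) \<and> (\<forall>c. A c \<longrightarrow> rv c \<le> s) \<and>
     (\<forall>t. (\<forall>c. A c \<longrightarrow> rv c \<le> t) \<longrightarrow> s \<le> t)"

lemma (in aca_def) ex_lub:
  assumes "dP (\<lambda>x e. A (e 0))" "A a0" "\<And>c. A c \<Longrightarrow> rv c \<le> (b :: 'n rr)"
  shows "\<exists>s. lub A s"
proof (rule ex_sup[OF assms])
  fix s assume *: "\<And>c. A c \<Longrightarrow> rv c \<le> s" "\<And>c. rv c < s \<longleftrightarrow> (\<exists>a. A a \<and> qv c < qv a)"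
    "\<And>t. (\<And>c. A c \<Longrightarrow> rv c \<le> t) \<Longrightarrow> s \<le> t"
  have "s \<le> t" if "\<forall>c. A c \<longrightarrow> rv c \<le> t" for t by (rule *(3)) (use that in blast)
  then have "lub A s" unfolding lub_def using *(1,2) by blast
  then show ?thesis by blast
qed

context baire
begin

text \<open>Level \<open>i\<close> asks for a rational point only, for functions with index up to
  \<open>i\<close>, and with slack \<open>2^-i\<close>. So rationals near a true point pass every
  level, while bisection leads from points at all levels to a real \<open>y\<close> with
  \<open>F n y \<ge> r\<close> for all \<open>n \<ge> m\<close>. As \<open>r\<close> lies strictly
  above \<open>q\<close>, this weak inequality suffices.\<close>

definition exceeds :: "'n \<Rightarrow> 'n \<Rightarrow> 'n \<Rightarrow> bool" where
  "exceeds a b q \<longleftrightarrow> (\<exists>m r. rv q < rv r \<and> (\<forall>i. \<exists>c. rv a \<le> rv c \<and> rv c \<le> rv b \<and>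
     (\<forall>n. m \<le> n \<and> n \<le> i \<longrightarrow> rv r < Fq n c + cK (pw i))))"

text \<open>By compactness, the existence of a real at which \<open>f\<close> exceeds \<open>q\<close> is arithmetical.\<close>

lemma exceeds_iff:
  assumes ab: "0 \<le> rv a" "rv a < rv b" "rv b \<le> 1"
  shows "exceeds a b q \<longleftrightarrow> (\<exists>y. unit y \<and> rv a \<le> y \<and> y \<le> rv b \<and> rv q < f y)"
proof
  assume "exceeds a b q"
  then obtain m r where r: "rv q < rv r" and
    *: "\<And>i. \<exists>c. rv a \<le> rv c \<and> rv c \<le> rv b \<and> (\<forall>n. m \<le> n \<and> n \<le> i \<longrightarrow> rv r < Fq n c + cK (pw i))"
    unfolding exceeds_def by blast
  define good where "good a b \<longleftrightarrow> (\<forall>i. \<exists>c. rv a \<le> rv c \<and> rv c \<le> rv b \<and>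
     (\<forall>n. m \<le> n \<and> n \<le> i \<longrightarrow> rv r < Fq n c + cK (pw i)))" for a b
  define Sp where "Sp k a b a' b' \<longleftrightarrow> (good a b \<longrightarrow> good a' b')" for k a b a' b' :: 'n
  obtain y A B where y: "MR y" "A 0 = a" "B 0 = b" "\<And>k. rv (A k) \<le> y" "\<And>k. y \<le> rv (B k)"
    "\<And>k. rv a \<le> rv (A k)" "\<And>k. rv (A k) < rv (B k)" "\<And>k. rv (B k) \<le> rv b"
    "\<And>k. rv (B k) - rv (A k) \<le> cK (pw k)"
    "\<And>k. Sp k (A k) (B k) (A (k + 1)) (B (k + 1))"
    and dAB: "dN (\<lambda>x e. A (e 0))" "dN (\<lambda>x e. B (e 0))"
  proof (rule nested[of Sp a b])
    show "dP (\<lambda>x e. Sp (e 0) (e 1) (e 2) (e 3) (e 4))"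
      unfolding Sp_def good_def
      by (intro dP_ex dP_all dP_conj dP_imp dR_le dR_less dP_le dR_add dF dR_q dR_pw dN_var dN_const)
    show "rv a < rv b" "rv b - rv a \<le> 1" using ab by linarith+
    fix k a1 b1 assume 1: "rv a \<le> rv a1" "rv a1 < rv b1" "rv b1 \<le> rv b"
    obtain c where "qv c = (qv a1 + qv b1) / 2" by (rule qv_surj)
    then have "qv c + qv c = qv a1 + qv b1" by (simp add: field_simps)
    then have c: "rv c + rv c = rv a1 + rv b1" by (metis cK_hom(3))
    then have lt: "rv a1 < rv c" "rv c < rv b1" using 1(2) by linarith+
    \<comment> \<open>If the left half fails at level \<open>i\<close> and the right half at level
      \<open>j\<close>, no point passes level \<open>max i j\<close>, because passing a level
      implies passing all lower ones.\<close>
    have "good a1 c \<or> good c b1" if g: "good a1 b1"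
    proof (rule ccontr)
      assume "\<not> ?thesis"
      then obtain i j where i: "\<And>z. rv a1 \<le> rv z \<Longrightarrow> rv z \<le> rv c \<Longrightarrow>
            \<exists>n. m \<le> n \<and> n \<le> i \<and> \<not> rv r < Fq n z + cK (pw i)"
          and j: "\<And>z. rv c \<le> rv z \<Longrightarrow> rv z \<le> rv b1 \<Longrightarrow>
            \<exists>n. m \<le> n \<and> n \<le> j \<and> \<not> rv r < Fq n z + cK (pw j)"
        unfolding good_def by blast
      define l where "l = max i j"
      have l: "i \<le> l" "j \<le> l" by (simp_all add: l_def)
      have pwl: "cK (pw l) \<le> (cK (pw i) :: 'n rr)" "cK (pw l) \<le> (cK (pw j) :: 'n rr)"
        using l by (simp_all add: pw_mono)
      obtain z where z: "rv a1 \<le> rv z" "rv z \<le> rv b1"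
        "\<And>n. m \<le> n \<Longrightarrow> n \<le> l \<Longrightarrow> rv r < Fq n z + cK (pw l)"
        using g unfolding good_def by blast
      have 2: "rv r < Fq n z + cK (pw i)" if "m \<le> n" "n \<le> i" for n
        using z(3)[of n] that l pwl by (meson add_left_mono less_le_trans order_trans)
      have 3: "rv r < Fq n z + cK (pw j)" if "m \<le> n" "n \<le> j" for n
        using z(3)[of n] that l pwl by (meson add_left_mono less_le_trans order_trans)
      show False
      proof (cases "rv z \<le> rv c")
        case True
        then show False using i[OF z(1)] 2 by blast
      next
        case False
        then have "rv c \<le> rv z" by linarith
        then show False using j[OF _ z(2)] 3 by blast
      qed
    qed
    then consider "Sp k a1 b1 a1 c" | "Sp k a1 b1 c b1" unfolding Sp_def by blast
    then show "\<exists>a' b'. rv a1 \<le> rv a' \<and> rv a' < rv b' \<and> rv b' \<le> rv b1 \<and>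
        (rv b' - rv a') + (rv b' - rv a') \<le> rv b1 - rv a1 \<and> Sp k a1 b1 a' b'"
    proof cases
      case 1
      moreover have "(rv c - rv a1) + (rv c - rv a1) \<le> rv b1 - rv a1" using c by linarith
      ultimately show ?thesis using lt less_imp_le by blast
    next
      case 2
      moreover have "(rv b1 - rv c) + (rv b1 - rv c) \<le> rv b1 - rv a1" using c by linarith
      ultimately show ?thesis using lt less_imp_le by blast
    qed
  qed blast
  have good: "good (A k) (B k)" for k
  proof (rule induct_n[where P = "\<lambda>k. good (A k) (B k)"])
    have dA: "dN (\<lambda>x e. A (s x e))" if "dN s" for s
      using dN_sub2[of "\<lambda>x a b. A a", OF dAB(1) that that] .
    have dB: "dN (\<lambda>x e. B (s x e))" if "dN s" for s
      using dN_sub2[of "\<lambda>x a b. B a", OF dAB(2) that that] .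
    show "dP (\<lambda>x e. good (A (e 0)) (B (e 0)))"
      unfolding good_def
      by (intro dP_ex dP_all dP_conj dP_imp dR_le dR_less dP_le dR_add dF dR_q dR_pw dA dB dN_var dN_const)
    show "good (A 0) (B 0)" unfolding good_def y(2,3) using * by blast
    show "good (A (k + 1)) (B (k + 1))" if "good (A k) (B k)" for k
      using y(10)[of k] that by (simp add: Sp_def)
  qed
  have "0 \<le> y" "y \<le> 1" using y(4)[of 0] y(5)[of 0] y(6)[of 0] y(8)[of 0] ab by linarith+
  then have uy: "unit y" using y(1) by (simp add: unit_def)
  \<comment> \<open>A rational in a small interval around \<open>y\<close> passes level
    \<open>i\<close>, where \<open>i \<ge> n\<close> so that \<open>F n\<close> is among the
    functions tested; slack and continuity error are at most \<open>pw (l + 1)\<close> each.\<close>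
  have Fge: "rv r \<le> F n y" if n: "m \<le> n" for n
  proof (rule le_pw_R)
    fix l
    obtain \<delta> where d: "0 < \<delta>" "\<And>z. unit z \<Longrightarrow> \<bar>y - z\<bar> < \<delta> \<Longrightarrow> \<bar>F n y - F n z\<bar> < cK (pw (l + 1))"
      by (rule contF_eps[OF uy cK_pw_pos]) blast
    obtain k where k: "cK (pw k) < \<delta>" using pw_arch_R[OF d(1)] .
    define i where "i = max n (l + 1)"
    have i: "n \<le> i" "l + 1 \<le> i" by (simp_all add: i_def)
    obtain c where c: "rv (A k) \<le> rv c" "rv c \<le> rv (B k)" "rv r < Fq n c + cK (pw i)"
      using good[of k] n i(1) unfolding good_def by blast
    have uc: "unit (rv c)" "uq c = rv c" using unit_rv[of c] c(1,2) y(6)[of k] y(8)[of k] ab by linarith+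
    have "\<bar>y - rv c\<bar> < \<delta>" using c(1,2) y(4)[of k] y(5)[of k] y(9)[of k] k by linarith
    then have "\<bar>F n y - F n (rv c)\<bar> < cK (pw (l + 1))" using d(2)[OF uc(1)] by blast
    moreover have "cK (pw i) \<le> (cK (pw (l + 1)) :: 'n rr)" using i(2) by (simp add: pw_mono)
    ultimately show "rv r \<le> F n y + cK (pw l)" using c(3) pw_Suc_R[of l] unfolding uc(2) by linarith
  qed
  have "rv r \<le> f y"
  proof (rule le_pw_R)
    fix l
    obtain m' where m': "\<And>n. m' \<le> n \<Longrightarrow> \<bar>F n y - f y\<bar> < cK (pw l)"
      by (rule limF_eps[OF uy cK_pw_pos]) blast
    show "rv r \<le> f y + cK (pw l)" using m'[OF max.cobounded2, of m] Fge[OF max.cobounded1, of m'] by linarith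
  qed
  then show "\<exists>y. unit y \<and> rv a \<le> y \<and> y \<le> rv b \<and> rv q < f y"
    using uy r y(4)[of 0] y(5)[of 0] unfolding y(2,3) by (meson less_le_trans)
next
  assume "\<exists>y. unit y \<and> rv a \<le> y \<and> y \<le> rv b \<and> rv q < f y"
  then obtain y where y: "unit y" "rv a \<le> y" "y \<le> rv b" "rv q < f y" by blast
  obtain r where r: "rv q < rv r" "rv r < f y" using y(4) by (rule ex_between)
  have "0 < f y - rv r" using r by simp
  then obtain m where m: "\<And>n. m \<le> n \<Longrightarrow> \<bar>F n y - f y\<bar> < f y - rv r" by (rule limF_eps[OF y(1)]) blast
  have Fgt: "rv r < F n y" if "m \<le> n" for n using m[OF that] by linarith
  have dy: "dR (\<lambda>x e. y)" using y(1) by (intro dR_MR) (simp add: unit_def)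
  \<comment> \<open>One neighbourhood of \<open>y\<close> has to serve all indices from
    \<open>m\<close> to \<open>i\<close>. Since \<open>i\<close> may be nonstandard, this is no
    minimum over a finite set; it is proved by induction in the model, with \<open>P\<close>
    definable because it quantifies over numbers and rational points only.\<close>
  define P where "P i \<longleftrightarrow> (\<exists>l. \<forall>c. 0 \<le> rv c \<and> rv c \<le> 1 \<and> \<bar>y - rv c\<bar> < cK (pw l) \<longrightarrow>
      (\<forall>n. m \<le> n \<and> n \<le> i \<longrightarrow> rv r < Fq n c))" for i
  have near: "\<exists>l. \<forall>c. 0 \<le> rv c \<and> rv c \<le> 1 \<and> \<bar>y - rv c\<bar> < cK (pw l) \<longrightarrow> rv r < Fq n c" if n: "m \<le> n" for n
  proof -
    have "0 < F n y - rv r" using Fgt[OF n] by simp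
    then obtain \<delta> where d: "0 < \<delta>" "\<And>z. unit z \<Longrightarrow> \<bar>y - z\<bar> < \<delta> \<Longrightarrow> \<bar>F n y - F n z\<bar> < F n y - rv r"
      by (rule contF_eps[OF y(1)]) blast
    obtain l where l: "cK (pw l) < \<delta>" using pw_arch_R[OF d(1)] .
    have "rv r < Fq n c" if "0 \<le> rv c" "rv c \<le> 1" "\<bar>y - rv c\<bar> < cK (pw l)" for c
    proof -
      have "unit (rv c)" "uq c = rv c" using unit_rv[OF that(1,2)] by blast+
      then show ?thesis using d(2)[of "rv c"] that(3) l by simp
    qed
    then show ?thesis by blast
  qed
  have d0: "dR (\<lambda>x e. 0)" "dR (\<lambda>x e. 1)" using dR_q[OF dN_const, of q0] dR_q[OF dN_const, of q1] by (simp_all only: rv_01)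
  have P: "P i" for i
  proof (rule induct_n[where P = P])
    show "dP (\<lambda>x e. P (e 0))" unfolding P_def
      by (intro dP_ex dP_all dP_conj dP_imp dR_le dR_less dR_diff dR_abs dP_le dF dR_q dR_pw d0 dy dN_var dN_const)
    show "P 0"
    proof (cases "m = 0")
      case True
      then show ?thesis using near[of 0] unfolding P_def by (metis antisym)
    next
      case False
      then have "\<not> (m \<le> n \<and> n \<le> 0)" for n using nonneg_n[of m] by (metis antisym order_trans)
      then show ?thesis unfolding P_def by blast
    qed
    fix i assume "P i"
    then obtain l where l: "\<And>c n. 0 \<le> rv c \<Longrightarrow> rv c \<le> 1 \<Longrightarrow> \<bar>y - rv c\<bar> < cK (pw l) \<Longrightarrow> m \<le> n \<Longrightarrow> n \<le> i \<Longrightarrow>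
        rv r < Fq n c" unfolding P_def by blast
    show "P (i + 1)"
    proof (cases "m \<le> i + 1")
      case True
      then obtain l' where l': "\<And>c. 0 \<le> rv c \<Longrightarrow> rv c \<le> 1 \<Longrightarrow> \<bar>y - rv c\<bar> < cK (pw l') \<Longrightarrow> rv r < Fq (i + 1) c"
        using near by blast
      define j where "j = max l l'"
      have j: "cK (pw j) \<le> (cK (pw l) :: 'n rr)" "cK (pw j) \<le> (cK (pw l') :: 'n rr)"
        by (simp_all add: j_def pw_mono)
      have "rv r < Fq n c" if c: "0 \<le> rv c" "rv c \<le> 1" "\<bar>y - rv c\<bar> < cK (pw j)" and n: "m \<le> n" "n \<le> i + 1" for c n
      proof (cases "n = i + 1")
        case True
        then show ?thesis using l'[OF c(1,2) less_le_trans[OF c(3) j(2)]] by simp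
      next
        case False
        then have "n \<le> i" using n(2) less_Suc_iff[of n i] order.strict_iff_order[of n "i + 1"] by blast
        then show ?thesis using l[OF c(1,2) less_le_trans[OF c(3) j(1)] n(1)] by blast
      qed
      then show ?thesis unfolding P_def by blast
    next
      case False
      then have "\<not> (m \<le> n \<and> n \<le> i + 1)" for n by (meson order_trans)
      then show ?thesis unfolding P_def by blast
    qed
  qed
  have "\<exists>c. rv a \<le> rv c \<and> rv c \<le> rv b \<and> (\<forall>n. m \<le> n \<and> n \<le> i \<longrightarrow> rv r < Fq n c + cK (pw i))" for i
  proof -
    obtain l where l: "\<And>c n. 0 \<le> rv c \<Longrightarrow> rv c \<le> 1 \<Longrightarrow> \<bar>y - rv c\<bar> < cK (pw l) \<Longrightarrow> m \<le> n \<Longrightarrow> n \<le> i \<Longrightarrow>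
        rv r < Fq n c" using P[of i] unfolding P_def by blast
    obtain c where c: "rv a \<le> rv c" "rv c \<le> rv b" "\<bar>y - rv c\<bar> < cK (pw l)"
      by (rule rat_near[OF ab(2) y(2,3) cK_pw_pos]) blast
    have "0 \<le> rv c" "rv c \<le> 1" using c ab by linarith+
    then have "rv r < Fq n c + cK (pw i)" if "m \<le> n" "n \<le> i" for n
      using l[OF _ _ c(3) that] cK_pw_pos[of i] by linarith
    then show ?thesis using c(1,2) by blast
  qed
  then show "exceeds a b q" unfolding exceeds_def using r(1) by blast
qed

text \<open>The points of the ball with centre \<open>\<xi>\<close> and radius \<open>2\<^sup>-\<^sup>k\<close> are those \<open>y\<close> with
  \<open>unit y\<close> and \<open>\<bar>\<xi> - y\<bar> < cK (pw k)\<close>.\<close>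

definition ball_gt :: "'n rr \<Rightarrow> 'n \<Rightarrow> 'n \<Rightarrow> bool" where
  "ball_gt \<xi> k q \<longleftrightarrow> (\<exists>y. unit y \<and> \<bar>\<xi> - y\<bar> < cK (pw k) \<and> rv q < f y)"

text \<open>The ball is exhausted by closed rational intervals, to which \<open>exceeds_iff\<close>
  applies. A point at an end of the unit interval must also be an end of such an interval, hence the
  case distinctions on \<open>y = 0\<close> and \<open>y = 1\<close>.\<close>

lemma ball_gt_iff:
  assumes \<xi>: "unit \<xi>"
  shows "ball_gt \<xi> k q \<longleftrightarrow> (\<exists>a b. 0 \<le> rv a \<and> rv a < rv b \<and> rv b \<le> 1 \<and> \<xi> - cK (pw k) < rv a \<and>
    rv b < \<xi> + cK (pw k) \<and> exceeds a b q)" (is "_ \<longleftrightarrow> ?R")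
proof
  assume "ball_gt \<xi> k q"
  then obtain y where y: "unit y" "\<bar>\<xi> - y\<bar> < cK (pw k)" "rv q < f y" unfolding ball_gt_def by blast
  have y01: "0 \<le> y" "y \<le> 1" using y(1) by (simp_all add: unit_def)
  have "\<exists>a. 0 \<le> rv a \<and> rv a \<le> y \<and> \<xi> - cK (pw k) < rv a \<and> (y = 0 \<or> rv a < y)"
  proof (cases "y = 0")
    case True
    have "\<xi> - cK (pw k) < 0" using y(2) True by linarith
    then show ?thesis using True by (intro exI[of _ q0]) (simp only: rv_01, simp)
  next
    case False
    then have "max 0 (\<xi> - cK (pw k)) < y" using y01 y(2) by (simp add: less_le) linarith
    then obtain a where "max 0 (\<xi> - cK (pw k)) < rv a" "rv a < y" by (rule ex_between)
    then show ?thesis by (intro exI[of _ a]) auto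
  qed
  then obtain a where a: "0 \<le> rv a" "rv a \<le> y" "\<xi> - cK (pw k) < rv a" "y = 0 \<or> rv a < y" by blast
  have "\<exists>b. rv b \<le> 1 \<and> y \<le> rv b \<and> rv b < \<xi> + cK (pw k) \<and> (y = 1 \<or> y < rv b)"
  proof (cases "y = 1")
    case True
    have "1 < \<xi> + cK (pw k)" using y(2) True by linarith
    then show ?thesis using True by (intro exI[of _ q1]) (simp only: rv_01, simp)
  next
    case False
    then have "y < min 1 (\<xi> + cK (pw k))" using y01 y(2) by (simp add: less_le) linarith
    then obtain b where "y < rv b" "rv b < min 1 (\<xi> + cK (pw k))" by (rule ex_between)
    then show ?thesis by (intro exI[of _ b]) auto
  qed
  then obtain b where b: "rv b \<le> 1" "y \<le> rv b" "rv b < \<xi> + cK (pw k)" "y = 1 \<or> y < rv b" by blast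
  have "rv a < rv b" using a(2,4) b(2,4) zero_less_one[where 'a = "'n rr"] by (metis le_less_trans less_le_trans)
  then show ?R using exceeds_iff[OF a(1) _ b(1), of q] a b y by blast
next
  assume ?R
  then obtain a b where ab: "0 \<le> rv a" "rv a < rv b" "rv b \<le> 1" "\<xi> - cK (pw k) < rv a"
    "rv b < \<xi> + cK (pw k)" "exceeds a b q" by blast
  then obtain y where y: "unit y" "rv a \<le> y" "y \<le> rv b" "rv q < f y" using exceeds_iff by blast
  moreover have "\<bar>\<xi> - y\<bar> < cK (pw k)" using y(2,3) ab(4,5) by linarith
  ultimately show "ball_gt \<xi> k q" unfolding ball_gt_def by blast
qed

text \<open>Boundedness above only; boundedness below is the same notion for
  \<open>- f\<close>.\<close>

definition ball_bdd :: "'n rr \<Rightarrow> 'n \<Rightarrow> bool" where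
  "ball_bdd \<xi> k \<longleftrightarrow> (\<exists>b. \<not> ball_gt \<xi> k b)"

definition is_ball_sup :: "'n rr \<Rightarrow> 'n \<Rightarrow> 'n rr \<Rightarrow> bool" where
  "is_ball_sup \<xi> k s \<longleftrightarrow> (\<forall>y. unit y \<and> \<bar>\<xi> - y\<bar> < cK (pw k) \<longrightarrow> f y \<le> s) \<and>
     (\<forall>t. (\<forall>y. unit y \<and> \<bar>\<xi> - y\<bar> < cK (pw k) \<longrightarrow> f y \<le> t) \<longrightarrow> s \<le> t)"

definition ball_sup :: "'n rr \<Rightarrow> 'n \<Rightarrow> 'n rr" where
  "ball_sup \<xi> k = (if ball_bdd \<xi> k then SOME s. \<forall>c. rv c < s \<longleftrightarrow> ball_gt \<xi> k c else 0)"

lemma ball_bdd_iff: "ball_bdd \<xi> k \<longleftrightarrow> (\<exists>s. MR s \<and> (\<forall>y. unit y \<and> \<bar>\<xi> - y\<bar> < cK (pw k) \<longrightarrow> f y \<le> s))"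
proof
  assume "ball_bdd \<xi> k"
  then obtain b where "\<not> ball_gt \<xi> k b" unfolding ball_bdd_def by blast
  then show "\<exists>s. MR s \<and> (\<forall>y. unit y \<and> \<bar>\<xi> - y\<bar> < cK (pw k) \<longrightarrow> f y \<le> s)"
    unfolding ball_gt_def by (intro exI[of _ "rv b"] conjI MR_q) (auto simp: not_less)
next
  assume "\<exists>s. MR s \<and> (\<forall>y. unit y \<and> \<bar>\<xi> - y\<bar> < cK (pw k) \<longrightarrow> f y \<le> s)"
  then obtain s where s: "\<And>y. unit y \<Longrightarrow> \<bar>\<xi> - y\<bar> < cK (pw k) \<Longrightarrow> f y \<le> s" by blast
  obtain b where "s < rv b" by (rule ex_above)
  then have "\<not> ball_gt \<xi> k b" unfolding ball_gt_def using s by (meson less_asym less_le_trans not_less)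
  then show "ball_bdd \<xi> k" unfolding ball_bdd_def by blast
qed

lemma ball_gt_self: "unit \<xi> \<Longrightarrow> rv c < f \<xi> \<Longrightarrow> ball_gt \<xi> k c"
  unfolding ball_gt_def by (intro exI[of _ \<xi>]) simp

text \<open>The predicate \<open>ball_gt \<xi> k\<close> is closed downwards and has no greatest
  element, so it equals the lower cut of its supremum. As it is arithmetical in the centre, the
  supremum becomes definable uniformly.\<close>

lemma ball_sup_cut:
  assumes \<xi>: "unit \<xi>" and b: "ball_bdd \<xi> k"
  shows "rv c < ball_sup \<xi> k \<longleftrightarrow> ball_gt \<xi> k c"
proof -
  have d\<xi>: "dR (\<lambda>x e. \<xi>)" using \<xi> by (intro dR_MR) (simp add: unit_def)
  have d0: "dR (\<lambda>x e. 0)" "dR (\<lambda>x e. 1)" using dR_q[OF dN_const, of q0] dR_q[OF dN_const, of q1] by (simp_all only: rv_01)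
  have dA: "dP (\<lambda>x e. ball_gt \<xi> k (e 0))"
    unfolding ball_gt_iff[OF \<xi>] exceeds_def
    by (intro dP_ex dP_all dP_conj dP_imp dR_le dR_less dR_diff dR_add dP_le dF dR_q dR_pw d0 d\<xi> dN_var dN_const)
  obtain a0 where "rv a0 < f \<xi>" by (rule ex_below)
  then have a0: "ball_gt \<xi> k a0" using \<xi> by (rule ball_gt_self[rotated])
  obtain b' where b': "\<not> ball_gt \<xi> k b'" using b unfolding ball_bdd_def by blast
  have ub: "rv c \<le> rv b'" if c: "ball_gt \<xi> k c" for c
  proof (rule ccontr)
    assume "\<not> rv c \<le> rv b'"
    then have "rv b' < rv c" by (simp only: not_le)
    then show False using c b' unfolding ball_gt_def by (meson less_trans)
  qed
  obtain s where s: "\<forall>c. rv c < s \<longleftrightarrow> (\<exists>a. ball_gt \<xi> k a \<and> qv c < qv a)"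
    using ex_lub[of "ball_gt \<xi> k", OF dA a0 ub] unfolding lub_def by blast
  have "(\<exists>a. ball_gt \<xi> k a \<and> qv c < qv a) \<longleftrightarrow> ball_gt \<xi> k c" for c
  proof
    assume "\<exists>a. ball_gt \<xi> k a \<and> qv c < qv a"
    then obtain a where a: "ball_gt \<xi> k a" "rv c < rv a" by auto
    then show "ball_gt \<xi> k c" unfolding ball_gt_def by (meson less_trans)
  next
    assume "ball_gt \<xi> k c"
    then obtain y where y: "unit y" "\<bar>\<xi> - y\<bar> < cK (pw k)" "rv c < f y" unfolding ball_gt_def by blast
    obtain a where "rv c < rv a" "rv a < f y" using y(3) by (rule ex_between)
    then show "\<exists>a. ball_gt \<xi> k a \<and> qv c < qv a" using y(1,2) unfolding ball_gt_def by auto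
  qed
  then have "\<forall>c. rv c < s \<longleftrightarrow> ball_gt \<xi> k c" using s by simp
  then have "\<forall>c. rv c < (SOME s. \<forall>c. rv c < s \<longleftrightarrow> ball_gt \<xi> k c) \<longleftrightarrow> ball_gt \<xi> k c"
    by (rule someI)
  then show ?thesis using b by (simp add: ball_sup_def)
qed

lemma ball_sup: assumes \<xi>: "unit \<xi>" and b: "ball_bdd \<xi> k" shows "is_ball_sup \<xi> k (ball_sup \<xi> k)"
  unfolding is_ball_sup_def
proof (intro conjI allI impI)
  note cut = ball_sup_cut[OF assms]
  fix y assume y: "unit y \<and> \<bar>\<xi> - y\<bar> < cK (pw k)"
  show "f y \<le> ball_sup \<xi> k"
  proof (rule ccontr)
    assume "\<not> ?thesis"
    then have "ball_sup \<xi> k < f y" by simp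
    then obtain c where c: "ball_sup \<xi> k < rv c" "rv c < f y" by (rule ex_between)
    then have "ball_gt \<xi> k c" using y unfolding ball_gt_def by blast
    then show False using cut c(1) by (meson less_asym)
  qed
next
  note cut = ball_sup_cut[OF assms]
  fix t assume t: "\<forall>y. unit y \<and> \<bar>\<xi> - y\<bar> < cK (pw k) \<longrightarrow> f y \<le> t"
  show "ball_sup \<xi> k \<le> t"
  proof (rule ccontr)
    assume "\<not> ?thesis"
    then have "t < ball_sup \<xi> k" by simp
    then obtain c where c: "t < rv c" "rv c < ball_sup \<xi> k" by (rule ex_between)
    then obtain y where "unit y" "\<bar>\<xi> - y\<bar> < cK (pw k)" "rv c < f y" using cut unfolding ball_gt_def by blast
    then show False using t c(1) by (meson less_asym less_le_trans)
  qed
qed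

lemma ball_sup_ge: assumes "unit \<xi>" "ball_bdd \<xi> k" shows "f \<xi> \<le> ball_sup \<xi> k"
proof -
  have "\<forall>y. unit y \<and> \<bar>\<xi> - y\<bar> < cK (pw k) \<longrightarrow> f y \<le> ball_sup \<xi> k"
    using ball_sup[OF assms] unfolding is_ball_sup_def by (rule conjunct1)
  from this[rule_format, of \<xi>] show ?thesis using assms(1) by simp
qed

lemma ball_mono:
  assumes "k \<le> k'" "ball_bdd \<xi> k"
  shows "ball_bdd \<xi> k'" "unit \<xi> \<Longrightarrow> ball_sup \<xi> k' \<le> ball_sup \<xi> k"
proof -
  have "cK (pw k') \<le> (cK (pw k) :: 'n rr)" using assms(1) by (simp add: pw_mono)
  then have sub: "\<bar>\<xi> - y\<bar> < cK (pw k)" if "\<bar>\<xi> - y\<bar> < cK (pw k')" for y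
    using that by (rule less_le_trans[rotated])
  obtain b0 where "\<not> ball_gt \<xi> k b0" using assms(2) unfolding ball_bdd_def by blast
  then have "\<not> ball_gt \<xi> k' b0" using sub unfolding ball_gt_def by blast
  then show b: "ball_bdd \<xi> k'" unfolding ball_bdd_def by blast
  show "ball_sup \<xi> k' \<le> ball_sup \<xi> k" if "unit \<xi>"
  proof -
    have "\<forall>y. unit y \<and> \<bar>\<xi> - y\<bar> < cK (pw k) \<longrightarrow> f y \<le> ball_sup \<xi> k"
      using ball_sup[OF that assms(2)] unfolding is_ball_sup_def by (rule conjunct1)
    then have "\<forall>y. unit y \<and> \<bar>\<xi> - y\<bar> < cK (pw k') \<longrightarrow> f y \<le> ball_sup \<xi> k" using sub by blast
    then show ?thesis using ball_sup[OF that b] unfolding is_ball_sup_def by blast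
  qed
qed

end

section \<open>Oscillation as a definable function of the centre\<close>

locale baire_unit = baire D ap cn ls num X F f
  for D :: "ty \<Rightarrow> 'u set" and ap (infixl \<open>\<bullet>\<close> 90) and cn ls
    and num :: "'n::linordered_semidom \<Rightarrow> 'u" and X F f +
  assumes X_eq: "X = {u \<in> D T1. isr (fn u) \<and> unit (val (fn u))}"
begin

lemma X_unit: "x \<in> X \<Longrightarrow> isr (fn x) \<and> unit (val (fn x))"
  using X_eq by blast

lemma baire_unit_uminus: "baire_unit D (\<bullet>) cn ls num X (\<lambda>n y. - F n y) (\<lambda>y. - f y)"
  by (intro baire_unit.intro baire_uminus baire_unit_axioms.intro X_eq)

lemma dR_x: "dR (\<lambda>x e. val (fn x))"
  by (rule dR_val[of "\<lambda>x e. fn x"]) (use X_unit in \<open>auto intro: dN_x dN_var\<close>)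

lemma dP_ball_gt: "dN s \<Longrightarrow> dN t \<Longrightarrow> dP (\<lambda>x e. ball_gt (val (fn x)) (s x e) (t x e))"
proof -
  assume st: "dN s" "dN t"
  have d0: "dR (\<lambda>x e. 0)" "dR (\<lambda>x e. 1)" using dR_q[OF dN_const, of q0] dR_q[OF dN_const, of q1] by (simp_all only: rv_01)
  have "dP (\<lambda>x e. \<exists>a b. 0 \<le> rv a \<and> rv a < rv b \<and> rv b \<le> 1 \<and> val (fn x) - cK (pw (e 0)) < rv a \<and>
      rv b < val (fn x) + cK (pw (e 0)) \<and> exceeds a b (e 1))"
    unfolding exceeds_def
    by (intro dP_ex dP_all dP_conj dP_imp dR_le dR_less dR_diff dR_add dP_le dF dR_q dR_pw d0 dR_x dN_var dN_const)
  then have "dP (\<lambda>x e. ball_gt (val (fn x)) (e 0) (e 1))"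
    by (rule dP_cong) (simp add: ball_gt_iff X_unit)
  from dP_sub3[of "\<lambda>x a b c. ball_gt (val (fn x)) a b", OF this st st(1)] show ?thesis .
qed

lemma dP_ball_bdd: "dN s \<Longrightarrow> dP (\<lambda>x e. ball_bdd (val (fn x)) (s x e))"
proof -
  assume s: "dN s"
  have "dP (\<lambda>x e. ball_bdd (val (fn x)) (e 0))"
    unfolding ball_bdd_def by (intro dP_ex dP_not dP_ball_gt dN_var)
  from dP_sub1[of "\<lambda>x a. ball_bdd (val (fn x)) a", OF this s] show ?thesis .
qed

lemma dR_ball_sup: "dN s \<Longrightarrow> dR (\<lambda>x e. ball_sup (val (fn x)) (s x e))"
proof -
  assume s: "dN s"
  have d0: "dR (\<lambda>x e. 0)" using dR_q[OF dN_const, of q0] by (simp only: rv_01)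
  have iff: "rv c < ball_sup (val (fn x)) k \<longleftrightarrow> ball_bdd (val (fn x)) k \<and> ball_gt (val (fn x)) k c \<or>
      \<not> ball_bdd (val (fn x)) k \<and> rv c < 0" if "x \<in> X" for x k c
  proof (cases "ball_bdd (val (fn x)) k")
    case True
    then show ?thesis using ball_sup_cut[of "val (fn x)" k c] X_unit[OF that] by simp
  qed (simp add: ball_sup_def)
  have "dP (\<lambda>x e. ball_bdd (val (fn x)) (s x (\<lambda>i. e (i + 1))) \<and> ball_gt (val (fn x)) (s x (\<lambda>i. e (i + 1))) (e 0) \<or>
      \<not> ball_bdd (val (fn x)) (s x (\<lambda>i. e (i + 1))) \<and> rv (e 0) < 0)"
    by (intro dP_disj dP_conj dP_not dP_ball_gt dP_ball_bdd dN_shift s dN_var dR_less dR_q d0)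
  then show ?thesis unfolding dR_def by (rule dP_cong) (simp only: iff)
qed

text \<open>With infima expressed through \<open>- f\<close>, the oscillation on a ball is a sum of
  two suprema. It does not increase as the ball shrinks, so the limit is an infimum, obtained as the
  supremum of the rationals strictly below all finite values (\<open>low\<close>). Finiteness passes
  to smaller balls; so either no ball has finite oscillation or all sufficiently small ones
  do.\<close>

theorem oscillation:
  fixes infinite :: "'n rr \<Rightarrow> bool" and L :: "'n rr \<Rightarrow> 'n \<Rightarrow> bool" and i :: "'n rr \<Rightarrow> 'n \<Rightarrow> 'n rr"
  defines "L \<equiv> baire.ball_bdd D (\<bullet>) cn num (\<lambda>y. - f y)" and "i \<equiv> baire.ball_sup D (\<bullet>) cn num (\<lambda>y. - f y)"
  defines "infinite \<equiv> \<lambda>\<xi>. \<forall>k. \<not> (ball_bdd \<xi> k \<and> L \<xi> k)"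
  obtains G where "dR (\<lambda>x e. G (val (fn x)))" "dP (\<lambda>x e. infinite (val (fn x)))"
    "\<And>\<xi> j. unit \<xi> \<Longrightarrow> \<not> infinite \<xi> \<Longrightarrow> \<exists>m. \<forall>k\<ge>m. ball_bdd \<xi> k \<and> L \<xi> k \<and>
      \<bar>(ball_sup \<xi> k + i \<xi> k) - G \<xi>\<bar> < cK (pw j)"
proof -
  interpret N: baire_unit D "(\<bullet>)" cn ls num X "\<lambda>n y. - F n y" "\<lambda>y. - f y" by (rule baire_unit_uminus)
  define fin where "fin \<xi> k \<longleftrightarrow> ball_bdd \<xi> k \<and> L \<xi> k" for \<xi> k
  define osc where "osc \<xi> k = ball_sup \<xi> k + i \<xi> k" for \<xi> k
  have dfin: "dP (\<lambda>x e. fin (val (fn x)) (s x e))" if "dN s" for s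
    unfolding fin_def L_def by (intro dP_conj dP_ball_bdd N.dP_ball_bdd that)
  have dosc: "dR (\<lambda>x e. osc (val (fn x)) (s x e))" if "dN s" for s
    unfolding osc_def i_def by (intro dR_add dR_ball_sup N.dR_ball_sup that)
  have dinf: "dP (\<lambda>x e. infinite (val (fn x)))"
    unfolding infinite_def fin_def[symmetric] by (intro dP_all dP_not dfin dN_var)
  have osc0: "0 \<le> osc \<xi> k" if "unit \<xi>" "fin \<xi> k" for \<xi> k
    using ball_sup_ge[of \<xi> k] N.ball_sup_ge[of \<xi> k] that unfolding fin_def osc_def L_def i_def by simp
  have mono: "fin \<xi> k' \<and> osc \<xi> k' \<le> osc \<xi> k" if "unit \<xi>" "fin \<xi> k" "k \<le> k'" for \<xi> k k'
    using ball_mono[OF that(3), of \<xi>] N.ball_mono[OF that(3), of \<xi>] that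
    unfolding fin_def osc_def L_def i_def by (simp add: add_mono)
  define low where "low \<xi> c \<longleftrightarrow> (\<forall>k. fin \<xi> k \<longrightarrow> rv c < osc \<xi> k)" for \<xi> c
  have "dP (\<lambda>x e. low (val (fn x)) (e 0))"
    unfolding low_def by (intro dP_all dP_imp dfin dR_less dR_q dosc dN_var)
  from dP_sub1[of "\<lambda>x a. low (val (fn x)) a", OF this]
  have dlow: "dP (\<lambda>x e. low (val (fn x)) (s x e))" if "dN s" for s using that .
  define lim where "lim \<xi> v \<longleftrightarrow> lub (low \<xi>) v" for \<xi> v
  have ex: "\<exists>v. lim \<xi> v" if \<xi>: "unit \<xi>" and k: "fin \<xi> k" for \<xi> k
  proof -
    obtain x where x: "x \<in> X" "val (fn x) = \<xi>"
      using \<xi> unfolding X_eq by (auto simp: unit_def MR_def)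
    have d: "dP (\<lambda>x e. low \<xi> (e 0))" using dP_inst[OF dlow[OF dN_var] x(1)] unfolding x(2) .
    obtain a0 where "rv a0 < 0" by (rule ex_below)
    then have a0: "low \<xi> a0" unfolding low_def using osc0[OF \<xi>] less_le_trans by blast
    have ub: "rv c \<le> osc \<xi> k" if "low \<xi> c" for c
      using that k unfolding low_def by (blast intro: less_imp_le)
    obtain s where "lub (low \<xi>) s" using ex_lub[of "low \<xi>", OF d a0 ub] by blast
    then show ?thesis unfolding lim_def by blast
  qed
  \<comment> \<open>At points of infinite oscillation the value 0 is a placeholder, which keeps the
    cut definable.\<close>
  define G where "G \<xi> = (if infinite \<xi> then 0 else SOME v. lim \<xi> v)" for \<xi>
  have G: "lim \<xi> (G \<xi>)" if \<xi>: "unit \<xi>" "\<not> infinite \<xi>" for \<xi>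
  proof -
    have "\<exists>v. lim \<xi> v" using that ex[OF \<xi>(1)] unfolding infinite_def fin_def by blast
    then show ?thesis using that(2) someI_ex[of "lim \<xi>"] by (simp add: G_def)
  qed
  have d0: "dR (\<lambda>x e. 0)" using dR_q[OF dN_const, of q0] by (simp only: rv_01)
  have "dP (\<lambda>x e. \<not> infinite (val (fn x)) \<and> (\<exists>a. low (val (fn x)) a \<and> qv (e 0) < qv a) \<or>
      infinite (val (fn x)) \<and> rv (e 0) < 0)"
    by (intro dP_disj dP_conj dP_not dinf dP_ex dlow dP_qless dR_less dR_q d0 dN_var)
  then have dG: "dR (\<lambda>x e. G (val (fn x)))"
    unfolding dR_def
  proof (rule dP_cong)
    fix x e assume x: "x \<in> X"
    show "(\<not> infinite (val (fn x)) \<and> (\<exists>a. low (val (fn x)) a \<and> qv (fn e 0) < qv a) \<or>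
        infinite (val (fn x)) \<and> rv (fn e 0) < 0) \<longleftrightarrow> rv (fn e 0) < G (val (fn x))"
    proof (cases "infinite (val (fn x))")
      case False
      then show ?thesis using G[of "val (fn x)"] X_unit[OF x] unfolding lim_def lub_def by blast
    qed (simp add: G_def)
  qed
  show ?thesis
  proof (rule that[OF dG dinf])
    fix \<xi> j assume \<xi>: "unit \<xi>" "\<not> infinite \<xi>"
    note lim = G[OF \<xi>, unfolded lim_def lub_def]
    have "\<exists>k1. fin \<xi> k1 \<and> osc \<xi> k1 < G \<xi> + cK (pw j)"
    proof (rule ccontr)
      assume *: "\<nexists>k1. fin \<xi> k1 \<and> osc \<xi> k1 < G \<xi> + cK (pw j)"
      have "G \<xi> < G \<xi> + cK (pw j)" by simp
      then obtain c where c: "G \<xi> < rv c" "rv c < G \<xi> + cK (pw j)" by (rule ex_between)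
      have "low \<xi> c" unfolding low_def using * c(2) by (meson less_le_trans not_less)
      then show False using lim c(1) by (meson not_less)
    qed
    then obtain m where m: "fin \<xi> m" "osc \<xi> m < G \<xi> + cK (pw j)" by blast
    have "ball_bdd \<xi> k \<and> L \<xi> k \<and> \<bar>(ball_sup \<xi> k + i \<xi> k) - G \<xi>\<bar> < cK (pw j)" if "m \<le> k" for k
    proof -
      have k: "fin \<xi> k" "osc \<xi> k \<le> osc \<xi> m" using mono[OF \<xi>(1) m(1) that] by simp_all
      have "G \<xi> \<le> osc \<xi> k" using lim k(1) unfolding low_def by (meson less_imp_le)
      then have "\<bar>osc \<xi> k - G \<xi>\<bar> < cK (pw j)" using m(2) k(2) by linarith
      then show ?thesis using k(1) unfolding fin_def osc_def by blast
    qed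
    then show "\<exists>m. \<forall>k\<ge>m. ball_bdd \<xi> k \<and> L \<xi> k \<and> \<bar>(ball_sup \<xi> k + i \<xi> k) - G \<xi>\<bar> < cK (pw j)"
      by blast
  qed
qed

end

section \<open>The meaning of the formulas\<close>

context aca_num
begin

definition dec :: "'n \<Rightarrow> 'n \<times> 'n \<times> 'n" where
  "dec c = (if vc c then SOME (p, m, d). 0 < d \<and> c = pr (pr p m) d else (0, 0, 1))"

abbreviation "cp c \<equiv> fst (dec c)"
abbreviation "cm c \<equiv> fst (snd (dec c))"
abbreviation "cd c \<equiv> snd (snd (dec c))"

lemma dec_pr: "0 < d \<Longrightarrow> dec (pr (pr p m) d) = (p, m, d)"
proof -
  assume d: "0 < d"
  then have "vc (pr (pr p m) d)" by (auto simp: vc_def)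
  moreover have "(SOME (p', m', d'). 0 < d' \<and> pr (pr p m) d = pr (pr p' m') d') = (p, m, d)"
    by (rule some_equality) (use d in auto)
  ultimately show ?thesis by (simp add: dec_def)
qed

lemma dec_frac [simp]: "0 < cd c" "frac (cp c) (cm c) (cd c) = qv c"
proof -
  have "0 < cd c \<and> frac (cp c) (cm c) (cd c) = qv c"
  proof (cases "vc c")
    case True
    then obtain p m d where "0 < d" "c = pr (pr p m) d" by (auto simp: vc_def)
    then show ?thesis by (simp add: dec_pr)
  qed (simp add: dec_def qv_invalid frac_def kn_hom)
  then show "0 < cd c" "frac (cp c) (cm c) (cd c) = qv c" by blast+
qed

abbreviation upd3 :: "(nat \<times> ty \<Rightarrow> 'u) \<Rightarrow> nat \<Rightarrow> 'n \<Rightarrow> nat \<times> ty \<Rightarrow> 'u" where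
  "upd3 e n c \<equiv> e((n, Num) := num (cp c), (Suc n, Num) := num (cm c), (Suc (Suc n), Num) := num (cd c))"

abbreviation psh3 :: "(nat \<Rightarrow> 'u) \<Rightarrow> 'n \<Rightarrow> nat \<Rightarrow> 'u" where
  "psh3 b c \<equiv> case_nat (num (cd c)) (case_nat (num (cm c)) (case_nat (num (cp c)) b))"

abbreviation fre3 :: "nat \<Rightarrow> quot" where
  "fre3 n \<equiv> (Free n Num, Free (Suc n) Num, Free (Suc (Suc n)) Num)"

text \<open>Pairing is injective, so the three quantifiers of \<open>with_rat\<close> have at most
  one witness, found by \<open>dec\<close>: they amount to a test for validity and an assignment to
  three further variables.\<close>

lemma sat_with_rat:
  assumes "ok n q" "teval b e q = num c"
  shows "sat b e (with_rat q Q n) \<longleftrightarrow> vc c \<and> sat (psh3 b c) (upd3 e n c) (Q (fre3 n) (Suc (Suc (Suc n))))"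
proof -
  have eq: "num a = pl (ti (pl (num i) (num j)) (pl (num i) (num j))) (num i) \<longleftrightarrow> a = pr i j" for a i j
    by (simp add: pr_def flip: num_pl num_ti)
  have eq': "pl (ti (pl (num i) (num j)) (pl (num i) (num j))) (num i) = num (pr i j)" for i j
    by (simp add: pr_def num_pl num_ti)
  show ?thesis
    unfolding with_rat_def pair_def
    by (auto simp: sat_form assms eq' bex_Num num_ls vc_def dec_pr simp flip: num_zero)
qed

definition qok :: "(nat \<Rightarrow> 'u) \<Rightarrow> (nat \<times> ty \<Rightarrow> 'u) \<Rightarrow> quot \<Rightarrow> bool" where
  "qok b e q \<longleftrightarrow> (case q of (p, m, d) \<Rightarrow> \<exists>i j k. teval b e p = num i \<and> teval b e m = num j \<and>
     teval b e d = num k \<and> 0 < k)"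

definition qval :: "(nat \<Rightarrow> 'u) \<Rightarrow> (nat \<times> ty \<Rightarrow> 'u) \<Rightarrow> quot \<Rightarrow> 'n kk" where
  "qval b e q = (case q of (p, m, d) \<Rightarrow>
     frac (inv num (teval b e p)) (inv num (teval b e m)) (inv num (teval b e d)))"

lemma qokE:
  assumes "qok b e q"
  obtains p m d i j k where "q = (p, m, d)" "teval b e p = num i" "teval b e m = num j"
    "teval b e d = num k" "0 < k"
  using assms by (cases q) (auto simp: qok_def)

lemma sat_q:
  assumes "qok b e q" "qok b e r"
  shows "sat b e (qless q r n) \<longleftrightarrow> qval b e q < qval b e r"
    "sat b e (qle q r n) \<longleftrightarrow> qval b e q \<le> qval b e r"
proof -
  obtain p m d i j k where q: "q = (p, m, d)" "teval b e p = num i" "teval b e m = num j"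
    "teval b e d = num k" "0 < k" by (rule qokE[OF assms(1)])
  obtain p' m' d' i' j' k' where r: "r = (p', m', d')" "teval b e p' = num i'" "teval b e m' = num j'"
    "teval b e d' = num k'" "0 < k'" by (rule qokE[OF assms(2)])
  show "sat b e (qless q r n) \<longleftrightarrow> qval b e q < qval b e r"
    "sat b e (qle q r n) \<longleftrightarrow> qval b e q \<le> qval b e r"
    by (simp_all add: q r sat_form qval_def num_ls frac_less frac_le le_less[symmetric]
        num_pl[symmetric] num_ti[symmetric])
qed

lemma qval_simps:
  assumes "qok b e q" "qok b e r"
  shows "qok b e (qadd q r)" "qval b e (qadd q r) = qval b e q + qval b e r"
    "qok b e (qneg q)" "qval b e (qneg q) = - qval b e q"
proof -
  obtain p m d i j k where q: "q = (p, m, d)" "teval b e p = num i" "teval b e m = num j"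
    "teval b e d = num k" "0 < k" by (rule qokE[OF assms(1)])
  obtain p' m' d' i' j' k' where r: "r = (p', m', d')" "teval b e p' = num i'" "teval b e m' = num j'"
    "teval b e d' = num k'" "0 < k'" by (rule qokE[OF assms(2)])
  show "qok b e (qadd q r)" "qval b e (qadd q r) = qval b e q + qval b e r"
    "qok b e (qneg q)" "qval b e (qneg q) = - qval b e q"
    by (simp_all add: q r qok_def qval_def frac_add frac_minus num_pl[symmetric] num_ti[symmetric])
qed

lemma teval_two_pow: "teval b e k = num a \<Longrightarrow> teval b e (two_pow k) = num (tp a)"
  using ap_num[OF tpU_typed, of a] by (simp add: two_pow_def tp_def)

lemma qval_atoms:
  assumes "teval b e t = num a"
  shows "qok b e (qnat t)" "qval b e (qnat t) = kn a" "qok b e (qpow t)" "qval b e (qpow t) = pw a"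
    "qok b e (qpow_twice t)" "qval b e (qpow_twice t) = 2 * pw a"
proof -
  have two: "pl one one = num (1 + 1)" by (simp only: num_pl num_one)
  have one: "inv num one = 1" "inv num zero = 0" by (simp_all flip: num_one num_zero)
  show "qok b e (qnat t)" "qok b e (qpow t)" "qok b e (qpow_twice t)"
    using teval_two_pow[OF assms] assms
    by (auto simp: qok_def qnat_def qpow_def qpow_twice_def two intro: num_one[symmetric] num_zero[symmetric]
        exI[of _ 1] exI[of _ 0])
  show "qval b e (qnat t) = kn a" "qval b e (qpow t) = pw a"
    using teval_two_pow[OF assms] assms
    by (simp_all add: qval_def qnat_def qpow_def one pw_def) (simp add: frac_def kn_hom)
  have "inv num (pl one one) = 2" unfolding two inv_num by simp
  moreover have "kn (2 :: 'n) = 2" by (metis kn_hom(2,3) one_add_one)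
  ultimately show "qval b e (qpow_twice t) = 2 * pw a"
    using teval_two_pow[OF assms] by (simp add: qval_def qpow_twice_def one pw_eq frac_def kn_hom)
qed

lemma q_fre3 [simp]:
  "qok (psh3 b c) (upd3 e n c) (fre3 n)" "qval (psh3 b c) (upd3 e n c) (fre3 n) = qv c"
  by (auto simp: qok_def qval_def)

definition okq :: "nat \<Rightarrow> quot \<Rightarrow> bool" where
  "okq n q \<longleftrightarrow> (case q of (p, m, d) \<Rightarrow> ok n p \<and> ok n m \<and> ok n d)"

lemma okq_fre3 [simp]: "okq (Suc (Suc (Suc n))) (fre3 n)"
  by (simp add: okq_def)

lemma q_upd3 [simp]:
  "okq n q \<Longrightarrow> qok (psh3 b c) (upd3 e n c) q \<longleftrightarrow> qok b e q"
  "okq n q \<Longrightarrow> qval (psh3 b c) (upd3 e n c) q = qval b e q"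
  by (cases q; simp add: okq_def qok_def qval_def)+

lemma ap_fn: "teval b e x \<in> D T1 \<Longrightarrow> teval b e k = num a \<Longrightarrow> teval b e (x \<cdot> k) = num (fn (teval b e x) a)"
  by (simp add: ap_num)

lemma pl_num: "teval b e k = num a \<Longrightarrow> teval b e l = num c \<Longrightarrow> teval b e (k \<^bold>+ l) = num (a + c)"
  "teval b e k = num a \<Longrightarrow> teval b e (k \<^bold>+ One) = num (a + 1)"
  by (simp_all add: num_pl num_one)

text \<open>Real expressions pass their \<open>k\<close>-th member to a continuation
  \<open>Q\<close>. Such an expression denotes the sequence \<open>r\<close> if the outcome is
  \<open>P (r a)\<close> whenever \<open>Q\<close> means \<open>P\<close>. As \<open>Q\<close> may
  be evaluated under additional quantifiers, its meaning is required for larger \<open>n'\<close>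
  and for assignments that agree on the old terms.\<close>

definition den :: "(nat \<Rightarrow> 'u) \<Rightarrow> (nat \<times> ty \<Rightarrow> 'u) \<Rightarrow> nat \<Rightarrow> rexp \<Rightarrow> ('n \<Rightarrow> 'n kk) \<Rightarrow> bool" where
  "den b e n X r \<longleftrightarrow> (\<forall>k a Q P. ok n k \<longrightarrow> teval b e k = num a \<longrightarrow>
     (\<forall>b' e' n' q. n \<le> n' \<longrightarrow> (\<forall>t. ok n t \<longrightarrow> teval b' e' t = teval b e t) \<longrightarrow> qok b' e' q \<longrightarrow> okq n' q \<longrightarrow>
        sat b' e' (Q q n') = P (qval b' e' q)) \<longrightarrow>
     sat b e (X k Q n) = P (r a))"

lemma den_rl:
  assumes "ok n x" "teval b e x \<in> D T1" "\<And>k. vc (fn (teval b e x) k)"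
  shows "den b e n (rl x) (\<lambda>k. qv (fn (teval b e x) k))"
  unfolding den_def rl_def
proof (intro allI impI)
  fix k a Q P
  assume k: "ok n k" "teval b e k = num a"
    and Q: "\<forall>b' e' n' q. n \<le> n' \<longrightarrow> (\<forall>t. ok n t \<longrightarrow> teval b' e' t = teval b e t) \<longrightarrow> qok b' e' q \<longrightarrow> okq n' q \<longrightarrow>
        sat b' e' (Q q n') = P (qval b' e' q)"
  let ?c = "fn (teval b e x) a"
  have "sat b e (with_rat (x \<cdot> k) Q n) \<longleftrightarrow>
      sat (psh3 b ?c) (upd3 e n ?c) (Q (fre3 n) (Suc (Suc (Suc n))))"
    using sat_with_rat[of n "x \<cdot> k" b e ?c Q] assms k ap_fn[OF assms(2) k(2)] by simp
  also have "\<dots> = P (qval (psh3 b ?c) (upd3 e n ?c) (fre3 n))"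
    by (rule Q[rule_format]) (simp_all del: teval.simps)
  finally show "sat b e (with_rat (x \<cdot> k) Q n) = P (qv ?c)" by (simp only: q_fre3)
qed

lemma den_const: "qok b e q \<Longrightarrow> okq n q \<Longrightarrow> den b e n (rconst q) (\<lambda>k. qval b e q)"
  unfolding den_def rconst_def
proof (intro allI impI)
  fix k a Q P assume q: "qok b e q" "okq n q"
    and Q: "\<forall>b' e' n' q. n \<le> n' \<longrightarrow> (\<forall>t. ok n t \<longrightarrow> teval b' e' t = teval b e t) \<longrightarrow> qok b' e' q \<longrightarrow> okq n' q \<longrightarrow>
        sat b' e' (Q q n') = P (qval b' e' q)"
  show "sat b e (Q q n) = P (qval b e q)" by (rule Q[rule_format]) (use q in simp_all)
qed

lemma denD:
  assumes "den b e n X r" "ok n k" "teval b e k = num a"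
    "\<And>b' e' n' q. n \<le> n' \<Longrightarrow> (\<And>t. ok n t \<Longrightarrow> teval b' e' t = teval b e t) \<Longrightarrow> qok b' e' q \<Longrightarrow> okq n' q \<Longrightarrow>
        sat b' e' (Q q n') = P (qval b' e' q)"
  shows "sat b e (X k Q n) = P (r a)"
proof -
  have "\<forall>b' e' n' q. n \<le> n' \<longrightarrow> (\<forall>t. ok n t \<longrightarrow> teval b' e' t = teval b e t) \<longrightarrow> qok b' e' q \<longrightarrow> okq n' q \<longrightarrow>
        sat b' e' (Q q n') = P (qval b' e' q)"
    by (intro allI impI, rule assms(4)) simp_all
  with assms(1-3) show ?thesis unfolding den_def by simp
qed

text \<open>The denotation of an expression must persist under assignments to further variables.\<close>

definition denp :: "(nat \<Rightarrow> 'u) \<Rightarrow> (nat \<times> ty \<Rightarrow> 'u) \<Rightarrow> nat \<Rightarrow> rexp \<Rightarrow> ('n \<Rightarrow> 'n kk) \<Rightarrow> bool" where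
  "denp b e n X r \<longleftrightarrow> (\<forall>b' e' n'. n \<le> n' \<longrightarrow> (\<forall>t. ok n t \<longrightarrow> teval b' e' t = teval b e t) \<longrightarrow> den b' e' n' X r)"

lemma ok_mono: "ok n t \<Longrightarrow> n \<le> n' \<Longrightarrow> ok n' t"
  by (induction t) auto

lemma okq_mono: "okq n q \<Longrightarrow> n \<le> n' \<Longrightarrow> okq n' q"
  by (auto simp: okq_def intro: ok_mono split: prod.splits)

lemma q_agree:
  assumes "okq n q" "\<And>t. ok n t \<Longrightarrow> teval b' e' t = teval b e t"
  shows "qok b' e' q \<longleftrightarrow> qok b e q" "qval b' e' q = qval b e q"
  using assms by (auto simp: okq_def qok_def qval_def split: prod.splits)

lemma denpD:
  assumes "denp b e n X r" "n \<le> n'" "\<And>t. ok n t \<Longrightarrow> teval b' e' t = teval b e t"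
    "ok n' k" "teval b' e' k = num a"
    "\<And>b'' e'' n'' q. n' \<le> n'' \<Longrightarrow> (\<And>t. ok n' t \<Longrightarrow> teval b'' e'' t = teval b' e' t) \<Longrightarrow>
      qok b'' e'' q \<Longrightarrow> okq n'' q \<Longrightarrow> sat b'' e'' (Q q n'') = P (qval b'' e'' q)"
  shows "sat b' e' (X k Q n') = P (r a)"
proof -
  have "den b' e' n' X r"
    by (rule assms(1)[unfolded denp_def, rule_format]) (use assms(2,3) in simp_all)
  then show ?thesis using assms(4-6) by (rule denD)
qed

lemma denp_rl:
  assumes "ok n x" "teval b e x \<in> D T1" "isr (fn (teval b e x))"
  shows "denp b e n (rl x) (\<lambda>k. qv (fn (teval b e x) k))"
  unfolding denp_def
proof (intro allI impI)
  fix b' e' n' assume n': "n \<le> n'" "\<forall>t. ok n t \<longrightarrow> teval b' e' t = teval b e t"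
  then have x: "teval b' e' x = teval b e x" using assms(1) by blast
  have "vc (fn (teval b e x) k)" for k using assms(3) by (simp add: isr_def)
  then show "den b' e' n' (rl x) (\<lambda>k. qv (fn (teval b e x) k))"
    using den_rl[of n' x b' e'] ok_mono[OF assms(1) n'(1)] assms(2) by (simp only: x)
qed

lemma denp_const:
  assumes "qok b e q" "okq n q" shows "denp b e n (rconst q) (\<lambda>k. qval b e q)"
  unfolding denp_def
proof (intro allI impI)
  fix b' e' n' assume n': "n \<le> n'" "\<forall>t. ok n t \<longrightarrow> teval b' e' t = teval b e t"
  have "qok b' e' q" "qval b' e' q = qval b e q"
    using q_agree[OF assms(2), of b' e' b e] n' assms(1) by blast+
  then show "den b' e' n' (rconst q) (\<lambda>k. qval b e q)"
    using den_const[of b' e' q n'] okq_mono[OF assms(2) n'(1)] by simp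
qed

lemma denp_mono:
  "denp b e n X r \<Longrightarrow> n \<le> n' \<Longrightarrow> (\<And>t. ok n t \<Longrightarrow> teval b' e' t = teval b e t) \<Longrightarrow> denp b' e' n' X r"
  unfolding denp_def
proof (intro allI impI)
  fix b1 e1 n1
  assume X: "\<forall>b' e' n'. n \<le> n' \<longrightarrow> (\<forall>t. ok n t \<longrightarrow> teval b' e' t = teval b e t) \<longrightarrow> den b' e' n' X r"
    and n': "n \<le> n'" "\<And>t. ok n t \<Longrightarrow> teval b' e' t = teval b e t"
    and 1: "n' \<le> n1" "\<forall>t. ok n' t \<longrightarrow> teval b1 e1 t = teval b' e' t"
  show "den b1 e1 n1 X r"
    by (rule X[rule_format]) (use n' 1 ok_mono in simp_all)
qed

lemma okq_simps: "okq n q \<Longrightarrow> okq n r \<Longrightarrow> okq n (qadd q r)" "okq n q \<Longrightarrow> okq n (qneg q)"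
  by (cases q; cases r; simp add: okq_def)+

lemma denp_diff:
  assumes X: "denp b e n X r" and Y: "denp b e n Y s"
  shows "denp b e n (rdiff X Y) (\<lambda>k. r (k + 1) - s (k + 1))"
  unfolding denp_def den_def rdiff_def
proof (intro allI impI)
  fix b1 e1 n1 k a Q P
  assume 1: "n \<le> n1" "\<forall>t. ok n t \<longrightarrow> teval b1 e1 t = teval b e t" and k: "ok n1 k" "teval b1 e1 k = num a"
    and Q: "\<forall>b' e' n' q. n1 \<le> n' \<longrightarrow> (\<forall>t. ok n1 t \<longrightarrow> teval b' e' t = teval b1 e1 t) \<longrightarrow> qok b' e' q \<longrightarrow> okq n' q \<longrightarrow>
        sat b' e' (Q q n') = P (qval b' e' q)"
  note X1 = denp_mono[OF X 1(1) 1(2)[rule_format]] and Y1 = denp_mono[OF Y 1(1) 1(2)[rule_format]]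
  have k1: "ok n1 (k \<^bold>+ One)" "teval b1 e1 (k \<^bold>+ One) = num (a + 1)" using k pl_num(2)[OF k(2)] by simp_all
  \<comment> \<open>The members are resolved from outside in: for the outer expression the
    continuation means a predicate in which the second member already has its value.\<close>
  show "sat b1 e1 (X (k \<^bold>+ One) (\<lambda>q. Y (k \<^bold>+ One) (\<lambda>r. Q (qadd q (qneg r)))) n1) = P (r (a + 1) - s (a + 1))"
  proof (rule denpD[OF X1 order_refl refl k1, where P = "\<lambda>u. P (u - s (a + 1))"])
    fix b2 e2 n2 q
    assume 2: "n1 \<le> n2" "\<And>t. ok n1 t \<Longrightarrow> teval b2 e2 t = teval b1 e1 t" and q: "qok b2 e2 q" "okq n2 q"
    have k2: "ok n2 (k \<^bold>+ One)" "teval b2 e2 (k \<^bold>+ One) = num (a + 1)"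
      using ok_mono[OF k1(1) 2(1)] 2(2)[OF k1(1)] k1(2) by simp_all
    show "sat b2 e2 (Y (k \<^bold>+ One) (\<lambda>r. Q (qadd q (qneg r))) n2) = P (qval b2 e2 q - s (a + 1))"
    proof (rule denpD[OF Y1 2 k2, where P = "\<lambda>u. P (qval b2 e2 q - u)"])
      fix b3 e3 n3 r'
      assume 3: "n2 \<le> n3" "\<And>t. ok n2 t \<Longrightarrow> teval b3 e3 t = teval b2 e2 t" and r: "qok b3 e3 r'" "okq n3 r'"
      have q3: "qok b3 e3 q" "qval b3 e3 q = qval b2 e2 q" "okq n3 q"
        using q_agree[OF q(2) 3(2)] q(1) okq_mono[OF q(2) 3(1)] by simp_all
      have "sat b3 e3 (Q (qadd q (qneg r')) n3) = P (qval b3 e3 (qadd q (qneg r')))"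
      proof (rule Q[rule_format])
        show "n1 \<le> n3" using 2 3 by simp
        show "teval b3 e3 t = teval b1 e1 t" if "ok n1 t" for t
          using 3(2)[OF ok_mono[OF that 2(1)]] 2(2)[OF that] by simp
      qed (use q3 r in \<open>auto intro: qval_simps okq_simps\<close>)
      also have "qval b3 e3 (qadd q (qneg r')) = qval b2 e2 q - qval b3 e3 r'"
        using qval_simps[OF q3(1) qval_simps(3)[OF r(1) r(1)]] qval_simps(4)[OF r(1) r(1)] q3(2) by simp
      finally show "sat b3 e3 (Q (qadd q (qneg r')) n3) = P (qval b2 e2 q - qval b3 e3 r')" .
    qed
  qed
qed

lemma denp_abs:
  assumes X: "denp b e n X r"
  shows "denp b e n (rabs X) (\<lambda>k. \<bar>r k\<bar>)"
  unfolding denp_def den_def rabs_def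
proof (intro allI impI)
  fix b1 e1 n1 k a Q P
  assume 1: "n \<le> n1" "\<forall>t. ok n t \<longrightarrow> teval b1 e1 t = teval b e t" and k: "ok n1 k" "teval b1 e1 k = num a"
    and Q: "\<forall>b' e' n' q. n1 \<le> n' \<longrightarrow> (\<forall>t. ok n1 t \<longrightarrow> teval b' e' t = teval b1 e1 t) \<longrightarrow> qok b' e' q \<longrightarrow> okq n' q \<longrightarrow>
        sat b' e' (Q q n') = P (qval b' e' q)"
  show "sat b1 e1 (X k (\<lambda>q. (qle (qnat Zero) q \<^bold>\<and> Q q) \<^bold>\<or> (qless q (qnat Zero) \<^bold>\<and> Q (qneg q))) n1) = P \<bar>r a\<bar>"
  proof (rule denpD[OF X 1(1) 1(2)[rule_format] k, where P = "\<lambda>u. P \<bar>u\<bar>"])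
    fix b2 e2 n2 q
    assume 2: "n1 \<le> n2" "\<And>t. ok n1 t \<Longrightarrow> teval b2 e2 t = teval b1 e1 t" and q: "qok b2 e2 q" "okq n2 q"
    have z: "teval b2 e2 Zero = num 0" by (simp add: num_zero)
    note z = qval_atoms(1,2)[OF z]
    have Qq: "sat b2 e2 (Q q n2) = P (qval b2 e2 q)" "sat b2 e2 (Q (qneg q) n2) = P (- qval b2 e2 q)"
      using Q[rule_format, OF 2(1) 2(2) q]
        Q[rule_format, OF 2(1) 2(2) qval_simps(3)[OF q(1) q(1)] okq_simps(2)[OF q(2)]]
        qval_simps(4)[OF q(1) q(1)] by simp_all
    show "sat b2 e2 (((qle (qnat Zero) q \<^bold>\<and> Q q) \<^bold>\<or> (qless q (qnat Zero) \<^bold>\<and> Q (qneg q))) n2) = P \<bar>qval b2 e2 q\<bar>"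
      using z q(1) by (simp add: sat_form sat_q Qq kn_hom abs_if not_less)
  qed
qed

lemma denp_step:
  assumes "denp b e n X r"
  shows "denp (case_nat u b) (e((n, \<tau>) := u)) (Suc n) X r"
  by (rule denp_mono[OF assms]) simp_all

lemma sat_rle:
  assumes X: "denp b e n X r" "approx r \<xi>" and Y: "denp b e n Y s" "approx s \<eta>"
  shows "sat b e (rle X Y n) \<longleftrightarrow> \<xi> \<le> \<eta>"
proof -
  have "sat (case_nat (num a) b) (e((n, Num) := num a))
      (X (Free n Num) (\<lambda>q. Y (Free n Num) (\<lambda>r. qle q (qadd r (qpow_twice (Free n Num))))) (Suc n)) \<longleftrightarrow>
      r a \<le> s a + 2 * pw a" (is "sat ?b ?e _ \<longleftrightarrow> _") for a
  proof (rule denpD[OF denp_step[OF X(1)] order_refl refl, where P = "\<lambda>u. u \<le> s a + 2 * pw a"])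
    fix b2 e2 n2 q
    assume 2: "Suc n \<le> n2" "\<And>t. ok (Suc n) t \<Longrightarrow> teval b2 e2 t = teval ?b ?e t" and q: "qok b2 e2 q" "okq n2 q"
    have k2: "ok n2 (Free n Num)" "teval b2 e2 (Free n Num) = num a"
      using 2(1) 2(2)[of "Free n Num"] by simp_all
    show "sat b2 e2 (Y (Free n Num) (\<lambda>r. qle q (qadd r (qpow_twice (Free n Num)))) n2) \<longleftrightarrow>
        qval b2 e2 q \<le> s a + 2 * pw a"
    proof (rule denpD[OF denp_step[OF Y(1)] 2 k2, where P = "\<lambda>u. qval b2 e2 q \<le> u + 2 * pw a"])
      fix b3 e3 n3 r'
      assume 3: "n2 \<le> n3" "\<And>t. ok n2 t \<Longrightarrow> teval b3 e3 t = teval b2 e2 t" and r: "qok b3 e3 r'"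
      have q3: "qok b3 e3 q" "qval b3 e3 q = qval b2 e2 q" using q_agree[OF q(2) 3(2)] q(1) by simp_all
      have "teval b3 e3 (Free n Num) = num a" using 3(2)[OF k2(1)] k2(2) by simp
      note p = qval_atoms(5,6)[OF this]
      show "sat b3 e3 (qle q (qadd r' (qpow_twice (Free n Num))) n3) \<longleftrightarrow> qval b2 e2 q \<le> qval b3 e3 r' + 2 * pw a"
        using sat_q(2)[OF q3(1) qval_simps(1)[OF r p(1)]] qval_simps(2)[OF r p(1)] p(2) q3(2) by simp
    qed
  qed simp_all
  then show ?thesis unfolding rle_def using approx_le[OF X(2) Y(2)] by (simp add: sat_form ball_Num)
qed

lemma sat_req:
  assumes X: "denp b e n X r" "approx r \<xi>" and Y: "denp b e n Y s" "approx s \<eta>"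
  shows "sat b e (req X Y n) \<longleftrightarrow> \<xi> = \<eta>"
proof -
  have "sat (case_nat (num a) b) (e((n, Num) := num a))
      (X (Free n Num) (\<lambda>q. Y (Free n Num) (\<lambda>r. qle (qadd q (qneg r)) (qpow_twice (Free n Num)) \<^bold>\<and>
        qle (qadd r (qneg q)) (qpow_twice (Free n Num)))) (Suc n)) \<longleftrightarrow>
      r a - s a \<le> 2 * pw a \<and> s a - r a \<le> 2 * pw a" (is "sat ?b ?e _ \<longleftrightarrow> _") for a
  proof (rule denpD[OF denp_step[OF X(1)] order_refl refl, where P = "\<lambda>u. u - s a \<le> 2 * pw a \<and> s a - u \<le> 2 * pw a"])
    fix b2 e2 n2 q
    assume 2: "Suc n \<le> n2" "\<And>t. ok (Suc n) t \<Longrightarrow> teval b2 e2 t = teval ?b ?e t" and q: "qok b2 e2 q" "okq n2 q"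
    have k2: "ok n2 (Free n Num)" "teval b2 e2 (Free n Num) = num a"
      using 2(1) 2(2)[of "Free n Num"] by simp_all
    show "sat b2 e2 (Y (Free n Num) (\<lambda>r. qle (qadd q (qneg r)) (qpow_twice (Free n Num)) \<^bold>\<and>
        qle (qadd r (qneg q)) (qpow_twice (Free n Num))) n2) \<longleftrightarrow>
        qval b2 e2 q - s a \<le> 2 * pw a \<and> s a - qval b2 e2 q \<le> 2 * pw a"
    proof (rule denpD[OF denp_step[OF Y(1)] 2 k2,
          where P = "\<lambda>u. qval b2 e2 q - u \<le> 2 * pw a \<and> u - qval b2 e2 q \<le> 2 * pw a"])
      fix b3 e3 n3 r'
      assume 3: "n2 \<le> n3" "\<And>t. ok n2 t \<Longrightarrow> teval b3 e3 t = teval b2 e2 t" and r: "qok b3 e3 r'"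
      have q3: "qok b3 e3 q" "qval b3 e3 q = qval b2 e2 q" using q_agree[OF q(2) 3(2)] q(1) by simp_all
      have "teval b3 e3 (Free n Num) = num a" using 3(2)[OF k2(1)] k2(2) by simp
      note p = qval_atoms(5,6)[OF this]
      note nq = qval_simps(3,4)[OF q3(1) q3(1)] and nr = qval_simps(3,4)[OF r r]
      show "sat b3 e3 ((qle (qadd q (qneg r')) (qpow_twice (Free n Num)) \<^bold>\<and>
          qle (qadd r' (qneg q)) (qpow_twice (Free n Num))) n3) \<longleftrightarrow>
          qval b2 e2 q - qval b3 e3 r' \<le> 2 * pw a \<and> qval b3 e3 r' - qval b2 e2 q \<le> 2 * pw a"
        unfolding sat_form
        using sat_q(2)[OF qval_simps(1)[OF q3(1) nr(1)] p(1)] sat_q(2)[OF qval_simps(1)[OF r nq(1)] p(1)]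
          qval_simps(2)[OF q3(1) nr(1)] qval_simps(2)[OF r nq(1)] nq(2) nr(2) p(2) q3(2) by simp
    qed
  qed simp_all
  then show ?thesis unfolding req_def using approx_eq[OF X(2) Y(2)] by (simp add: sat_form ball_Num)
qed

lemma sat_is_real:
  assumes "ok n x" "teval b e x \<in> D T1"
  shows "sat b e (is_real x n) \<longleftrightarrow> isr (fn (teval b e x))"
proof -
  let ?x = "fn (teval b e x)"
  have "sat (case_nat (num i) (case_nat (num k) b)) (e((n, Num) := num k, (Suc n, Num) := num i))
      (with_rat (x \<cdot> Free n Num) (\<lambda>q. with_rat (x \<cdot> (Free n Num \<^bold>+ Free (Suc n) Num)) (\<lambda>r.
        qless (qadd q (qneg r)) (qpow (Free n Num)) \<^bold>\<and> qless (qadd r (qneg q)) (qpow (Free n Num))))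
        (Suc (Suc n))) \<longleftrightarrow> vc (?x k) \<and> vc (?x (k + i)) \<and> \<bar>qv (?x k) - qv (?x (k + i))\<bar> < pw k"
    (is "sat ?b ?e _ \<longleftrightarrow> _") for k i
  proof -
    let ?m = "Suc (Suc n)" and ?c = "?x k" and ?d = "?x (k + i)"
    let ?b1 = "psh3 ?b ?c" and ?e1 = "upd3 ?e ?m ?c" and ?m1 = "Suc (Suc (Suc (Suc (Suc n))))"
    let ?b2 = "psh3 ?b1 ?d" and ?e2 = "upd3 ?e1 ?m1 ?d"
    have x: "teval ?b ?e x = teval b e x" "teval ?b1 ?e1 x = teval b e x" using assms(1) by simp_all
    have c: "teval ?b ?e (x \<cdot> Free n Num) = num ?c" using assms(2) by (simp add: x ap_num)
    have d: "teval ?b1 ?e1 (x \<cdot> (Free n Num \<^bold>+ Free (Suc n) Num)) = num ?d"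
      using assms(2) x(2) by (simp add: ap_num flip: num_pl)
    have k: "teval ?b2 ?e2 (Free n Num) = num k" by simp
    note p = qval_atoms(3,4)[OF k]
    have q: "qok ?b2 ?e2 (fre3 ?m)" "qval ?b2 ?e2 (fre3 ?m) = qv ?c"
      using q_upd3[where n = ?m1 and q = "fre3 ?m" and b = ?b1 and c = ?d and e = ?e1]
        q_fre3[where b = ?b and c = ?c and e = ?e and n = ?m] okq_fre3[of ?m] by (simp_all only:)
    have r: "qok ?b2 ?e2 (fre3 ?m1)" "qval ?b2 ?e2 (fre3 ?m1) = qv ?d" by (rule q_fre3)+
    note nq = qval_simps(3,4)[OF q(1) q(1)] and nr = qval_simps(3,4)[OF r(1) r(1)]
    let ?A = "\<lambda>q r. qless (qadd q (qneg r)) (qpow (Free n Num)) \<^bold>\<and> qless (qadd r (qneg q)) (qpow (Free n Num))"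
    let ?W = "\<lambda>q. with_rat (x \<cdot> (Free n Num \<^bold>+ Free (Suc n) Num)) (?A q)"
    have "sat ?b ?e (with_rat (x \<cdot> Free n Num) ?W ?m) \<longleftrightarrow> vc ?c \<and> sat ?b1 ?e1 (?W (fre3 ?m) ?m1)"
      by (rule sat_with_rat[OF _ c]) (use assms(1) in simp)
    also have "sat ?b1 ?e1 (?W (fre3 ?m) ?m1) \<longleftrightarrow> vc ?d \<and> sat ?b2 ?e2 (?A (fre3 ?m) (fre3 ?m1) (Suc (Suc (Suc ?m1))))"
      by (rule sat_with_rat[OF _ d]) (use assms(1) in simp)
    also have "sat ?b2 ?e2 (?A (fre3 ?m) (fre3 ?m1) (Suc (Suc (Suc ?m1)))) \<longleftrightarrow>
        qv ?c - qv ?d < pw k \<and> qv ?d - qv ?c < pw k"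
      unfolding sat_form(6) sat_q(1)[OF qval_simps(1)[OF q(1) nr(1)] p(1)] sat_q(1)[OF qval_simps(1)[OF r(1) nq(1)] p(1)]
        qval_simps(2)[OF q(1) nr(1)] qval_simps(2)[OF r(1) nq(1)] nq(2) nr(2) p(2) q(2) r(2) by simp
    also have "(qv ?c - qv ?d < pw k \<and> qv ?d - qv ?c < pw k) \<longleftrightarrow> \<bar>qv ?c - qv ?d\<bar> < pw k" by (auto simp: abs_less_iff)
    finally show ?thesis .
  qed
  then show ?thesis unfolding is_real_def isr_def by (simp add: sat_form ball_Num)
qed

end

section \<open>The notions of the theorem in the model\<close>

context aca_num
begin

abbreviation vl :: "'u \<Rightarrow> 'n rr" where "vl u \<equiv> val (fn u)"

definition Xu :: "'u set" where "Xu = {u \<in> D T1. isr (fn u) \<and> unit (vl u)}"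

lemma XuD [simp]: "u \<in> Xu \<Longrightarrow> u \<in> D T1" "u \<in> Xu \<Longrightarrow> isr (fn u)" "u \<in> Xu \<Longrightarrow> unit (vl u)"
  by (auto simp: Xu_def)

definition rt :: "(nat \<Rightarrow> 'u) \<Rightarrow> (nat \<times> ty \<Rightarrow> 'u) \<Rightarrow> nat \<Rightarrow> tm \<Rightarrow> bool" where
  "rt b e n x \<longleftrightarrow> ok n x \<and> teval b e x \<in> D T1 \<and> isr (fn (teval b e x))"

lemma rt_den: "rt b e n x \<Longrightarrow> denp b e n (rl x) (\<lambda>k. qv (fn (teval b e x) k))"
  "rt b e n x \<Longrightarrow> approx (\<lambda>k. qv (fn (teval b e x) k)) (vl (teval b e x))"
  by (auto simp: rt_def intro: denp_rl isr_approx)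

lemma sat_le:
  assumes "rt b e n x" "rt b e n y"
  shows "sat b e (rle (rl x) (rl y) n) \<longleftrightarrow> vl (teval b e x) \<le> vl (teval b e y)"
    "sat b e (rless (rl x) (rl y) n) \<longleftrightarrow> vl (teval b e x) < vl (teval b e y)"
    "sat b e (req (rl x) (rl y) n) \<longleftrightarrow> vl (teval b e x) = vl (teval b e y)"
  unfolding rless_def sat_form(4)
    sat_rle[OF rt_den[OF assms(1)] rt_den[OF assms(2)]] sat_rle[OF rt_den[OF assms(2)] rt_den[OF assms(1)]]
    sat_req[OF rt_den[OF assms(1)] rt_den[OF assms(2)]]
  by (simp_all add: not_le)

lemma sat_req_diff:
  assumes "rt b e n u" "rt b e n s" "rt b e n i"
  shows "sat b e (req (rl u) (rdiff (rl s) (rl i)) n) \<longleftrightarrow> vl (teval b e u) = vl (teval b e s) - vl (teval b e i)"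
  by (rule sat_req[OF rt_den[OF assms(1)] denp_diff[OF rt_den(1)[OF assms(2)] rt_den(1)[OF assms(3)]]
      approx_diff[OF rt_den(2)[OF assms(2)] rt_den(2)[OF assms(3)]]])

lemma qnat_den:
  assumes "ok n t" "teval b e t = num a"
  shows "denp b e n (rconst (qnat t)) (\<lambda>k. kn a)" "denp b e n (rconst (qpow t)) (\<lambda>k. pw a)"
proof -
  have "okq n (qnat t)" "okq n (qpow t)" using assms(1) by (auto simp: okq_def qnat_def qpow_def two_pow_def)
  then show "denp b e n (rconst (qnat t)) (\<lambda>k. kn a)" "denp b e n (rconst (qpow t)) (\<lambda>k. pw a)"
    using denp_const[of b e "qnat t" n] denp_const[of b e "qpow t" n] qval_atoms(1-4)[OF assms(2)] by simp_all
qed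

lemma sat_close:
  assumes "ok n k" "teval b e k = num a" "rt b e n x" "rt b e n y"
  shows "sat b e (close_to k x y n) \<longleftrightarrow> \<bar>vl (teval b e x) - vl (teval b e y)\<bar> < cK (pw a)"
  unfolding close_to_def rless_def sat_form(4)
    sat_rle[OF qnat_den(2)[OF assms(1,2)] approx_const
      denp_abs[OF denp_diff[OF rt_den(1)[OF assms(3)] rt_den(1)[OF assms(4)]]]
      approx_abs[OF approx_diff[OF rt_den(2)[OF assms(3)] rt_den(2)[OF assms(4)]]]]
  by (rule not_le)

lemma sat_in_unit: "rt b e n x \<Longrightarrow> sat b e (in_unit x n) \<longleftrightarrow> unit (vl (teval b e x))"
proof -
  assume x: "rt b e n x"
  have 01: "teval b e Zero = num 0" "teval b e One = num 1" by (simp_all add: num_zero num_one)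
  have "MR (vl (teval b e x))" using x by (auto simp: MR_def rt_def)
  then show ?thesis
    using sat_rle[OF qnat_den(1)[OF _ 01(1)] approx_const rt_den[OF x]]
      sat_rle[OF rt_den[OF x] qnat_den(1)[OF _ 01(2)] approx_const]
    unfolding in_unit_def sat_form(6) by (simp add: kn_hom unit_def)
qed

lemma sat_real_quant:
  "sat b e (all_real G n) \<longleftrightarrow> (\<forall>u\<in>D T1. isr (fn u) \<longrightarrow> sat (case_nat u b) (e((n, T1) := u)) (G (Free n T1) (Suc n)))"
  "sat b e (ex_real G n) \<longleftrightarrow> (\<exists>u\<in>D T1. isr (fn u) \<and> sat (case_nat u b) (e((n, T1) := u)) (G (Free n T1) (Suc n)))"
  unfolding all_real_def ex_real_def by (simp_all add: sat_form sat_is_real cong: ball_cong bex_cong)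

lemma sat_unit_quant:
  "sat b e (all_unit G n) \<longleftrightarrow> (\<forall>u\<in>Xu. sat (case_nat u b) (e((n, T1) := u)) (G (Free n T1) (Suc n)))"
  "sat b e (ex_unit G n) \<longleftrightarrow> (\<exists>u\<in>Xu. sat (case_nat u b) (e((n, T1) := u)) (G (Free n T1) (Suc n)))"
proof -
  have "sat (case_nat u b) (e((n, T1) := u)) (in_unit (Free n T1) (Suc n)) \<longleftrightarrow> unit (vl u)"
    if "u \<in> D T1" "isr (fn u)" for u
    using sat_in_unit[of "case_nat u b" "e((n, T1) := u)" "Suc n" "Free n T1"] that by (simp add: rt_def)
  then show "sat b e (all_unit G n) \<longleftrightarrow> (\<forall>u\<in>Xu. sat (case_nat u b) (e((n, T1) := u)) (G (Free n T1) (Suc n)))"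
    "sat b e (ex_unit G n) \<longleftrightarrow> (\<exists>u\<in>Xu. sat (case_nat u b) (e((n, T1) := u)) (G (Free n T1) (Suc n)))"
    unfolding all_unit_def ex_unit_def sat_real_quant sat_form Xu_def by blast+
qed

definition Fun :: "'u \<Rightarrow> bool" where
  "Fun g \<longleftrightarrow> (\<forall>u\<in>Xu. isr (fn (g \<bullet> u))) \<and> (\<forall>u\<in>Xu. \<forall>v\<in>Xu. vl u = vl v \<longrightarrow> vl (g \<bullet> u) = vl (g \<bullet> v))"

definition Cont :: "'u \<Rightarrow> 'u \<Rightarrow> bool" where
  "Cont g u \<longleftrightarrow> (\<forall>k. \<exists>m. \<forall>v\<in>Xu. \<bar>vl u - vl v\<bar> < cK (pw m) \<longrightarrow> \<bar>vl (g \<bullet> u) - vl (g \<bullet> v)\<bar> < cK (pw k))"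

lemma FunD [simp]: "Fun g \<Longrightarrow> u \<in> Xu \<Longrightarrow> isr (fn (g \<bullet> u))"
  by (simp add: Fun_def)

lemma rt_simps:
  "rt b e n (Free i T1) \<longleftrightarrow> i < n \<and> e (i, T1) \<in> D T1 \<and> isr (fn (e (i, T1)))"
  "rt b e n (g \<cdot> x) \<longleftrightarrow> ok n g \<and> ok n x \<and> teval b e g \<bullet> teval b e x \<in> D T1 \<and> isr (fn (teval b e g \<bullet> teval b e x))"
  by (auto simp: rt_def)

lemma sat_le_num:
  "teval b e s = num a \<Longrightarrow> teval b e t = num c \<Longrightarrow> sat b e ((s \<^bold>\<le> t) n) \<longleftrightarrow> a \<le> c"
  by (simp add: sat_form num_ls le_less)

lemmas sat_rules = sat_form(1-7,9,10) sat_le_num ball_Num bex_Num sat_unit_quant sat_real_quant sat_le sat_req_diff sat_close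
  rt_simps ap_typed num_ls

lemma sat_is_fun:
  assumes "ok n g" "teval b e g \<in> D (T1 \<rightarrow> T1)"
  shows "sat b e (is_fun g n) \<longleftrightarrow> Fun (teval b e g)"
\<comment> \<open>\<open>req\<close> has its intended meaning only for representatives of reals. If
  some value is no real, the first conjunct already decides the formula.\<close>
proof (cases "\<forall>u\<in>Xu. isr (fn (teval b e g \<bullet> u))")
  case True
  then show ?thesis using assms unfolding is_fun_def Fun_def
    by (simp add: sat_rules sat_is_real cong: ball_cong)
next
  case False
  then show ?thesis using assms unfolding is_fun_def Fun_def
    by (simp add: sat_form sat_unit_quant sat_is_real ap_typed cong: ball_cong) blast
qed

lemma sat_cont_at:
  assumes "ok n g" "ok n x" "teval b e g \<in> D (T1 \<rightarrow> T1)" "Fun (teval b e g)" "teval b e x \<in> Xu"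
  shows "sat b e (cont_at g x n) \<longleftrightarrow> Cont (teval b e g) (teval b e x)"
proof -
  have "rt b e n x" using assms by (simp add: rt_def)
  show ?thesis unfolding cont_at_def Cont_def using assms
    by (simp add: sat_rules rt_def cong: ball_cong)
qed

lemma sat_baire1:
  assumes "ok n g" "teval b e g \<in> D (T1 \<rightarrow> T1)" "Fun (teval b e g)"
  shows "sat b e (baire1 g n) \<longleftrightarrow> (\<exists>H\<in>D (Num \<rightarrow> T1 \<rightarrow> T1).
    (\<forall>a. Fun (H \<bullet> num a) \<and> (\<forall>u\<in>Xu. Cont (H \<bullet> num a) u)) \<and>
    (\<forall>u\<in>Xu. \<forall>k. \<exists>m. \<forall>a. m \<le> a \<longrightarrow> \<bar>vl (H \<bullet> num a \<bullet> u) - vl (teval b e g \<bullet> u)\<bar> < cK (pw k)))"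
  unfolding baire1_def sat_form(10)
proof (rule bex_cong[OF refl])
  fix H assume H: "H \<in> D (Num \<rightarrow> T1 \<rightarrow> T1)"
  let ?b = "case_nat H b" and ?e = "e((n, Num \<rightarrow> T1 \<rightarrow> T1) := H)" and ?F = "Free n (Num \<rightarrow> T1 \<rightarrow> T1)"
  have 1: "sat ?b ?e ((\<^bold>\<forall>i. is_fun (?F \<cdot> i) \<^bold>\<and> (\<^bold>\<forall>\<^sub>I x. cont_at (?F \<cdot> i) x)) (Suc n)) \<longleftrightarrow>
      (\<forall>a. Fun (H \<bullet> num a) \<and> (\<forall>u\<in>Xu. Cont (H \<bullet> num a) u))"
    using H by (simp add: sat_form ball_Num sat_unit_quant sat_is_fun sat_cont_at ap_typed cong: conj_cong ball_cong)
  have 2: "sat ?b ?e ((\<^bold>\<forall>\<^sub>I x. \<^bold>\<forall>k. \<^bold>\<exists>m. \<^bold>\<forall>i. m \<^bold>\<le> i \<^bold>\<longrightarrow> close_to k (?F \<cdot> i \<cdot> x) (g \<cdot> x)) (Suc n)) \<longleftrightarrow>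
      (\<forall>u\<in>Xu. \<forall>k. \<exists>m. \<forall>a. m \<le> a \<longrightarrow> \<bar>vl (H \<bullet> num a \<bullet> u) - vl (teval b e g \<bullet> u)\<bar> < cK (pw k))"
    if "\<forall>a. Fun (H \<bullet> num a)"
    using H assms that by (simp add: sat_rules cong: ball_cong)
  show "sat ?b ?e (((\<^bold>\<forall>i. is_fun (?F \<cdot> i) \<^bold>\<and> (\<^bold>\<forall>\<^sub>I x. cont_at (?F \<cdot> i) x)) \<^bold>\<and>
      (\<^bold>\<forall>\<^sub>I x. \<^bold>\<forall>k. \<^bold>\<exists>m. \<^bold>\<forall>i. m \<^bold>\<le> i \<^bold>\<longrightarrow> close_to k (?F \<cdot> i \<cdot> x) (g \<cdot> x))) (Suc n)) \<longleftrightarrow>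
    (\<forall>a. Fun (H \<bullet> num a) \<and> (\<forall>u\<in>Xu. Cont (H \<bullet> num a) u)) \<and>
    (\<forall>u\<in>Xu. \<forall>k. \<exists>m. \<forall>a. m \<le> a \<longrightarrow> \<bar>vl (H \<bullet> num a \<bullet> u) - vl (teval b e g \<bullet> u)\<bar> < cK (pw k))"
    unfolding sat_form(6) 1 using 2 by blast
qed

lemma sat_has_cont_point:
  assumes "ok n g" "teval b e g \<in> D (T1 \<rightarrow> T1)" "Fun (teval b e g)"
  shows "sat b e (has_cont_point g n) \<longleftrightarrow> (\<exists>u\<in>Xu. Cont (teval b e g) u)"
  unfolding has_cont_point_def using assms by (simp add: sat_unit_quant sat_cont_at cong: bex_cong)

lemma sat_bounded:
  assumes "ok n g" "teval b e g \<in> D (T1 \<rightarrow> T1)" "Fun (teval b e g)"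
  shows "sat b e (bounded_on_interval g n) \<longleftrightarrow> (\<exists>N. \<exists>c\<in>Xu. \<exists>d\<in>Xu. vl c < vl d \<and>
    (\<forall>y\<in>Xu. vl c < vl y \<and> vl y < vl d \<longrightarrow> \<bar>vl (teval b e g \<bullet> y)\<bar> \<le> cK (kn (N + 1))))"
proof -
  have abs: "sat b e (rle (rabs (rl x)) (rconst (qnat (t \<^bold>+ One))) n) \<longleftrightarrow> \<bar>vl (teval b e x)\<bar> \<le> cK (kn (a + 1))"
    if "ok n t" "teval b e t = num a" "rt b e n x" for b e n x t a
    by (rule sat_rle[OF denp_abs[OF rt_den(1)[OF that(3)]] approx_abs[OF rt_den(2)[OF that(3)]]
        qnat_den(1)[OF _ pl_num(2)[OF that(2)]] approx_const]) (simp add: that(1))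
  show ?thesis unfolding bounded_on_interval_def using assms
    by (simp add: sat_rules abs cong: bex_cong ball_cong)
qed

definition UB :: "'u \<Rightarrow> 'u \<Rightarrow> 'n \<Rightarrow> 'n rr \<Rightarrow> bool" where
  "UB g x a r \<longleftrightarrow> (\<forall>v\<in>Xu. \<bar>vl x - vl v\<bar> < cK (pw a) \<longrightarrow> vl (g \<bullet> v) \<le> r)"

definition LB :: "'u \<Rightarrow> 'u \<Rightarrow> 'n \<Rightarrow> 'n rr \<Rightarrow> bool" where
  "LB g x a r \<longleftrightarrow> (\<forall>v\<in>Xu. \<bar>vl x - vl v\<bar> < cK (pw a) \<longrightarrow> r \<le> vl (g \<bullet> v))"

definition BO :: "'u \<Rightarrow> 'u \<Rightarrow> 'n \<Rightarrow> 'n rr \<Rightarrow> bool" where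
  "BO g x a r \<longleftrightarrow> (\<exists>s i. MR s \<and> MR i \<and> UB g x a s \<and> (\<forall>t. MR t \<and> UB g x a t \<longrightarrow> s \<le> t) \<and>
     LB g x a i \<and> (\<forall>t. MR t \<and> LB g x a t \<longrightarrow> t \<le> i) \<and> r = s - i)"

definition BI :: "'u \<Rightarrow> 'u \<Rightarrow> 'n \<Rightarrow> bool" where
  "BI g x a \<longleftrightarrow> (\<nexists>s. MR s \<and> UB g x a s) \<or> (\<nexists>s. MR s \<and> LB g x a s)"

lemma MR_bex: "(\<exists>s. MR s \<and> P s) \<longleftrightarrow> (\<exists>u\<in>D T1. isr (fn u) \<and> P (vl u))"
  and MR_ball: "(\<forall>s. MR s \<and> P s \<longrightarrow> Q s) \<longleftrightarrow> (\<forall>u\<in>D T1. isr (fn u) \<longrightarrow> P (vl u) \<longrightarrow> Q (vl u))"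
  unfolding MR_def by blast+

lemma sat_bounds:
  assumes "ok n g" "teval b e g \<in> D (T1 \<rightarrow> T1)" "Fun (teval b e g)" "ok n x" "teval b e x \<in> Xu"
    "ok n k" "teval b e k = num a" "rt b e n s"
  shows "sat b e (upper_bound g x k s n) \<longleftrightarrow> UB (teval b e g) (teval b e x) a (vl (teval b e s))"
    "sat b e (lower_bound g x k s n) \<longleftrightarrow> LB (teval b e g) (teval b e x) a (vl (teval b e s))"
  unfolding upper_bound_def lower_bound_def UB_def LB_def using assms
  by (simp_all add: sat_rules rt_def cong: ball_cong)

lemma sat_ball_osc:
  assumes "ok n g" "teval b e g \<in> D (T1 \<rightarrow> T1)" "Fun (teval b e g)" "ok n x" "teval b e x \<in> Xu"
    "ok n k" "teval b e k = num a"
  shows "rt b e n u \<Longrightarrow> sat b e (ball_osc g x k u n) \<longleftrightarrow> BO (teval b e g) (teval b e x) a (vl (teval b e u))"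
    "sat b e (ball_osc_infinite g x k n) \<longleftrightarrow> BI (teval b e g) (teval b e x) a"
proof -
  have "(\<exists>s i. MR s \<and> MR i \<and> P s i) \<longleftrightarrow> (\<exists>s\<in>D T1. isr (fn s) \<and> (\<exists>i\<in>D T1. isr (fn i) \<and> P (vl s) (vl i)))" for P
    unfolding MR_def by blast
  then show "sat b e (ball_osc g x k u n) \<longleftrightarrow> BO (teval b e g) (teval b e x) a (vl (teval b e u))" if u: "rt b e n u"
    unfolding ball_osc_def is_sup_def is_inf_def BO_def using assms u
    by (simp add: sat_rules sat_bounds MR_ball rt_def conj_assoc cong: bex_cong ball_cong conj_cong)
  show "sat b e (ball_osc_infinite g x k n) \<longleftrightarrow> BI (teval b e g) (teval b e x) a"
    unfolding ball_osc_infinite_def BI_def MR_bex using assms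
    by (simp add: sat_rules sat_bounds cong: bex_cong conj_cong)
qed

definition OL :: "'u \<Rightarrow> 'u \<Rightarrow> 'n rr \<Rightarrow> bool" where
  "OL g x v \<longleftrightarrow> (\<forall>j. \<exists>m. \<forall>k. m \<le> k \<longrightarrow> (\<exists>u. MR u \<and> BO g x k u \<and> \<bar>u - v\<bar> < cK (pw j)))"

lemma sat_osc_limit:
  assumes "ok n g" "teval b e g \<in> D (T1 \<rightarrow> T1)" "Fun (teval b e g)" "ok n x" "teval b e x \<in> Xu" "rt b e n v"
  shows "sat b e (osc_limit g x v n) \<longleftrightarrow> OL (teval b e g) (teval b e x) (vl (teval b e v))"
  unfolding osc_limit_def OL_def MR_bex using assms
  by (simp add: sat_rules sat_ball_osc rt_def cong: bex_cong conj_cong)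

text \<open>One direction is enough: \<open>osc_limit_infinite\<close> will be claimed only at
  points where no ball has finite oscillation, and there its first disjunct holds for every
  \<open>k\<close>. At all other points the limit is finite.\<close>

lemma sat_osc_limit_infinite:
  assumes "ok n g" "teval b e g \<in> D (T1 \<rightarrow> T1)" "Fun (teval b e g)" "ok n x" "teval b e x \<in> Xu"
    and BI: "\<forall>a. BI (teval b e g) (teval b e x) a"
  shows "sat b e (osc_limit_infinite g x n)"
  unfolding osc_limit_infinite_def using assms
  by (simp add: sat_rules sat_ball_osc)

end

section \<open>Functionals of the model as functions on reals\<close>

context aca_num
begin

lemma MR_minus: "MR r \<Longrightarrow> MR (- r)"
  by (rule full.MR_dR[OF full.dR_minus[OF full.dR_MR]])

lemma isr_const: "vc c \<Longrightarrow> isr (\<lambda>_. c)" "vc c \<Longrightarrow> val (\<lambda>_. c) = rv c"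
proof -
  assume c: "vc c"
  show isr: "isr (\<lambda>_. c)" using c by (simp add: isr_def)
  show "val (\<lambda>_. c) = rv c"
    using approx_eq[OF isr_approx[OF isr] approx_const[of "qv c"]] by (simp add: less_imp_le)
qed

text \<open>Rational points are represented by constant sequences, which the model obtains uniformly
  from the code.\<close>

definition cst :: "'n \<Rightarrow> 'u" where
  "cst c = K Num Num \<bullet> num c"

lemma cst: "cst c \<in> D T1" "fn (cst c) = (\<lambda>_. c)"
proof -
  show "cst c \<in> D T1" unfolding cst_def by (rule ap_dom[OF cn_typed(5)]) simp
  show "fn (cst c) = (\<lambda>_. c)" unfolding cst_def fn_def by (simp add: K_eq)
qed

definition uc :: "'n \<Rightarrow> 'n" where
  "uc c = (if vc c \<and> 0 \<le> rv c \<and> rv c \<le> 1 then c else q0)"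

lemma vc_q0: "vc q0"
  unfolding vc_def using zero_less_one by blast

lemma cst_uc: "cst (uc c) \<in> Xu" "vl (cst (uc c)) = uq c"
proof -
  have uc: "vc (uc c)" "rv (uc c) = uq c"
  proof -
    show "vc (uc c)" by (simp add: uc_def vc_q0)
    show "rv (uc c) = uq c"
      using rv_01(1) cK_hom(1) by (auto simp: uc_def uq_def qv_invalid)
  qed
  show v: "vl (cst (uc c)) = uq c" using isr_const(2)[OF uc(1)] uc(2) by (simp add: cst)
  have "unit (uq c)" using full.MR_q[of "uc c"] uc(2) by (simp add: unit_def uq_def)
  then show "cst (uc c) \<in> Xu" using isr_const(1)[OF uc(1)] v by (simp add: Xu_def cst del: XuD)
qed

text \<open>The representative is chosen outside the model; \<open>Fun G\<close> makes the value of
  \<open>ev G\<close> independent of it. For definability at rational points,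
  \<open>cst (uc c)\<close> takes the place of the chosen representative.\<close>

definition rep :: "'n rr \<Rightarrow> 'u" where
  "rep r = (SOME u. u \<in> Xu \<and> vl u = r)"

definition ev :: "'u \<Rightarrow> 'n rr \<Rightarrow> 'n rr" where
  "ev G r = vl (G \<bullet> rep r)"

lemma rep: "unit r \<Longrightarrow> rep r \<in> Xu" "unit r \<Longrightarrow> vl (rep r) = r"
proof -
  assume r: "unit r"
  then have "\<exists>u. u \<in> Xu \<and> vl u = r" by (auto simp: unit_def MR_def Xu_def simp del: XuD)
  then have "rep r \<in> Xu \<and> vl (rep r) = r" unfolding rep_def by (rule someI_ex)
  then show "rep r \<in> Xu" "vl (rep r) = r" by blast+
qed

lemma ev_vl: "Fun G \<Longrightarrow> u \<in> Xu \<Longrightarrow> vl (G \<bullet> u) = ev G (vl u)"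
  unfolding ev_def Fun_def using rep[of "vl u"] XuD(3) by metis

lemma ball_ev:
  assumes "Fun G"
  shows "(\<forall>v\<in>Xu. P (vl v) (vl (G \<bullet> v))) \<longleftrightarrow> (\<forall>y. unit y \<longrightarrow> P y (ev G y))"
proof -
  have "(\<forall>v\<in>Xu. P (vl v) (vl (G \<bullet> v))) \<longleftrightarrow> (\<forall>v\<in>Xu. P (vl v) (ev G (vl v)))"
    using ev_vl[OF assms] by simp
  also have "\<dots> \<longleftrightarrow> (\<forall>y. unit y \<longrightarrow> P y (ev G y))"
    using rep XuD(3) by metis
  finally show ?thesis .
qed

lemma Cont_ev:
  assumes "Fun G" "u \<in> Xu"
  shows "Cont G u \<longleftrightarrow> (\<forall>k. \<exists>m. \<forall>z. unit z \<and> \<bar>vl u - z\<bar> < cK (pw m) \<longrightarrow> \<bar>ev G (vl u) - ev G z\<bar> < cK (pw k))"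
  unfolding Cont_def ev_vl[OF assms]
  using ball_ev[OF assms(1), of "\<lambda>y z. \<bar>vl u - y\<bar> < cK (pw m) \<longrightarrow> \<bar>ev G (vl u) - z\<bar> < cK (pw k)" for m k]
  by (simp add: imp_conjL)

lemma bounds_ev:
  assumes "Fun G"
  shows "UB G x a r \<longleftrightarrow> (\<forall>y. unit y \<and> \<bar>vl x - y\<bar> < cK (pw a) \<longrightarrow> ev G y \<le> r)"
    "LB G x a r \<longleftrightarrow> (\<forall>y. unit y \<and> \<bar>vl x - y\<bar> < cK (pw a) \<longrightarrow> r \<le> ev G y)"
  unfolding UB_def LB_def
    ball_ev[OF assms, of "\<lambda>y z. \<bar>vl x - y\<bar> < cK (pw a) \<longrightarrow> z \<le> r"]
    ball_ev[OF assms, of "\<lambda>y z. \<bar>vl x - y\<bar> < cK (pw a) \<longrightarrow> r \<le> z"] by (simp_all add: imp_conjL)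

end

locale baire1_model = aca_num D ap cn ls num
  for D :: "ty \<Rightarrow> 'u set" and ap (infixl \<open>\<bullet>\<close> 90) and cn ls
    and num :: "'n::linordered_semidom \<Rightarrow> 'u" +
  fixes g H :: 'u
  assumes g: "Fun g" and H: "H \<in> D (Num \<rightarrow> T1 \<rightarrow> T1)"
    and FunH: "Fun (H \<bullet> num a)" and ContH: "u \<in> Xu \<Longrightarrow> Cont (H \<bullet> num a) u"
    and limH: "u \<in> Xu \<Longrightarrow> \<exists>m. \<forall>a. m \<le> a \<longrightarrow> \<bar>vl (H \<bullet> num a \<bullet> u) - vl (g \<bullet> u)\<bar> < cK (pw k)"
begin

sublocale baire_unit D "(\<bullet>)" cn ls num Xu "\<lambda>n. ev (H \<bullet> num n)" "ev g"
proof -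
  have Xu: "Xu \<subseteq> D T1" "Xu \<noteq> {}" using cst_uc(1) XuD(1) by blast+
  interpret u: aca_def D "(\<bullet>)" cn ls num Xu by unfold_locales (rule Xu)+
  \<comment> \<open>At a rational point, \<open>H\<close> is applied to a number and to a constant
    sequence, both definable; the result is a fast sequence of the model, so its limit is a
    definable real.\<close>
  have dF: "u.dR (\<lambda>x e. ev (H \<bullet> num (s x e)) (uq (t x e)))" if st: "u.dN s" "u.dN t" for s t
  proof -
    have d0: "u.dR (\<lambda>x e. 0)" "u.dR (\<lambda>x e. 1)"
      using u.dR_q[OF u.dN_const, of q0] u.dR_q[OF u.dN_const, of q1] by (simp_all only: rv_01)
    have duc: "u.dN (\<lambda>x e. uc (t x e))"
      unfolding uc_def by (intro u.dN_if u.dP_conj u.dP_vc u.dR_le u.dR_q d0 st u.dN_const)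
    note rs = u.dN_rp[OF u.dN_shift[OF st(1)]] and rt = u.dN_rp[OF u.dN_shift[OF duc]]
    have r: "u.rp T1 (\<lambda>x e. H \<bullet> num (s x (\<lambda>i. fn e (i + 1))) \<bullet> cst (uc (t x (\<lambda>i. fn e (i + 1)))))"
      unfolding cst_def by (intro u.rp_ap[OF u.rp_ap[OF u.rp_const[OF H] rs] u.rp_ap[OF u.rp_const[OF cn_typed(5)] rt]])
    have "u.dR (\<lambda>x e. val (fn (H \<bullet> num (s x e) \<bullet> cst (uc (t x e)))))"
    proof (rule u.dR_val)
      show "u.dN (\<lambda>x e. fn (H \<bullet> num (s x (\<lambda>i. e (i + 1))) \<bullet> cst (uc (t x (\<lambda>i. e (i + 1))))) (e 0))"
        by (rule u.dN_rp1[OF r _ u.dN_var]) simp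
      show "isr (fn (H \<bullet> num (s x (fn e)) \<bullet> cst (uc (t x (fn e)))))" for x e
        by (rule FunD[OF FunH cst_uc(1)])
    qed
    then show ?thesis by (simp add: ev_vl[OF FunH cst_uc(1)] cst_uc(2))
  qed
  show "baire_unit D (\<bullet>) cn ls num Xu (\<lambda>n. ev (H \<bullet> num n)) (ev g)"
  proof unfold_locales
    show "u.dR (\<lambda>x e. ev (H \<bullet> num (s x e)) (uq (t x e)))" if "u.dN s" "u.dN t" for s t
      by (rule dF[OF that])
  next
    fix y n k assume y: "unit y"
    have "Cont (H \<bullet> num n) (rep y)" by (rule ContH[OF rep(1)[OF y]])
    then show "\<exists>m. \<forall>z. unit z \<and> \<bar>y - z\<bar> < cK (pw m) \<longrightarrow>
        \<bar>ev (H \<bullet> num n) y - ev (H \<bullet> num n) z\<bar> < cK (pw k)"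
      unfolding Cont_ev[OF FunH rep(1)[OF y]] rep(2)[OF y] by blast
  next
    fix y k assume y: "unit y"
    show "\<exists>m. \<forall>n\<ge>m. \<bar>ev (H \<bullet> num n) y - ev g y\<bar> < cK (pw k)"
      using limH[OF rep(1)[OF y], of k] unfolding ev_def .
  qed (rule Xu_def)
qed

lemma ex_cont: "\<exists>u\<in>Xu. Cont g u"
proof -
  obtain y where y: "unit y" "\<forall>k. \<exists>m. \<forall>z. unit z \<and> \<bar>y - z\<bar> < cK (pw m) \<longrightarrow> \<bar>ev g y - ev g z\<bar> < cK (pw k)"
    using continuity_point by blast
  then show ?thesis using Cont_ev[OF g rep(1)[OF y(1)]] rep[OF y(1)] by auto
qed

text \<open>Within the ball that continuity gives for the tolerance \<open>pw 0 = 1\<close>, the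
  modulus of the function exceeds its value at the point of continuity by less than 1. A rational
  interval is taken inside this ball and the unit interval.\<close>

lemma ex_bounded: "\<exists>N. \<exists>c\<in>Xu. \<exists>d\<in>Xu. vl c < vl d \<and>
    (\<forall>y\<in>Xu. vl c < vl y \<and> vl y < vl d \<longrightarrow> \<bar>vl (g \<bullet> y)\<bar> \<le> cK (kn (N + 1)))"
proof -
  obtain y where y: "unit y" "\<forall>k. \<exists>m. \<forall>z. unit z \<and> \<bar>y - z\<bar> < cK (pw m) \<longrightarrow> \<bar>ev g y - ev g z\<bar> < cK (pw k)"
    using continuity_point by blast
  obtain m where m: "\<And>z. unit z \<Longrightarrow> \<bar>y - z\<bar> < cK (pw m) \<Longrightarrow> \<bar>ev g y - ev g z\<bar> < cK (pw 0)"
    using y(2) by blast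
  have y01: "rv q0 \<le> y" "y \<le> rv q1" "rv q0 < rv q1" using y(1) unfolding rv_01 by (simp_all add: unit_def)
  obtain c d where cd: "rv q0 \<le> rv c" "rv c < rv d" "rv d \<le> rv q1" "y - cK (pw m) < rv c" "rv d < y + cK (pw m)"
    by (rule sub_near[OF y01(3,1,2) cK_pw_pos]) blast
  have "0 \<le> rv c" "rv c \<le> 1" "0 \<le> rv d" "rv d \<le> 1" using cd(1-3) unfolding rv_01 by linarith+
  then have u: "unit (rv c)" "unit (rv d)" using unit_rv by blast+
  obtain a where a: "\<bar>ev g y\<bar> < rv a" by (rule ex_above)
  obtain N where "qv a \<le> kn N" by (rule kn_ge)
  then have "rv a \<le> (cK (kn N) :: 'n rr)" by simp
  then have N: "\<bar>ev g y\<bar> + 1 \<le> cK (kn (N + 1))" using a unfolding kn_hom cK_hom by linarith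
  have 1: "cK (pw 0) = (1 :: 'n rr)" by (simp add: cK_hom)
  have "\<bar>ev g z\<bar> \<le> cK (kn (N + 1))" if z: "unit z" "rv c < z" "z < rv d" for z
  proof -
    have "\<bar>y - z\<bar> < cK (pw m)" using z(2,3) cd(4,5) by linarith
    from m[OF z(1) this] show ?thesis using N unfolding 1 by linarith
  qed
  then have "\<forall>z\<in>Xu. rv c < vl z \<and> vl z < rv d \<longrightarrow> \<bar>vl (g \<bullet> z)\<bar> \<le> cK (kn (N + 1))"
    using ev_vl[OF g] by simp
  then show ?thesis using rep[OF u(1)] rep[OF u(2)] cd(2)
    by (intro exI[of _ N] bexI[of _ "rep (rv c)"] bexI[of _ "rep (rv d)"]) auto
qed

interpretation N: baire_unit D "(\<bullet>)" cn ls num Xu "\<lambda>n y. - ev (H \<bullet> num n) y" "\<lambda>y. - ev g y"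
  by (rule baire_unit_uminus)

lemma bdd_iff:
  assumes "x \<in> Xu"
  shows "BI g x k \<longleftrightarrow> \<not> (ball_bdd (vl x) k \<and> N.ball_bdd (vl x) k)"
proof -
  have "(\<exists>s. MR s \<and> LB g x k s) \<longleftrightarrow> N.ball_bdd (vl x) k"
    unfolding N.ball_bdd_iff bounds_ev[OF g]
  proof (intro iffI; elim exE conjE)
    fix s assume "MR s" "\<forall>y. unit y \<and> \<bar>vl x - y\<bar> < cK (pw k) \<longrightarrow> s \<le> ev g y"
    then show "\<exists>s. MR s \<and> (\<forall>y. unit y \<and> \<bar>vl x - y\<bar> < cK (pw k) \<longrightarrow> - ev g y \<le> s)"
      by (intro exI[of _ "- s"]) (simp add: MR_minus)
  next
    fix s assume "MR s" "\<forall>y. unit y \<and> \<bar>vl x - y\<bar> < cK (pw k) \<longrightarrow> - ev g y \<le> s"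
    then show "\<exists>s. MR s \<and> (\<forall>y. unit y \<and> \<bar>vl x - y\<bar> < cK (pw k) \<longrightarrow> s \<le> ev g y)"
      by (intro exI[of _ "- s"]) (auto simp: MR_minus minus_le_iff)
  qed
  then show ?thesis unfolding BI_def bounds_ev(1)[OF g, of x k] ball_bdd_iff by blast
qed

text \<open>The infimum is \<open>- N.ball_sup\<close>, so the difference of supremum and infimum is
  the sum that \<open>oscillation\<close> controls. Both belong to the model because their cuts are
  definable.\<close>

lemma BO_ball_sup:
  assumes x: "x \<in> Xu" and b: "ball_bdd (vl x) k" "N.ball_bdd (vl x) k"
  shows "BO g x k (ball_sup (vl x) k + N.ball_sup (vl x) k)" "MR (ball_sup (vl x) k + N.ball_sup (vl x) k)"
proof -
  obtain e where e: "e \<in> D T1" using XuD(1)[OF x] by blast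
  note d = dR_inst[OF dR_ball_sup[OF dN_const[of k]] x e] dR_inst[OF N.dR_ball_sup[OF dN_const[of k]] x e]
  show "MR (ball_sup (vl x) k + N.ball_sup (vl x) k)" by (rule MR_dR[OF dR_add[OF d]])
  let ?s = "ball_sup (vl x) k" and ?i = "- N.ball_sup (vl x) k"
  have s: "UB g x k ?s" "\<And>t. UB g x k t \<Longrightarrow> ?s \<le> t"
    using ball_sup[OF XuD(3)[OF x] b(1)] unfolding is_ball_sup_def bounds_ev[OF g] by blast+
  have i: "LB g x k ?i" "\<And>t. LB g x k t \<Longrightarrow> t \<le> ?i"
  proof -
    note * = N.ball_sup[OF XuD(3)[OF x] b(2), unfolded N.is_ball_sup_def]
    show "LB g x k ?i" using * unfolding bounds_ev[OF g] by (simp add: minus_le_iff)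
    show "t \<le> ?i" if "LB g x k t" for t
      using *[THEN conjunct2, rule_format, of "- t"] that unfolding bounds_ev[OF g] by simp
  qed
  show "BO g x k (?s + N.ball_sup (vl x) k)"
    unfolding BO_def using s i MR_dR[OF d(1)] MR_minus[OF MR_dR[OF d(2)]]
    by (intro exI[of _ ?s] exI[of _ ?i]) simp
qed

text \<open>\<open>W\<close> gives the canonical code of the limit and \<open>J\<close> the
  indicator of infinity. On \<open>Xu\<close> both depend on \<open>vl x\<close> only, hence respect
  equality of reals.\<close>

lemma ex_osc:
  obtains W J where "W \<in> D (T1 \<rightarrow> T1)" "J \<in> D T2" "Fun W"
    "\<And>x y. x \<in> Xu \<Longrightarrow> y \<in> Xu \<Longrightarrow> vl x = vl y \<Longrightarrow> J \<bullet> x = J \<bullet> y"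
    "\<And>x. x \<in> Xu \<Longrightarrow> J \<bullet> x = zero \<and> OL g x (vl (W \<bullet> x)) \<or> J \<bullet> x = one \<and> (\<forall>a. BI g x a)"
proof -
  define inft where "inft \<xi> \<longleftrightarrow> (\<forall>k. \<not> (ball_bdd \<xi> k \<and> N.ball_bdd \<xi> k))" for \<xi>
  obtain G where dG: "dR (\<lambda>x e. G (vl x))" and dI: "dP (\<lambda>x e. inft (vl x))"
    and lim: "\<And>\<xi> j. unit \<xi> \<Longrightarrow> \<not> inft \<xi> \<Longrightarrow> \<exists>m. \<forall>k\<ge>m. ball_bdd \<xi> k \<and> N.ball_bdd \<xi> k \<and>
      \<bar>(ball_sup \<xi> k + N.ball_sup \<xi> k) - G \<xi>\<bar> < cK (pw j)"
    unfolding inft_def by (rule oscillation) blast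
  obtain W where W: "W \<in> D (T1 \<rightarrow> T1)" "\<And>x. x \<in> Xu \<Longrightarrow> fn (W \<bullet> x) = code (G (vl x))"
    by (rule dN_object[OF dN_code[OF dG]]) blast
  obtain J where J: "J \<in> D T2" "\<And>x. x \<in> Xu \<Longrightarrow> J \<bullet> x = num (if inft (vl x) then 1 else 0)"
    by (rule dN_object_T2[OF dN_if[OF dI dN_const dN_const]]) blast
  have Wx: "isr (fn (W \<bullet> x))" "vl (W \<bullet> x) = G (vl x)" if x: "x \<in> Xu" for x
    using isr_code[OF dR_inst[OF dG x XuD(1)[OF x]]] W(2)[OF x] by simp_all
  have OL: "OL g x (vl (W \<bullet> x))" if x: "x \<in> Xu" "\<not> inft (vl x)" for x
    unfolding OL_def
  proof
    fix j
    obtain m where m: "\<And>k. m \<le> k \<Longrightarrow> ball_bdd (vl x) k \<and> N.ball_bdd (vl x) k \<and>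
        \<bar>(ball_sup (vl x) k + N.ball_sup (vl x) k) - G (vl x)\<bar> < cK (pw j)"
      using lim[OF XuD(3)[OF x(1)] x(2), of j] by blast
    show "\<exists>m. \<forall>k. m \<le> k \<longrightarrow> (\<exists>u. MR u \<and> BO g x k u \<and> \<bar>u - vl (W \<bullet> x)\<bar> < cK (pw j))"
      unfolding Wx(2)[OF x(1)] using m BO_ball_sup[OF x(1)] by meson
  qed
  have BI: "BI g x a" if "x \<in> Xu" "inft (vl x)" for x a
    using that bdd_iff unfolding inft_def by blast
  show ?thesis
  proof (rule that[OF W(1) J(1)])
    show "Fun W" unfolding Fun_def using Wx by auto
    show "J \<bullet> x = J \<bullet> y" if "x \<in> Xu" "y \<in> Xu" "vl x = vl y" for x y
      using that J(2) by simp
    show "J \<bullet> x = zero \<and> OL g x (vl (W \<bullet> x)) \<or> J \<bullet> x = one \<and> (\<forall>a. BI g x a)" if "x \<in> Xu" for x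
      using that OL BI J(2) num_zero num_one by (cases "inft (vl x)") simp_all
  qed
qed

end

section \<open>Truth of the sentence in the model\<close>

context aca_num
begin

lemma sat_osc_exists:
  assumes g: "ok n g" "teval b e g \<in> D (T1 \<rightarrow> T1)" "Fun (teval b e g)"
    and W: "W \<in> D (T1 \<rightarrow> T1)" "J \<in> D T2" "Fun W"
    and J: "\<And>x y. x \<in> Xu \<Longrightarrow> y \<in> Xu \<Longrightarrow> vl x = vl y \<Longrightarrow> J \<bullet> x = J \<bullet> y"
    and osc: "\<And>x. x \<in> Xu \<Longrightarrow> J \<bullet> x = zero \<and> OL (teval b e g) x (vl (W \<bullet> x)) \<or>
      J \<bullet> x = one \<and> (\<forall>a. BI (teval b e g) x a)"
  shows "sat b e (osc_exists g n)"
  unfolding osc_exists_def sat_form(10)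
proof (rule bexI[OF _ W(1)], rule bexI[OF _ W(2)])
  let ?W = "Free n (T1 \<rightarrow> T1)" and ?J = "Free (Suc n) T2"
  let ?b = "case_nat J (case_nat W b)" and ?e = "e((n, T1 \<rightarrow> T1) := W, (Suc n, T2) := J)"
  have 1: "sat ?b ?e (is_fun ?W (Suc (Suc n)))" using W by (simp add: sat_is_fun)
  have 2: "sat ?b ?e ((\<^bold>\<forall>\<^sub>I x. \<^bold>\<forall>\<^sub>I y. req (rl x) (rl y) \<^bold>\<longrightarrow> ?J \<cdot> x \<^bold>= ?J \<cdot> y) (Suc (Suc n)))"
    by (simp add: sat_rules) (intro ballI impI; rule J)
  have 3: "sat ?b ?e ((\<^bold>\<forall>\<^sub>I x. (?J \<cdot> x \<^bold>= Zero \<^bold>\<and> osc_limit g x (?W \<cdot> x)) \<^bold>\<or>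
      (?J \<cdot> x \<^bold>= One \<^bold>\<and> osc_limit_infinite g x)) (Suc (Suc n)))"
    unfolding sat_unit_quant
  proof
    fix x assume x: "x \<in> Xu"
    show "sat (case_nat x ?b) (?e((Suc (Suc n), T1) := x))
      (((?J \<cdot> Free (Suc (Suc n)) T1 \<^bold>= Zero \<^bold>\<and> osc_limit g (Free (Suc (Suc n)) T1) (?W \<cdot> Free (Suc (Suc n)) T1)) \<^bold>\<or>
      (?J \<cdot> Free (Suc (Suc n)) T1 \<^bold>= One \<^bold>\<and> osc_limit_infinite g (Free (Suc (Suc n)) T1))) (Suc (Suc (Suc n))))"
      using osc[OF x] x g W by (auto simp: sat_rules sat_osc_limit sat_osc_limit_infinite)
  qed
  show "sat ?b ?e ((is_fun ?W \<^bold>\<and> (\<^bold>\<forall>\<^sub>I x. \<^bold>\<forall>\<^sub>I y. req (rl x) (rl y) \<^bold>\<longrightarrow> ?J \<cdot> x \<^bold>= ?J \<cdot> y) \<^bold>\<and>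
      (\<^bold>\<forall>\<^sub>I x. (?J \<cdot> x \<^bold>= Zero \<^bold>\<and> osc_limit g x (?W \<cdot> x)) \<^bold>\<or>
        (?J \<cdot> x \<^bold>= One \<^bold>\<and> osc_limit_infinite g x))) (Suc (Suc n)))"
    unfolding sat_form(6) using 1 2 3 by blast
qed

theorem sat_baire1_functions:
  "sat b e (fall (T1 \<rightarrow> T1) (\<lambda>f. is_fun f \<^bold>\<and> baire1 f \<^bold>\<longrightarrow>
     has_cont_point f \<^bold>\<and> bounded_on_interval f \<^bold>\<and> osc_exists f) 0)"
  unfolding sat_form(3,6,9)
proof (intro ballI impI)
  fix f assume f: "f \<in> D (T1 \<rightarrow> T1)"
  let ?b = "case_nat f b" and ?e = "e((0, T1 \<rightarrow> T1) := f)" and ?f = "Free 0 (T1 \<rightarrow> T1)"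
  have ok: "ok (Suc 0) ?f" "teval ?b ?e ?f \<in> D (T1 \<rightarrow> T1)" and t: "teval ?b ?e ?f = f"
    using f by simp_all
  assume *: "sat ?b ?e (is_fun ?f (Suc 0)) \<and> sat ?b ?e (baire1 ?f (Suc 0))"
  have Fun: "Fun (teval ?b ?e ?f)" using * sat_is_fun[OF ok] by blast
  obtain H where H: "H \<in> D (Num \<rightarrow> T1 \<rightarrow> T1)" and
    HF: "(\<forall>a. Fun (H \<bullet> num a) \<and> (\<forall>u\<in>Xu. Cont (H \<bullet> num a) u)) \<and>
      (\<forall>u\<in>Xu. \<forall>k. \<exists>m. \<forall>a. m \<le> a \<longrightarrow> \<bar>vl (H \<bullet> num a \<bullet> u) - vl (teval ?b ?e ?f \<bullet> u)\<bar> < cK (pw k))"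
    using conjunct2[OF *] unfolding sat_baire1[OF ok Fun] by (rule bexE)
  interpret m: baire1_model D "(\<bullet>)" cn ls num "teval ?b ?e ?f" H
  proof unfold_locales
    show "Fun (H \<bullet> num a)" for a using HF by (elim conjE allE)
    show "Cont (H \<bullet> num a) u" if "u \<in> Xu" for a u by (rule HF[THEN conjunct1, rule_format, THEN conjunct2, rule_format, OF that])
    show "\<exists>m. \<forall>a. m \<le> a \<longrightarrow> \<bar>vl (H \<bullet> num a \<bullet> u) - vl (teval ?b ?e ?f \<bullet> u)\<bar> < cK (pw k)"
      if "u \<in> Xu" for u k by (rule HF[THEN conjunct2, THEN bspec, OF that, THEN spec])
  qed (rule Fun H)+
  have osc: "sat ?b ?e (osc_exists ?f (Suc 0))"
  proof (rule m.ex_osc)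
    fix W J assume WJ: "W \<in> D (T1 \<rightarrow> T1)" "J \<in> D T2" "Fun W"
      "\<And>x y. x \<in> Xu \<Longrightarrow> y \<in> Xu \<Longrightarrow> vl x = vl y \<Longrightarrow> J \<bullet> x = J \<bullet> y"
      "\<And>x. x \<in> Xu \<Longrightarrow> J \<bullet> x = zero \<and> OL (teval ?b ?e ?f) x (vl (W \<bullet> x)) \<or>
        J \<bullet> x = one \<and> (\<forall>a. BI (teval ?b ?e ?f) x a)"
    show ?thesis by (rule sat_osc_exists[OF ok Fun WJ])
  qed
  show "sat ?b ?e (has_cont_point ?f (Suc 0)) \<and> sat ?b ?e (bounded_on_interval ?f (Suc 0)) \<and>
      sat ?b ?e (osc_exists ?f (Suc 0))"
    unfolding sat_has_cont_point[OF ok Fun] sat_bounded[OF ok Fun]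
    by (intro conjI m.ex_cont m.ex_bounded osc)
qed

end

section \<open>The numbers of a Henkin model as a type\<close>

definition baire1_sentence :: fm where
  "baire1_sentence = fall (T1 \<rightarrow> T1) (\<lambda>f. is_fun f \<^bold>\<and> baire1 f \<^bold>\<longrightarrow>
     has_cont_point f \<^bold>\<and> bounded_on_interval f \<^bold>\<and> osc_exists f) 0"

text \<open>A type of numbers needs a fixed set and cannot depend on a variable theory; the choice
  operator provides one theory for everything that follows.\<close>

definition HH :: "fm set" where
  "HH = (SOME H. henkin ACA0_omega H \<and> baire1_sentence \<notin> H)"

abbreviation "good \<equiv> henkin ACA0_omega HH"

locale good_theory =
  assumes good: good
begin

sublocale henkin_theory ACA0_omega HH
  by unfold_locales (rule good ACA0_subsets(6))+

sublocale aca_model "cls_dom HH" "cls_ap HH" "cls HH" "cls_less HH" ..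

abbreviation "DN \<equiv> cls_dom HH Num"

end

text \<open>A type definition cannot depend on the hypothesis that the sentence is unprovable: if it is
  provable, so that \<open>HH\<close> need not be a Henkin theory, the type consists of the standard numbers.\<close>

typedef nn = "{u :: tm set + nat. case u of Inl c \<Rightarrow> good \<and> c \<in> cls_dom HH Num | Inr n \<Rightarrow> \<not> good}"
proof (cases good)
  case True
  then show ?thesis by (intro exI[of _ "Inl (cls HH Zero)"]) (auto simp: cls_dom_def)
next
  case False
  then show ?thesis by (intro exI[of _ "Inr 0"]) simp
qed

definition mk :: "tm set \<Rightarrow> nat \<Rightarrow> nn" where
  "mk c n = Abs_nn (if good then Inl c else Inr n)"

definition gn :: "nn \<Rightarrow> tm set" where "gn a = projl (Rep_nn a)"
definition bn :: "nn \<Rightarrow> nat" where "bn a = projr (Rep_nn a)"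

lemma gn: "good \<Longrightarrow> gn a \<in> cls_dom HH Num" "good \<Longrightarrow> a = b \<longleftrightarrow> gn a = gn b"
  "good \<Longrightarrow> c \<in> cls_dom HH Num \<Longrightarrow> gn (mk c n) = c"
  using Rep_nn[of a] Rep_nn[of b] Rep_nn_inject[of a b]
  by (auto simp: gn_def mk_def Abs_nn_inverse split: sum.splits)

lemma bn: "\<not> good \<Longrightarrow> a = b \<longleftrightarrow> bn a = bn b" "\<not> good \<Longrightarrow> bn (mk c n) = n"
  using Rep_nn[of a] Rep_nn[of b] Rep_nn_inject[of a b]
  by (auto simp: bn_def mk_def Abs_nn_inverse split: sum.splits)

instantiation nn :: linordered_semidom
begin

definition "0 = mk (cls HH Zero) 0"
definition "1 = mk (cls HH One) 1"
definition "a + b = mk (cls_ap HH (cls_ap HH (cls HH Plus) (gn a)) (gn b)) (bn a + bn b)" for a b :: nn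
definition "a * b = mk (cls_ap HH (cls_ap HH (cls HH Times) (gn a)) (gn b)) (bn a * bn b)" for a b :: nn
definition "a < b \<longleftrightarrow> (if good then cls_less HH (gn a) (gn b) else bn a < bn b)" for a b :: nn
definition "a \<le> b \<longleftrightarrow> a = b \<or> a < b" for a b :: nn
definition "a - b = (if b \<le> a then THE c. c + b = a else 0)" for a b :: nn

lemma nn_good:
  assumes g: good
  shows "gn 0 = cls HH Zero" "gn 1 = cls HH One" "gn (a + b) = cls_ap HH (cls_ap HH (cls HH Plus) (gn a)) (gn b)"
    "gn (a * b) = cls_ap HH (cls_ap HH (cls HH Times) (gn a)) (gn b)" "a < b \<longleftrightarrow> cls_less HH (gn a) (gn b)"
proof -
  interpret good_theory by unfold_locales (rule g)
  show "gn 0 = cls HH Zero" "gn 1 = cls HH One" "gn (a + b) = cls_ap HH (cls_ap HH (cls HH Plus) (gn a)) (gn b)"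
    "gn (a * b) = cls_ap HH (cls_ap HH (cls HH Times) (gn a)) (gn b)" "a < b \<longleftrightarrow> cls_less HH (gn a) (gn b)"
    unfolding zero_nn_def one_nn_def plus_nn_def times_nn_def less_nn_def
    by (simp_all only: gn[OF g] g if_True cn_typed pl_typed ti_typed)
qed

lemma nn_bad:
  assumes "\<not> good"
  shows "bn 0 = 0" "bn 1 = 1" "bn (a + b) = bn a + bn b" "bn (a * b) = bn a * bn b" "a < b \<longleftrightarrow> bn a < bn b"
  using assms unfolding zero_nn_def one_nn_def plus_nn_def times_nn_def less_nn_def
  by (simp_all add: bn(2))

text \<open>For a Henkin theory these are the axioms of the ordered semiring, with positivity from
  induction and differences from the recursor; in the other case they are the laws of
  \<open>nat\<close>.\<close>

lemma nn_laws:
  fixes a b c :: nn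
  shows "(a + b) + c = a + (b + c)" "a + b = b + a" "a + 0 = a" "(a * b) * c = a * (b * c)" "a * b = b * a"
    "a * 1 = a" "a * 0 = 0" "a * (b + c) = a * b + a * c" "\<not> a < a" "a < b \<Longrightarrow> b < c \<Longrightarrow> a < c"
    "a < b \<or> a = b \<or> b < a" "a < b \<Longrightarrow> a + c < b + c" "0 < c \<Longrightarrow> a < b \<Longrightarrow> a * c < b * c"
    "(0 :: nn) < 1" "a = 0 \<or> 0 < a" "\<not> a < b \<Longrightarrow> \<exists>d. d + b = a"
proof -
  let ?all = "(a + b) + c = a + (b + c) \<and> a + b = b + a \<and> a + 0 = a \<and> (a * b) * c = a * (b * c) \<and> a * b = b * a \<and>
    a * 1 = a \<and> a * 0 = 0 \<and> a * (b + c) = a * b + a * c \<and> \<not> a < a \<and> (a < b \<longrightarrow> b < c \<longrightarrow> a < c) \<and>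
    (a < b \<or> a = b \<or> b < a) \<and> (a < b \<longrightarrow> a + c < b + c) \<and> (0 < c \<longrightarrow> a < b \<longrightarrow> a * c < b * c) \<and>
    (0 :: nn) < 1 \<and> (a = 0 \<or> 0 < a) \<and> (\<not> a < b \<longrightarrow> (\<exists>d. d + b = a))"
  have 1: ?all if g: good
  proof -
    interpret good_theory by unfold_locales (rule g)
    note t = gn(1)[OF g]
    have d: "\<exists>d. d + b = a" if "\<not> a < b"
    proof
      show "mk (monus (gn a) (gn b)) 0 + b = a"
        using that unfolding gn(2)[OF g] nn_good[OF g] gn(3)[OF g monus_typed(3)[OF t t]]
        by (rule monus_eq[OF t t])
    qed
    show ?thesis
      unfolding gn(2)[OF g, of "_ :: nn"] nn_good[OF g]
      using sr[OF t[of a] t[of b] t[of c]] nonneg[OF t[of a]] d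
      unfolding gn(2)[OF g, of "_ :: nn"] nn_good[OF g] by (intro conjI impI)
  qed
  have 2: ?all if g: "\<not> good"
  proof -
    have "\<exists>d. d + b = a" if "\<not> a < b"
      using that by (intro exI[of _ "mk {} (bn a - bn b)"]) (simp add: bn[OF g] nn_bad[OF g])
    then show ?thesis by (auto simp: bn[OF g] nn_bad[OF g] algebra_simps)
  qed
  have all: ?all using 1 2 by (rule case_split)
  show "(a + b) + c = a + (b + c)" "a + b = b + a" "a + 0 = a" "(a * b) * c = a * (b * c)" "a * b = b * a"
    "a * 1 = a" "a * 0 = 0" "a * (b + c) = a * b + a * c" "\<not> a < a" "a < b \<Longrightarrow> b < c \<Longrightarrow> a < c"
    "a < b \<or> a = b \<or> b < a" "a < b \<Longrightarrow> a + c < b + c" "0 < c \<Longrightarrow> a < b \<Longrightarrow> a * c < b * c"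
    "(0 :: nn) < 1" "a = 0 \<or> 0 < a" "\<not> a < b \<Longrightarrow> \<exists>d. d + b = a"
    by (insert all, (elim conjE; (assumption | iprover))+)
qed

lemma nn_cancel: "a + c = b + c \<longleftrightarrow> a = b" for a b c :: nn
  using nn_laws(9,11,12) by metis

lemma nn_le_iff: "b \<le> a \<longleftrightarrow> (\<exists>d. d + b = a)" for a b :: nn
proof
  show "\<exists>d. d + b = a" if "b \<le> a"
    using that nn_laws(16)[of a b] nn_laws(9,10) unfolding less_eq_nn_def by metis
  show "b \<le> a" if "\<exists>d. d + b = a"
    using that nn_laws(12)[of 0 _ b] nn_laws(15) nn_laws(2,3) unfolding less_eq_nn_def by metis
qed

lemma nn_diff: "c + b = a \<Longrightarrow> a - b = c" for a b c :: nn
proof -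
  assume a: "c + b = a"
  have "(THE x. x + b = a) = c" by (rule the_equality) (use a nn_cancel in metis)+
  then show ?thesis using a nn_le_iff[of b a] by (auto simp: minus_nn_def)
qed

lemma nn_diff_0: "\<not> b \<le> a \<Longrightarrow> a - b = 0" for a b :: nn
  by (simp add: minus_nn_def)

instance
proof
  fix a b c :: nn
  show "a + b + c = a + (b + c)" "a + b = b + a" "a * b * c = a * (b * c)" "a * b = b * a"
    "a * (b + c) = a * b + a * c"
    by (fact nn_laws)+
  show "a \<noteq> 0 \<Longrightarrow> b \<noteq> 0 \<Longrightarrow> a * b \<noteq> 0" using nn_laws(5,7,9,13,15) by metis
  show "0 + a = a" "1 * a = a" "0 * a = 0" "a * 0 = 0" "(a + b) * c = a * c + b * c"
    using nn_laws(2,3,5,6,7,8) by metis+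
  show "(0 :: nn) \<noteq> 1" "(0 :: nn) < 1" using nn_laws(9,14) by metis+
  show less: "a < b \<longleftrightarrow> a \<le> b \<and> \<not> b \<le> a" unfolding less_eq_nn_def using nn_laws(9,10) by metis
  show "a \<le> a" "a \<le> b \<Longrightarrow> b \<le> c \<Longrightarrow> a \<le> c" "a \<le> b \<Longrightarrow> b \<le> a \<Longrightarrow> a = b" "a \<le> b \<or> b \<le> a"
    unfolding less_eq_nn_def using nn_laws(9,10,11) by metis+
  show "a \<le> b \<Longrightarrow> c + a \<le> c + b"
    unfolding less_eq_nn_def using nn_laws(2,12) by metis
  show "a < b \<Longrightarrow> 0 < c \<Longrightarrow> c * a < c * b" using nn_laws(5,13) by metis
  show diff1: "a + b - a = b" by (rule nn_diff) (fact nn_laws)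
  show "b \<le> a \<Longrightarrow> a - b + b = a" using nn_le_iff nn_diff by metis
  show "a - b - c = a - (b + c)"
  proof (cases "\<exists>d. d + (b + c) = a")
    case True
    then obtain d where d: "d + (b + c) = a" by blast
    have "a - b = d + c" by (rule nn_diff) (use d nn_laws(1,2) in metis)
    then show ?thesis using nn_diff[OF d] nn_diff[of d c] by simp
  next
    case no: False
    then have z: "a - (b + c) = 0" by (intro nn_diff_0) (simp add: nn_le_iff)
    show ?thesis
    proof (cases "\<exists>d. d + b = a")
      case True
      then obtain d where d: "d + b = a" by blast
      have "\<nexists>x. x + c = d" using no d nn_laws(1,2) by metis
      then show ?thesis unfolding nn_diff[OF d] z by (intro nn_diff_0) (simp add: nn_le_iff)
    next
      case False
      then have "a - b = 0" by (intro nn_diff_0) (simp add: nn_le_iff)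
      moreover have "0 - c = 0"
      proof (cases "c = 0")
        case True
        then show ?thesis by (intro nn_diff) (use nn_laws(3) in simp)
      next
        case False
        then have "\<not> c \<le> 0" using nn_laws(9,10,15) unfolding less_eq_nn_def by metis
        then show ?thesis by (rule nn_diff_0)
      qed
      ultimately show ?thesis using z by simp
    qed
  qed
  show "a * (b - c) = a * b - a * c"
  proof (cases "c \<le> b")
    case True
    then obtain d where d: "d + c = b" unfolding nn_le_iff by blast
    have "a * d + a * c = a * b" using d nn_laws(8) by metis
    then show ?thesis using nn_diff[OF d] nn_diff by metis
  next
    case False
    then have b: "b - c = 0" "b < c" using nn_laws(11)[of b c] nn_diff_0 unfolding less_eq_nn_def by blast+
    have "a * b - a * c = 0"
    proof (cases "a = 0")
      case True
      then show ?thesis using nn_diff[of 0 0 0] nn_laws(2,3,5,7) by metis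
    next
      case False
      then have "0 < a" using nn_laws(15) by blast
      then have "a * b < a * c" using b(2) nn_laws(5,13) by metis
      then have "\<not> a * c \<le> a * b" using nn_laws(9,10) unfolding less_eq_nn_def by metis
      then show ?thesis by (rule nn_diff_0)
    qed
    then show ?thesis using b(1) nn_laws(7) by metis
  qed
qed

end

context good_theory
begin

sublocale aca_num "cls_dom HH" "cls_ap HH" "cls HH" "cls_less HH" gn
proof unfold_locales
  show "bij_betw gn UNIV DN"
  proof (rule bij_betw_byWitness[where f' = "\<lambda>c. mk c 0"]; intro ballI image_subsetI UNIV_I subset_UNIV)
    show "gn x \<in> DN" for x by (rule gn(1)[OF good])
    show "mk (gn x) 0 = x" for x unfolding gn(2)[OF good] by (rule gn(3)[OF good gn(1)[OF good]])
    show "gn (mk c 0) = c" if "c \<in> DN" for c by (rule gn(3)[OF good that])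
  qed
qed (simp_all only: nn_good[OF good])

end

section \<open>The theorem\<close>

definition wq :: "quot \<Rightarrow> bool" where
  "wq q \<longleftrightarrow> (case q of (p, m, d) \<Rightarrow> has_type [] p Num \<and> has_type [] m Num \<and> has_type [] d Num)"

definition wr :: "rexp \<Rightarrow> bool" where
  "wr X \<longleftrightarrow> (\<forall>k F n. has_type [] k Num \<longrightarrow> (\<forall>q n. wq q \<longrightarrow> wf_fm [] (F q n)) \<longrightarrow> wf_fm [] (X k F n))"

lemma wrD: "wr X \<Longrightarrow> has_type [] k Num \<Longrightarrow> (\<And>q n. wq q \<Longrightarrow> wf_fm [] (F q n)) \<Longrightarrow> wf_fm [] (X k F n)"
  by (simp add: wr_def)

lemma wrI:
  "(\<And>k F n. has_type [] k Num \<Longrightarrow> (\<And>q n. wq q \<Longrightarrow> wf_fm [] (F q n)) \<Longrightarrow> wf_fm [] (X k F n)) \<Longrightarrow> wr X"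
  unfolding wr_def by blast

lemma has_type_ap: "has_type [] f (\<sigma> \<rightarrow> \<tau>) \<Longrightarrow> has_type [] x \<sigma> \<Longrightarrow> has_type [] (f \<cdot> x) \<tau>"
  and has_type_num: "has_type [] k Num \<Longrightarrow> has_type [] l Num \<Longrightarrow> has_type [] (k \<^bold>+ l) Num"
    "has_type [] k Num \<Longrightarrow> has_type [] l Num \<Longrightarrow> has_type [] (k \<^bold>* l) Num"
    "has_type [] Zero Num" "has_type [] One Num"
  by auto

lemma wf_connectives:
  "has_type [] s Num \<Longrightarrow> has_type [] t Num \<Longrightarrow> wf_fm [] ((s \<^bold>= t) n)"
  "has_type [] s Num \<Longrightarrow> has_type [] t Num \<Longrightarrow> wf_fm [] ((s \<^bold>< t) n)"
  "has_type [] s Num \<Longrightarrow> has_type [] t Num \<Longrightarrow> wf_fm [] ((s \<^bold>\<le> t) n)"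
  "wf_fm [] (A n) \<Longrightarrow> wf_fm [] (B n) \<Longrightarrow> wf_fm [] ((A \<^bold>\<longrightarrow> B) n)"
  "wf_fm [] (A n) \<Longrightarrow> wf_fm [] (B n) \<Longrightarrow> wf_fm [] ((A \<^bold>\<or> B) n)"
  "wf_fm [] (A n) \<Longrightarrow> wf_fm [] (B n) \<Longrightarrow> wf_fm [] ((A \<^bold>\<and> B) n)"
  "wf_fm [] (A n) \<Longrightarrow> wf_fm [] ((\<^bold>\<not> A) n)"
  by (simp_all add: wf_form)

lemma wf_quantifiers:
  "(\<And>x n. has_type [] x \<tau> \<Longrightarrow> wf_fm [] (Q x n)) \<Longrightarrow> wf_fm [] (fall \<tau> Q n)"
  "(\<And>x n. has_type [] x \<tau> \<Longrightarrow> wf_fm [] (Q x n)) \<Longrightarrow> wf_fm [] (fex \<tau> Q n)"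
  by (intro wf_quant; simp)+

lemmas wf_basic = has_type_num wf_connectives wf_quantifiers

lemma wq:
  "wq q \<Longrightarrow> wq r \<Longrightarrow> wq (qadd q r)" "wq q \<Longrightarrow> wq (qneg q)" "has_type [] t Num \<Longrightarrow> wq (qnat t)"
  "has_type [] t Num \<Longrightarrow> wq (qpow t)" "has_type [] t Num \<Longrightarrow> wq (qpow_twice t)"
  by (cases q; cases r; auto simp: wq_def qnat_def qpow_def qpow_twice_def two_pow_def)+

lemma wf_qless:
  "wq q \<Longrightarrow> wq r \<Longrightarrow> wf_fm [] (qless q r n)" "wq q \<Longrightarrow> wq r \<Longrightarrow> wf_fm [] (qle q r n)"
  by (cases q; cases r; simp add: wq_def wf_form)+

lemma wf_with_rat: "has_type [] q Num \<Longrightarrow> (\<And>q n. wq q \<Longrightarrow> wf_fm [] (F q n)) \<Longrightarrow> wf_fm [] (with_rat q F n)"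
  unfolding with_rat_def pair_def by (intro wf_basic) (auto simp: wq_def)

lemma wr: "has_type [] x T1 \<Longrightarrow> wr (rl x)" "wq q \<Longrightarrow> wr (rconst q)" "wr X \<Longrightarrow> wr Y \<Longrightarrow> wr (rdiff X Y)"
  "wr X \<Longrightarrow> wr (rabs X)"
proof -
  show "wr (rl x)" if "has_type [] x T1"
    unfolding rl_def by (intro wrI wf_with_rat has_type_ap[OF that])
  show "wr (rconst q)" if "wq q" unfolding rconst_def by (intro wrI) (use that in blast)
  show "wr (rdiff X Y)" if "wr X" "wr Y"
    unfolding rdiff_def
    by (rule wrI, rule wrD[OF that(1)], (rule has_type_num; assumption?)+, rule wrD[OF that(2)],
      (rule has_type_num; assumption?)+) (blast intro: wq)
  show "wr (rabs X)" if "wr X"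
    unfolding rabs_def
    by (rule wrI, rule wrD[OF that], assumption)
      (rule wf_connectives wf_qless wq has_type_num | assumption | blast intro: wq)+
qed

lemma wf_reals:
  "wr X \<Longrightarrow> wr Y \<Longrightarrow> wf_fm [] (rle X Y n)" "wr X \<Longrightarrow> wr Y \<Longrightarrow> wf_fm [] (req X Y n)"
  "has_type [] x T1 \<Longrightarrow> wf_fm [] (is_real x n)"
proof -
  show "wf_fm [] (rle X Y n)" "wf_fm [] (req X Y n)" if "wr X" "wr Y"
    unfolding rle_def req_def
    by (rule wf_connectives wf_quantifiers wf_qless wq wrD[OF that(1)] wrD[OF that(2)] | assumption)+
  show "wf_fm [] (is_real x n)" if "has_type [] x T1"
    unfolding is_real_def
    by (rule has_type_num wf_connectives wf_quantifiers wf_qless wq wf_with_rat has_type_ap[OF that] | assumption)+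
qed

lemma wf_rless: "wr X \<Longrightarrow> wr Y \<Longrightarrow> wf_fm [] (rless X Y n)"
  unfolding rless_def by (intro wf_connectives wf_reals)

lemma wf_close_to:
  "has_type [] k Num \<Longrightarrow> has_type [] x T1 \<Longrightarrow> has_type [] y T1 \<Longrightarrow> wf_fm [] (close_to k x y n)"
  unfolding close_to_def by (intro wf_rless wr wq)

lemma wf_real_quantifiers:
  assumes "\<And>x n. has_type [] x T1 \<Longrightarrow> wf_fm [] (F x n)"
  shows "wf_fm [] (all_real F n)" "wf_fm [] (ex_real F n)" "wf_fm [] (all_unit F n)" "wf_fm [] (ex_unit F n)"
  unfolding all_unit_def ex_unit_def all_real_def ex_real_def in_unit_def
  by (intro wf_quantifiers wf_connectives wf_reals wr wq has_type_num assms; assumption)+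

lemma wf_baire1_sentence: "wf_fm [] baire1_sentence"
  unfolding baire1_sentence_def is_fun_def baire1_def has_cont_point_def bounded_on_interval_def osc_exists_def
    cont_at_def osc_limit_def osc_limit_infinite_def ball_osc_def ball_osc_infinite_def is_sup_def is_inf_def
    upper_bound_def lower_bound_def
  by (assumption | rule wf_connectives wf_real_quantifiers wf_quantifiers wf_reals wf_rless wf_close_to wr wq
    has_type_num has_type_ap)+

theorem theorem2p10:
  "ACA0_omega \<turnstile>
     fall (T1 \<rightarrow> T1) (\<lambda>f. is_fun f \<^bold>\<and> baire1 f \<^bold>\<longrightarrow>
       has_cont_point f \<^bold>\<and> bounded_on_interval f \<^bold>\<and> osc_exists f) 0"
  unfolding baire1_sentence_def[symmetric]
proof (rule ccontr)
  assume "\<not> ACA0_omega \<turnstile> baire1_sentence"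
  then have "\<exists>H. henkin ACA0_omega H \<and> baire1_sentence \<notin> H" by (rule ex_henkin[OF wf_baire1_sentence])
  \<comment> \<open>Under the assumption of unprovability the chosen \<open>HH\<close> is a Henkin
    theory, so \<open>nn\<close> consists of the numbers of its model and everything proved in
    \<open>good_theory\<close> applies.\<close>
  then have HH: "henkin ACA0_omega HH \<and> baire1_sentence \<notin> HH" unfolding HH_def by (rule someI_ex)
  then interpret good_theory by unfold_locales blast
  have "C.sat (\<lambda>_. {}) (\<lambda>(n, \<sigma>). cls HH (Free n \<sigma>)) baire1_sentence"
    unfolding baire1_sentence_def by (rule sat_baire1_functions)
  then show False using sat_cls[OF wf_baire1_sentence] HH by blast
qed

end
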